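(* Let $\rho\in L^1(\Omega)$ be a weight with grading $\gamma_\rho$, let $h\in L^1(\Omega)$ be a mesh size function with grading $\gamma_h$, let $p\in[1,\infty]$, and let $\gamma_{\max}$ be the worst grading for $Q_\Gamma$. (i) ($L^p$-stability) If $\gamma_\rho\gamma_h^{d|\frac12-\frac1p|}<\gamma_{\max}$, then there exists a constant $c=c(\gamma_\rho,\gamma_h,d,p,K,\chi_0)<\infty$ (with $\chi_0$ the shape-regularity parameter of $\mathcal{T}$) such that $$\|\rho\,Q_\Gamma u\|_p\le c\,\|\rho u\|_p\qquad\text{for all }u\in L^p(\Omega).$$ (ii) ($W^{1,p}$-stability) If $\gamma_\rho\gamma_h^{1+d|\frac12-\frac1p|}<\gamma_{\max}$, then there exists a constant $c=c(\gamma_\rho,\gamma_h,d,p,K,\chi_0)<\infty$ such that $$\|\rho\,\nabla Q_\Gamma u\|_p\le c\,\|\rho\,\nabla u\|_p\qquad\text{for all }u\in W^{1,p}_\Gamma(\Omega).$$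
   Context: Let $d,K\in\mathbb{N}$ (both $\geq 1$), $\Omega\subset\mathbb{R}^d$ a bounded polyhedral (connected) domain, $\mathcal{T}$ a regular triangulation of $\Omega$ into closed simplices with shape-regularity parameter $\chi_0$ (the maximal ratio of the diameter of $T\in\mathcal{T}$ to its inradius). Let $\Gamma\subset\partial\Omega$ be a part of the boundary resolved by the triangulation (a union of boundary faces of $\mathcal{T}$). $\mathcal{L}^1_K(\mathcal{T})$ is the space of continuous functions on $\Omega$ that are polynomials of degree at most $K$ on each $T\in\mathcal{T}$, $\mathcal{L}^1_{K,\Gamma}(\mathcal{T})=\{v\in\mathcal{L}^1_K(\mathcal{T}):v|_\Gamma=0\}$, and $W^{1,p}_\Gamma(\Omega)=\{u\in W^{1,p}(\Omega):u|_\Gamma=0\}$. $Q_\Gamma$ is the $L^2$-projection onto $\mathcal{L}^1_{K,\Gamma}(\mathcal{T})$: $\langle Q_\Gamma u,v\rangle=\langle u,v\rangle$ for all $v\in\mathcal{L}^1_{K,\Gamma}(\mathcal{T})$, where $\langle\cdot,\cdot\rangle$ is the $L^2(\Omega)$ pairing, extended to $u\in L^1(\Omega)$ by the same formula. $\|\cdot\|_p$ is the norm of $L^p(\Omega)$. Distance $\delta$: distinct simplices $T,T'\in\mathcal{T}$ are neighbors if they share a vertex; $\delta(T,T')$ is the smallest $N\in\mathbb{N}_0$ such that there are $T_0=T,\dots,T_N=T'$ in $\mathcal{T}$ with $T_{j-1},T_j$ neighbors for $j=1,\dots,N$. A positive function $\rho\in L^1(\Omega)$ is a weight with grading $\gamma_\rho\ge1$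 (with respect to $\delta$) if for all $T,T'\in\mathcal{T}$: $\operatorname{ess\,sup}_T\rho\le\gamma_\rho\operatorname{ess\,inf}_T\rho$; and if $\delta(T,T')=1$, then $\operatorname{ess\,sup}_{T'}\rho\le\gamma_\rho\operatorname{ess\,sup}_T\rho$ and $\operatorname{ess\,inf}_{T'}\rho\le\gamma_\rho\operatorname{ess\,inf}_T\rho$. A mesh size function is a positive weight $h\in L^1(\Omega)$ such that $\operatorname{ess\,inf}_Th\eqsim\operatorname{diam}(T)\eqsim\operatorname{ess\,sup}_Th$ for all $T\in\mathcal{T}$ with equivalence constants independent of $T$. The worst grading $\gamma_{\max}$ for $Q_\Gamma$ is the number such that for all weights $\rho\in L^1(\Omega)$ with grading $\gamma_\rho<\gamma_{\max}$ there is a constant $C(\gamma_\rho)<\infty$ with $\|\rho Q_\Gamma u\|_2\le C(\gamma_\rho)\|\rho u\|_2$ for all $u\in L^2(\Omega)$. *)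

theory Defs
  imports "HOL-Analysis.Analysis" "HOL-Probability.Essential_Supremum"
begin

text \<open>
  The ambient space is \<open>real ^ 'n\<close> with \<open>d = CARD('n)\<close>. Functions on a set are total functions
  whose values off that set (and on null sets) are irrelevant.
\<close>

section \<open>Lebesgue spaces, \<open>p \<in> [1, \<infinity>]\<close>\<close>

definition Lp_norm ::
    "ennreal \<Rightarrow> (real ^ 'n) set \<Rightarrow> (real ^ 'n \<Rightarrow> 'b::euclidean_space) \<Rightarrow> ennreal" where
  "Lp_norm p S f =
     (if p = \<infinity> then esssup (lebesgue_on S) (\<lambda>x. ennreal (norm (f x)))
      else let I = (\<integral>\<^sup>+ x. ennreal (norm (f x) powr enn2real p) \<partial>lebesgue_on S)
           in if I = \<infinity> then \<infinity> else ennreal (enn2real I powr (1 / enn2real p)))"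

definition Lp :: "ennreal \<Rightarrow> (real ^ 'n) set \<Rightarrow> (real ^ 'n \<Rightarrow> 'b::euclidean_space) set" where
  "Lp p S = {f \<in> borel_measurable (lebesgue_on S). Lp_norm p S f < \<infinity>}"

definition pairing ::
    "(real ^ 'n) set \<Rightarrow> (real ^ 'n \<Rightarrow> real) \<Rightarrow> (real ^ 'n \<Rightarrow> real) \<Rightarrow> real" where
  "pairing \<Omega> u v = (LINT x|lebesgue_on \<Omega>. u x * v x)"


section \<open>Triangulations\<close>

definition boundary_faces ::
    "(real ^ 'n) set \<Rightarrow> (real ^ 'n) set set \<Rightarrow> (real ^ 'n) set set" where
  "boundary_faces \<Omega> \<T> = {F. F \<subseteq> frontier \<Omega> \<and> (\<exists>T\<in>\<T>. F facet_of T)}"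

text \<open>
  \<open>triangulation\<close> is the library's notion: finitely many simplices, any two of which meet in a
  common (possibly empty) face. The last clause says that the boundary is resolved by \<open>\<T>\<close>; it holds
  automatically if \<open>\<Omega>\<close> is the interior of its closure, and it admits slit domains whose slits are
  unions of faces.
\<close>
definition regular_triangulation :: "(real ^ 'n) set \<Rightarrow> (real ^ 'n) set set \<Rightarrow> bool" where
  "regular_triangulation \<Omega> \<T> \<longleftrightarrow>
     triangulation \<T> \<and> (\<forall>T\<in>\<T>. int CARD('n) simplex T) \<and>
     closure \<Omega> = \<Union>\<T> \<and> frontier \<Omega> = \<Union>(boundary_faces \<Omega> \<T>)"

definition inradius :: "(real ^ 'n) set \<Rightarrow> real" where
  "inradius T = Sup {r. \<exists>x. cball x r \<subseteq> T}"

definition shape_regularity :: "(real ^ 'n) set set \<Rightarrow> real" where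
  "shape_regularity \<T> = Max ((\<lambda>T. diameter T / inradius T) ` \<T>)"

text \<open>A triangulated bounded polyhedral domain with a resolved part \<open>\<Gamma>\<close> of its boundary.\<close>
definition triangulated_domain ::
    "(real ^ 'n) set \<Rightarrow> (real ^ 'n) set set \<Rightarrow> (real ^ 'n) set \<Rightarrow> bool" where
  "triangulated_domain \<Omega> \<T> \<Gamma> \<longleftrightarrow>
     open \<Omega> \<and> connected \<Omega> \<and> bounded \<Omega> \<and> \<Omega> \<noteq> {} \<and> regular_triangulation \<Omega> \<T> \<and>
     (\<exists>\<F> \<subseteq> boundary_faces \<Omega> \<T>. \<Gamma> = \<Union>\<F>)"

definition neighbors :: "(real ^ 'n) set set \<Rightarrow> ((real ^ 'n) set \<times> (real ^ 'n) set) set" where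
  "neighbors \<T> = {(T, T'). T \<in> \<T> \<and> T' \<in> \<T> \<and> T \<noteq> T' \<and>
     (\<exists>x. x extreme_point_of T \<and> x extreme_point_of T')}"

definition delta :: "(real ^ 'n) set set \<Rightarrow> (real ^ 'n) set \<Rightarrow> (real ^ 'n) set \<Rightarrow> nat" where
  "delta \<T> T T' = (LEAST N. (T, T') \<in> neighbors \<T> ^^ N)"


section \<open>Lagrange finite elements and the \<open>L\<^sup>2\<close>-projection\<close>

definition poly_fun :: "nat \<Rightarrow> (real ^ 'n \<Rightarrow> real) \<Rightarrow> bool" where
  "poly_fun K q \<longleftrightarrow> (\<exists>c :: ('n \<Rightarrow> nat) \<Rightarrow> real.
     q = (\<lambda>x. \<Sum>\<alpha> | sum \<alpha> UNIV \<le> K. c \<alpha> * (\<Prod>i\<in>UNIV. x $ i ^ \<alpha> i)))"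

text \<open>Elements are functions on the open set \<open>\<Omega>\<close>, so continuity is required in \<open>\<Omega>\<close> only.\<close>
definition Lagrange :: "nat \<Rightarrow> (real ^ 'n) set \<Rightarrow> (real ^ 'n) set set \<Rightarrow> (real ^ 'n \<Rightarrow> real) set" where
  "Lagrange K \<Omega> \<T> = {v. continuous_on \<Omega> v \<and>
     (\<forall>T\<in>\<T>. \<exists>q. poly_fun K q \<and> (\<forall>x \<in> T \<inter> \<Omega>. v x = q x))}"

text \<open>
  \<open>v = 0\<close> on \<open>\<Gamma>\<close> is imposed on each face of which \<open>\<Gamma>\<close> is made, as the limit from inside \<open>\<Omega>\<close> at every
  point of the relative interior. If \<open>v\<close> extends continuously to the closure of \<open>\<Omega>\<close> (for instance
  if \<open>\<Omega>\<close> is Lipschitz), then this says that the extension vanishes at all points of \<open>\<Gamma>\<close>. If the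
  closure of \<open>\<Omega>\<close> touches itself at lower-dimensional faces, nothing is imposed on simplices which
  meet \<open>\<Gamma>\<close> only across such a contact.
\<close>
definition Lagrange_bc ::
    "nat \<Rightarrow> (real ^ 'n) set \<Rightarrow> (real ^ 'n) set set \<Rightarrow> (real ^ 'n) set \<Rightarrow> (real ^ 'n \<Rightarrow> real) set" where
  "Lagrange_bc K \<Omega> \<T> \<Gamma> = {v \<in> Lagrange K \<Omega> \<T>.
     \<forall>F \<in> boundary_faces \<Omega> \<T>. F \<subseteq> \<Gamma> \<longrightarrow> (\<forall>x \<in> rel_interior F. (v \<longlongrightarrow> 0) (at x within \<Omega>))}"

definition L2_projection ::
    "nat \<Rightarrow> (real ^ 'n) set \<Rightarrow> (real ^ 'n) set set \<Rightarrow> (real ^ 'n) set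
      \<Rightarrow> (real ^ 'n \<Rightarrow> real) \<Rightarrow> (real ^ 'n \<Rightarrow> real)" where
  "L2_projection K \<Omega> \<T> \<Gamma> u = (SOME w. w \<in> Lagrange_bc K \<Omega> \<T> \<Gamma> \<and>
     (\<forall>v \<in> Lagrange_bc K \<Omega> \<T> \<Gamma>. pairing \<Omega> w v = pairing \<Omega> u v))"


section \<open>Sobolev spaces\<close>

definition grad :: "(real ^ 'n \<Rightarrow> real) \<Rightarrow> real ^ 'n \<Rightarrow> real ^ 'n" where
  "grad f x = (\<chi> i. frechet_derivative f (at x) (axis i 1))"

primrec Ck :: "nat \<Rightarrow> (real ^ 'n \<Rightarrow> real) \<Rightarrow> bool" where
  "Ck 0 f \<longleftrightarrow> continuous_on UNIV f"
| "Ck (Suc k) f \<longleftrightarrow> (\<forall>x. f differentiable (at x)) \<and> (\<forall>i. Ck k (\<lambda>x. grad f x $ i))"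

definition smooth :: "(real ^ 'n \<Rightarrow> real) \<Rightarrow> bool" where
  "smooth f \<longleftrightarrow> (\<forall>k. Ck k f)"

definition test_function :: "(real ^ 'n) set \<Rightarrow> (real ^ 'n \<Rightarrow> real) \<Rightarrow> bool" where
  "test_function \<Omega> \<phi> \<longleftrightarrow>
     smooth \<phi> \<and> compact (closure {x. \<phi> x \<noteq> 0}) \<and> closure {x. \<phi> x \<noteq> 0} \<subseteq> \<Omega>"

definition weak_gradient ::
    "(real ^ 'n) set \<Rightarrow> (real ^ 'n \<Rightarrow> real) \<Rightarrow> (real ^ 'n \<Rightarrow> real ^ 'n) \<Rightarrow> bool" where
  "weak_gradient \<Omega> u G \<longleftrightarrow>
     (\<forall>S. compact S \<and> S \<subseteq> \<Omega> \<longrightarrow> u absolutely_integrable_on S \<and> G absolutely_integrable_on S) \<and>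
     (\<forall>\<phi> i. test_function \<Omega> \<phi> \<longrightarrow>
        pairing \<Omega> u (\<lambda>x. grad \<phi> x $ i) = - pairing \<Omega> (\<lambda>x. G x $ i) \<phi>)"

definition wgrad :: "(real ^ 'n) set \<Rightarrow> (real ^ 'n \<Rightarrow> real) \<Rightarrow> (real ^ 'n \<Rightarrow> real ^ 'n)" where
  "wgrad \<Omega> u = (SOME G. weak_gradient \<Omega> u G)"

definition W1p :: "ennreal \<Rightarrow> (real ^ 'n) set \<Rightarrow> (real ^ 'n \<Rightarrow> real) set" where
  "W1p p \<Omega> = {u \<in> Lp p \<Omega>. (\<exists>G. weak_gradient \<Omega> u G) \<and> wgrad \<Omega> u \<in> Lp p \<Omega>}"

text \<open>
  The \<open>(d-1)\<close>-dimensional surface integral over a facet \<open>F\<close>: \<open>F\<close> is thickened to the right prism of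
  height 1 around it, and the integrand is extended constantly in normal direction (the nearest
  point of the hyperplane \<open>affine hull F\<close> is the orthogonal projection). By Fubini the Lebesgue
  integral over the prism is the surface integral; for \<open>d = 1\<close> it is point evaluation.
\<close>
definition facet_integral :: "(real ^ 'n) set \<Rightarrow> (real ^ 'n \<Rightarrow> ennreal) \<Rightarrow> ennreal" where
  "facet_integral F f =
     (let P = closest_point (affine hull F)
      in \<integral>\<^sup>+ y. f (P y) \<partial>lebesgue_on {y. P y \<in> F \<and> dist y (P y) \<le> 1 / 2})"

text \<open>
  The trace on a facet \<open>F\<close> of a simplex \<open>T\<close> is the continuous extension of the restriction map, from
  functions smooth up to the boundary to \<open>W\<^sup>1\<^sup>,\<^sup>1(T)\<close> (in which such functions are dense), with values
  in \<open>L\<^sup>1(F)\<close>. Since \<open>T\<close> is bounded, this covers all \<open>W\<^sup>1\<^sup>,\<^sup>p\<close>, including \<open>p = \<infinity>\<close>. The trace of \<open>u\<close> is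
  zero iff the restrictions to \<open>F\<close> of some approximating sequence tend to zero in \<open>L\<^sup>1(F)\<close>.
\<close>
definition zero_trace ::
    "(real ^ 'n) set \<Rightarrow> (real ^ 'n) set \<Rightarrow> (real ^ 'n) set \<Rightarrow> (real ^ 'n \<Rightarrow> real) \<Rightarrow> bool" where
  "zero_trace \<Omega> T F u \<longleftrightarrow> (\<exists>\<phi> :: nat \<Rightarrow> real ^ 'n \<Rightarrow> real. (\<forall>k. smooth (\<phi> k)) \<and>
     (\<lambda>k. Lp_norm 1 T (\<lambda>x. \<phi> k x - u x)) \<longlonglongrightarrow> 0 \<and>
     (\<lambda>k. Lp_norm 1 T (\<lambda>x. grad (\<phi> k) x - wgrad \<Omega> u x)) \<longlonglongrightarrow> 0 \<and>
     (\<lambda>k. facet_integral F (\<lambda>x. ennreal \<bar>\<phi> k x\<bar>)) \<longlonglongrightarrow> 0)"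

definition W1p_bc ::
    "ennreal \<Rightarrow> (real ^ 'n) set \<Rightarrow> (real ^ 'n) set set \<Rightarrow> (real ^ 'n) set \<Rightarrow> (real ^ 'n \<Rightarrow> real) set" where
  "W1p_bc p \<Omega> \<T> \<Gamma> = {u \<in> W1p p \<Omega>.
     \<forall>T\<in>\<T>. \<forall>F. F facet_of T \<and> F \<subseteq> \<Gamma> \<longrightarrow> zero_trace \<Omega> T F u}"


section \<open>Weights, mesh size functions, and the worst grading\<close>

definition ess_sup :: "(real ^ 'n) set \<Rightarrow> (real ^ 'n \<Rightarrow> real) \<Rightarrow> ereal" where
  "ess_sup S f = esssup (lebesgue_on S) (\<lambda>x. ereal (f x))"

definition ess_inf :: "(real ^ 'n) set \<Rightarrow> (real ^ 'n \<Rightarrow> real) \<Rightarrow> ereal" where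
  "ess_inf S f = - ess_sup S (\<lambda>x. - f x)"

definition weight ::
    "(real ^ 'n) set \<Rightarrow> (real ^ 'n) set set \<Rightarrow> real \<Rightarrow> (real ^ 'n \<Rightarrow> real) \<Rightarrow> bool" where
  "weight \<Omega> \<T> \<gamma> \<rho> \<longleftrightarrow> \<gamma> \<ge> 1 \<and> \<rho> \<in> Lp 1 \<Omega> \<and> (AE x in lebesgue_on \<Omega>. \<rho> x > 0) \<and>
     (\<forall>T\<in>\<T>. ess_sup T \<rho> \<le> ereal \<gamma> * ess_inf T \<rho>) \<and>
     (\<forall>T\<in>\<T>. \<forall>T'\<in>\<T>. delta \<T> T T' = 1 \<longrightarrow>
        ess_sup T' \<rho> \<le> ereal \<gamma> * ess_sup T \<rho> \<and> ess_inf T' \<rho> \<le> ereal \<gamma> * ess_inf T \<rho>)"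

text \<open>\<open>M\<close> is the constant in both equivalences \<open>ess inf h \<eqsim> diam T \<eqsim> ess sup h\<close>.\<close>
definition mesh_size_function ::
    "real \<Rightarrow> (real ^ 'n) set \<Rightarrow> (real ^ 'n) set set \<Rightarrow> real \<Rightarrow> (real ^ 'n \<Rightarrow> real) \<Rightarrow> bool" where
  "mesh_size_function M \<Omega> \<T> \<gamma> h \<longleftrightarrow> weight \<Omega> \<T> \<gamma> h \<and>
     (\<forall>T\<in>\<T>. ess_inf T h \<le> ereal M * ereal (diameter T) \<and> ereal (diameter T) \<le> ereal M * ess_inf T h \<and>
            ess_sup T h \<le> ereal M * ereal (diameter T) \<and> ereal (diameter T) \<le> ereal M * ess_sup T h)"

text \<open>
  \<open>C \<gamma>\<close> is the stability constant for weights of grading \<open>\<gamma>\<close>. On one finite mesh such constants exist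
  for every \<open>\<gamma>\<close>, so the notion has content only through \<open>C\<close>, which is therefore a parameter: it is
  shared by all meshes to which one constant is meant to apply. That \<open>\<gamma>max\<close> is the largest such
  number (for the given \<open>C\<close>) is not required.
\<close>
definition worst_grading ::
    "(real \<Rightarrow> real) \<Rightarrow> nat \<Rightarrow> (real ^ 'n) set \<Rightarrow> (real ^ 'n) set set \<Rightarrow> (real ^ 'n) set \<Rightarrow> real \<Rightarrow> bool"
  where
  "worst_grading C K \<Omega> \<T> \<Gamma> \<gamma>max \<longleftrightarrow>
     (\<forall>\<gamma> \<rho>. weight \<Omega> \<T> \<gamma> \<rho> \<and> \<gamma> < \<gamma>max \<longrightarrow>
        (\<forall>u \<in> Lp 2 \<Omega>. Lp_norm 2 \<Omega> (\<lambda>x. \<rho> x * L2_projection K \<Omega> \<T> \<Gamma> u x)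
                      \<le> ennreal (C \<gamma>) * Lp_norm 2 \<Omega> (\<lambda>x. \<rho> x * u x)))"

end

theory Submission
  imports Defs "HOL-Computational_Algebra.Polynomial"
begin

text \<open>The weighted \<open>L\<^sup>2\<close> bound is only needed for weights that are constant on simplices. By inverse estimates
  \<open>Q u\<close> and \<open>u\<close> may be replaced by sequences indexed by the simplices, and summing a sequence against a
  geometrically decaying kernel in \<open>\<delta>\<close> produces a graded majorant; inserting a power of the majorant of one of the
  two sequences as an additional weight turns the \<open>L\<^sup>2\<close> bound into an \<open>L\<^sup>p\<close> bound. For the
  gradient, \<open>Q u - v = Q (u - v)\<close> with a quasi-interpolant \<open>v\<close> of \<open>u\<close>, and the \<open>L\<^sup>p\<close> bound is
  applied with the weight \<open>\<rho> / h\<close>.\<close>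

section \<open>Smooth functions\<close>

text \<open>The exponents come from counting volume. On a mesh with grading \<gamma> the simplices
  at distance \<open>n\<close> from \<open>S\<close> have total volume at most of order
  \<open>(n + 1)^d * \<gamma>^(n * d) * vol S\<close>, so the kernel
  \<open>(\<gamma>^d * s)^(-n)\<close> has bounded sums for every \<open>s > 1\<close>; such an
  \<open>s\<close> is the margin in the strict inequality on the gradings. A majorant built with it
  has grading \<open>\<gamma>^d * s\<close> and enters with a power of modulus \<open>2 * e\<close>,
  where \<open>e\<close> is the distance of \<open>1/p\<close> from \<open>1/2\<close>. As weights
  are squared in \<open>L^2\<close>, this costs \<open>\<gamma>^(d * e)\<close> up to powers of
  \<open>s\<close>; division by the mesh size costs one more \<gamma>. The geometric obstacle is
  that \<Omega> need not be Lipschitz: simplices with a common vertex may be separated by a slit.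
  Averages are therefore compared only for simplices that meet inside \<Omega>, through a ball in
  \<Omega> around the barycenter of their common face. At nodes on \<Gamma> the interpolant is 0, so
  a zero trace has to bound the average on an adjacent simplex. Every constant is an explicit term
  free of the mesh, hence uniform.\<close>

lemma grad_nth: "(f has_derivative f') (at x) \<Longrightarrow> grad f x $ i = f' (axis i 1)" by (simp add: grad_def frechet_derivative_at[symmetric])

lemma has_derivative_grad:
  assumes "f differentiable (at x)"
  shows "(f has_derivative (\<lambda>v. grad f x \<bullet> v)) (at x)" proof -
  have der: "(f has_derivative frechet_derivative f (at x)) (at x)" using assms frechet_derivative_works by blast
  have "frechet_derivative f (at x) v = grad f x \<bullet> v" for v proof -
    have "frechet_derivative f (at x) v = frechet_derivative f (at x) (\<Sum>i\<in>UNIV. (v $ i) *\<^sub>R axis i 1)"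
      using basis_expansion[of v] by (simp add: scalar_mult_eq_scaleR)
    also have "\<dots> = (\<Sum>i\<in>UNIV. (v $ i) * frechet_derivative f (at x) (axis i 1))" using linear_frechet_derivative[OF assms] by (simp add: linear_sum linear_cmul)
    finally show ?thesis by (simp add: grad_def inner_vec_def mult.commute)
  qed
  then have "frechet_derivative f (at x) = (\<lambda>v. grad f x \<bullet> v)" by auto
  then show ?thesis using der by simp
qed

lemma grad_unique:
  assumes "(f has_derivative (\<lambda>v. g \<bullet> v)) (at x)"
  shows "grad f x = g" using grad_nth[OF assms] by (simp add: vec_eq_iff inner_axis)

lemma grad_const [simp]: "grad (\<lambda>x. c) x = 0" by (rule grad_unique) auto

lemma grad_add:
  assumes "f differentiable (at x)" "g differentiable (at x)"
  shows "grad (\<lambda>x. f x + g x) x = grad f x + grad g x" by (rule grad_unique) (use has_derivative_add[OF has_derivative_grad[OF assms(1)] has_derivative_grad[OF assms(2)]]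
      in \<open>simp add: inner_add_left\<close>)

lemma grad_mult:
  assumes "f differentiable (at x)" "g differentiable (at x)"
  shows "grad (\<lambda>x. f x * g x) x = f x *\<^sub>R grad g x + g x *\<^sub>R grad f x" by (rule grad_unique)
    (use has_derivative_mult[OF has_derivative_grad[OF assms(1)] has_derivative_grad[OF assms(2)]]
      in \<open>simp add: inner_add_left algebra_simps\<close>)

lemma grad_compose_real:
  assumes "f differentiable (at x)" "(\<phi> has_real_derivative d) (at (f x))"
  shows "grad (\<lambda>x. \<phi> (f x)) x = d *\<^sub>R grad f x" proof (rule grad_unique)
  have "((\<lambda>x. \<phi> (f x)) has_derivative (\<lambda>v. d * (grad f x \<bullet> v))) (at x)"
    using has_derivative_compose[OF has_derivative_grad[OF assms(1)], of \<phi> "\<lambda>v. d * v"] assms(2) by (simp add: has_field_derivative_def)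
  then show "((\<lambda>x. \<phi> (f x)) has_derivative (\<lambda>v. (d *\<^sub>R grad f x) \<bullet> v)) (at x)" by simp
qed

lemma Ck_SucD: "Ck (Suc k) f \<Longrightarrow> Ck k f" proof (induction k arbitrary: f)
  case 0
  then show ?case by (auto intro!: continuous_at_imp_continuous_on differentiable_imp_continuous_within)
next
  case (Suc k)
  then show ?case by (metis Ck.simps(2))
qed

lemma Ck_const: "Ck k (\<lambda>x. c)" by (induction k arbitrary: c) auto

lemma Ck_add: "Ck k f \<Longrightarrow> Ck k g \<Longrightarrow> Ck k (\<lambda>x. f x + g x)" proof (induction k arbitrary: f g)
  case 0
  then show ?case by (auto intro: continuous_on_add)
next
  case (Suc k)
  then show ?case by (auto simp: grad_add)
qed

lemma Ck_mult: "Ck k f \<Longrightarrow> Ck k g \<Longrightarrow> Ck k (\<lambda>x. f x * g x)" proof (induction k arbitrary: f g)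
  case 0
  then show ?case by (auto intro: continuous_on_mult)
next
  case (Suc k)
  have "Ck k f" "Ck k g" using Suc.prems by (blast intro: Ck_SucD)+
  then show ?case using Suc by (auto simp: grad_mult intro!: Ck_add)
qed

text \<open>The chain rule brings in derivatives of \<open>\<phi>\<close>, so the induction on
  \<open>k\<close> has to run over all members of a family closed under differentiation at once. Two
  summands per derivative are what the family \<open>flat\<close> needs; for \<open>exp\<close> the
  second coefficient is 0.\<close>

lemma Ck_family_compose:
  assumes f: "Ck k f"
    and \<phi>: "\<phi> \<in> \<Phi>"
    and closed: "\<And>\<phi>. \<phi> \<in> \<Phi> \<Longrightarrow> \<exists>a b \<alpha> \<beta>. \<alpha> \<in> \<Phi> \<and> \<beta> \<in> \<Phi> \<and>
      (\<forall>t::real. (\<phi> has_real_derivative a * \<alpha> t + b * \<beta> t) (at t))"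
  shows "Ck k (\<lambda>x. \<phi> (f x))" using f \<phi> proof (induction k arbitrary: \<phi>)
  case 0
  obtain a b \<alpha> \<beta> where "\<And>t. (\<phi> has_real_derivative a * \<alpha> t + b * \<beta> t) (at t)" using closed[OF 0(2)] by metis
  then have "continuous_on UNIV \<phi>" by (meson DERIV_isCont continuous_at_imp_continuous_on)
  then show ?case using 0 by (auto intro: continuous_on_compose2)
next
  case (Suc k)
  obtain a b \<alpha> \<beta> where ab: "\<alpha> \<in> \<Phi>" "\<beta> \<in> \<Phi>"
    and der: "\<And>t. (\<phi> has_real_derivative a * \<alpha> t + b * \<beta> t) (at t)" using closed[OF Suc.prems(2)] by metis
  have fk: "Ck k f" and fd: "\<And>x. f differentiable (at x)" and fg: "\<And>i. Ck k (\<lambda>x. grad f x $ i)" using Suc.prems(1) Ck_SucD by auto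
  have "(\<lambda>x. grad (\<lambda>x. \<phi> (f x)) x $ i) = (\<lambda>x. (a * \<alpha> (f x) + b * \<beta> (f x)) * grad f x $ i)" for i
    by (simp add: grad_compose_real[OF fd der])
  moreover have "Ck k (\<lambda>x. (a * \<alpha> (f x) + b * \<beta> (f x)) * grad f x $ i)" for i by (intro Ck_mult Ck_add Ck_const Suc.IH[OF fk ab(1)] Suc.IH[OF fk ab(2)] fg)
  moreover have "(\<lambda>x. \<phi> (f x)) differentiable (at x)" for x proof -
    have "\<phi> differentiable (at (f x))" using der real_differentiable_def by blast
    then show ?thesis using differentiable_chain_at[OF fd[of x]] by (simp add: o_def)
  qed
  ultimately show ?case by simp
qed

lemma smooth_const: "smooth (\<lambda>x. c)" by (simp add: smooth_def Ck_const)

lemma smooth_add: "smooth f \<Longrightarrow> smooth g \<Longrightarrow> smooth (\<lambda>x. f x + g x)" by (simp add: smooth_def Ck_add)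

lemma smooth_mult: "smooth f \<Longrightarrow> smooth g \<Longrightarrow> smooth (\<lambda>x. f x * g x)" by (simp add: smooth_def Ck_mult)

lemma smooth_diff: "smooth f \<Longrightarrow> smooth g \<Longrightarrow> smooth (\<lambda>x. f x - g x)"
  using smooth_add[OF _ smooth_mult[OF smooth_const[of "-1"]], of f g] by simp

lemma smooth_sum: "(\<And>i. i \<in> I \<Longrightarrow> smooth (f i)) \<Longrightarrow> smooth (\<lambda>x. \<Sum>i\<in>I. f i x)"
  by (induction I rule: infinite_finite_induct) (auto intro: smooth_const smooth_add)

lemma smooth_prod: "(\<And>i. i \<in> I \<Longrightarrow> smooth (f i)) \<Longrightarrow> smooth (\<lambda>x. \<Prod>i\<in>I. f i x)"
  by (induction I rule: infinite_finite_induct) (auto intro: smooth_const smooth_mult)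

lemma smooth_power: "smooth f \<Longrightarrow> smooth (\<lambda>x. f x ^ n)" by (induction n) (auto intro: smooth_const smooth_mult)

lemma smooth_nth: "smooth (\<lambda>x::real^'n. x $ j)" proof -
  have "((\<lambda>x::real^'n. x $ j) has_derivative (\<lambda>v. v $ j)) (at x)" for x
    by (rule bounded_linear.has_derivative[OF bounded_linear_vec_nth]) (rule has_derivative_ident)
  note d = this
  have *: "(\<lambda>x. grad (\<lambda>x::real^'n. x $ j) x $ i) = (\<lambda>x. axis i 1 $ j)" for i using grad_nth[OF d] by auto
  show ?thesis unfolding smooth_def proof
    fix k
    show "Ck k (\<lambda>x::real^'n. x $ j)" proof (cases k)
      case 0
      then show ?thesis by (simp add: continuous_on_component)
    next
      case (Suc k)
      then show ?thesis using d * Ck_const by (auto simp: differentiable_def)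
    qed
  qed
qed

lemma smooth_differentiable: "smooth f \<Longrightarrow> f differentiable (at x)" unfolding smooth_def by (metis Ck.simps(2))

lemma smooth_continuous_on: "smooth f \<Longrightarrow> continuous_on S f" unfolding smooth_def by (metis Ck.simps(1) continuous_on_subset subset_UNIV)

lemma smooth_grad_nth: "smooth f \<Longrightarrow> smooth (\<lambda>x. grad f x $ i)" unfolding smooth_def by (metis Ck.simps(2))

lemma continuous_on_grad: "smooth f \<Longrightarrow> continuous_on S (grad f)" using smooth_continuous_on[OF smooth_grad_nth]
  by (intro continuous_on_vec_lambda[where f="\<lambda>i x. grad f x $ i", unfolded vec_lambda_eta]) blast

lemma smooth_shift: "smooth f \<Longrightarrow> smooth (\<lambda>x. f (x + a))" proof -
  have "Ck k f \<Longrightarrow> Ck k (\<lambda>x. f (x + a))" for k proof (induction k arbitrary: f)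
    case 0
    then show ?case by (auto intro!: continuous_intros intro: continuous_on_compose2)
  next
    case (Suc k)
    have fd: "\<And>x. f differentiable (at x)" and fg: "\<And>i. Ck k (\<lambda>x. grad f x $ i)" using Suc.prems by auto
    have D: "((\<lambda>x. f (x + a)) has_derivative (\<lambda>v. grad f (x + a) \<bullet> v)) (at x)" for x proof (rule has_derivative_compose[OF _ has_derivative_grad[OF fd]])
      show "((\<lambda>x. x + a) has_derivative (\<lambda>v. v)) (at x)" by (auto intro!: derivative_eq_intros)
    qed
    then have "grad (\<lambda>x. f (x + a)) x = grad f (x + a)" for x by (rule grad_unique)
    then show ?case using Suc.IH[OF fg] D by (auto simp: differentiable_def)
  qed
  then show "smooth f \<Longrightarrow> smooth (\<lambda>x. f (x + a))" by (simp add: smooth_def)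
qed

text \<open>\<open>flat 0\<close> is the classical smooth function \<open>exp (- 1 / t)\<close>
  continued by 0. The powers of \<open>t\<close> in the denominator are the ones that
  differentiation produces, so the family is closed under derivatives.\<close>

definition flat :: "nat \<Rightarrow> real \<Rightarrow> real" where
  "flat n t = (if t > 0 then exp (- 1 / t) / t ^ n else 0)"

text \<open>The exponential series at \<open>1 / t\<close> dominates its term of order
  \<open>n + 2\<close>. This order leaves a factor \<open>t\<^sup>2\<close>, which makes the
  difference quotient at 0 tend to 0. The value of the constant matters once more: for
  \<open>n = 2\<close> it is 24, which enters the bound for functions with zero trace.\<close>

lemma flat_bound:
  assumes "0 \<le> t"
  shows "flat n t \<le> fact (n + 2) * t\<^sup>2" proof (cases "t = 0")
  case False
  then have t: "t > 0" using assms by simp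
  have "(1/t) ^ (n+2) / fact (n+2) \<le> exp (1/t)" proof -
    have "(1/t) ^ (n+2) / fact (n+2) \<le> (\<Sum>m<n+3. (1/t) ^ m / fact m)" using t by (intro member_le_sum) auto
    also have "\<dots> \<le> (\<Sum>m. (1/t) ^ m / fact m)" using t summable_exp_generic[of "1/t"] by (intro sum_le_suminf) (auto simp: field_simps)
    finally show ?thesis by (simp add: exp_def field_simps)
  qed
  then have "exp (- 1/t) \<le> fact (n+2) * t ^ (n+2)" using t by (simp add: exp_minus field_simps power_divide del: fact_Suc)
  then show ?thesis using t by (simp add: flat_def field_simps power_add power2_eq_square del: fact_Suc)
qed (simp add: flat_def)

lemma flat_deriv: "(flat n has_real_derivative (- real n * flat (Suc n) t + 1 * flat (n + 2) t)) (at t)" proof -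
  consider "t > 0" | "t < 0" | "t = 0" by linarith
  then show ?thesis proof cases
    case 1
    have "((\<lambda>t. exp (- 1 / t) / t ^ n) has_real_derivative (- real n * flat (Suc n) t + flat (n + 2) t)) (at t)" proof (cases n)
      case 0
      then show ?thesis using 1 by (auto intro!: derivative_eq_intros simp: flat_def power2_eq_square field_simps)
    next
      case (Suc m)
      have "((\<lambda>t. exp (- 1 / t) / t ^ n) has_real_derivative
          (exp (- 1 / t) * (1 / t\<^sup>2) * t ^ n - exp (- 1 / t) * (real n * t ^ m)) / (t ^ n * t ^ n)) (at t)" proof -
        have "((\<lambda>t. t ^ n) has_real_derivative real n * t ^ m) (at t)" using DERIV_pow[of n t] Suc by simp
        moreover have "((\<lambda>t. exp (- 1 / t)) has_real_derivative exp (- 1 / t) * (1 / t\<^sup>2)) (at t)"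
          using 1 by (auto intro!: derivative_eq_intros simp: power2_eq_square)
        ultimately show ?thesis using 1 by (intro DERIV_divide) auto
      qed
      also have "(exp (- 1 / t) * (1 / t\<^sup>2) * t ^ n - exp (- 1 / t) * (real n * t ^ m)) / (t ^ n * t ^ n) =
          - real n * flat (Suc n) t + flat (n + 2) t" using 1 Suc by (simp add: flat_def field_simps power2_eq_square)
      finally show ?thesis .
    qed
    moreover have "eventually (\<lambda>s. s > 0) (nhds t)" using eventually_nhds_in_open[of "{0<..}" t] 1 by simp
    then have "eventually (\<lambda>s. flat n s = exp (- 1 / s) / s ^ n) (nhds t)" by eventually_elim (simp add: flat_def)
    ultimately show ?thesis by (subst DERIV_cong_ev[OF refl _ refl]) auto
  next
    case 2
    have "eventually (\<lambda>s. s < 0) (nhds t)" using eventually_nhds_in_open[of "{..<0}" t] 2 by simp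
    then have "eventually (\<lambda>s. flat n s = 0) (nhds t)" by eventually_elim (simp add: flat_def)
    then show ?thesis using 2 by (subst DERIV_cong_ev[OF refl _ refl]) (auto simp: flat_def)
  next
    case 3
    have "((\<lambda>s. (flat n s - flat n 0) / (s - 0)) \<longlongrightarrow> 0) (at 0)" proof (rule Lim_null_comparison)
      show "\<forall>\<^sub>F s in at 0. norm ((flat n s - flat n 0) / (s - 0)) \<le> fact (n+2) * \<bar>s\<bar>" proof (rule always_eventually, rule allI)
        fix s :: real
        have "\<bar>flat n s\<bar> \<le> fact (n+2) * s\<^sup>2" using flat_bound[of s n] by (cases "s \<ge> 0") (auto simp: flat_def)
        then show "norm ((flat n s - flat n 0) / (s - 0)) \<le> fact (n+2) * \<bar>s\<bar>"
          by (cases "s = 0") (auto simp: flat_def power2_eq_square field_simps abs_mult simp del: fact_Suc)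
      qed
      show "((\<lambda>s. fact (n+2) * \<bar>s\<bar>) \<longlongrightarrow> 0) (at (0::real))" by (rule tendsto_eq_intros refl)+ simp
    qed
    then show ?thesis using 3 by (simp add: has_field_derivative_iff flat_def)
  qed
qed

lemma smooth_flat: "smooth f \<Longrightarrow> smooth (\<lambda>x. flat n (f x))" unfolding smooth_def proof
  fix k
  assume f: "\<forall>k. Ck k f"
  show "Ck k (\<lambda>x. flat n (f x))" proof (rule Ck_family_compose[of k f _ "range flat"])
    show "\<exists>a b \<alpha> \<beta>. \<alpha> \<in> range flat \<and> \<beta> \<in> range flat \<and>
        (\<forall>t. (\<phi> has_real_derivative a * \<alpha> t + b * \<beta> t) (at t))" if \<phi>: "\<phi> \<in> range flat" for \<phi> proof -
      obtain m where "\<phi> = flat m" using \<phi> by blast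
      then show ?thesis using flat_deriv[of m] by (intro exI[of _ "- real m"] exI[of _ 1] exI[of _ "flat (Suc m)"]
          exI[of _ "flat (m + 2)"]) simp
    qed
  qed (use f in simp_all)
qed

lemma smooth_exp: "smooth f \<Longrightarrow> smooth (\<lambda>x. exp (f x))" unfolding smooth_def proof
  fix k
  assume f: "\<forall>k. Ck k f"
  show "Ck k (\<lambda>x. exp (f x))" proof (rule Ck_family_compose[of k f _ "{exp}"])
    show "\<exists>a b \<alpha> \<beta>. \<alpha> \<in> {exp} \<and> \<beta> \<in> {exp} \<and>
        (\<forall>t. (\<phi> has_real_derivative a * \<alpha> t + b * \<beta> t) (at t))" if "\<phi> \<in> {exp}" for \<phi> :: "real \<Rightarrow> real"
      using that by (intro exI[of _ 1] exI[of _ 0] exI[of _ exp]) (auto intro!: derivative_eq_intros)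
  qed (use f in simp_all)
qed

lemma smooth_dist_square: "smooth (\<lambda>x::real^'n. (norm (x - a))\<^sup>2)" unfolding power2_norm_eq_inner inner_vec_def inner_real_def vector_minus_component
  by (intro smooth_sum smooth_mult smooth_diff smooth_const smooth_nth)

text \<open>A finite sum \<open>b\<close> of radial bumps is positive on the compact set
  \<open>K\<close>, but its size there is unknown. The function \<open>1 - exp (- m * b x)\<close>
  has the same zeros, stays below 1, and for large \<open>m\<close> is uniformly close to 1 on
  \<open>K\<close>.\<close>

lemma test_function_compact_open:
  fixes K V :: "(real^'n) set"
  assumes "compact K" "open V" "K \<subseteq> V" "\<epsilon> > 0"
  obtains \<psi> where "test_function V \<psi>" "\<And>x. 0 \<le> \<psi> x" "\<And>x. \<psi> x \<le> 1" "\<And>x. x \<in> K \<Longrightarrow> 1 - \<epsilon> \<le> \<psi> x" proof -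
  have "\<exists>r>0. cball x r \<subseteq> V" if "x \<in> K" for x using assms that open_contains_cball by blast
  then obtain r where r: "\<And>x. x \<in> K \<Longrightarrow> r x > 0 \<and> cball x (r x) \<subseteq> V" by metis
  have "K \<subseteq> (\<Union>x\<in>K. ball x (r x))" using r by force
  then obtain F where F: "F \<subseteq> K" "finite F" "K \<subseteq> (\<Union>x\<in>F. ball x (r x))"
    using compactE_image[OF assms(1), of K "\<lambda>x. ball x (r x)"] by (metis open_ball)
  define b where "b = (\<lambda>x. \<Sum>a\<in>F. flat 0 ((r a)\<^sup>2 - (norm (x - a))\<^sup>2))"
  have flat_pos: "flat 0 t > 0 \<longleftrightarrow> t > 0" and flat_nonneg: "flat 0 t \<ge> 0" for t by (auto simp: flat_def)
  have b_smooth: "smooth b" unfolding b_def by (intro smooth_sum smooth_flat smooth_diff smooth_const smooth_dist_square)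
  have b_nonneg: "b x \<ge> 0" for x unfolding b_def by (intro sum_nonneg flat_nonneg)
  have b_pos: "b x > 0" if xK: "x \<in> K" for x proof -
    obtain a where a: "a \<in> F" "x \<in> ball a (r a)" using F(3) xK by blast
    then have "norm (x - a) < r a" by (simp add: dist_norm norm_minus_commute)
    then have "(norm (x - a))\<^sup>2 < (r a)\<^sup>2" by (intro power_strict_mono) auto
    then have "flat 0 ((r a)\<^sup>2 - (norm (x - a))\<^sup>2) > 0" by (subst flat_pos) simp
    then show ?thesis unfolding b_def by (rule sum_pos2[OF F(2) a(1)]) (rule flat_nonneg)
  qed
  have b_supp: "{x. b x \<noteq> 0} \<subseteq> (\<Union>a\<in>F. cball a (r a))" proof
    fix x assume "x \<in> {x. b x \<noteq> 0}"
    then have "(\<Sum>a\<in>F. flat 0 ((r a)\<^sup>2 - (norm (x - a))\<^sup>2)) \<noteq> 0" by (simp add: b_def)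
    then obtain a where a: "a \<in> F" "flat 0 ((r a)\<^sup>2 - (norm (x - a))\<^sup>2) \<noteq> 0" by (rule sum.not_neutral_contains_not_neutral)
    then have "(norm (x - a))\<^sup>2 < (r a)\<^sup>2" by (auto simp: flat_def split: if_splits)
    then have "norm (x - a) < r a" using r F(1) a(1) power_less_imp_less_base by fastforce
    then show "x \<in> (\<Union>a\<in>F. cball a (r a))" using a(1) by (auto simp: dist_norm norm_minus_commute intro!: bexI[of _ a])
  qed
  obtain c where c: "c > 0" "\<And>x. x \<in> K \<Longrightarrow> c \<le> b x" proof (cases "K = {}")
    case False
    obtain x where "x \<in> K" "\<And>y. y \<in> K \<Longrightarrow> b x \<le> b y" using continuous_attains_inf[OF assms(1) False smooth_continuous_on[OF b_smooth]] by blast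
    then show ?thesis using that b_pos by blast
  qed (use that[of 1] in auto)
  \<comment> \<open>The choice \<open>m = max 1 (- ln \<epsilon>) / c\<close> gives
    \<open>m * c \<ge> - ln \<epsilon>\<close>; the maximum keeps \<open>m\<close> positive when
    \<open>\<epsilon> \<ge> 1\<close>.\<close>
  obtain m where m: "exp (- m * c) \<le> \<epsilon>" "m > 0" proof -
    have *: "exp (- (max 1 (- ln \<epsilon>) / c) * c) \<le> exp (ln \<epsilon>)" using c by simp
    show ?thesis by (rule that[of "max 1 (- ln \<epsilon>) / c"]) (use * c assms(4) in auto)
  qed
  define \<psi> where "\<psi> = (\<lambda>x. 1 - exp (- m * b x))"
  have supp: "closure {x. \<psi> x \<noteq> 0} \<subseteq> (\<Union>a\<in>F. cball a (r a))" proof (rule closure_minimal)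
    show "closed (\<Union>a\<in>F. cball a (r a))" using F by auto
    show "{x. \<psi> x \<noteq> 0} \<subseteq> (\<Union>a\<in>F. cball a (r a))" using b_supp m by (auto simp: \<psi>_def)
  qed
  have cov: "compact (\<Union>a\<in>F. cball a (r a))" "(\<Union>a\<in>F. cball a (r a)) \<subseteq> V" using F r by (auto intro!: compact_UN)
  show ?thesis proof (rule that[of \<psi>])
    show "test_function V \<psi>" unfolding test_function_def proof (intro conjI)
      show "smooth \<psi>" unfolding \<psi>_def by (intro smooth_diff smooth_const smooth_exp smooth_mult b_smooth)
      show "compact (closure {x. \<psi> x \<noteq> 0})" using supp cov(1) by (meson bounded_subset closed_closure compact_eq_bounded_closed)
      show "closure {x. \<psi> x \<noteq> 0} \<subseteq> V" using supp cov(2) by blast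
    qed
    show "0 \<le> \<psi> x" "\<psi> x \<le> 1" for x using b_nonneg m by (auto simp: \<psi>_def)
    show "1 - \<epsilon> \<le> \<psi> x" if "x \<in> K" for x proof -
      have "exp (- m * b x) \<le> exp (- m * c)" using c(2)[OF that] m by simp
      then have "exp (- m * b x) \<le> \<epsilon>" using m(1) by (rule order_trans)
      then show ?thesis by (simp add: \<psi>_def)
    qed
  qed
qed

lemma test_functionD:
  assumes "test_function U \<psi>"
  shows "smooth \<psi>" "\<And>x. x \<notin> U \<Longrightarrow> \<psi> x = 0" proof -
  show "smooth \<psi>" using assms by (simp add: test_function_def)
  fix x assume "x \<notin> U"
  then show "\<psi> x = 0" using assms closure_subset[of "{x. \<psi> x \<noteq> 0}"] by (auto simp: test_function_def)
qed

lemma test_function_mono: "test_function U \<psi> \<Longrightarrow> U \<subseteq> V \<Longrightarrow> test_function V \<psi>" by (auto simp: test_function_def)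

lemma test_function_mult:
  assumes "test_function U \<psi>" "smooth f"
  shows "test_function U (\<lambda>x. f x * \<psi> x)" proof -
  have "closure {x. f x * \<psi> x \<noteq> 0} \<subseteq> closure {x. \<psi> x \<noteq> 0}" by (rule closure_mono) auto
  then show ?thesis using assms unfolding test_function_def by (auto intro: smooth_mult simp: compact_eq_bounded_closed bounded_subset)
qed

lemma test_function_diff:
  assumes "test_function U f" "test_function U g"
  shows "test_function U (\<lambda>x. f x - g x)" proof -
  have "closure {x. f x - g x \<noteq> 0} \<subseteq> closure {x. f x \<noteq> 0} \<union> closure {x. g x \<noteq> 0}" by (subst closure_Un[symmetric]) (rule closure_mono, auto)
  moreover have "compact (closure {x. f x \<noteq> 0} \<union> closure {x. g x \<noteq> 0})" using assms by (auto simp: test_function_def)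
  ultimately have "compact (closure {x. f x - g x \<noteq> 0})" by (meson bounded_subset closed_closure compact_eq_bounded_closed)
  then show ?thesis using assms \<open>closure {x. f x - g x \<noteq> 0} \<subseteq> _\<close> by (auto simp: test_function_def smooth_diff)
qed

lemma test_function_bounded:
  assumes "test_function U \<psi>"
  obtains B where "\<And>x. \<bar>\<psi> x\<bar> \<le> B" "B > 0" proof -
  have "compact (\<psi> ` closure {x. \<psi> x \<noteq> 0})" using assms by (intro compact_continuous_image) (auto simp: test_function_def smooth_continuous_on)
  then have "bounded (\<psi> ` closure {x. \<psi> x \<noteq> 0})" by (rule compact_imp_bounded)
  then obtain B where B: "B > 0" "\<forall>y \<in> \<psi> ` closure {x. \<psi> x \<noteq> 0}. norm y \<le> B" unfolding bounded_pos by blast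
  have "\<bar>\<psi> x\<bar> \<le> B" for x using B closure_subset[of "{x. \<psi> x \<noteq> 0}"] by (cases "\<psi> x = 0") auto
  then show ?thesis using that B by blast
qed

lemma grad_zero_off_support:
  fixes \<psi> :: "real^'n \<Rightarrow> real"
  assumes "x \<notin> closure {x. \<psi> x \<noteq> 0}"
  shows "grad \<psi> x = 0" proof (rule grad_unique)
  show "(\<psi> has_derivative (\<lambda>v. 0 \<bullet> v)) (at x)" by (rule has_derivative_transform_within_open[of "\<lambda>_. 0" _ _ UNIV "- closure {x. \<psi> x \<noteq> 0}"])
      (use assms closure_subset[of "{x. \<psi> x \<noteq> 0}"] in auto)
qed

lemma test_function_pderiv:
  assumes "test_function U \<psi>"
  shows "test_function U (\<lambda>x. grad \<psi> x \<bullet> w)" proof -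
  have "smooth (\<lambda>x. grad \<psi> x \<bullet> w)"
    unfolding inner_vec_def inner_real_def by (intro smooth_sum smooth_mult smooth_const smooth_grad_nth test_functionD(1)[OF assms])
  moreover have "closure {x. grad \<psi> x \<bullet> w \<noteq> 0} \<subseteq> closure {x. \<psi> x \<noteq> 0}"
    using grad_zero_off_support[of _ \<psi>] by (intro closure_minimal) force+
  ultimately show ?thesis using assms unfolding test_function_def by (auto simp: compact_eq_bounded_closed bounded_subset)
qed

lemma test_function_grad_nth: "test_function U \<psi> \<Longrightarrow> test_function U (\<lambda>x. grad \<psi> x $ i)"
  using test_function_pderiv[of U \<psi> "axis i 1"] by (simp add: inner_axis)

lemma test_function_lipschitz:
  fixes \<psi> :: "real^'n \<Rightarrow> real"
  assumes "test_function U \<psi>"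
  obtains L where "\<And>x y. \<bar>\<psi> x - \<psi> y\<bar> \<le> L * dist x y" "L \<ge> 0" proof -
  have "\<exists>B. \<forall>x. \<bar>grad \<psi> x $ i\<bar> \<le> B" for i using test_function_bounded[OF test_function_grad_nth[OF assms]] by metis
  then obtain B where B: "\<And>i x. \<bar>grad \<psi> x $ i\<bar> \<le> B i" by metis
  have gb: "norm (grad \<psi> x) \<le> (\<Sum>i\<in>UNIV. B i)" for x
    using norm_le_l1_cart[of "grad \<psi> x"] sum_mono[of UNIV "\<lambda>i. \<bar>grad \<psi> x $ i\<bar>" B] B by force
  show ?thesis proof (rule that)
    show "\<bar>\<psi> x - \<psi> y\<bar> \<le> (\<Sum>i\<in>UNIV. B i) * dist x y" for x y proof -
      have "norm (\<psi> x - \<psi> y) \<le> (\<Sum>i\<in>UNIV. B i) * norm (x - y)" proof (rule differentiable_bound[of UNIV])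
        show "(\<psi> has_derivative (\<lambda>v. grad \<psi> z \<bullet> v)) (at z within UNIV)" for z
          using has_derivative_grad smooth_differentiable test_functionD(1)[OF assms] by blast
        show "onorm (\<lambda>v. grad \<psi> z \<bullet> v) \<le> (\<Sum>i\<in>UNIV. B i)" for z proof (rule onorm_bound)
          show "norm (grad \<psi> z \<bullet> v) \<le> (\<Sum>i\<in>UNIV. B i) * norm v" for v
            using Cauchy_Schwarz_ineq2[of "grad \<psi> z" v] mult_right_mono[OF gb[of z] norm_ge_zero[of v]] by simp
        qed (use order_trans[OF norm_ge_zero gb] in blast)
      qed auto
      then show ?thesis by (simp add: dist_norm)
    qed
    show "(\<Sum>i\<in>UNIV. B i) \<ge> 0" using gb[of 0] norm_ge_zero order_trans by blast
  qed
qed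

section \<open>Translation invariance, duality of \<open>L^1\<close> with test functions, and
  derivatives that integrate to zero\<close>

section \<open>Integrals\<close>

lemma
  fixes a :: "'a::euclidean_space"
  shows measurable_lebesgue_translation: "(\<lambda>x. x + a) \<in> lebesgue \<rightarrow>\<^sub>M lebesgue"
    and distr_lebesgue_translation: "distr lebesgue lebesgue (\<lambda>x. x + a) = lebesgue" proof -
  have *: "(\<lambda>x. a + (\<Sum>j\<in>Basis. (1 * (x \<bullet> j)) *\<^sub>R j)) = (\<lambda>x. x + a)" by (simp add: euclidean_representation add.commute)
  show "(\<lambda>x. x + a) \<in> lebesgue \<rightarrow>\<^sub>M lebesgue" using lebesgue_affine_measurable[of "\<lambda>_. 1" a] unfolding * by simp
  show "distr lebesgue lebesgue (\<lambda>x. x + a) = lebesgue" using lebesgue_affine_euclidean[of "\<lambda>_. 1" a] unfolding * by (simp add: density_1)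
qed

lemma integral_lebesgue_translation:
  fixes f :: "'a::euclidean_space \<Rightarrow> real"
  assumes "f \<in> borel_measurable lebesgue"
  shows "(LINT x|lebesgue. f (x + a)) = (LINT x|lebesgue. f x)" using integral_distr[OF measurable_lebesgue_translation[of a], of f] assms by (simp add: distr_lebesgue_translation)

lemma integrable_lebesgue_translation:
  fixes f :: "'a::euclidean_space \<Rightarrow> real"
  assumes "integrable lebesgue f"
  shows "integrable lebesgue (\<lambda>x. f (x + a))" using integrable_distr[OF measurable_lebesgue_translation[of a], of f] assms by (simp add: distr_lebesgue_translation)

lemma continuous_imp_borel_lebesgue:
  "continuous_on UNIV f \<Longrightarrow> f \<in> borel_measurable lebesgue" by (simp add: borel_measurable_continuous_onI measurable_completion)

lemma integrable_mult_bounded: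
  fixes g f :: "'a \<Rightarrow> real"
  assumes g: "integrable M g" and f: "f \<in> borel_measurable M" "\<And>x. x \<in> space M \<Longrightarrow> \<bar>f x\<bar> \<le> B"
  shows "integrable M (\<lambda>x. g x * f x)" proof (rule Bochner_Integration.integrable_bound[of M "\<lambda>x. \<bar>B\<bar> * g x"])
  show "AE x in M. norm (g x * f x) \<le> norm (\<bar>B\<bar> * g x)"
    using order_trans[OF f(2) abs_ge_self] by (intro AE_I2) (auto simp: abs_mult mult.commute[of "\<bar>g _\<bar>" "\<bar>f _\<bar>"] intro!: mult_right_mono)
qed (use g f(1) in auto)

lemma integrable_indicator_times:
  fixes f :: "'a::euclidean_space \<Rightarrow> real"
  assumes "integrable lebesgue f" "S \<in> sets lebesgue"
  shows "integrable lebesgue (\<lambda>x. indicator S x * f x)" using integrable_mult_indicator[OF assms(2,1)] by simp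

lemma integrable_indicator_abs_diff:
  fixes u :: "'a::euclidean_space \<Rightarrow> real"
  assumes "integrable lebesgue u" "U \<in> lmeasurable"
  shows "integrable lebesgue (\<lambda>x. indicator U x * \<bar>u x - c\<bar>)" proof -
  have "integrable lebesgue (indicator U :: _ \<Rightarrow> real)" using assms(2) by (simp add: lmeasurable_iff_integrable)
  then have "integrable lebesgue (\<lambda>x. indicator U x * (u x - c))" using integrable_indicator_times[OF assms(1) fmeasurableD[OF assms(2)]] by (simp add: right_diff_distrib)
  from integrable_abs[OF this] show ?thesis by (simp add: abs_mult)
qed

lemma integral_dominated_convergence_within:
  fixes f :: "'a \<Rightarrow> real" and s :: "real \<Rightarrow> 'a \<Rightarrow> real"
  assumes [measurable]: "f \<in> borel_measurable M" "\<And>t. s t \<in> borel_measurable M"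
    and w: "integrable M w"
    and lim: "AE x in M. ((\<lambda>t. s t x) \<longlongrightarrow> f x) (at a within A)"
    and bound: "\<And>t. t \<in> A \<Longrightarrow> AE x in M. \<bar>s t x\<bar> \<le> w x"
  shows "((\<lambda>t. LINT x|M. s t x) \<longlongrightarrow> (LINT x|M. f x)) (at a within A)" unfolding tendsto_at_iff_sequentially proof (intro allI impI)
  fix X :: "nat \<Rightarrow> real"
  assume X: "\<forall>i. X i \<in> A - {a}" "X \<longlonglongrightarrow> a"
  have "(\<lambda>i. LINT x|M. s (X i) x) \<longlonglongrightarrow> (LINT x|M. f x)" proof (rule integral_dominated_convergence[OF _ _ w])
    show "AE x in M. (\<lambda>i. s (X i) x) \<longlonglongrightarrow> f x" using lim by eventually_elim (use X in \<open>simp add: tendsto_at_iff_sequentially o_def\<close>)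
    show "AE x in M. norm (s (X i) x) \<le> w x" for i using bound[of "X i"] X by simp
  qed auto
  then show "((\<lambda>t. LINT x|M. s t x) \<circ> X) \<longlonglongrightarrow> (LINT x|M. f x)" by (simp add: o_def)
qed

lemma lebesgue_inner_compact_exhaustion:
  fixes S :: "'a::euclidean_space set"
  assumes "S \<in> sets lebesgue"
  obtains K :: "nat \<Rightarrow> 'a set" where "\<And>n. compact (K n)" "incseq K" "(\<Union>n. K n) \<subseteq> S"
    "S - (\<Union>n. K n) \<in> null_sets lebesgue" proof -
  obtain C T where C: "fsigma C" and T: "T \<in> null_sets lebesgue" "C \<union> T = S" "disjnt C T" using lebesgue_set_almost_fsigma[OF assms] .
  obtain F :: "nat \<Rightarrow> 'a set" where F: "range F \<subseteq> Collect compact" "C = \<Union>(range F)" using C unfolding fsigma_Union_compact by blast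
  show ?thesis proof (rule that[of "\<lambda>n. \<Union>i\<le>n. F i"])
    show "compact (\<Union>i\<le>n. F i)" for n using F by (intro compact_UN) auto
    show "incseq (\<lambda>n. \<Union>i\<le>n. F i)" by (auto simp: incseq_def intro: order_trans)
    have *: "(\<Union>n. \<Union>i\<le>n. F i) = C" using F by auto
    show "(\<Union>n. \<Union>i\<le>n. F i) \<subseteq> S" unfolding * using T by auto
    have "S - C = T" using T by (auto simp: disjnt_def)
    then show "S - (\<Union>n. \<Union>i\<le>n. F i) \<in> null_sets lebesgue" unfolding * using T by simp
  qed
qed

text \<open>The sign of \<open>f\<close> is the ideal test function. It is approximated by the
  difference of two cutoffs, nearly 1 on compact subsets of \<open>P\<close> and of \<open>N\<close>
  and each supported away from the compact set of the other; integrability of \<open>f\<close> makes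
  the rest of \<open>U\<close> negligible in the limit.\<close>

lemma L1_norm_le_test_functions:
  fixes f :: "real^'n \<Rightarrow> real"
  assumes f: "integrable lebesgue f" and U: "open U"
    and B: "\<And>\<psi>. test_function U \<psi> \<Longrightarrow> (\<And>x. \<bar>\<psi> x\<bar> \<le> 1) \<Longrightarrow> (LINT x|lebesgue. f x * \<psi> x) \<le> B"
  shows "(LINT x|lebesgue. indicator U x * \<bar>f x\<bar>) \<le> B" proof -
  define P where "P = {x\<in>U. f x > 0}"
  define N where "N = {x\<in>U. f x < 0}"
  have fm [measurable]: "f \<in> borel_measurable lebesgue" using f by auto
  have Um [measurable]: "U \<in> sets lebesgue" using U by auto
  have Pm: "P \<in> sets lebesgue" and Nm: "N \<in> sets lebesgue" unfolding P_def N_def using fm Um by measurable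
  obtain K where K: "\<And>n. compact (K n)" "incseq K" "(\<Union>n. K n) \<subseteq> P" "P - (\<Union>n. K n) \<in> null_sets lebesgue"
    using lebesgue_inner_compact_exhaustion[OF Pm] by metis
  obtain L where L: "\<And>n. compact (L n)" "incseq L" "(\<Union>n. L n) \<subseteq> N" "N - (\<Union>n. L n) \<in> null_sets lebesgue"
    using lebesgue_inner_compact_exhaustion[OF Nm] by metis
  define I where "I = (LINT x|lebesgue. indicator U x * \<bar>f x\<bar>)"
  define J where "J n = (LINT x|lebesgue. indicator (K n \<union> L n) x * \<bar>f x\<bar>)" for n
  have KL: "K n \<union> L n \<in> sets lebesgue" for n using K L by (simp add: compact_imp_closed)
  have fU: "integrable lebesgue (\<lambda>x. indicator U x * \<bar>f x\<bar>)" using integrable_mult_indicator[OF Um, of "\<lambda>x. \<bar>f x\<bar>"] f by simp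
  have fKL: "integrable lebesgue (\<lambda>x. indicator (K n \<union> L n) x * \<bar>f x\<bar>)" for n
    using integrable_mult_indicator[OF KL, of "\<lambda>x. \<bar>f x\<bar>"] f by simp
  have lim: "J \<longlonglongrightarrow> I" unfolding J_def I_def proof (rule integral_dominated_convergence[where w="\<lambda>x. \<bar>f x\<bar>"])
    have "AE x in lebesgue. x \<notin> P - (\<Union>n. K n)" "AE x in lebesgue. x \<notin> N - (\<Union>n. L n)" using K(4) L(4) AE_not_in by blast+
    then show "AE x in lebesgue. (\<lambda>n. indicator (K n \<union> L n) x * \<bar>f x\<bar>) \<longlonglongrightarrow> indicator U x * \<bar>f x\<bar>" proof eventually_elim
      case (elim x)
      have "\<exists>m. \<forall>n\<ge>m. indicator (K n \<union> L n) x * \<bar>f x\<bar> = indicator U x * \<bar>f x\<bar>" proof (cases "f x = 0 \<or> x \<notin> U")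
        case True
        then show ?thesis using UN_subset_iff[THEN iffD1, OF K(3)] UN_subset_iff[THEN iffD1, OF L(3)] by (intro exI[of _ 0]) (auto simp: P_def N_def indicator_def)
      next
        case False
        then have "x \<in> (\<Union>n. K n) \<union> (\<Union>n. L n)" using elim by (auto simp: P_def N_def)
        then obtain m where "x \<in> K m \<union> L m" by auto
        then have "x \<in> K n \<union> L n" if "n \<ge> m" for n using incseqD[OF K(2) that] incseqD[OF L(2) that] by auto
        then show ?thesis using False by (intro exI[of _ m]) auto
      qed
      then show ?case by (intro tendsto_eventually) (simp only: eventually_sequentially)
    qed
    show "AE x in lebesgue. norm (indicator (K n \<union> L n) x * \<bar>f x\<bar>) \<le> \<bar>f x\<bar>" for n by (intro AE_I2) (simp add: indicator_def)
  qed (use f borel_measurable_integrable[OF fU] borel_measurable_integrable[OF fKL] in simp_all)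
  \<comment> \<open>On \<open>K n \<union> L n\<close> the product \<open>f x * \<psi> x\<close> is
    at least \<open>(1 - 1 / Suc n) * \<bar>f x\<bar>\<close>, elsewhere in \<open>U\<close> at
    least \<open>- \<bar>f x\<bar>\<close>; integration gives
    \<open>(1 - 1 / Suc n) * J n - (I - J n)\<close>.\<close>
  have ineq: "(2 - 1 / Suc n) * J n - I \<le> B" for n proof -
    have sub: "K n \<subseteq> U - L n" "L n \<subseteq> U - K n" using K(3) L(3) by (force simp: P_def N_def)+
    have op: "open (U - L n)" "open (U - K n)" using U K(1) L(1) by (auto intro!: open_Diff simp: compact_imp_closed)
    obtain \<phi> where \<phi>: "test_function (U - L n) \<phi>" "\<And>x. 0 \<le> \<phi> x" "\<And>x. \<phi> x \<le> 1"
      "\<And>x. x \<in> K n \<Longrightarrow> 1 - 1 / Suc n \<le> \<phi> x" using test_function_compact_open[OF K(1) op(1) sub(1), of "1 / Suc n"] by auto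
    obtain \<eta> where \<eta>: "test_function (U - K n) \<eta>" "\<And>x. 0 \<le> \<eta> x" "\<And>x. \<eta> x \<le> 1"
      "\<And>x. x \<in> L n \<Longrightarrow> 1 - 1 / Suc n \<le> \<eta> x" using test_function_compact_open[OF L(1) op(2) sub(2), of "1 / Suc n"] by auto
    define \<psi> where "\<psi> = (\<lambda>x. \<phi> x - \<eta> x)"
    have \<psi>: "test_function U \<psi>" unfolding \<psi>_def by (intro test_function_diff test_function_mono[OF \<phi>(1)] test_function_mono[OF \<eta>(1)]) auto
    have \<psi>1: "\<bar>\<psi> x\<bar> \<le> 1" for x using \<phi>(2,3)[of x] \<eta>(2,3)[of x] by (auto simp: \<psi>_def)
    have pt: "(2 - 1 / Suc n) * (indicator (K n \<union> L n) x * \<bar>f x\<bar>) - indicator U x * \<bar>f x\<bar> \<le> f x * \<psi> x" for x proof -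
      consider "x \<in> K n" | "x \<in> L n" | "x \<notin> K n \<union> L n" "x \<in> U" | "x \<notin> U" by auto
      then show ?thesis proof cases
        case 1
        then have x: "x \<in> U" "f x > 0" using K(3) by (auto simp: P_def)
        have "\<eta> x = 0" using 1 test_functionD(2)[OF \<eta>(1)] by auto
        then have "(1 - 1 / Suc n) * f x \<le> \<psi> x * f x" using \<phi>(4)[OF 1] x by (intro mult_right_mono) (auto simp: \<psi>_def)
        then show ?thesis using 1 x by (simp add: algebra_simps)
      next
        case 2
        then have x: "x \<in> U" "f x < 0" using L(3) by (auto simp: N_def)
        have "\<phi> x = 0" using 2 test_functionD(2)[OF \<phi>(1)] by auto
        then have "(1 - 1 / Suc n) * - f x \<le> - \<psi> x * - f x" using \<eta>(4)[OF 2] x by (intro mult_right_mono) (auto simp: \<psi>_def)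
        then show ?thesis using 2 x by (simp add: algebra_simps)
      next
        case 3
        have "\<bar>f x * \<psi> x\<bar> \<le> \<bar>f x\<bar>" using \<psi>1[of x] by (simp add: abs_mult mult_left_le)
        then show ?thesis using 3 by simp
      next
        case 4
        then have "x \<notin> K n \<union> L n" using sub by auto
        then show ?thesis using 4 test_functionD(2)[OF \<psi>] by simp
      qed
    qed
    have \<psi>m [measurable]: "\<psi> \<in> borel_measurable lebesgue" using smooth_continuous_on[OF test_functionD(1)[OF \<psi>]] by (rule continuous_imp_borel_lebesgue)
    have int: "integrable lebesgue (\<lambda>x. f x * \<psi> x)"
      by (rule Bochner_Integration.integrable_bound[OF f]) (use \<psi>1 in \<open>auto simp: abs_mult mult_left_le\<close>)
    have "(2 - 1 / Suc n) * J n - I =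
      (LINT x|lebesgue. (2 - 1 / Suc n) * (indicator (K n \<union> L n) x * \<bar>f x\<bar>) - indicator U x * \<bar>f x\<bar>)"
      unfolding J_def I_def using fU fKL[of n] by (subst Bochner_Integration.integral_diff) auto
    also have "\<dots> \<le> (LINT x|lebesgue. f x * \<psi> x)" using fU fKL[of n] int pt by (intro integral_mono) auto
    also have "\<dots> \<le> B" using B \<psi> \<psi>1 by blast
    finally show ?thesis .
  qed
  have "(\<lambda>n. (2 - 1 / Suc n) * J n - I) \<longlonglongrightarrow> (2 - 0) * I - I" by (intro tendsto_intros lim LIMSEQ_Suc[OF lim_1_over_n])
  then have "(2 - 0) * I - I \<le> B" by (rule LIMSEQ_le_const2) (use ineq in auto)
  then show ?thesis by (simp add: I_def)
qed

text \<open>A form of the divergence theorem: difference quotients of a compactly supported function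
  have integral 0 by translation invariance, and the Lipschitz bound on a fixed ball dominates them,
  so the limit has integral 0 as well.\<close>

lemma lipschitz_integral_directional_derivative:
  fixes f D :: "real^'n \<Rightarrow> real"
  assumes lip: "\<And>x y. \<bar>f x - f y\<bar> \<le> L * dist x y"
    and supp: "bounded S" "\<And>x. x \<notin> S \<Longrightarrow> f x = 0"
    and D [measurable]: "D \<in> borel_measurable lebesgue"
    and deriv: "AE x in lebesgue. ((\<lambda>t. f (x + t *\<^sub>R w)) has_real_derivative D x) (at 0)"
  shows "integrable lebesgue D" "(LINT x|lebesgue. D x) = 0" proof -
  obtain R where R: "\<And>x. x \<in> S \<Longrightarrow> norm x \<le> R" using supp(1) by (auto simp: bounded_iff)
  have L: "L \<ge> 0" using order_trans[OF abs_ge_zero lip[of 0 1]] by (auto simp: zero_le_mult_iff)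
  \<comment> \<open>All steps are at most \<open>norm w\<close> long, so every difference quotient
    vanishes outside the ball of radius \<open>R + norm w\<close>.\<close>
  define W where "W = (\<lambda>x::real^'n. indicator (cball 0 (R + norm w)) x * (L * norm w))"
  define q where "q n x = (f (x + (1 / Suc n) *\<^sub>R w) - f x) / (1 / Suc n)" for n x
  have fc: "continuous_on UNIV f" using L lip by (intro lipschitz_on_continuous_on[of L]) (auto simp: lipschitz_on_def dist_real_def)
  then have fm [measurable]: "f \<in> borel_measurable lebesgue" by (rule continuous_imp_borel_lebesgue)
  have fm' [measurable]: "(\<lambda>x. f (x + a)) \<in> borel_measurable lebesgue" for a
    by (intro continuous_imp_borel_lebesgue continuous_on_compose2[OF fc] continuous_intros) auto
  have W: "integrable lebesgue W" unfolding W_def by (intro integrable_mult_left) (simp add: integrable_indicator_iff emeasure_lborel_cball_finite[unfolded infinity_ennreal_def])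
  have qm [measurable]: "q n \<in> borel_measurable lebesgue" for n unfolding q_def by measurable
  have qW: "norm (q n x) \<le> W x" for n x proof (cases "norm x \<le> R + norm w")
    case True
    have "\<bar>f (x + (1 / Suc n) *\<^sub>R w) - f x\<bar> \<le> L * (1 / Suc n * norm w)" using lip[of "x + (1 / Suc n) *\<^sub>R w" x] by (simp add: dist_norm)
    then show ?thesis using True by (simp add: W_def q_def abs_mult pos_divide_le_eq del: of_nat_Suc) (simp add: field_simps del: of_nat_Suc)
  next
    case False
    have "norm x \<le> norm (x + (1 / Suc n) *\<^sub>R w) + norm ((1 / Suc n) *\<^sub>R w)"
      using norm_triangle_ineq4[of "x + (1 / Suc n) *\<^sub>R w" "(1 / Suc n) *\<^sub>R w"] by simp
    also have "norm ((1 / Suc n) *\<^sub>R w) \<le> norm w" by (simp add: field_simps)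
    finally have "norm (x + (1 / Suc n) *\<^sub>R w) > R" using False by simp
    moreover have "norm x > R" using False by (smt (verit) norm_ge_zero)
    ultimately have "x \<notin> S" "x + (1 / Suc n) *\<^sub>R w \<notin> S" using R by (meson not_le)+
    then show ?thesis using supp(2) L by (simp add: q_def W_def)
  qed
  have lim: "AE x in lebesgue. (\<lambda>n. q n x) \<longlonglongrightarrow> D x" using deriv proof eventually_elim
    case (elim x)
    have "((\<lambda>t. (f (x + t *\<^sub>R w) - f x) / t) \<longlongrightarrow> D x) (at 0)" using elim by (simp add: has_field_derivative_iff)
    then have "(\<lambda>n. (f (x + (1 / Suc n) *\<^sub>R w) - f x) / (1 / Suc n)) \<longlonglongrightarrow> D x" by (rule filterlim_compose)
        (use LIMSEQ_Suc[OF lim_1_over_n] in \<open>auto simp: filterlim_at\<close>)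
    then show ?case by (simp add: q_def)
  qed
  show "integrable lebesgue D" by (rule integrable_dominated_convergence[OF _ _ W lim]) (use qW in auto)
  have "(\<lambda>n. LINT x|lebesgue. q n x) \<longlonglongrightarrow> (LINT x|lebesgue. D x)" by (rule integral_dominated_convergence[OF _ _ W lim]) (use qW in auto)
  moreover have "(LINT x|lebesgue. q n x) = 0" for n proof -
    obtain B where B: "\<forall>x\<in>cball 0 R. \<bar>f x\<bar> \<le> B"
        using compact_imp_bounded[OF compact_continuous_image[OF continuous_on_subset[OF fc] compact_cball, of 0 R]] unfolding bounded_iff by auto
    have fi: "integrable lebesgue f" proof (rule Bochner_Integration.integrable_bound)
      show "integrable lebesgue (\<lambda>x. indicator (cball 0 R) x * B)"
        by (intro integrable_mult_left) (simp add: integrable_indicator_iff emeasure_lborel_cball_finite[unfolded infinity_ennreal_def])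
      show "AE x in lebesgue. norm (f x) \<le> norm (indicator (cball 0 R) x * B)" proof (rule AE_I2)
        fix x
        show "norm (f x) \<le> norm (indicator (cball 0 R) x * B)" using bspec[OF B, of x] supp(2)[of x] R[of x] by (cases "norm x \<le> R") auto
      qed
    qed measurable
    have "(LINT x|lebesgue. q n x) =
      ((LINT x|lebesgue. f (x + (1 / Suc n) *\<^sub>R w)) - (LINT x|lebesgue. f x)) / (1 / Suc n)" unfolding q_def using fi integrable_lebesgue_translation[OF fi] by simp
    then show ?thesis using integral_lebesgue_translation[OF fm] by simp
  qed
  ultimately show "(LINT x|lebesgue. D x) = 0" by (simp add: LIMSEQ_const_iff)
qed

text \<open>The increment of \<open>u\<close> is tested against \<open>\<psi>\<close>; moving the translation onto \<open>\<psi>\<close> turns it into an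
  integral of the weak derivative, so no mollification is needed.\<close>
lemma weak_derivative_increment_le:
  fixes u g :: "real^'n \<Rightarrow> real"
  assumes u: "integrable lebesgue u" and g: "integrable lebesgue g"
    and weak: "\<And>\<psi>. test_function U \<psi> \<Longrightarrow>
      (LINT x|lebesgue. u x * (grad \<psi> x \<bullet> w)) = - (LINT x|lebesgue. g x * \<psi> x)"
    and A: "open A" "\<And>x t. x \<in> A \<Longrightarrow> 0 \<le> t \<Longrightarrow> t \<le> 1 \<Longrightarrow> x + t *\<^sub>R w \<in> U"
  shows "(LINT x|lebesgue. indicator A x * \<bar>u (x + w) - u x\<bar>) \<le> (LINT x|lebesgue. \<bar>g x\<bar>)" proof (rule L1_norm_le_test_functions[OF _ A(1)])
  show "integrable lebesgue (\<lambda>x. u (x + w) - u x)" by (intro Bochner_Integration.integrable_diff integrable_lebesgue_translation u)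
  fix \<psi> :: "real^'n \<Rightarrow> real"
  assume \<psi>: "test_function A \<psi>" and \<psi>1: "\<And>x. \<bar>\<psi> x\<bar> \<le> 1"
  have um [measurable]: "u \<in> borel_measurable lebesgue" and gm [measurable]: "g \<in> borel_measurable lebesgue" using u g by auto
  note sm = test_functionD(1)[OF \<psi>]
  have \<psi>c: "continuous_on UNIV \<psi>" and gc: "continuous_on UNIV (grad \<psi>)" using smooth_continuous_on[OF sm] continuous_on_grad[OF sm] by auto
  have \<psi>m [measurable]: "(\<lambda>x. \<psi> (x - a)) \<in> borel_measurable lebesgue" for a
    by (intro continuous_imp_borel_lebesgue continuous_on_compose2[OF \<psi>c] continuous_intros) auto
  have gradm [measurable]: "(\<lambda>x. grad \<psi> (x - a) \<bullet> w) \<in> borel_measurable lebesgue" for a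
    by (intro continuous_imp_borel_lebesgue continuous_intros continuous_on_compose2[OF gc]) auto
  obtain L where L: "\<And>x y. \<bar>\<psi> x - \<psi> y\<bar> \<le> L * dist x y" "L \<ge> 0" using test_function_lipschitz[OF \<psi>] by metis
  \<comment> \<open>\<open>F 1 - F 0\<close> is the increment of \<open>u\<close> tested with
    \<open>\<psi>\<close>. Its derivative in \<open>t\<close> falls on \<open>\<psi>\<close>, where
    the Lipschitz bound dominates the difference quotients.\<close>
  define F where "F t = (LINT x|lebesgue. u x * \<psi> (x - t *\<^sub>R w))" for t
  have u\<psi>: "integrable lebesgue (\<lambda>x. u x * \<psi> (x - t *\<^sub>R w))" for t
    by (rule Bochner_Integration.integrable_bound[OF u]) (use \<psi>1 in \<open>auto simp: abs_mult mult_left_le\<close>)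
  have dF: "(F has_real_derivative - (LINT x|lebesgue. u x * (grad \<psi> (x - t *\<^sub>R w) \<bullet> w))) (at t)" for t unfolding has_field_derivative_iff proof -
    have *: "(F s - F t) / (s - t) =
      (LINT x|lebesgue. u x * ((\<psi> (x - s *\<^sub>R w) - \<psi> (x - t *\<^sub>R w)) / (s - t)))" for s proof -
      have "F s - F t = (LINT x|lebesgue. u x * \<psi> (x - s *\<^sub>R w) - u x * \<psi> (x - t *\<^sub>R w))"
        unfolding F_def by (rule Bochner_Integration.integral_diff[OF u\<psi> u\<psi>, symmetric])
      then show ?thesis by (simp only: integral_divide_zero[symmetric] right_diff_distrib[symmetric] times_divide_eq_right)
    qed
    have "((\<lambda>s. LINT x|lebesgue. u x * ((\<psi> (x - s *\<^sub>R w) - \<psi> (x - t *\<^sub>R w)) / (s - t))) \<longlongrightarrow>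
      (LINT x|lebesgue. - (u x * (grad \<psi> (x - t *\<^sub>R w) \<bullet> w)))) (at t within UNIV)"
    proof (rule integral_dominated_convergence_within[where w="\<lambda>x. \<bar>u x\<bar> * (L * norm w)"])
      show "integrable lebesgue (\<lambda>x. \<bar>u x\<bar> * (L * norm w))" using u by auto
      show "AE x in lebesgue. \<bar>u x * ((\<psi> (x - s *\<^sub>R w) - \<psi> (x - t *\<^sub>R w)) / (s - t))\<bar> \<le> \<bar>u x\<bar> * (L * norm w)" for s proof (rule AE_I2)
        fix x
        have "\<bar>\<psi> (x - s *\<^sub>R w) - \<psi> (x - t *\<^sub>R w)\<bar> \<le> L * (\<bar>s - t\<bar> * norm w)" using L(1)[of "x - s *\<^sub>R w" "x - t *\<^sub>R w"]
          by (simp add: dist_norm scaleR_diff_left[symmetric] abs_minus_commute)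
        then have "\<bar>(\<psi> (x - s *\<^sub>R w) - \<psi> (x - t *\<^sub>R w)) / (s - t)\<bar> \<le> L * norm w"
          using L(2) by (cases "s = t") (simp_all add: abs_divide pos_divide_le_eq mult.commute mult.left_commute)
        then show "\<bar>u x * ((\<psi> (x - s *\<^sub>R w) - \<psi> (x - t *\<^sub>R w)) / (s - t))\<bar> \<le> \<bar>u x\<bar> * (L * norm w)"
          unfolding abs_mult by (intro mult_left_mono) auto
      qed
      show "AE x in lebesgue. ((\<lambda>s. u x * ((\<psi> (x - s *\<^sub>R w) - \<psi> (x - t *\<^sub>R w)) / (s - t)))
          \<longlongrightarrow> - (u x * (grad \<psi> (x - t *\<^sub>R w) \<bullet> w))) (at t within UNIV)" proof (rule AE_I2)
        fix x
        have "((\<lambda>s. \<psi> (x - s *\<^sub>R w)) has_derivative (\<lambda>h. grad \<psi> (x - t *\<^sub>R w) \<bullet> (- (h *\<^sub>R w)))) (at t)"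
        proof (rule has_derivative_compose[OF _ has_derivative_grad[OF smooth_differentiable[OF sm]]])
          show "((\<lambda>s. x - s *\<^sub>R w) has_derivative (\<lambda>h. - (h *\<^sub>R w))) (at t)" by (auto intro!: derivative_eq_intros)
        qed
        then have "((\<lambda>s. \<psi> (x - s *\<^sub>R w)) has_real_derivative - (grad \<psi> (x - t *\<^sub>R w) \<bullet> w)) (at t)"
          by (rule has_derivative_imp_has_field_derivative) simp
        then have "((\<lambda>s. (\<psi> (x - s *\<^sub>R w) - \<psi> (x - t *\<^sub>R w)) / (s - t)) \<longlongrightarrow> - (grad \<psi> (x - t *\<^sub>R w) \<bullet> w)) (at t)"
          by (simp add: has_field_derivative_iff)
        from tendsto_mult_left[OF this, of "u x"]
        show "((\<lambda>s. u x * ((\<psi> (x - s *\<^sub>R w) - \<psi> (x - t *\<^sub>R w)) / (s - t)))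
          \<longlongrightarrow> - (u x * (grad \<psi> (x - t *\<^sub>R w) \<bullet> w))) (at t within UNIV)" by simp
      qed
    qed measurable
    then show "((\<lambda>s. (F s - F t) / (s - t)) \<longlongrightarrow>
      - (LINT x|lebesgue. u x * (grad \<psi> (x - t *\<^sub>R w) \<bullet> w))) (at t)" unfolding * by simp
  qed
  \<comment> \<open>The translate \<open>\<eta>\<close> is supported in \<open>U\<close> because
    segments in direction \<open>w\<close> from points of \<open>A\<close> stay there; so the weak
    derivative can be inserted at each \<open>t\<close>.\<close>
  have slope: "- (LINT x|lebesgue. u x * (grad \<psi> (x - t *\<^sub>R w) \<bullet> w)) \<le> (LINT x|lebesgue. \<bar>g x\<bar>)" if t: "0 \<le> t" "t \<le> 1" for t proof -
    define \<eta> where "\<eta> = (\<lambda>x. \<psi> (x - t *\<^sub>R w))"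
    have supp: "closure {x. \<eta> x \<noteq> 0} = (\<lambda>x. t *\<^sub>R w + x) ` closure {x. \<psi> x \<noteq> 0}" proof -
      have "{x. \<eta> x \<noteq> 0} = (\<lambda>x. t *\<^sub>R w + x) ` {x. \<psi> x \<noteq> 0}" by (auto simp: \<eta>_def image_iff intro!: exI[of _ "_ - t *\<^sub>R w"])
      then show ?thesis by (simp add: closure_translation)
    qed
    have "test_function U \<eta>" unfolding test_function_def supp proof (intro conjI)
      show "smooth \<eta>" using smooth_shift[OF sm, of "- (t *\<^sub>R w)"] by (simp add: \<eta>_def)
      show "compact ((\<lambda>x. t *\<^sub>R w + x) ` closure {x. \<psi> x \<noteq> 0})" using \<psi> by (intro compact_translation) (simp add: test_function_def)
      show "(\<lambda>x. t *\<^sub>R w + x) ` closure {x. \<psi> x \<noteq> 0} \<subseteq> U" using \<psi> A(2) t by (auto simp: test_function_def add.commute)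
    qed
    note weak[OF this]
    moreover have "grad \<eta> x = grad \<psi> (x - t *\<^sub>R w)" for x unfolding \<eta>_def proof (rule grad_unique)
      show "((\<lambda>x. \<psi> (x - t *\<^sub>R w)) has_derivative (\<lambda>v. grad \<psi> (x - t *\<^sub>R w) \<bullet> v)) (at x)"
        by (rule has_derivative_compose[OF _ has_derivative_grad[OF smooth_differentiable[OF sm]]])
          (auto intro!: derivative_eq_intros)
    qed
    ultimately have "- (LINT x|lebesgue. u x * (grad \<psi> (x - t *\<^sub>R w) \<bullet> w)) = (LINT x|lebesgue. g x * \<eta> x)" by simp
    also have "\<dots> \<le> (LINT x|lebesgue. \<bar>g x\<bar>)" proof (rule integral_mono)
      show "integrable lebesgue (\<lambda>x. g x * \<eta> x)" unfolding \<eta>_def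
        by (rule Bochner_Integration.integrable_bound[OF g]) (use \<psi>1 in \<open>auto simp: abs_mult mult_left_le\<close>)
      show "g x * \<eta> x \<le> \<bar>g x\<bar>" for x using \<psi>1[of "x - t *\<^sub>R w"] abs_le_D1[of "g x * \<eta> x"] by (simp add: \<eta>_def abs_mult mult_left_le)
    qed (use g in auto)
    finally show ?thesis .
  qed
  obtain \<xi> where \<xi>: "0 < \<xi>" "\<xi> < 1"
    "F 1 - F 0 = (1 - 0) * (- (LINT x|lebesgue. u x * (grad \<psi> (x - \<xi> *\<^sub>R w) \<bullet> w)))" using MVT2[of 0 1 F, OF _ dF] by auto
  have "(LINT x|lebesgue. (u (x + w) - u x) * \<psi> x) =
    (LINT x|lebesgue. u (x + w) * \<psi> (x + w - w)) - (LINT x|lebesgue. u x * \<psi> x)" using integrable_lebesgue_translation[OF u\<psi>[of 1], of w] u\<psi>[of 0]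
    by (simp add: left_diff_distrib)
  also have "(LINT x|lebesgue. u (x + w) * \<psi> (x + w - w)) = F 1" using integral_lebesgue_translation[of "\<lambda>x. u x * \<psi> (x - w)" w] by (simp add: F_def)
  also have "(LINT x|lebesgue. u x * \<psi> x) = F 0" by (simp add: F_def)
  also have "F 1 - F 0 \<le> (LINT x|lebesgue. \<bar>g x\<bar>)" using slope[of \<xi>] \<xi> by simp
  finally show "(LINT x|lebesgue. (u (x + w) - u x) * \<psi> x) \<le> (LINT x|lebesgue. \<bar>g x\<bar>)" .
qed

text \<open>Along a segment the closed sets pull back to a finite closed cover of
  \<open>{0..1}\<close>, and a function on an interval that is Lipschitz on each of finitely many
  closed pieces is Lipschitz with the same constant.\<close>

lemma lipschitz_of_closed_cover:
  fixes g :: "'a::real_normed_vector \<Rightarrow> real" and f :: "'i \<Rightarrow> 'a \<Rightarrow> real"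
  assumes J: "finite J" and C: "\<And>j. j \<in> J \<Longrightarrow> closed (C j)" "(\<Union>j\<in>J. C j) = UNIV" and L: "L \<ge> 0"
    and eq: "\<And>j x. j \<in> J \<Longrightarrow> x \<in> C j \<Longrightarrow> g x = f j x"
    and lip: "\<And>j x y. j \<in> J \<Longrightarrow> \<bar>f j x - f j y\<bar> \<le> L * dist x y"
  shows "\<bar>g x - g y\<bar> \<le> L * dist x y" proof -
  define h where "h t = x + t *\<^sub>R (y - x)" for t
  have "(L * dist x y)-lipschitz_on {0..1} (\<lambda>t. g (h t))" proof (rule lipschitz_on_closed_Union[where U="\<lambda>j. h -` C j" and I=J])
    fix j assume j: "j \<in> J"
    show "closed (h -` C j)" unfolding h_def by (intro closed_vimage C j continuous_intros)
    show "(L * dist x y)-lipschitz_on (h -` C j) (\<lambda>t. g (h t))" proof (rule lipschitz_onI)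
      fix s t assume "s \<in> h -` C j" "t \<in> h -` C j"
      moreover have "dist (h s) (h t) = dist s t * dist x y" by (simp add: h_def dist_norm norm_minus_commute[of x] scaleR_diff_left[symmetric])
      ultimately show "dist (g (h s)) (g (h t)) \<le> L * dist x y * dist s t" using lip[OF j, of "h s" "h t"] eq[OF j] by (simp add: dist_real_def mult_ac)
    qed (use L in simp)
  next
    show "{0..1} \<subseteq> (\<Union>j\<in>J. h -` C j)" using C(2) unfolding vimage_UN[symmetric] by simp
  qed (use J L in auto)
  from lipschitz_onD[OF this, of 0 1] show ?thesis by (simp add: h_def dist_real_def)
qed

section \<open>Integration by parts for continuous piecewise smooth functions\<close>

section \<open>Weak derivatives\<close>

lemma continuous_on_test_function_times:
  fixes v :: "real^'n \<Rightarrow> real"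
  assumes "open \<Omega>" "continuous_on \<Omega> v" "test_function \<Omega> \<phi>"
  shows "continuous_on UNIV (\<lambda>x. v x * \<phi> x)" proof -
  let ?S = "closure {x. \<phi> x \<noteq> 0}"
  have "continuous_on \<Omega> (\<lambda>x. v x * \<phi> x)" by (intro continuous_intros assms smooth_continuous_on[OF test_functionD(1)[OF assms(3)]])
  moreover have "continuous_on (- ?S) (\<lambda>x. v x * \<phi> x) \<longleftrightarrow> continuous_on (- ?S) (\<lambda>x. 0::real)"
    using closure_subset[of "{x. \<phi> x \<noteq> 0}"] by (intro continuous_on_cong) auto
  ultimately have "continuous_on (\<Omega> \<union> - ?S) (\<lambda>x. v x * \<phi> x)" using assms(1) by (intro continuous_on_open_Un) auto
  moreover have "\<Omega> \<union> - ?S = UNIV" using assms(3) by (auto simp: test_function_def)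
  ultimately show ?thesis by simp
qed

lemma integrable_continuous_times_test_function:
  fixes v :: "real^'n \<Rightarrow> real"
  assumes "open \<Omega>" "continuous_on \<Omega> v" "test_function \<Omega> \<phi>"
  shows "integrable lebesgue (\<lambda>x. v x * \<phi> x)" proof -
  let ?S = "closure {x. \<phi> x \<noteq> 0}"
  have S: "compact ?S" using assms by (simp add: test_function_def)
  note c = continuous_on_test_function_times[OF assms]
  have "bounded ((\<lambda>x. v x * \<phi> x) ` ?S)" by (intro compact_imp_bounded compact_continuous_image S continuous_on_subset[OF c]) auto
  then obtain B where B: "\<forall>x\<in>?S. norm (v x * \<phi> x) \<le> B" unfolding bounded_iff by auto
  show ?thesis proof (rule Bochner_Integration.integrable_bound)
    show "integrable lebesgue (\<lambda>x. indicator ?S x * B)" proof (intro integrable_mult_left)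
      have "emeasure lborel ?S < \<infinity>" "closed ?S" using emeasure_compact_finite[OF S] by simp_all
      then show "integrable lebesgue (indicator ?S :: _ \<Rightarrow> real)" unfolding integrable_indicator_iff by simp
    qed
    show "(\<lambda>x. v x * \<phi> x) \<in> borel_measurable lebesgue" by (rule continuous_imp_borel_lebesgue[OF c])
    show "AE x in lebesgue. norm (v x * \<phi> x) \<le> norm (indicator ?S x * B)" proof (rule AE_I2)
      fix x
      show "norm (v x * \<phi> x) \<le> norm (indicator ?S x * B)" proof (cases "x \<in> ?S")
        case True
        then have "indicator ?S x * B = B" by simp
        moreover have "\<bar>v x * \<phi> x\<bar> \<le> \<bar>B\<bar>" using bspec[OF B True] unfolding real_norm_def by (rule order_trans[OF _ abs_ge_self])
        ultimately show ?thesis by (simp only: real_norm_def)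
      next
        case False
        then have "\<phi> x = 0" using closure_subset[of "{x. \<phi> x \<noteq> 0}"] by blast
        then show ?thesis by simp
      qed
    qed
  qed
qed

text \<open>Instead of integrating by parts on each piece and cancelling the contributions of common
  faces, the product of \<open>v\<close> with the test function is shown to be Lipschitz on the
  whole space. Then its directional derivative, known off the frontiers, integrates to 0.\<close>

lemma piecewise_smooth_weak_derivative:
  fixes v :: "real^'n \<Rightarrow> real" and G :: "real^'n \<Rightarrow> real^'n"
  assumes \<Omega>: "open \<Omega>" and v: "continuous_on \<Omega> v" and fin: "finite \<T>"
    and T: "\<And>T. T \<in> \<T> \<Longrightarrow> closed T" "\<And>T. T \<in> \<T> \<Longrightarrow> negligible (frontier T)"
    and cover: "\<Omega> \<subseteq> \<Union>\<T>"
    and q: "\<And>T. T \<in> \<T> \<Longrightarrow> smooth (q T)" "\<And>T x. T \<in> \<T> \<Longrightarrow> x \<in> T \<inter> \<Omega> \<Longrightarrow> v x = q T x"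
    and G: "G \<in> borel_measurable lebesgue" "\<And>T x. T \<in> \<T> \<Longrightarrow> x \<in> interior T \<inter> \<Omega> \<Longrightarrow> G x = grad (q T) x"
    and \<phi>: "test_function \<Omega> \<phi>"
  shows "(LINT x|lebesgue. v x * (grad \<phi> x \<bullet> w)) = - (LINT x|lebesgue. (G x \<bullet> w) * \<phi> x)" proof -
  let ?S = "closure {x. \<phi> x \<noteq> 0}"
  have S: "compact ?S" "?S \<subseteq> \<Omega>" using \<phi> by (auto simp: test_function_def)
  have \<phi>0: "\<phi> x = 0" "grad \<phi> x = 0" if "x \<notin> ?S" for x using that closure_subset[of "{x. \<phi> x \<noteq> 0}"] grad_zero_off_support[OF that] by auto
  define f where "f x = v x * \<phi> x" for x
  have fc: "continuous_on UNIV f" unfolding f_def by (rule continuous_on_test_function_times[OF \<Omega> v \<phi>])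
  have "\<exists>L. \<forall>x y. \<bar>q T x * \<phi> x - q T y * \<phi> y\<bar> \<le> L * dist x y \<and> L \<ge> 0" if "T \<in> \<T>" for T
    using test_function_lipschitz[OF test_function_mult[OF \<phi> q(1)[OF that]]] by metis
  then obtain L where L: "\<And>T x y. T \<in> \<T> \<Longrightarrow> \<bar>q T x * \<phi> x - q T y * \<phi> y\<bar> \<le> L T * dist x y"
      "\<And>T. T \<in> \<T> \<Longrightarrow> L T \<ge> 0" by metis
  define M where "M = (\<Sum>T\<in>\<T>. L T)"
  have LM: "L T \<le> M" if "T \<in> \<T>" for T unfolding M_def using fin L(2) that by (intro member_le_sum) auto
  have M0: "M \<ge> 0" unfolding M_def using L(2) by (intro sum_nonneg) auto
  \<comment> \<open>\<open>None\<close> stands for the zero set of \<open>f\<close> and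
    \<open>Some T\<close> for the part of \<open>T\<close> in the support, where all points lie in
    \<Omega> and \<open>q T\<close> represents \<open>v\<close>; together these closed sets cover
    the space.\<close>
  have lip: "\<bar>f x - f y\<bar> \<le> M * dist x y" for x y proof (rule lipschitz_of_closed_cover[of "insert None (Some ` \<T>)"
      "\<lambda>j. case j of None \<Rightarrow> {x. f x = 0} | Some T \<Rightarrow> T \<inter> ?S" _ f "\<lambda>j x. case j of None \<Rightarrow> 0 | Some T \<Rightarrow> q T x * \<phi> x"])
    fix j assume j: "j \<in> insert None (Some ` \<T>)"
    show "closed (case j of None \<Rightarrow> {x. f x = 0} | Some T \<Rightarrow> T \<inter> ?S)"
      using j T(1) closed_Collect_eq[OF fc continuous_on_const] by (auto split: option.split intro: closed_Int)
    show "f x = (case j of None \<Rightarrow> 0 | Some T \<Rightarrow> q T x * \<phi> x)"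
      if "x \<in> (case j of None \<Rightarrow> {x. f x = 0} | Some T \<Rightarrow> T \<inter> ?S)" for x using that j q(2) S(2) by (auto simp: f_def subset_iff)
    have "\<bar>q T x * \<phi> x - q T y * \<phi> y\<bar> \<le> M * dist x y" if "T \<in> \<T>" for T x y
      by (rule order_trans[OF L(1)[OF that] mult_right_mono[OF LM[OF that] zero_le_dist]])
    then show "\<bar>(case j of None \<Rightarrow> 0 | Some T \<Rightarrow> q T x * \<phi> x) - (case j of None \<Rightarrow> 0 | Some T \<Rightarrow> q T y * \<phi> y)\<bar> \<le> M * dist x y" for x y
      using j M0 by (cases j) auto
  next
    have "f x = 0 \<or> (\<exists>T\<in>\<T>. x \<in> T \<inter> ?S)" for x using S(2) cover \<phi>0(1)[of x] by (cases "x \<in> ?S") (auto simp: f_def)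
    then show "(\<Union>j\<in>insert None (Some ` \<T>). case j of None \<Rightarrow> {x. f x = 0} | Some T \<Rightarrow> T \<inter> ?S) = UNIV" by auto
  qed (use fin M0 in auto)
  define D where "D x = (G x \<bullet> w) * \<phi> x + v x * (grad \<phi> x \<bullet> w)" for x
  have pd: "test_function \<Omega> (\<lambda>x. grad \<phi> x \<bullet> w)" by (rule test_function_pderiv[OF \<phi>])
  have int2: "integrable lebesgue (\<lambda>x. v x * (grad \<phi> x \<bullet> w))" by (rule integrable_continuous_times_test_function[OF \<Omega> v pd])
  have \<phi>m: "\<phi> \<in> borel_measurable lebesgue" by (intro continuous_imp_borel_lebesgue smooth_continuous_on test_functionD(1)[OF \<phi>])
  have Dm: "D \<in> borel_measurable lebesgue" unfolding D_def by (intro borel_measurable_add borel_measurable_times borel_measurable_inner G(1) \<phi>m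
        borel_measurable_integrable[OF int2] borel_measurable_const)
  \<comment> \<open>Off the frontiers a point of the support is interior to some piece, and near it
    \<open>f\<close> is a smooth product.\<close>
  have "negligible (\<Union>T\<in>\<T>. frontier T)" using fin T(2) by (intro negligible_Union) auto
  then have ae: "AE x in lebesgue. x \<notin> (\<Union>T\<in>\<T>. frontier T)" unfolding negligible_iff_null_sets by (rule AE_not_in)
  have deriv: "AE x in lebesgue. ((\<lambda>t. f (x + t *\<^sub>R w)) has_real_derivative D x) (at 0)" using ae proof eventually_elim
    case (elim x)
    have line: "((\<lambda>t. F (x + t *\<^sub>R w)) has_real_derivative d) (at 0)" if "(F has_derivative F') (at x)" "F' w = d" for F F' d proof -
      have "((\<lambda>t. F (x + t *\<^sub>R w)) has_derivative (\<lambda>h. F' (h *\<^sub>R w))) (at 0)" by (rule has_derivative_compose[where f="\<lambda>t. x + t *\<^sub>R w"])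
          (use that in \<open>auto intro!: derivative_eq_intros\<close>)
      then show ?thesis using that(2) linear_cmul[OF has_derivative_linear[OF that(1)]] by (intro has_derivative_imp_has_field_derivative) (auto simp: mult.commute)
    qed
    show ?case proof (cases "x \<in> ?S")
      case False
      have "(f has_derivative (\<lambda>h. 0)) (at x)" proof (rule has_derivative_transform_within_open[of "\<lambda>_. 0"])
        show "open (- ?S)" "x \<in> - ?S" using False by auto
        show "0 = f y" if "y \<in> - ?S" for y using \<phi>0(1)[of y] that by (simp add: f_def)
      qed auto
      from line[OF this refl] show ?thesis using \<phi>0[OF False] by (simp add: D_def)
    next
      case True
      then have x\<Omega>: "x \<in> \<Omega>" using S by auto
      then obtain T where T': "T \<in> \<T>" "x \<in> T" using cover by auto
      have xi: "x \<in> interior T" using elim T' T(1)[of T] by (auto simp: frontier_def)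
      have dq: "q T differentiable at x" and d\<phi>: "\<phi> differentiable at x" using smooth_differentiable q(1)[OF T'(1)] test_functionD(1)[OF \<phi>] by blast+
      have "((\<lambda>x. q T x * \<phi> x) has_derivative (\<lambda>h. q T x * (grad \<phi> x \<bullet> h) + (grad (q T) x \<bullet> h) * \<phi> x)) (at x)"
        by (rule has_derivative_mult[OF has_derivative_grad[OF dq] has_derivative_grad[OF d\<phi>]])
      then have "(f has_derivative (\<lambda>h. q T x * (grad \<phi> x \<bullet> h) + (grad (q T) x \<bullet> h) * \<phi> x)) (at x)"
      proof (rule has_derivative_transform_within_open)
        show "open (interior T \<inter> \<Omega>)" "x \<in> interior T \<inter> \<Omega>" using xi x\<Omega> \<Omega> by auto
        show "q T y * \<phi> y = f y" if "y \<in> interior T \<inter> \<Omega>" for y using that q(2)[OF T'(1), of y] interior_subset[of T] by (auto simp: f_def)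
      qed
      from line[OF this refl] show ?thesis using G(2)[OF T'(1)] q(2)[OF T'(1)] xi x\<Omega> T'(2) by (simp add: D_def add.commute)
    qed
  qed
  have f0: "f x = 0" if "x \<notin> ?S" for x using \<phi>0(1)[OF that] by (simp add: f_def)
  note D = lipschitz_integral_directional_derivative[OF lip compact_imp_bounded[OF S(1)] f0 Dm deriv]
  have "(LINT x|lebesgue. (G x \<bullet> w) * \<phi> x) = (LINT x|lebesgue. D x - v x * (grad \<phi> x \<bullet> w))" by (simp add: D_def)
  also have "\<dots> = - (LINT x|lebesgue. v x * (grad \<phi> x \<bullet> w))" using D int2 by simp
  finally show ?thesis by simp
qed

section \<open>The Poincare inequality\<close>

abbreviation "vol \<equiv> measure lebesgue"

lemma nn_integral_lborel_translation:
  fixes a :: "'a::euclidean_space"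
  assumes [measurable]: "f \<in> borel_measurable borel"
  shows "(\<integral>\<^sup>+y. f y \<partial>lborel) = (\<integral>\<^sup>+w. f (a + w) \<partial>lborel)" proof -
  have "(\<integral>\<^sup>+y. f y \<partial>lborel) = (\<integral>\<^sup>+y. f y \<partial>distr lborel borel ((+) a))" by (simp add: lborel_distr_plus)
  also have "\<dots> = (\<integral>\<^sup>+w. f (a + w) \<partial>lborel)" by (subst nn_integral_distr) auto
  finally show ?thesis .
qed

text \<open>With \<open>y = x + w\<close> and the integrals interchanged, the inner integral is an
  increment in a fixed direction \<open>w\<close>, bounded by \<open>norm w\<close> times the
  integral of the gradient. Convexity of \<open>U\<close> keeps the segments inside, and only
  \<open>w\<close> with \<open>norm w \<le> \<delta>\<close> contribute, whence the volume of a
  ball.\<close>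

lemma poincare_double_integral:
  fixes u :: "real^'n \<Rightarrow> real" and G :: "real^'n \<Rightarrow> real^'n"
  assumes u: "integrable lebesgue u" and G: "integrable lebesgue G"
    and weak: "\<And>\<psi> w. test_function U \<psi> \<Longrightarrow>
      (LINT x|lebesgue. u x * (grad \<psi> x \<bullet> w)) = - (LINT x|lebesgue. (G x \<bullet> w) * \<psi> x)"
    and U: "open U" "convex U" "\<And>x y. x \<in> U \<Longrightarrow> y \<in> U \<Longrightarrow> dist x y \<le> \<delta>" "0 \<le> \<delta>"
  shows "(\<integral>\<^sup>+x. \<integral>\<^sup>+y. indicator U x * indicator U y * ennreal \<bar>u x - u y\<bar> \<partial>lebesgue \<partial>lebesgue)
    \<le> ennreal (\<delta> * vol (cball (0::real^'n) \<delta>) * (LINT x|lebesgue. norm (G x)))" proof -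
  \<comment> \<open>The interchange of integrals needs measurability in the pair of variables, which
    a Borel representative provides.\<close>
  obtain u' where u' [measurable]: "u' \<in> borel_measurable borel" and ae: "AE x in lborel. u x = u' x" using completion_ex_borel_measurable_real[of u lborel] u by auto
  have ael: "AE x in lebesgue. u x = u' x" using ae by (rule AE_completion)
  have u'i: "integrable lebesgue u'" by (rule integrable_cong_AE_imp[OF u]) (use ael in \<open>auto intro: measurable_completion\<close>)
  define I where "I = (LINT x|lebesgue. norm (G x))"
  have I0: "I \<ge> 0" unfolding I_def by simp
  have Um [measurable]: "U \<in> sets borel" using U by auto
  define f where "f = (\<lambda>x y. indicator U x * indicator U y * ennreal \<bar>u' x - u' y\<bar>)"
  have fm [measurable]: "case_prod f \<in> borel_measurable (borel \<Otimes>\<^sub>M borel)" unfolding f_def by measurable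
  have "(\<integral>\<^sup>+x. \<integral>\<^sup>+y. indicator U x * indicator U y * ennreal \<bar>u x - u y\<bar> \<partial>lebesgue \<partial>lebesgue)
    = (\<integral>\<^sup>+x. \<integral>\<^sup>+y. f x y \<partial>lborel \<partial>lborel)" proof -
    have "(\<integral>\<^sup>+y. indicator U x * indicator U y * ennreal \<bar>u x - u y\<bar> \<partial>lebesgue) = (\<integral>\<^sup>+y. f x y \<partial>lborel)"
      if "u x = u' x" for x unfolding nn_integral_completion using ae by (intro nn_integral_cong_AE, eventually_elim) (simp add: f_def that)
    then have "AE x in lborel. (\<integral>\<^sup>+y. indicator U x * indicator U y * ennreal \<bar>u x - u y\<bar> \<partial>lebesgue) = (\<integral>\<^sup>+y. f x y \<partial>lborel)"
      by (rule eventually_mono[OF ae])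
    then have "AE x in lebesgue. (\<integral>\<^sup>+y. indicator U x * indicator U y * ennreal \<bar>u x - u y\<bar> \<partial>lebesgue) = (\<integral>\<^sup>+y. f x y \<partial>lborel)"
      by (rule AE_completion)
    then have "(\<integral>\<^sup>+x. \<integral>\<^sup>+y. indicator U x * indicator U y * ennreal \<bar>u x - u y\<bar> \<partial>lebesgue \<partial>lebesgue)
      = (\<integral>\<^sup>+x. \<integral>\<^sup>+y. f x y \<partial>lborel \<partial>lebesgue)" by (rule nn_integral_cong_AE)
    then show ?thesis by (simp only: nn_integral_completion)
  qed
  also have "\<dots> = (\<integral>\<^sup>+x. \<integral>\<^sup>+w. f x (x + w) \<partial>lborel \<partial>lborel)" proof (rule nn_integral_cong)
    fix x
    show "(\<integral>\<^sup>+y. f x y \<partial>lborel) = (\<integral>\<^sup>+w. f x (x + w) \<partial>lborel)" by (rule nn_integral_lborel_translation) measurable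
  qed
  also have "\<dots> = (\<integral>\<^sup>+w. \<integral>\<^sup>+x. f x (x + w) \<partial>lborel \<partial>lborel)" proof (rule lborel_pair.Fubini'[symmetric])
    show "(\<lambda>(x, w). f x (x + w)) \<in> borel_measurable (lborel \<Otimes>\<^sub>M lborel)" using fm by measurable
  qed
  also have "\<dots> \<le> (\<integral>\<^sup>+w. indicator (cball (0::real^'n) \<delta>) w * ennreal (\<delta> * I) \<partial>lborel)" proof (rule nn_integral_mono)
    fix w :: "real^'n"
    show "(\<integral>\<^sup>+x. f x (x + w) \<partial>lborel) \<le> indicator (cball 0 \<delta>) w * ennreal (\<delta> * I)" proof (cases "norm w \<le> \<delta>")
      case False
      have "f x (x + w) = 0" for x using U(3)[of x "x + w"] False by (auto simp: f_def indicator_def dist_norm)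
      then show ?thesis by simp
    next
      case True
      define A where "A = U \<inter> (\<lambda>x. x + w) -` U"
      have Ao: "open A" unfolding A_def using U(1) by (intro open_Int open_vimage continuous_intros) auto
      have AU: "x + t *\<^sub>R w \<in> U" if "x \<in> A" "0 \<le> t" "t \<le> 1" for x t proof -
        have "(1 - t) *\<^sub>R x + t *\<^sub>R (x + w) \<in> U" using U(2) that unfolding A_def convex_alt by auto
        then show ?thesis by (simp add: algebra_simps)
      qed
      have Gw: "integrable lebesgue (\<lambda>x. G x \<bullet> w)" using G by auto
      have weak': "(LINT x|lebesgue. u' x * (grad \<psi> x \<bullet> w)) = - (LINT x|lebesgue. (G x \<bullet> w) * \<psi> x)" if "test_function U \<psi>" for \<psi> proof -
        have gm: "(\<lambda>x. grad \<psi> x \<bullet> w) \<in> borel_measurable lebesgue"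
          by (intro continuous_imp_borel_lebesgue smooth_continuous_on test_functionD(1)[OF test_function_pderiv[OF that]])
        have "(LINT x|lebesgue. u' x * (grad \<psi> x \<bullet> w)) = (LINT x|lebesgue. u x * (grad \<psi> x \<bullet> w))" proof (rule integral_cong_AE)
          show "AE x in lebesgue. u' x * (grad \<psi> x \<bullet> w) = u x * (grad \<psi> x \<bullet> w)" using ael by eventually_elim simp
        qed (use gm u u'i in \<open>auto intro!: borel_measurable_times\<close>)
        then show ?thesis using weak[OF that] by simp
      qed
      have "(LINT x|lebesgue. indicator A x * \<bar>u' (x + w) - u' x\<bar>) \<le> (LINT x|lebesgue. \<bar>G x \<bullet> w\<bar>)"
        by (rule weak_derivative_increment_le[OF u'i Gw weak' Ao AU])
      also have "\<dots> \<le> (LINT x|lebesgue. norm (G x) * norm w)" using Gw G by (intro integral_mono) (auto simp: Cauchy_Schwarz_ineq2)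
      also have "\<dots> = I * norm w" by (simp add: I_def)
      also have "\<dots> \<le> \<delta> * I" using mult_left_mono[OF True I0] by (simp add: mult.commute)
      finally have le: "(LINT x|lebesgue. indicator A x * \<bar>u' (x + w) - u' x\<bar>) \<le> \<delta> * I" .
      have "integrable lebesgue (\<lambda>x. \<bar>u' (x + w) - u' x\<bar>)" by (intro integrable_abs Bochner_Integration.integrable_diff integrable_lebesgue_translation u'i)
      then have ii: "integrable lebesgue (\<lambda>x. indicator A x * \<bar>u' (x + w) - u' x\<bar>)"
        using integrable_mult_indicator[of A lebesgue "\<lambda>x. \<bar>u' (x + w) - u' x\<bar>"] Ao by simp
      have "(\<integral>\<^sup>+x. f x (x + w) \<partial>lborel) = (\<integral>\<^sup>+x. ennreal (indicator A x * \<bar>u' (x + w) - u' x\<bar>) \<partial>lebesgue)"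
        unfolding nn_integral_completion by (intro nn_integral_cong) (auto simp: f_def A_def indicator_def abs_minus_commute)
      also have "\<dots> = ennreal (LINT x|lebesgue. indicator A x * \<bar>u' (x + w) - u' x\<bar>)" using ii by (intro nn_integral_eq_integral) auto
      also have "\<dots> \<le> ennreal (\<delta> * I)" using le by (rule ennreal_leI)
      finally show ?thesis using True by simp
    qed
  qed
  also have "\<dots> = emeasure lborel (cball (0::real^'n) \<delta>) * ennreal (\<delta> * I)" by (subst nn_integral_multc) (simp_all add: borel_measurable_indicator)
  also have "emeasure lborel (cball (0::real^'n) \<delta>) = ennreal (vol (cball (0::real^'n) \<delta>))" using emeasure_lborel_cball_finite[of "0::real^'n" \<delta>]
    by (simp add: emeasure_eq_ennreal_measure less_top[symmetric] measure_completion)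
  finally show ?thesis using U(4) I0 by (simp add: ennreal_mult'[symmetric] I_def mult_ac)
qed

definition average :: "(real^'n) set \<Rightarrow> (real^'n \<Rightarrow> real) \<Rightarrow> real" where
  "average S f = (LINT x|lebesgue. indicator S x * f x) / vol S"

text \<open>The deviation of \<open>u x\<close> from the average is the average of the differences
  \<open>u x - u y\<close>. The two volumes stay on their sides; on simplices their ratio is later
  bounded by shape regularity.\<close>

lemma poincare:
  fixes u :: "real^'n \<Rightarrow> real" and G :: "real^'n \<Rightarrow> real^'n"
  assumes u: "integrable lebesgue u" and G: "integrable lebesgue G"
    and weak: "\<And>\<psi> w. test_function U \<psi> \<Longrightarrow>
      (LINT x|lebesgue. u x * (grad \<psi> x \<bullet> w)) = - (LINT x|lebesgue. (G x \<bullet> w) * \<psi> x)"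
    and U: "open U" "convex U" "\<And>x y. x \<in> U \<Longrightarrow> y \<in> U \<Longrightarrow> dist x y \<le> \<delta>" "0 \<le> \<delta>"
    and pos: "vol U > 0"
  shows "(LINT x|lebesgue. indicator U x * \<bar>u x - average U u\<bar>) * vol U
    \<le> \<delta> * vol (cball (0::real^'n) \<delta>) * (LINT x|lebesgue. norm (G x))" proof -
  let ?m = "vol U"
  have Um: "U \<in> lmeasurable" proof (rule lmeasurable_open[OF _ U(1)])
    show "bounded U" unfolding bounded_def using U(3) by blast
  qed
  have iU: "integrable lebesgue (indicator U :: _ \<Rightarrow> real)" using Um unfolding integrable_indicator_iff fmeasurable_def by (simp del: emeasure_completion)
  have fi: "integrable lebesgue (\<lambda>x. indicator U x * u x)" using Um by (intro integrable_indicator_times u) auto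
  define J where "J x = (LINT y|lebesgue. indicator U y * \<bar>u x - u y\<bar>)" for x
  have Ji: "integrable lebesgue (\<lambda>y. indicator U y * \<bar>u x - u y\<bar>)" for x using integrable_indicator_abs_diff[OF u Um, of "u x"] by (simp add: abs_minus_commute)
  have pt: "indicator U x * \<bar>u x - average U u\<bar> * ?m \<le> indicator U x * J x" for x proof -
    have "(u x - average U u) * ?m = (LINT y|lebesgue. indicator U y * u x) - (LINT y|lebesgue. indicator U y * u y)"
      using pos Um by (simp add: average_def left_diff_distrib fmeasurable_def)
    also have "\<dots> = (LINT y|lebesgue. indicator U y * (u x - u y))" using iU fi by (subst Bochner_Integration.integral_diff[symmetric]) (auto simp: right_diff_distrib)
    finally have "\<bar>u x - average U u\<bar> * ?m = \<bar>LINT y|lebesgue. indicator U y * (u x - u y)\<bar>" using pos by (metis abs_mult abs_of_pos)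
    also have "\<dots> \<le> (LINT y|lebesgue. \<bar>indicator U y * (u x - u y)\<bar>)" by (rule integral_abs_bound)
    also have "\<dots> = J x" by (simp add: J_def abs_mult)
    finally show ?thesis by (simp add: mult.assoc mult_left_mono)
  qed
  note ui = integrable_indicator_abs_diff[OF u Um, of "average U u"]
  have "ennreal ((LINT x|lebesgue. indicator U x * \<bar>u x - average U u\<bar>) * ?m)
    = ennreal (LINT x|lebesgue. indicator U x * \<bar>u x - average U u\<bar> * ?m)" by simp
  also have "\<dots> = (\<integral>\<^sup>+x. ennreal (indicator U x * \<bar>u x - average U u\<bar> * ?m) \<partial>lebesgue)"
    using ui by (intro nn_integral_eq_integral[symmetric]) auto
  also have "\<dots> \<le> (\<integral>\<^sup>+x. ennreal (indicator U x * J x) \<partial>lebesgue)" using pt by (intro nn_integral_mono ennreal_leI)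
  also have "\<dots> = (\<integral>\<^sup>+x. \<integral>\<^sup>+y. indicator U x * indicator U y * ennreal \<bar>u x - u y\<bar> \<partial>lebesgue \<partial>lebesgue)"
  proof (rule nn_integral_cong)
    fix x
    have "ennreal (J x) = (\<integral>\<^sup>+y. ennreal (indicator U y * \<bar>u x - u y\<bar>) \<partial>lebesgue)"
      unfolding J_def using Ji by (intro nn_integral_eq_integral[symmetric]) auto
    then show "ennreal (indicator U x * J x) = (\<integral>\<^sup>+y. indicator U x * indicator U y * ennreal \<bar>u x - u y\<bar> \<partial>lebesgue)"
      by (cases "x \<in> U") (auto simp: ennreal_mult' ennreal_indicator)
  qed
  also have "\<dots> \<le> ennreal (\<delta> * vol (cball (0::real^'n) \<delta>) * (LINT x|lebesgue. norm (G x)))" by (rule poincare_double_integral[OF u G weak U])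
  finally show ?thesis using U(4) by (subst (asm) ennreal_le_iff) auto
qed

section \<open>Inequalities of Markov and Nikolskii type, reduced to polynomials in one
  variable\<close>

section \<open>Polynomials\<close>

lemma poly_eq_sum_atMost:
  fixes p :: "'a::comm_semiring_1 poly"
  assumes "degree p \<le> n"
  shows "poly p x = (\<Sum>j\<le>n. coeff p j * x ^ j)" unfolding poly_altdef using assms by (intro sum.mono_neutral_left) (auto simp: coeff_eq_0)

text \<open>The factor \<open>1 + 2 ^ Suc n\<close> undoes the normalization of the auxiliary
  polynomial of lower degree. The outer sum recovers the leading coefficient from the value at 1 and
  the lower coefficients.\<close>

primrec coeff_bound :: "nat \<Rightarrow> real" where
  "coeff_bound 0 = 1"
| "coeff_bound (Suc n) = 1 + (real n + 2) * (coeff_bound n * (1 + 2 ^ Suc n))"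

lemma coeff_bound_ge_1: "coeff_bound n \<ge> 1" by (induction n) auto

text \<open>Since \<open>p(t) - 2\<^sup>n p(t/2)\<close> has lower degree, its coefficients, hence those of \<open>p\<close>, are bounded
  by induction.\<close>
lemma abs_coeff_le_coeff_bound:
  fixes p :: "real poly"
  assumes "degree p \<le> n" "\<And>t. 0 \<le> t \<Longrightarrow> t \<le> 1 \<Longrightarrow> \<bar>poly p t\<bar> \<le> 1"
  shows "\<bar>coeff p i\<bar> \<le> coeff_bound n" using assms proof (induction n arbitrary: p i)
  case 0
  then obtain c where "p = [:c:]" using degree_eq_zeroE by auto
  then show ?case using 0(2)[of 0] by (cases i) auto
next
  case (Suc n)
  let ?N = "2 ^ Suc n :: real"
  \<comment> \<open>The combination cancels the coefficient of degree \<open>Suc n\<close>, and the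
    scalar factor keeps the supremum on the unit interval at most 1.\<close>
  define r where "r = smult (1 / (1 + ?N)) (p - smult ?N (pcompose p [:0, 1/2:]))"
  have N: "?N > 0" "0 < 1 + 2 * (2::real) ^ n" by (simp_all add: add_pos_pos)
  have cr: "coeff r j = coeff p j * (1 - ?N / 2 ^ j) / (1 + ?N)" for j by (simp add: r_def coeff_pcompose_linear field_simps power_divide)
  have "degree r \<le> n" proof (rule degree_le, intro allI impI)
    fix j assume j: "n < j"
    show "coeff r j = 0" proof (cases "j = Suc n")
      case False
      then have "coeff p j = 0" using Suc.prems(1) j by (intro coeff_eq_0) auto
      then show ?thesis by (simp add: cr)
    qed (simp add: cr)
  qed
  moreover have "\<bar>poly r t\<bar> \<le> 1" if t: "0 \<le> t" "t \<le> 1" for t proof -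
    have "poly (pcompose p [:0, 1/2:]) t = poly p (t / 2)" by (simp add: poly_pcompose)
    moreover have "\<bar>poly p t\<bar> \<le> 1" "\<bar>poly p (t/2)\<bar> \<le> 1" using Suc.prems(2)[of t] Suc.prems(2)[of "t/2"] t by auto
    moreover have "\<bar>?N * poly p (t/2)\<bar> \<le> ?N * 1" unfolding abs_mult using calculation(3) N by (intro mult_mono) auto
    ultimately have "\<bar>poly p t - ?N * poly (pcompose p [:0, 1/2:]) t\<bar> \<le> 1 + ?N" using abs_triangle_ineq4[of "poly p t" "?N * poly p (t/2)"] by simp
    moreover have "poly r t = (poly p t - ?N * poly (pcompose p [:0, 1/2:]) t) / (1 + ?N)" by (simp add: r_def)
    ultimately show ?thesis using N by (simp add: abs_divide divide_le_eq_1)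
  qed
  ultimately have IH: "\<bar>coeff r j\<bar> \<le> coeff_bound n" for j by (rule Suc.IH)
  define C where "C = coeff_bound n * (1 + ?N)"
  have C: "C \<ge> 0" using coeff_bound_ge_1[of n] N unfolding C_def by (intro mult_nonneg_nonneg) auto
  \<comment> \<open>For \<open>j \<le> n\<close> the factor \<open>1 - 2 ^ Suc n / 2 ^ j\<close> has
    modulus at least 1, so the return from \<open>r\<close> to \<open>p\<close> loses only the
    normalization.\<close>
  have low: "\<bar>coeff p j\<bar> \<le> C" if "j \<le> n" for j proof -
    have "2 ^ Suc j \<le> ?N" using that by (intro power_increasing) auto
    then have "?N / 2 ^ j \<ge> 2" by (simp add: field_simps)
    then have "1 \<le> \<bar>1 - ?N / 2 ^ j\<bar>" by linarith
    then have "\<bar>coeff p j\<bar> * 1 \<le> \<bar>coeff p j\<bar> * \<bar>1 - ?N / 2 ^ j\<bar>" by (rule mult_left_mono) simp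
    also have "\<dots> = \<bar>coeff r j\<bar> * (1 + ?N)" using N by (simp add: cr abs_mult abs_divide)
    also have "\<dots> \<le> C" unfolding C_def using IH[of j] N by (intro mult_right_mono) auto
    finally show ?thesis by simp
  qed
  have CS: "coeff_bound (Suc n) = 1 + (real n + 2) * C" by (simp add: C_def)
  consider "i \<le> n" | "i = Suc n" | "i > Suc n" by linarith
  then show ?case proof cases
    case 1
    have "C \<le> (real n + 2) * C" using C mult_right_mono[of 1 "real n + 2" C] by simp
    then show ?thesis using low[OF 1] CS by linarith
  next
    case 2
    have "poly p 1 = (\<Sum>j\<le>Suc n. coeff p j)" using poly_eq_sum_atMost[OF Suc.prems(1), of 1] by simp
    then have e: "coeff p (Suc n) = poly p 1 - (\<Sum>j\<le>n. coeff p j)" by simp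
    have "\<bar>\<Sum>j\<le>n. coeff p j\<bar> \<le> (\<Sum>j\<le>n. C)" using low by (intro order_trans[OF sum_abs] sum_mono) auto
    also have "\<dots> = (real n + 1) * C" by simp
    finally have "\<bar>coeff p (Suc n)\<bar> \<le> 1 + (real n + 1) * C" using Suc.prems(2)[of 1] unfolding e by linarith
    also have "\<dots> \<le> 1 + (real n + 2) * C" using C by (simp add: algebra_simps)
    finally show ?thesis using 2 CS by simp
  next
    case 3
    then have "coeff p i = 0" using Suc.prems(1) by (intro coeff_eq_0) auto
    then show ?thesis using coeff_bound_ge_1[of "Suc n"] by simp
  qed
qed

lemma abs_coeff_le:
  fixes p :: "real poly"
  assumes "degree p \<le> n" "\<And>t. 0 \<le> t \<Longrightarrow> t \<le> 1 \<Longrightarrow> \<bar>poly p t\<bar> \<le> S"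
  shows "\<bar>coeff p i\<bar> \<le> coeff_bound n * S" proof -
  have S: "S \<ge> 0" using assms(2)[of 0] by linarith
  show ?thesis proof (cases "S = 0")
    case True
    \<comment> \<open>For \<open>S = 0\<close> scaling is impossible, but a polynomial with
      infinitely many zeros vanishes.\<close>
    have "infinite {t::real. 0 \<le> t \<and> t \<le> 1}" using infinite_Icc[of "0::real" 1] by (simp add: atLeastAtMost_def atLeast_def atMost_def Int_def)
    moreover have "{t. 0 \<le> t \<and> t \<le> 1} \<subseteq> {t. poly p t = 0}" using assms(2) True by auto
    ultimately have "p = 0" using poly_roots_finite[of p] finite_subset by blast
    then show ?thesis using True by simp
  next
    case False
    then have S: "S > 0" using S by simp
    have "\<bar>coeff (smult (1 / S) p) i\<bar> \<le> coeff_bound n" by (rule abs_coeff_le_coeff_bound) (use assms S in \<open>auto simp: abs_mult field_simps\<close>)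
    then show ?thesis using S by (simp add: abs_mult field_simps)
  qed
qed

text \<open>A constant of Markov type for increments from the end point 0 of the unit interval. The
  factor \<open>n + 1\<close> in place of \<open>n\<close> keeps it at least 1 also for
  \<open>n = 0\<close>.\<close>

definition markov :: "nat \<Rightarrow> real" where
  "markov n = real (n + 1) * coeff_bound n"

lemma markov_ge_1: "markov n \<ge> 1" using coeff_bound_ge_1[of n] mult_mono[of 1 "real (n+1)" 1 "coeff_bound n"] by (simp add: markov_def)

lemma abs_poly_diff_le:
  fixes p :: "real poly"
  assumes "degree p \<le> n" "\<And>t. 0 \<le> t \<Longrightarrow> t \<le> 1 \<Longrightarrow> \<bar>poly p t\<bar> \<le> S" and t: "0 \<le> t" "t \<le> 1"
  shows "\<bar>poly p t - poly p 0\<bar> \<le> markov n * S * t" proof -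
  have S: "S \<ge> 0" using assms(2)[of 0] by linarith
  have "poly p t = (\<Sum>j\<le>n. coeff p j * t ^ j)" using assms(1) by (rule poly_eq_sum_atMost)
  also have "{..n} = insert 0 {1..n}" by auto
  finally have e: "poly p t - poly p 0 = (\<Sum>j\<in>{1..n}. coeff p j * t ^ j)" by (simp add: poly_0_coeff_0)
  have "\<bar>poly p t - poly p 0\<bar> \<le> (\<Sum>j\<in>{1..n}. \<bar>coeff p j * t ^ j\<bar>)" unfolding e by (rule sum_abs)
  also have "\<dots> \<le> (\<Sum>j\<in>{1..n}. coeff_bound n * S * t)" proof (rule sum_mono)
    fix j assume j: "j \<in> {1..n}"
    have "t ^ j \<le> t ^ 1" using j t by (intro power_decreasing) auto
    then show "\<bar>coeff p j * t ^ j\<bar> \<le> coeff_bound n * S * t" unfolding abs_mult using abs_coeff_le[OF assms(1,2), of j] t S coeff_bound_ge_1[of n]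
      by (intro mult_mono) auto
  qed
  also have "\<dots> = real n * (coeff_bound n * S * t)" by simp
  also have "\<dots> \<le> real (n + 1) * (coeff_bound n * S * t)" using S t coeff_bound_ge_1[of n] by (intro mult_right_mono mult_nonneg_nonneg) auto
  finally show ?thesis by (simp add: markov_def mult_ac)
qed

lemma finite_multi_indices: "finite {\<alpha> :: 'n::finite \<Rightarrow> nat. sum \<alpha> UNIV \<le> K}" proof (rule finite_subset)
  show "{\<alpha> :: 'n \<Rightarrow> nat. sum \<alpha> UNIV \<le> K} \<subseteq> PiE UNIV (\<lambda>_. {..K})" proof
    fix \<alpha> :: "'n \<Rightarrow> nat" assume \<alpha>: "\<alpha> \<in> {\<alpha>. sum \<alpha> UNIV \<le> K}"
    have "\<alpha> i \<le> K" for i using member_le_sum[of i UNIV \<alpha>] \<alpha> by simp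
    then show "\<alpha> \<in> PiE UNIV (\<lambda>_. {..K})" by (simp add: PiE_def Pi_def)
  qed
qed (intro finite_PiE, simp_all)

lemma poly_fun_line:
  fixes q :: "real^'n \<Rightarrow> real"
  assumes "poly_fun K q"
  obtains p where "degree p \<le> K" "\<And>t. poly p t = q (x + t *\<^sub>R w)" proof -
  obtain c where q: "q = (\<lambda>x. \<Sum>\<alpha> | sum \<alpha> UNIV \<le> K. c \<alpha> * (\<Prod>i\<in>UNIV. x $ i ^ \<alpha> i))" using assms by (auto simp: poly_fun_def)
  define p where "p = (\<Sum>\<alpha> | sum \<alpha> UNIV \<le> K. smult (c \<alpha>) (\<Prod>i\<in>UNIV. [:x $ i, w $ i:] ^ \<alpha> i))"
  show ?thesis proof (rule that)
    show "degree p \<le> K" unfolding p_def proof (rule degree_sum_le[OF finite_multi_indices])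
      fix \<alpha> :: "'n \<Rightarrow> nat" assume \<alpha>: "\<alpha> \<in> {\<alpha>. sum \<alpha> UNIV \<le> K}"
      have "degree (\<Prod>i\<in>UNIV. [:x $ i, w $ i:] ^ \<alpha> i) \<le> (\<Sum>i\<in>UNIV. degree ([:x $ i, w $ i:] ^ \<alpha> i))"
        using degree_prod_sum_le[of UNIV "\<lambda>i. [:x $ i, w $ i:] ^ \<alpha> i"] by (simp add: o_def)
      also have "\<dots> \<le> (\<Sum>i\<in>UNIV. \<alpha> i)" proof (rule sum_mono)
        fix i
        have "degree ([:x $ i, w $ i:] ^ \<alpha> i) \<le> degree [:x $ i, w $ i:] * \<alpha> i" by (rule degree_power_le)
        also have "\<dots> \<le> \<alpha> i" by simp
        finally show "degree ([:x $ i, w $ i:] ^ \<alpha> i) \<le> \<alpha> i" .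
      qed
      finally show "degree (smult (c \<alpha>) (\<Prod>i\<in>UNIV. [:x $ i, w $ i:] ^ \<alpha> i)) \<le> K" using \<alpha> by (intro order_trans[OF degree_smult_le]) auto
    qed
    show "poly p t = q (x + t *\<^sub>R w)" for t by (simp add: p_def q poly_sum poly_prod poly_power)
  qed
qed

lemma poly_fun_add: "poly_fun K f \<Longrightarrow> poly_fun K g \<Longrightarrow> poly_fun K (\<lambda>x. f x + g x)" unfolding poly_fun_def proof clarify
  fix c d :: "('a \<Rightarrow> nat) \<Rightarrow> real"
  show "\<exists>e. (\<lambda>x. (\<Sum>\<alpha> | sum \<alpha> UNIV \<le> K. c \<alpha> * (\<Prod>i\<in>UNIV. x $ i ^ \<alpha> i)) +
      (\<Sum>\<alpha> | sum \<alpha> UNIV \<le> K. d \<alpha> * (\<Prod>i\<in>UNIV. x $ i ^ \<alpha> i))) =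
      (\<lambda>x. \<Sum>\<alpha> | sum \<alpha> UNIV \<le> K. e \<alpha> * (\<Prod>i\<in>UNIV. x $ i ^ \<alpha> i))"
    by (intro exI[of _ "\<lambda>\<alpha>. c \<alpha> + d \<alpha>"]) (simp add: distrib_right sum.distrib)
qed

lemma poly_fun_cmult: "poly_fun K f \<Longrightarrow> poly_fun K (\<lambda>x. a * f x)" unfolding poly_fun_def proof clarify
  fix c :: "('a \<Rightarrow> nat) \<Rightarrow> real"
  show "\<exists>e. (\<lambda>x. a * (\<Sum>\<alpha> | sum \<alpha> UNIV \<le> K. c \<alpha> * (\<Prod>i\<in>UNIV. x $ i ^ \<alpha> i))) =
      (\<lambda>x. \<Sum>\<alpha> | sum \<alpha> UNIV \<le> K. e \<alpha> * (\<Prod>i\<in>UNIV. x $ i ^ \<alpha> i))"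
    by (intro exI[of _ "\<lambda>\<alpha>. a * c \<alpha>"]) (simp add: sum_distrib_left mult.assoc)
qed

lemma poly_fun_diff: "poly_fun K f \<Longrightarrow> poly_fun K g \<Longrightarrow> poly_fun K (\<lambda>x. f x - g x)"
  using poly_fun_add[of K f "\<lambda>x. -1 * g x"] poly_fun_cmult[of K g "-1"] by simp

lemma poly_fun_monomial:
  fixes \<beta> :: "'n::finite \<Rightarrow> nat"
  assumes "sum \<beta> UNIV \<le> K"
  shows "poly_fun K (\<lambda>x::real^'n. \<Prod>i\<in>UNIV. x $ i ^ \<beta> i)" unfolding poly_fun_def
proof (intro exI[of _ "\<lambda>\<alpha>. if \<alpha> = \<beta> then 1 else 0"] ext)
  fix x :: "real^'n"
  show "(\<Prod>i\<in>UNIV. x $ i ^ \<beta> i) =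
    (\<Sum>\<alpha> | sum \<alpha> UNIV \<le> K. (if \<alpha> = \<beta> then 1 else 0) * (\<Prod>i\<in>UNIV. x $ i ^ \<alpha> i))" proof -
    have "(\<Sum>\<alpha> | sum \<alpha> UNIV \<le> K. (if \<alpha> = \<beta> then 1 else 0) * (\<Prod>i\<in>UNIV. x $ i ^ \<alpha> i)) =
      (\<Sum>\<alpha> | sum \<alpha> UNIV \<le> K. if \<alpha> = \<beta> then (\<Prod>i\<in>UNIV. x $ i ^ \<beta> i) else 0)" by (intro sum.cong) simp_all
    also have "\<dots> = (\<Prod>i\<in>UNIV. x $ i ^ \<beta> i)" using assms by (simp only: sum.delta[OF finite_multi_indices] mem_Collect_eq if_True)
    finally show ?thesis by simp
  qed
qed

lemma poly_fun_const: "poly_fun K (\<lambda>x::real^'n. a)" using poly_fun_cmult[OF poly_fun_monomial[of "\<lambda>_. 0" K], of a] by simp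

lemma poly_fun_nth:
  assumes "K \<ge> 1"
  shows "poly_fun K (\<lambda>x::real^'n. x $ j)" proof -
  have "(\<Prod>i\<in>UNIV. x $ i ^ (if i = j then 1 else 0)) = x $ j" for x :: "real^'n" proof -
    have "(\<Prod>i\<in>UNIV. x $ i ^ (if i = j then 1 else 0)) = (\<Prod>i\<in>UNIV. if i = j then x $ j else 1)" by (intro prod.cong) simp_all
    then show ?thesis by simp
  qed
  then show ?thesis using poly_fun_monomial[of "\<lambda>i. if i = j then 1 else 0" K] assms by simp
qed

lemma poly_fun_sum: "(\<And>i. i \<in> I \<Longrightarrow> poly_fun K (f i)) \<Longrightarrow> poly_fun K (\<lambda>x. \<Sum>i\<in>I. f i x)"
  by (induction I rule: infinite_finite_induct) (auto intro: poly_fun_const poly_fun_add)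

lemma poly_fun_inner:
  assumes "K \<ge> 1"
  shows "poly_fun K (\<lambda>x::real^'n. x \<bullet> a)" unfolding inner_vec_def inner_real_def
  by (intro poly_fun_sum) (subst mult.commute, rule poly_fun_cmult[OF poly_fun_nth[OF assms]])

lemma smooth_poly_fun: "poly_fun K q \<Longrightarrow> smooth q" unfolding poly_fun_def by (auto intro!: smooth_sum smooth_mult smooth_const smooth_prod smooth_power smooth_nth)

text \<open>On the segment from \<open>x\<close> to \<open>y\<close> the derivative at
  \<open>x\<close> is the linear coefficient of a polynomial in one variable, hence bounded.
  Opposite end points \<open>c + e\<close> and \<open>c - e\<close> with \<open>e\<close> parallel
  to the gradient isolate the norm of the gradient although \<open>x\<close> need not be the
  centre.\<close>

lemma abs_grad_poly_fun_le:
  fixes q :: "real^'n \<Rightarrow> real"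
  assumes q: "poly_fun K q" and S: "convex S" "cball c r \<subseteq> S" "x \<in> S" "r > 0"
    and bd: "\<And>y. y \<in> S \<Longrightarrow> \<bar>q y\<bar> \<le> m"
  shows "norm (grad q x) * r \<le> coeff_bound K * m" proof -
  have *: "\<bar>grad q x \<bullet> (y - x)\<bar> \<le> coeff_bound K * m" if y: "y \<in> S" for y proof -
    obtain p where p: "degree p \<le> K" "\<And>t. poly p t = q (x + t *\<^sub>R (y - x))" using poly_fun_line[OF q] by metis
    have "x + t *\<^sub>R (y - x) \<in> S" if "0 \<le> t" "t \<le> 1" for t proof -
      have "(1 - t) *\<^sub>R x + t *\<^sub>R y \<in> S" using S(1,3) y that unfolding convex_alt by auto
      then show ?thesis by (simp add: algebra_simps)
    qed
    then have cb: "\<bar>coeff p 1\<bar> \<le> coeff_bound K * m" using abs_coeff_le[OF p(1), of m 1] bd p(2) by simp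
    have "((\<lambda>t. q (x + t *\<^sub>R (y - x))) has_derivative (\<lambda>h. grad q (x + 0 *\<^sub>R (y - x)) \<bullet> (h *\<^sub>R (y - x)))) (at 0)"
    proof (rule has_derivative_compose[OF _ has_derivative_grad[OF smooth_differentiable[OF smooth_poly_fun[OF q]]]])
      show "((\<lambda>t. x + t *\<^sub>R (y - x)) has_derivative (\<lambda>h. h *\<^sub>R (y - x))) (at 0)" by (auto intro!: derivative_eq_intros)
    qed
    then have "((\<lambda>t. q (x + t *\<^sub>R (y - x))) has_real_derivative grad q x \<bullet> (y - x)) (at 0)" by (intro has_derivative_imp_has_field_derivative) auto
    moreover have "((\<lambda>t. q (x + t *\<^sub>R (y - x))) has_real_derivative poly (pderiv p) 0) (at 0)" using poly_DERIV[of p 0] p(2) by simp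
    ultimately have "grad q x \<bullet> (y - x) = poly (pderiv p) 0" by (rule DERIV_unique)
    also have "\<dots> = coeff p 1" by (simp add: poly_0_coeff_0 coeff_pderiv)
    finally show ?thesis using cb by simp
  qed
  show ?thesis proof (cases "grad q x = 0")
    case True
    then show ?thesis using *[OF S(3)] by simp
  next
    case False
    define e where "e = (r / norm (grad q x)) *\<^sub>R grad q x"
    have "norm e = r" using False S(4) by (simp add: e_def)
    then have "c + e \<in> S" "c - e \<in> S" using S(2) by (auto simp: subset_iff dist_norm)
    from *[OF this(1)] *[OF this(2)] have "\<bar>grad q x \<bullet> (2 *\<^sub>R e)\<bar> \<le> 2 * (coeff_bound K * m)" by (auto simp: inner_diff_right inner_add_right)
    moreover have "grad q x \<bullet> (2 *\<^sub>R e) = 2 * (norm (grad q x) * r)" using False by (simp add: e_def power2_norm_eq_inner[symmetric] power2_eq_square)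
    ultimately show ?thesis using S(4) by (simp add: abs_mult)
  qed
qed

text \<open>The first factor 2 stands for half of the maximum; \<open>2 * markov K\<close> is the
  inverse of the ratio by which the set is contracted towards a maximum point, and the power is the
  resulting loss of volume.\<close>

definition nikolskii :: "nat \<Rightarrow> nat \<Rightarrow> real" where
  "nikolskii d K = 2 * (2 * markov K) ^ d"

lemma nikolskii_ge_1: "nikolskii d K \<ge> 1" proof -
  have "1 ^ d \<le> (2 * markov K) ^ d" using markov_ge_1[of K] by (intro power_mono) auto
  then show ?thesis by (simp add: nikolskii_def)
qed

text \<open>Along every segment from a maximum point, a polynomial stays above half its maximum for a fixed
  fraction of the segment; so it does on a fixed fraction of the volume.\<close>
lemma sup_poly_fun_le_average:
  fixes q :: "real^'n \<Rightarrow> real"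
  assumes q: "poly_fun K q" and S: "convex S" "compact S" "x \<in> S"
  shows "\<bar>q x\<bar> * vol S \<le> nikolskii CARD('n) K * (LINT y|lebesgue. indicator S y * \<bar>q y\<bar>)" proof -
  have qc: "continuous_on UNIV q" by (rule smooth_continuous_on[OF smooth_poly_fun[OF q]])
  then have "continuous_on S (\<lambda>y. \<bar>q y\<bar>)" by (intro continuous_intros continuous_on_subset[OF qc]) auto
  then obtain z where z: "z \<in> S" "\<And>y. y \<in> S \<Longrightarrow> \<bar>q y\<bar> \<le> \<bar>q z\<bar>" using continuous_attains_sup[OF S(2)] S(3) by blast
  \<comment> \<open>With this contraction the Markov bound allows a drop of exactly half of the
    maximum.\<close>
  define \<epsilon> where "\<epsilon> = 1 / (2 * markov K)"
  have \<epsilon>: "0 < \<epsilon>" "\<epsilon> \<le> 1" using markov_ge_1[of K] by (auto simp: \<epsilon>_def)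
  define S' where "S' = (\<lambda>y. \<epsilon> *\<^sub>R y + (1 - \<epsilon>) *\<^sub>R z) ` S"
  have S': "S' \<subseteq> S" unfolding S'_def using S(1) z(1) \<epsilon> by (auto simp: convex_alt add.commute)
  have S'c: "compact S'" unfolding S'_def by (intro compact_continuous_image continuous_intros S(2))
  have half: "\<bar>q y\<bar> \<ge> \<bar>q z\<bar> / 2" if "y \<in> S'" for y proof -
    obtain v where v: "v \<in> S" "y = z + \<epsilon> *\<^sub>R (v - z)" using \<open>y \<in> S'\<close> unfolding S'_def by (auto simp: algebra_simps)
    obtain p where p: "degree p \<le> K" "\<And>t. poly p t = q (z + t *\<^sub>R (v - z))" using poly_fun_line[OF q] by metis
    have "z + t *\<^sub>R (v - z) \<in> S" if "0 \<le> t" "t \<le> 1" for t proof -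
      have "(1 - t) *\<^sub>R z + t *\<^sub>R v \<in> S" using S(1) z(1) v(1) that unfolding convex_alt by auto
      then show ?thesis by (simp add: algebra_simps)
    qed
    then have "\<bar>poly p \<epsilon> - poly p 0\<bar> \<le> markov K * \<bar>q z\<bar> * \<epsilon>" using p z(2) \<epsilon> by (intro abs_poly_diff_le) auto
    also have "\<dots> = \<bar>q z\<bar> / 2" using markov_ge_1[of K] by (simp add: \<epsilon>_def field_simps)
    finally have "\<bar>q y - q z\<bar> \<le> \<bar>q z\<bar> / 2" using p(2)[of \<epsilon>] p(2)[of 0] v(2) by simp
    then show ?thesis by linarith
  qed
  have mS: "vol S' = \<epsilon> ^ CARD('n) * vol S" unfolding S'_def using measure_lebesgue_affine[of \<epsilon> "(1 - \<epsilon>) *\<^sub>R z" S] \<epsilon> by simp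
  have SS: "S \<in> sets lebesgue" "S' \<in> lmeasurable" using S(2) S'c by (auto simp: compact_imp_closed lmeasurable_compact)
  have iq: "integrable lebesgue (\<lambda>y. indicator S y * \<bar>q y\<bar>)" proof (rule Bochner_Integration.integrable_bound)
    show "integrable lebesgue (\<lambda>y. indicator S y * \<bar>q z\<bar>)"
      using lmeasurable_compact[OF S(2)] by (intro integrable_mult_left) (simp add: fmeasurable_def integrable_indicator_iff del: emeasure_completion)
    show "(\<lambda>y. indicator S y * \<bar>q y\<bar>) \<in> borel_measurable lebesgue" using continuous_imp_borel_lebesgue[OF qc] SS(1) by measurable
  qed (use z(2) in \<open>auto simp: indicator_def\<close>)
  have i1: "integrable lebesgue (indicator S' :: _ \<Rightarrow> real)" using SS(2) by (simp add: fmeasurable_def integrable_indicator_iff del: emeasure_completion)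
  have "\<bar>q x\<bar> * vol S \<le> \<bar>q z\<bar> * vol S" using z(2)[OF S(3)] by (intro mult_right_mono) auto
  also have "\<dots> = nikolskii CARD('n) K * (\<bar>q z\<bar> / 2 * vol S')"
    using markov_ge_1[of K] unfolding mS nikolskii_def \<epsilon>_def by (simp add: power_divide power_mult_distrib)
  also have "\<bar>q z\<bar> / 2 * vol S' = (LINT y|lebesgue. indicator S' y * (\<bar>q z\<bar> / 2))" using SS(2) by (simp add: fmeasurable_def)
  also have "\<dots> \<le> (LINT y|lebesgue. indicator S y * \<bar>q y\<bar>)" proof (rule integral_mono[OF integrable_mult_left[OF i1] iq])
    show "indicator S' y * (\<bar>q z\<bar> / 2) \<le> indicator S y * \<bar>q y\<bar>" for y using half[of y] S' by (auto simp: indicator_def)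
  qed
  finally show ?thesis using nikolskii_ge_1[of "CARD('n)" K] by (simp add: mult_left_mono)
qed

section \<open>Orthogonal projections\<close>

text \<open>The pointwise bound makes evaluation continuous, so \<open>\<Sum> f(x)\<^sup>2 \<le> A\<close> for every orthonormal
  family; its size is thereby bounded, and a maximal one spans.\<close>
lemma ex_orthogonal_projection:
  fixes V :: "('a \<Rightarrow> real) set"
  assumes "finite_measure M"
    and add: "\<And>f g. f \<in> V \<Longrightarrow> g \<in> V \<Longrightarrow> (\<lambda>x. f x + g x) \<in> V"
    and scale: "\<And>f a. f \<in> V \<Longrightarrow> (\<lambda>x. a * f x) \<in> V" and ne: "V \<noteq> {}"
    and meas: "\<And>f. f \<in> V \<Longrightarrow> f \<in> borel_measurable M"
    and bdd: "\<And>f. f \<in> V \<Longrightarrow> \<exists>b. \<forall>x\<in>space M. \<bar>f x\<bar> \<le> b"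
    and pt: "\<And>f x. f \<in> V \<Longrightarrow> x \<in> space M \<Longrightarrow> (f x)\<^sup>2 \<le> A * (LINT y|M. f y * f y)"
    and A: "A \<ge> 0"
    and u: "integrable M u"
  shows "\<exists>w\<in>V. \<forall>v\<in>V. (LINT x|M. w x * v x) = (LINT x|M. u x * v x)" proof -
  interpret finite_measure M by fact
  define ip where "ip f g = (LINT x|M. f x * g x)" for f g :: "'a \<Rightarrow> real"
  have int: "integrable M (\<lambda>x. f x * g x)" if f: "integrable M f" and g: "g \<in> V" for f g using bdd[OF g] integrable_mult_bounded[OF f meas[OF g]] by blast
  have Vint: "integrable M f" if "f \<in> V" for f using int[OF integrable_const[of 1] that] by simp
  have zero: "(\<lambda>x. 0) \<in> V" using scale[of _ 0] ne by auto
  have sums: "(\<lambda>x. \<Sum>f\<in>F. c f * f x) \<in> V" if "F \<subseteq> V" for F c using that proof (induction F rule: infinite_finite_induct)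
    case (insert g F)
    have "(\<lambda>x. c g * g x + (\<Sum>f\<in>F. c f * f x)) \<in> V" using insert by (intro add[OF scale]) blast+
    then show ?case using insert.hyps by simp
  qed (use zero in simp_all)
  have ipsum: "ip (\<lambda>x. \<Sum>f\<in>F. c f * f x) g = (\<Sum>f\<in>F. c f * ip f g)" if "F \<subseteq> V" "g \<in> V" for F c g proof -
    have "ip (\<lambda>x. \<Sum>f\<in>F. c f * f x) g = (LINT x|M. (\<Sum>f\<in>F. c f * (f x * g x)))" by (simp add: ip_def sum_distrib_right mult.assoc)
    also have "\<dots> = (\<Sum>f\<in>F. LINT x|M. c f * (f x * g x))" using that by (intro Bochner_Integration.integral_sum integrable_mult_right int Vint) auto
    finally show ?thesis by (simp add: ip_def)
  qed
  have ipsym: "ip f g = ip g f" for f g by (simp add: ip_def mult.commute)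
  define ON where "ON F \<longleftrightarrow> finite F \<and> F \<subseteq> V \<and> (\<forall>f\<in>F. \<forall>g\<in>F. ip f g = (if f = g then 1 else 0))" for F
  have ONcard: "real (card F) \<le> A * measure M (space M)" if "ON F" for F proof -
    have F: "finite F" "F \<subseteq> V" "\<And>f g. f \<in> F \<Longrightarrow> g \<in> F \<Longrightarrow> ip f g = (if f = g then 1 else 0)"
      using \<open>ON F\<close> by (auto simp: ON_def)
    have le: "(\<Sum>f\<in>F. f x * f x) \<le> A" if x: "x \<in> space M" for x proof -
      \<comment> \<open>\<open>v\<close> is the reproducing kernel at \<open>x\<close> of the span
        of \<open>F\<close>. Both \<open>v x\<close> and the squared norm of \<open>v\<close> equal
        \<open>s\<close>, so the pointwise bound reads \<open>s * s \<le> A * s\<close>.\<close>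
      define s where "s = (\<Sum>f\<in>F. f x * f x)"
      define v where "v = (\<lambda>y. \<Sum>f\<in>F. f x * f y)"
      have v: "v \<in> V" unfolding v_def by (rule sums[OF F(2)])
      have ipv: "ip f v = f x" if f: "f \<in> F" for f proof -
        have "ip f v = (\<Sum>g\<in>F. g x * ip g f)" unfolding ipsym[of f] v_def using F(2) f by (intro ipsum) auto
        also have "\<dots> = (\<Sum>g\<in>F. if g = f then g x else 0)" using F(3) f by (intro sum.cong) auto
        finally show ?thesis using F(1) f by simp
      qed
      have "ip v v = (\<Sum>f\<in>F. f x * ip f v)" using ipsum[OF F(2) v, of "\<lambda>f. f x"] by (simp add: v_def[symmetric])
      also have "\<dots> = s" unfolding s_def using ipv by (intro sum.cong) auto
      finally have "s * s \<le> A * s" using pt[OF v x] by (simp add: ip_def s_def v_def power2_eq_square)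
      moreover have "s \<ge> 0" unfolding s_def by (intro sum_nonneg) auto
      ultimately have "s \<le> A" using A by (cases "s = 0") auto
      then show ?thesis by (simp add: s_def)
    qed
    have "real (card F) = (\<Sum>f\<in>F. ip f f)" using F(3) by simp
    also have "\<dots> = (LINT x|M. (\<Sum>f\<in>F. f x * f x))" unfolding ip_def using F(2) by (intro Bochner_Integration.integral_sum[symmetric] int Vint) auto
    also have "\<dots> \<le> (LINT x|M. A)" proof (rule integral_mono)
      show "integrable M (\<lambda>x. \<Sum>f\<in>F. f x * f x)" using F(2) by (intro Bochner_Integration.integrable_sum int Vint) auto
    qed (use le in auto)
    finally show ?thesis by (simp add: mult.commute)
  qed
  have "ON {}" by (simp add: ON_def)
  moreover have "\<forall>F. ON F \<longrightarrow> card F \<le> nat \<lfloor>A * measure M (space M)\<rfloor>" using ONcard by (intro allI impI le_nat_floor)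
  ultimately obtain F where F: "ON F" "\<And>F'. ON F' \<Longrightarrow> card F' \<le> card F"
    using ex_has_greatest_nat[of ON "{}" card "Suc (nat \<lfloor>A * measure M (space M)\<rfloor>)"] by (metis le_imp_less_Suc)
  have F': "finite F" "F \<subseteq> V" "\<And>f g. f \<in> F \<Longrightarrow> g \<in> F \<Longrightarrow> ip f g = (if f = g then 1 else 0)" using F(1) by (auto simp: ON_def)
  have span: "v x = (\<Sum>f\<in>F. ip v f * f x)" if v: "v \<in> V" and x: "x \<in> space M" for v x proof -
    define p where "p = (\<lambda>x. \<Sum>f\<in>F. ip v f * f x)"
    define z where "z = (\<lambda>x. v x + (-1) * p x)"
    have p: "p \<in> V" unfolding p_def by (rule sums[OF F'(2)])
    have z: "z \<in> V" unfolding z_def by (intro add scale v p)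
    have ipz: "ip z g = ip v g - ip p g" if "g \<in> V" for g unfolding ip_def z_def using int[OF Vint[OF v] that] int[OF Vint[OF p] that] by (simp add: left_diff_distrib)
    have zF: "ip z f = 0" if f: "f \<in> F" for f proof -
      have "ip p f = (\<Sum>g\<in>F. ip v g * ip g f)" unfolding p_def using F'(2) f by (intro ipsum) auto
      also have "\<dots> = (\<Sum>g\<in>F. if g = f then ip v g else 0)" using F'(3) f by (intro sum.cong) auto
      finally show ?thesis using F'(1,2) f ipz[of f] by auto
    qed
    \<comment> \<open>Otherwise the normalized remainder could be adjoined to the orthonormal family
      of maximal size.\<close>
    have "ip z z = 0" proof (rule ccontr)
      assume "ip z z \<noteq> 0"
      moreover have "ip z z \<ge> 0" unfolding ip_def by simp
      ultimately have pos: "ip z z > 0" by simp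
      define y where "y = (\<lambda>x. (1 / sqrt (ip z z)) * z x)"
      have y: "y \<in> V" unfolding y_def by (rule scale[OF z])
      have yf: "ip y g = ip z g / sqrt (ip z z)" for g by (simp add: ip_def y_def)
      have yy: "ip y y = 1" proof -
        have "ip y y = ip z y / sqrt (ip z z)" by (rule yf)
        also have "ip z y = ip z z / sqrt (ip z z)" unfolding ipsym[of z y] by (rule yf)
        finally show ?thesis using pos by (simp add: real_div_sqrt)
      qed
      have yF: "ip y f = 0" "ip f y = 0" if "f \<in> F" for f using yf[of f] zF[OF that] ipsym[of f y] by simp_all
      have "y \<notin> F" using yF(1)[of y] yy by force
      moreover have "ON (insert y F)" unfolding ON_def proof (intro conjI ballI)
        fix f g assume "f \<in> insert y F" "g \<in> insert y F"
        then show "ip f g = (if f = g then 1 else 0)" using yF[of f] yF[of g] yy F'(3)[of f g] \<open>y \<notin> F\<close> by (cases "f = y"; cases "g = y") simp_all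
      qed (use F' y in simp_all)
      ultimately show False using F(2)[of "insert y F"] F'(1) by simp
    qed
    \<comment> \<open>The pointwise bound turns a vanishing norm into a vanishing value, so the
      expansion holds at every point.\<close>
    then have "z x = 0" using pt[OF z x] by (simp add: ip_def)
    then show ?thesis by (simp add: z_def p_def)
  qed
  define w where "w = (\<lambda>x. \<Sum>f\<in>F. ip u f * f x)"
  have w: "w \<in> V" unfolding w_def by (rule sums[OF F'(2)])
  show ?thesis proof (intro bexI[OF _ w] ballI)
    fix v assume v: "v \<in> V"
    have "ip w v = (\<Sum>f\<in>F. ip u f * ip f v)" unfolding w_def by (rule ipsum[OF F'(2) v])
    also have "\<dots> = (\<Sum>f\<in>F. LINT x|M. ip v f * (u x * f x))" by (simp add: ip_def mult.commute)
    also have "\<dots> = (LINT x|M. (\<Sum>f\<in>F. ip v f * (u x * f x)))" using F'(2) by (intro Bochner_Integration.integral_sum[symmetric] integrable_mult_right int u) auto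
    also have "\<dots> = (LINT x|M. u x * v x)" by (intro Bochner_Integration.integral_cong refl) (simp add: span[OF v] sum_distrib_left mult_ac)
    finally show "(LINT x|M. w x * v x) = (LINT x|M. u x * v x)" by (simp add: ip_def)
  qed
qed

section \<open>Barycentric coordinates, faces, and the size of a simplex\<close>

section \<open>Simplices\<close>

definition vertices :: "(real^'n) set \<Rightarrow> (real^'n) set" where
  "vertices T = {v. v extreme_point_of T}"

text \<open>The gradient of the barycentric coordinate of \<open>v\<close>. For a nondegenerate
  simplex the differences \<open>w - v\<close> form a basis, so the condition determines it.\<close>

definition bary_grad :: "(real^'n) set \<Rightarrow> real^'n \<Rightarrow> real^'n" where
  "bary_grad T v = (SOME a. \<forall>w\<in>vertices T. w \<noteq> v \<longrightarrow> a \<bullet> (w - v) = -1)"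

text \<open>The barycentric coordinate of \<open>v\<close>, taken as an affine function on the whole
  space so that it can be evaluated outside the simplex as well.\<close>

definition bary :: "(real^'n) set \<Rightarrow> real^'n \<Rightarrow> real^'n \<Rightarrow> real" where
  "bary T v x = 1 + bary_grad T v \<bullet> (x - v)"

lemma linear_real_eq_inner:
  fixes g :: "'a::euclidean_space \<Rightarrow> real"
  assumes "linear g"
  obtains a where "\<And>x. g x = a \<bullet> x" proof (rule that[of "adjoint g 1"])
  show "g x = adjoint g 1 \<bullet> x" for x using adjoint_works[OF assms, of x 1] by (simp add: inner_commute)
qed

abbreviation lint :: "(real^'n) set \<Rightarrow> (real^'n \<Rightarrow> real) \<Rightarrow> real" where
  "lint T f \<equiv> LINT x|lebesgue. indicator (interior T) x * f x"

locale full_simplex =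
  fixes T :: "(real^'n) set"
  assumes n_simplex: "int CARD('n) simplex T"
begin

lemma vertices_simplex:
  shows "finite (vertices T)" "\<not> affine_dependent (vertices T)" "card (vertices T) = CARD('n) + 1"
    "convex hull (vertices T) = T" proof -
  obtain C where C: "\<not> affine_dependent C" "int (card C) = int CARD('n) + 1" "T = convex hull C" using n_simplex by (auto simp: simplex_def)
  have "vertices T = C" unfolding vertices_def C(3) using extreme_point_of_convex_hull_affine_independent[OF C(1)] by auto
  then have V: "vertices T = C" .
  show "finite (vertices T)" "\<not> affine_dependent (vertices T)" "convex hull (vertices T) = T"
    using C(1) C(3)[symmetric] aff_independent_finite[OF C(1)] unfolding V by - (assumption+)
  have "int (card C) = int (CARD('n) + 1)" using C(2) by simp
  then show "card (vertices T) = CARD('n) + 1" unfolding V by (simp only: of_nat_eq_iff)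
qed

lemma vertices_subset: "vertices T \<subseteq> T" using hull_subset[of "vertices T" convex] unfolding vertices_simplex(4) .

lemma vertices_nonempty: "vertices T \<noteq> {}" using vertices_simplex(3) by auto

lemma convex_T: "convex T" and compact_T: "compact T" and closed_T: "closed T" using n_simplex convex_simplex compact_simplex closed_simplex by blast+

lemma bounded_T: "bounded T" using compact_T compact_imp_bounded by blast

lemma aff_dim_T: "aff_dim T = int CARD('n)" using aff_dim_simplex n_simplex by blast

lemma affine_hull_vertices: "affine hull (vertices T) = UNIV" proof -
  have "aff_dim (vertices T) = int DIM(real^'n)" using vertices_simplex(2,3) aff_dim_affine_independent[of "vertices T"] by simp
  then show ?thesis using aff_dim_eq_full[of "vertices T"] by simp
qed

lemma interior_nonempty: "interior T \<noteq> {}" proof -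
  have "affine hull T = UNIV" using affine_hull_convex_hull[of "vertices T"] unfolding vertices_simplex(4) affine_hull_vertices .
  then have "rel_interior T = interior T" by (rule rel_interior_interior)
  moreover have "rel_interior T \<noteq> {}" using convex_T vertices_nonempty vertices_subset rel_interior_eq_empty by blast
  ultimately show ?thesis by simp
qed

text \<open>Affine independence of the vertices makes the differences \<open>w - v\<close> linearly
  independent, so some linear functional takes the value -1 on all of them; it is an inner product
  with a vector.\<close>

lemma bary_grad_vertex:
  assumes v: "v \<in> vertices T" and w: "w \<in> vertices T" "w \<noteq> v"
  shows "bary_grad T v \<bullet> (w - v) = -1" proof -
  have "affine_dependent (insert v (vertices T - {v})) \<longleftrightarrow> dependent ((\<lambda>x. -v + x) ` (vertices T - {v}))" by (rule affine_dependent_iff_dependent) simp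
  then have "independent ((\<lambda>x. x - v) ` (vertices T - {v}))" using v vertices_simplex(2) by (simp add: insert_absorb)
  then obtain g where g: "linear g" "\<And>b. b \<in> (\<lambda>x. x - v) ` (vertices T - {v}) \<Longrightarrow> g b = (-1::real)"
    using linear_independent_extend[of "(\<lambda>x. x - v) ` (vertices T - {v})" "\<lambda>_. -1::real"] by blast
  obtain a where a: "\<And>x. g x = a \<bullet> x" using linear_real_eq_inner[OF g(1)] by blast
  have "\<forall>w\<in>vertices T. w \<noteq> v \<longrightarrow> a \<bullet> (w - v) = -1" using g(2) unfolding a by blast
  then have "\<forall>w\<in>vertices T. w \<noteq> v \<longrightarrow> bary_grad T v \<bullet> (w - v) = -1" unfolding bary_grad_def by (rule someI)
  then show ?thesis using w by blast
qed

lemma bary_vertex: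
  assumes "v \<in> vertices T" "w \<in> vertices T"
  shows "bary T v w = (if w = v then 1 else 0)" using bary_grad_vertex[OF assms] by (simp add: bary_def)

lemma bary_affine_combination:
  assumes "sum u I = 1"
  shows "bary T v (\<Sum>i\<in>I. u i *\<^sub>R x i) = (\<Sum>i\<in>I. u i * bary T v (x i))" proof -
  have "(\<Sum>i\<in>I. u i * bary T v (x i)) = (\<Sum>i\<in>I. u i * (1 - bary_grad T v \<bullet> v)) + (\<Sum>i\<in>I. u i * (bary_grad T v \<bullet> x i))"
    by (simp add: bary_def inner_diff_right algebra_simps sum.distrib[symmetric] sum_subtractf[symmetric])
  also have "(\<Sum>i\<in>I. u i * (1 - bary_grad T v \<bullet> v)) = 1 - bary_grad T v \<bullet> v" using assms by (simp add: sum_distrib_right[symmetric])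
  also have "(\<Sum>i\<in>I. u i * (bary_grad T v \<bullet> x i)) = bary_grad T v \<bullet> (\<Sum>i\<in>I. u i *\<^sub>R x i)" by (simp add: inner_sum_right)
  finally show ?thesis by (simp add: bary_def inner_diff_right)
qed

lemma bary_coefficients:
  assumes "sum u (vertices T) = 1" "v \<in> vertices T"
  shows "bary T v (\<Sum>w\<in>vertices T. u w *\<^sub>R w) = u v" proof -
  have "bary T v (\<Sum>w\<in>vertices T. u w *\<^sub>R w) = (\<Sum>w\<in>vertices T. u w * bary T v w)" by (rule bary_affine_combination[OF assms(1)])
  also have "\<dots> = (\<Sum>w\<in>vertices T. if w = v then u v else 0)" using assms(2) by (intro sum.cong refl) (simp add: bary_vertex)
  also have "\<dots> = u v" using vertices_simplex(1) assms(2) by simp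
  finally show ?thesis .
qed

lemma
  shows sum_bary: "(\<Sum>v\<in>vertices T. bary T v x) = 1"
    and sum_bary_vertex: "(\<Sum>v\<in>vertices T. bary T v x *\<^sub>R v) = x" proof -
  have "x \<in> affine hull (vertices T)" by (simp add: affine_hull_vertices)
  then obtain u where u: "sum u (vertices T) = 1" "(\<Sum>v\<in>vertices T. u v *\<^sub>R v) = x" unfolding affine_hull_finite[OF vertices_simplex(1)] by blast
  then have "bary T v x = u v" if "v \<in> vertices T" for v using bary_coefficients[OF u(1) that] by simp
  then show "(\<Sum>v\<in>vertices T. bary T v x) = 1" "(\<Sum>v\<in>vertices T. bary T v x *\<^sub>R v) = x" using u by auto
qed

lemma mem_simplex_iff: "x \<in> T \<longleftrightarrow> (\<forall>v\<in>vertices T. 0 \<le> bary T v x)" proof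
  assume "x \<in> T"
  then have "x \<in> convex hull (vertices T)" using vertices_simplex(4) by simp
  then obtain u where u: "\<forall>v\<in>vertices T. 0 \<le> u v" "sum u (vertices T) = 1" "(\<Sum>v\<in>vertices T. u v *\<^sub>R v) = x"
    unfolding convex_hull_finite[OF vertices_simplex(1)] by blast
  then show "\<forall>v\<in>vertices T. 0 \<le> bary T v x" using bary_coefficients[OF u(2)] by simp
next
  assume "\<forall>v\<in>vertices T. 0 \<le> bary T v x"
  then have "x \<in> convex hull (vertices T)" unfolding convex_hull_finite[OF vertices_simplex(1)] mem_Collect_eq
    by (intro exI[of _ "\<lambda>v. bary T v x"] conjI sum_bary sum_bary_vertex)
  then show "x \<in> T" using vertices_simplex(4) by simp
qed

lemma bary_le_1:
  assumes "x \<in> T" "v \<in> vertices T"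
  shows "bary T v x \<le> 1" proof -
  have "bary T v x \<le> (\<Sum>w\<in>vertices T. bary T w x)" using assms mem_simplex_iff vertices_simplex(1) by (intro member_le_sum) auto
  then show ?thesis by (simp add: sum_bary)
qed

lemma bary_diff: "bary T v x - bary T v y = bary_grad T v \<bullet> (x - y)" by (simp add: bary_def inner_diff_right)

text \<open>A coordinate varies by at most 1 over the simplex, in particular along a radius of the
  ball in the direction of the gradient.\<close>

lemma norm_bary_grad_le:
  assumes "cball c r \<subseteq> T" "v \<in> vertices T" "r \<ge> 0"
  shows "norm (bary_grad T v) * r \<le> 1" proof (cases "bary_grad T v = 0")
  case False
  define e where "e = (r / norm (bary_grad T v)) *\<^sub>R bary_grad T v"
  have "norm e = r" using False assms(3) by (simp add: e_def)
  then have "c + e \<in> T" "c \<in> T" using assms(1,3) by (auto simp: subset_iff dist_norm)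
  then have "bary T v (c + e) - bary T v c \<le> 1" using bary_le_1[of "c + e"] assms(2) mem_simplex_iff by force
  moreover have "bary T v (c + e) - bary T v c = norm (bary_grad T v) * r" unfolding bary_diff using False by (simp add: e_def power2_norm_eq_inner[symmetric] power2_eq_square)
  ultimately show ?thesis by simp
qed simp

text \<open>Half of the inradius is certainly the radius of an inscribed ball, whether or not the
  supremum is attained. Negative radii give empty balls and belong to the set, hence the case
  distinction in its upper bound.\<close>

lemma inradius_pos: "inradius T > 0" and incircle: "\<exists>c. cball c (inradius T / 2) \<subseteq> T" proof -
  let ?R = "{r. \<exists>x. cball x r \<subseteq> T}"
  obtain c e where ce: "e > 0" "cball c e \<subseteq> T" using interior_nonempty mem_interior_cball by blast
  have bd: "bdd_above ?R" proof
    fix r assume "r \<in> ?R"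
    then obtain x where x: "cball x r \<subseteq> T" by blast
    show "r \<le> diameter T" proof (cases "r \<ge> 0")
      case True
      have "norm (axis undefined 1 :: real^'n) = 1" by simp
      then have "x + r *\<^sub>R axis undefined 1 \<in> T" "x \<in> T" using x True by (auto simp: subset_iff dist_norm)
      from diameter_bounded_bound[OF bounded_T this] show ?thesis using True by (simp add: dist_norm)
    next
      case False
      then show ?thesis using diameter_ge_0[OF bounded_T] by linarith
    qed
  qed
  have "e \<in> ?R" using ce by blast
  then have "e \<le> inradius T" unfolding inradius_def by (rule cSup_upper[OF _ bd])
  then show pos: "inradius T > 0" using ce by linarith
  then have "inradius T / 2 < Sup ?R" by (simp add: inradius_def)
  then obtain r where "r \<in> ?R" "inradius T / 2 < r" using less_cSup_iff[OF _ bd] \<open>e \<in> ?R\<close> by blast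
  then show "\<exists>c. cball c (inradius T / 2) \<subseteq> T" using subset_cball[of "inradius T / 2" r] by force
qed

lemma norm_bary_grad_le_inradius:
  assumes "v \<in> vertices T"
  shows "norm (bary_grad T v) \<le> 2 / inradius T" using incircle norm_bary_grad_le[OF _ assms, of _ "inradius T / 2"] inradius_pos by (auto simp: field_simps)

lemma measurable_T: "T \<in> lmeasurable" using lmeasurable_compact[OF compact_T] .

lemma measure_ge_inradius:
  "vol (cball (0::real^'n) 1) * (inradius T / 2) ^ CARD('n) \<le> vol T" proof -
  obtain c where c: "cball c (inradius T / 2) \<subseteq> T" using incircle by blast
  have "vol (cball c (inradius T / 2)) \<le> vol T" using c measurable_T by (intro measure_mono_fmeasurable) auto
  moreover have "vol (cball c (inradius T / 2)) = vol (cball (0::real^'n) 1) * (inradius T / 2) ^ CARD('n)"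
    using inradius_pos content_cball[of "inradius T / 2" c] content_cball[of 1 "0::real^'n"] by simp
  ultimately show ?thesis by simp
qed

lemma measure_pos: "vol T > 0" proof -
  have "vol (cball (0::real^'n) 1) > 0" by simp
  then show ?thesis using measure_ge_inradius inradius_pos by (smt (verit) half_gt_zero mult_pos_pos zero_less_power)
qed

lemma diameter_pos: "diameter T > 0" and inradius_le_diameter: "inradius T \<le> diameter T" proof -
  obtain c where c: "cball c (inradius T / 2) \<subseteq> T" using incircle by blast
  let ?a = "(inradius T / 2) *\<^sub>R (axis undefined 1 :: real^'n)"
  have "norm ?a = inradius T / 2" using inradius_pos by simp
  then have "c + ?a \<in> T" "c - ?a \<in> T" using c by (auto simp: subset_iff dist_norm)
  from diameter_bounded_bound[OF bounded_T this] have "norm (2 *\<^sub>R ?a) \<le> diameter T" by (simp add: dist_norm scaleR_2[symmetric])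
  then show "inradius T \<le> diameter T" using inradius_pos by simp
  then show "diameter T > 0" using inradius_pos by linarith
qed

lemma measure_le_diameter:
  "vol T \<le> vol (cball (0::real^'n) 1) * diameter T ^ CARD('n)" proof -
  obtain x where x: "x \<in> T" using interior_nonempty interior_subset by blast
  have "T \<subseteq> cball x (diameter T)" using diameter_bounded_bound[OF bounded_T x] by auto
  then have "vol T \<le> vol (cball x (diameter T))" by (intro measure_mono_fmeasurable fmeasurableD[OF measurable_T] lmeasurable_cball)
  also have "\<dots> = vol (cball (0::real^'n) 1) * diameter T ^ CARD('n)" using diameter_pos content_cball[of "diameter T" x] content_cball[of 1 "0::real^'n"] by simp
  finally show ?thesis .
qed

lemma negligible_frontier_T: "negligible (frontier T)" using convex_T by (rule negligible_convex_frontier)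

lemma measure_interior: "vol (interior T) = vol T" using measure_interior[OF bounded_T negligible_frontier_T] .

text \<open>A positive coordinate leaves room to prolong the segment from \<open>v\<close> through
  \<open>y\<close> a little beyond \<open>y\<close> inside \<open>T\<close>. Then \<open>y\<close>
  is an inner point of a segment with end point \<open>v\<close>, and a face containing
  \<open>y\<close> contains both ends.\<close>

lemma vertex_in_face:
  assumes F: "F face_of T" and y: "y \<in> F" and v: "v \<in> vertices T" "bary T v y > 0"
  shows "v \<in> F" proof (cases "y = v")
  case False
  have yT: "y \<in> T" using F y face_of_imp_subset by blast
  have vT: "v \<in> T" using v vertices_subset by blast
  define \<epsilon> where "\<epsilon> = bary T v y"
  have \<epsilon>1: "0 < \<epsilon>" "\<epsilon> \<le> 1" using v bary_le_1[OF yT v(1)] by (auto simp: \<epsilon>_def)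
  \<comment> \<open>With the step \<open>\<epsilon> / 2\<close> the coordinate of \<open>v\<close>
    at \<open>z\<close> is \<open>(\<epsilon> + \<epsilon>\<^sup>2) / 2\<close>, still positive; all
    other coordinates only grow.\<close>
  define z where "z = y + (\<epsilon> / 2) *\<^sub>R (y - v)"
  have bz: "bary T w z = (1 + \<epsilon> / 2) * bary T w y - \<epsilon> / 2 * bary T w v" for w by (simp add: z_def bary_def inner_diff_right inner_add_right algebra_simps)
  have "z \<in> T" unfolding mem_simplex_iff proof
    fix w assume w: "w \<in> vertices T"
    show "0 \<le> bary T w z" proof (cases "w = v")
      case True
      then show ?thesis using \<epsilon>1 bary_vertex[OF v(1) v(1)] unfolding bz by (simp add: \<epsilon>_def[symmetric] algebra_simps)
    next
      case False
      then show ?thesis using \<epsilon>1 bary_vertex[OF w v(1)] yT w unfolding bz by (auto simp: mem_simplex_iff)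
    qed
  qed
  moreover have "y \<in> open_segment v z" proof -
    have "y = (1 - 1 / (1 + \<epsilon>/2)) *\<^sub>R v + (1 / (1 + \<epsilon>/2)) *\<^sub>R z" proof -
      have "(1 / (1 + \<epsilon>/2)) *\<^sub>R z = (1 / (1 + \<epsilon>/2)) *\<^sub>R ((1 + \<epsilon>/2) *\<^sub>R y) - (1 / (1 + \<epsilon>/2) * (\<epsilon>/2)) *\<^sub>R v"
        by (simp add: z_def algebra_simps)
      also have "(1 / (1 + \<epsilon>/2)) *\<^sub>R ((1 + \<epsilon>/2) *\<^sub>R y) = y" using \<epsilon>1 by simp
      also have "1 / (1 + \<epsilon>/2) * (\<epsilon>/2) = 1 - 1 / (1 + \<epsilon>/2)" using \<epsilon>1 by (simp add: field_simps)
      finally show ?thesis by simp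
    qed
    moreover have "0 < 1 / (1 + \<epsilon>/2)" "1 / (1 + \<epsilon>/2) < 1" using \<epsilon>1 by auto
    moreover have "v \<noteq> z" proof
      assume "v = z"
      then have "(1 + \<epsilon>/2) *\<^sub>R (y - v) = 0" by (simp add: z_def algebra_simps)
      then show False using False \<epsilon>1 by simp
    qed
    ultimately show ?thesis unfolding in_segment by blast
  qed
  ultimately show ?thesis using F y vT unfolding face_of_def by blast
qed (use y in simp)

lemma face_eq_or_subset_vertices:
  assumes "F face_of T" "y \<in> F" "\<And>v. v \<in> E \<Longrightarrow> v \<in> vertices T \<and> bary T v y > 0"
  shows "convex hull E \<subseteq> F" using vertex_in_face[OF assms(1,2)] assms(3) face_of_imp_convex[OF assms(1)] by (intro hull_minimal) auto

lemma facet_vertex: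
  assumes "F facet_of T"
  obtains v where "v \<in> vertices T" "vertices T - {v} \<noteq> {}" "F = convex hull (vertices T - {v})"
    "F = {x\<in>T. bary T v x = 0}" "affine hull F = {x. bary T v x = 0}" proof -
  have "F facet_of (convex hull vertices T)" using assms by (simp only: vertices_simplex(4))
  then obtain v where v: "F \<noteq> {}" "v \<in> vertices T" "F = convex hull (vertices T - {v})" using facet_of_convex_hull_affine_independent[OF vertices_simplex(2)] by blast
  have ne: "vertices T - {v} \<noteq> {}" using v by auto
  have aff: "affine hull F = {x. bary T v x = 0}" proof
    have "affine {x. bary T v x = 0}" proof -
      have "{x. bary T v x = 0} = {x. bary_grad T v \<bullet> x = bary_grad T v \<bullet> v - 1}" by (auto simp: bary_def inner_diff_right)
      then show ?thesis by (simp add: affine_hyperplane)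
    qed
    moreover have "vertices T - {v} \<subseteq> {x. bary T v x = 0}" using v(2) by (auto simp: bary_vertex)
    ultimately show "affine hull F \<subseteq> {x. bary T v x = 0}" unfolding v(3) affine_hull_convex_hull by (intro hull_minimal)
    show "{x. bary T v x = 0} \<subseteq> affine hull F" proof
      fix x assume "x \<in> {x. bary T v x = 0}"
      then have "(\<Sum>w\<in>vertices T - {v}. bary T w x) = 1" "(\<Sum>w\<in>vertices T - {v}. bary T w x *\<^sub>R w) = x"
        using sum_bary[of x] sum_bary_vertex[of x] v(2) vertices_simplex(1) by (auto simp: sum.remove)
      then show "x \<in> affine hull F" unfolding v(3) affine_hull_convex_hull using vertices_simplex(1) by (subst affine_hull_finite) auto
    qed
  qed
  have "F = {x\<in>T. bary T v x = 0}" proof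
    have "F \<subseteq> T" using assms facet_of_imp_subset by blast
    then show "F \<subseteq> {x\<in>T. bary T v x = 0}" using aff hull_subset[of F affine] by auto
    show "{x\<in>T. bary T v x = 0} \<subseteq> F" proof
      fix x assume x: "x \<in> {x\<in>T. bary T v x = 0}"
      then have "(\<Sum>w\<in>vertices T - {v}. bary T w x) = 1" "(\<Sum>w\<in>vertices T - {v}. bary T w x *\<^sub>R w) = x"
        using sum_bary[of x] sum_bary_vertex[of x] v(2) vertices_simplex(1) by (auto simp: sum.remove)
      moreover have "\<forall>w\<in>vertices T - {v}. 0 \<le> bary T w x" using x mem_simplex_iff by auto
      ultimately show "x \<in> F" unfolding v(3) using vertices_simplex(1) by (subst convex_hull_finite) auto
    qed
  qed
  then show ?thesis using that v ne aff by blast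
qed

lemma bary_grad_nonzero:
  assumes "v \<in> vertices T" "vertices T - {v} \<noteq> {}"
  shows "bary_grad T v \<noteq> 0" using assms bary_grad_vertex by (metis Diff_iff all_not_in_conv inner_zero_left insert_iff zero_neq_neg_one)

lemma negligible_facet:
  assumes "F facet_of T"
  shows "negligible F" proof -
  obtain v where v: "v \<in> vertices T" "vertices T - {v} \<noteq> {}" "F = {x\<in>T. bary T v x = 0}" using facet_vertex[OF assms] by metis
  have "negligible {x. bary_grad T v \<bullet> x = bary_grad T v \<bullet> v - 1}" using bary_grad_nonzero[OF v(1,2)] by (intro negligible_hyperplane) auto
  moreover have "F \<subseteq> {x. bary_grad T v \<bullet> x = bary_grad T v \<bullet> v - 1}" unfolding v(3) by (auto simp: bary_def inner_diff_right)
  ultimately show ?thesis by (rule negligible_subset)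
qed

lemma poly_fun_bary: "K \<ge> 1 \<Longrightarrow> poly_fun K (bary T v)" proof -
  have e: "bary T v = (\<lambda>x. (1 - bary_grad T v \<bullet> v) + x \<bullet> bary_grad T v)"
    by (rule ext) (simp add: bary_def inner_diff_right inner_commute[of "bary_grad T v"])
  show "K \<ge> 1 \<Longrightarrow> poly_fun K (bary T v)" unfolding e by (intro poly_fun_add poly_fun_const poly_fun_inner)
qed

end

section \<open>Decomposition of the domain up to null sets, the mesh distance, and weights as
  functions of simplices\<close>

section \<open>Triangulated domains\<close>

locale triangulated =
  fixes \<Omega> :: "(real^'n) set" and \<T> :: "(real^'n) set set" and \<Gamma> :: "(real^'n) set"
  assumes dom: "triangulated_domain \<Omega> \<T> \<Gamma>"
begin

lemma open_domain: "open \<Omega>" and connected_domain: "connected \<Omega>" and bounded_domain: "bounded \<Omega>"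
  and domain_nonempty: "\<Omega> \<noteq> {}"
  and finite_mesh: "finite \<T>"
  and closure_domain: "closure \<Omega> = \<Union>\<T>"
  and frontier_domain: "frontier \<Omega> = \<Union>(boundary_faces \<Omega> \<T>)" using dom by (auto simp: triangulated_domain_def regular_triangulation_def triangulation_def)

lemma full_simplex: "T \<in> \<T> \<Longrightarrow> full_simplex T" using dom by (auto simp: full_simplex_def triangulated_domain_def regular_triangulation_def)

lemma face_Int: "T \<in> \<T> \<Longrightarrow> T' \<in> \<T> \<Longrightarrow> (T \<inter> T') face_of T"
  using dom by (auto simp: triangulated_domain_def regular_triangulation_def triangulation_def)

lemma face_Int': "T \<in> \<T> \<Longrightarrow> T' \<in> \<T> \<Longrightarrow> (T \<inter> T') face_of T'" using face_Int[of T' T] by (simp add: Int_commute)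

lemma mesh_nonempty: "\<T> \<noteq> {}" using closure_domain domain_nonempty by auto

lemma domain_subset: "\<Omega> \<subseteq> \<Union>\<T>" using closure_domain closure_subset by blast

lemma domain_disjoint_frontier: "\<Omega> \<inter> frontier \<Omega> = {}" using open_domain by (simp add: frontier_def interior_open)

text \<open>If \<open>F\<close> is a facet of \<open>S\<close>, then \<open>F \<inter> T\<close> is
  \<open>F \<inter> (S \<inter> T)\<close>, a face of the common face \<open>S \<inter> T\<close>
  and therefore of \<open>T\<close>. So boundary faces fit all simplices, not only those they belong
  to.\<close>

lemma boundary_face_Int_face:
  assumes F: "F \<in> boundary_faces \<Omega> \<T>" and T: "T \<in> \<T>"
  shows "(F \<inter> T) face_of T" proof -
  obtain S where S: "S \<in> \<T>" "F facet_of S" using F by (auto simp: boundary_faces_def)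
  have FS: "F face_of S" using S facet_of_imp_face_of by blast
  have "F \<inter> (S \<inter> T) face_of S" by (rule face_of_Int[OF FS face_Int[OF S(1) T]])
  moreover have "F \<inter> (S \<inter> T) = F \<inter> T" using face_of_imp_subset[OF FS] by auto
  ultimately have "F \<inter> T face_of (S \<inter> T)" using face_of_imp_subset[OF FS] by (simp add: face_of_face[OF face_Int[OF S(1) T]]) auto
  then show ?thesis using face_of_trans face_Int'[OF S(1) T] by blast
qed

lemma not_in_frontier: "x \<in> \<Omega> \<Longrightarrow> F \<in> boundary_faces \<Omega> \<T> \<Longrightarrow> x \<notin> F"
  using domain_disjoint_frontier frontier_domain by auto

lemma boundary_faceE:
  assumes "x \<in> T" "T \<in> \<T>" "x \<notin> \<Omega>"
  obtains F where "F \<in> boundary_faces \<Omega> \<T>" "x \<in> F" proof -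
  have "x \<in> closure \<Omega>" using assms closure_domain by auto
  then have "x \<in> frontier \<Omega>" using assms(3) open_domain by (simp add: frontier_def interior_open)
  then show ?thesis using that frontier_domain by auto
qed

lemma negligible_boundary_face: "F \<in> boundary_faces \<Omega> \<T> \<Longrightarrow> negligible F"
  using full_simplex full_simplex.negligible_facet by (auto simp: boundary_faces_def)

text \<open>This uses that the frontier is a union of boundary faces: a face of \<open>T\<close>
  that meets the interior of \<open>T\<close> is all of \<open>T\<close>, whereas boundary faces are
  negligible.\<close>

lemma interior_subset_domain:
  assumes T: "T \<in> \<T>"
  shows "interior T \<subseteq> \<Omega>" proof
  interpret full_simplex T by (rule full_simplex[OF T])
  fix x assume x: "x \<in> interior T"
  show "x \<in> \<Omega>" proof (rule ccontr)
    assume "x \<notin> \<Omega>"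
    then obtain F where F: "F \<in> boundary_faces \<Omega> \<T>" "x \<in> F" using boundary_faceE T x interior_subset by blast
    have "F \<inter> T = T" using face_of_disjoint_interior[OF boundary_face_Int_face[OF F(1) T]] F(2) x interior_subset by blast
    then have "negligible T" using negligible_boundary_face[OF F(1)] negligible_subset by (metis inf_le1)
    then show False using interior_nonempty negligible_imp_measure0 measure_pos by force
  qed
qed

lemma interior_disjoint:
  assumes "T \<in> \<T>" "T' \<in> \<T>" "x \<in> interior T" "x \<in> T'"
  shows "T = T'" proof -
  have "x \<in> T \<inter> T'" using assms interior_subset by blast
  then have "T \<inter> T' = T" using face_of_disjoint_interior[OF face_Int[OF assms(1,2)]] assms by blast
  then have TT: "T \<subseteq> T'" by blast
  then have "x \<in> interior T'" using assms(3) interior_mono by blast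
  then have "T \<inter> T' = T'" using face_of_disjoint_interior[OF face_Int'[OF assms(1,2)]] assms \<open>x \<in> T \<inter> T'\<close> by blast
  then show ?thesis using TT by blast
qed

lemma interior_unique:
  assumes "T \<in> \<T>" "S \<in> \<T>" "x \<in> interior T" "x \<in> interior S"
  shows "S = T" using interior_disjoint[OF assms(1,2,3)] assms(4) interior_subset by blast

lemma negligible_skeleton: "negligible (\<Omega> - (\<Union>T\<in>\<T>. interior T))" proof (rule negligible_subset)
  show "negligible (\<Union>T\<in>\<T>. frontier T)" using finite_mesh full_simplex full_simplex.negligible_frontier_T by (intro negligible_Union) auto
  show "\<Omega> - (\<Union>T\<in>\<T>. interior T) \<subseteq> (\<Union>T\<in>\<T>. frontier T)" proof
    fix x assume x: "x \<in> \<Omega> - (\<Union>T\<in>\<T>. interior T)"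
    then obtain T where "T \<in> \<T>" "x \<in> T" using domain_subset by blast
    then show "x \<in> (\<Union>T\<in>\<T>. frontier T)" using x closure_subset[of T] by (auto simp: frontier_def)
  qed
qed

lemma indicator_domain_eq_sum:
  "AE x in lebesgue. (indicator \<Omega> x :: 'b::semiring_1) = (\<Sum>T\<in>\<T>. indicator (interior T) x)" proof -
  have "AE x in lebesgue. x \<notin> \<Omega> - (\<Union>T\<in>\<T>. interior T)" using negligible_skeleton unfolding negligible_iff_null_sets by (rule AE_not_in)
  then show ?thesis proof eventually_elim
    case (elim x)
    show ?case proof (cases "\<exists>T\<in>\<T>. x \<in> interior T")
      case True
      then obtain T where T: "T \<in> \<T>" "x \<in> interior T" by blast
      have "(\<Sum>S\<in>\<T>. indicator (interior S) x :: 'b) = (\<Sum>S\<in>\<T>. if S = T then 1 else 0)" proof (intro sum.cong refl)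
        fix S assume "S \<in> \<T>"
        then show "indicator (interior S) x = (if S = T then 1 else 0 :: 'b)" using interior_unique[OF T(1) _ T(2), of S] T(2) by (cases "S = T") (auto simp: indicator_def)
      qed
      also have "\<dots> = 1" using T(1) finite_mesh by simp
      finally show ?thesis using subsetD[OF interior_subset_domain[OF T(1)] T(2)] by simp
    next
      case False
      then have "x \<notin> \<Omega>" using elim by auto
      then show ?thesis using False by (simp add: indicator_def)
    qed
  qed
qed

lemma AE_domain_iff:
  "(AE x in lebesgue_on \<Omega>. P x) \<longleftrightarrow> (\<forall>T\<in>\<T>. AE x in lebesgue. x \<in> interior T \<longrightarrow> P x)" proof -
  have ae: "AE x in lebesgue. x \<notin> \<Omega> - (\<Union>T\<in>\<T>. interior T)" using negligible_skeleton unfolding negligible_iff_null_sets by (rule AE_not_in)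
  have "(AE x in lebesgue_on \<Omega>. P x) \<longleftrightarrow> (AE x in lebesgue. x \<in> \<Omega> \<longrightarrow> P x)"
    using open_domain by (intro AE_restrict_space_iff) auto
  also have "\<dots> \<longleftrightarrow> (AE x in lebesgue. \<forall>T\<in>\<T>. x \<in> interior T \<longrightarrow> P x)" proof
    assume "AE x in lebesgue. x \<in> \<Omega> \<longrightarrow> P x"
    then show "AE x in lebesgue. \<forall>T\<in>\<T>. x \<in> interior T \<longrightarrow> P x" by eventually_elim (use interior_subset_domain in blast)
  next
    assume "AE x in lebesgue. \<forall>T\<in>\<T>. x \<in> interior T \<longrightarrow> P x"
    with ae show "AE x in lebesgue. x \<in> \<Omega> \<longrightarrow> P x" by eventually_elim blast
  qed
  also have "\<dots> \<longleftrightarrow> (\<forall>T\<in>\<T>. AE x in lebesgue. x \<in> interior T \<longrightarrow> P x)" using finite_mesh by (rule AE_finite_all)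
  finally show ?thesis .
qed

lemma AE_simplex_iff:
  assumes T: "T \<in> \<T>"
  shows "(AE x in lebesgue_on T. P x) \<longleftrightarrow> (AE x in lebesgue. x \<in> interior T \<longrightarrow> P x)" proof -
  interpret full_simplex T by (rule full_simplex[OF T])
  have ae: "AE x in lebesgue. x \<notin> frontier T" using negligible_frontier_T unfolding negligible_iff_null_sets by (rule AE_not_in)
  have "(AE x in lebesgue_on T. P x) \<longleftrightarrow> (AE x in lebesgue. x \<in> T \<longrightarrow> P x)" using measurable_T by (intro AE_restrict_space_iff) auto
  also have "\<dots> \<longleftrightarrow> (AE x in lebesgue. x \<in> interior T \<longrightarrow> P x)" proof
    assume "AE x in lebesgue. x \<in> T \<longrightarrow> P x"
    then show "AE x in lebesgue. x \<in> interior T \<longrightarrow> P x" by eventually_elim (use interior_subset in blast)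
  next
    assume "AE x in lebesgue. x \<in> interior T \<longrightarrow> P x"
    with ae show "AE x in lebesgue. x \<in> T \<longrightarrow> P x" by eventually_elim (use closure_subset[of T] in \<open>auto simp: frontier_def\<close>)
  qed
  finally show ?thesis .
qed

lemma AE_simplex_not_False:
  assumes T: "T \<in> \<T>" and ae: "AE x in lebesgue. x \<in> interior T \<longrightarrow> P x"
  obtains x where "x \<in> interior T" "P x" proof -
  interpret full_simplex T by (rule full_simplex[OF T])
  have "\<exists>x\<in>interior T. P x" proof (rule ccontr)
    assume "\<not> (\<exists>x\<in>interior T. P x)"
    then have "AE x in lebesgue. x \<notin> interior T" using ae by (auto elim: eventually_mono)
    then have "interior T \<in> null_sets lebesgue" by (subst (asm) AE_iff_null_sets[symmetric]) auto
    then have "vol (interior T) = 0" by (simp add: null_sets_def measure_def)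
    then show False using measure_interior measure_pos by simp
  qed
  then show ?thesis using that by blast
qed

lemma integrable_simplex:
  fixes f :: "real^'n \<Rightarrow> 'b::euclidean_space"
  assumes f: "integrable (lebesgue_on \<Omega>) f" and T: "T \<in> \<T>"
  shows "integrable lebesgue (\<lambda>x. indicator (interior T) x *\<^sub>R f x)" proof -
  have "integrable lebesgue (\<lambda>x. indicator \<Omega> x *\<^sub>R f x)" using f open_domain by (subst (asm) integrable_restrict_space) auto
  then have "integrable lebesgue (\<lambda>x. indicator (interior T) x *\<^sub>R (indicator \<Omega> x *\<^sub>R f x))" by (rule integrable_mult_indicator[rotated]) simp
  moreover have "(\<lambda>x. indicator (interior T) x *\<^sub>R (indicator \<Omega> x *\<^sub>R f x)) = (\<lambda>x. indicator (interior T) x *\<^sub>R f x)"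
    using interior_subset_domain[OF T] by (auto simp: indicator_def fun_eq_iff)
  ultimately show ?thesis by simp
qed

lemma integral_domain:
  fixes f :: "real^'n \<Rightarrow> real"
  assumes f: "integrable (lebesgue_on \<Omega>) f"
  shows "(LINT x|lebesgue_on \<Omega>. f x) = (\<Sum>T\<in>\<T>. LINT x|lebesgue. indicator (interior T) x * f x)" proof -
  have i: "integrable lebesgue (\<lambda>x. indicator (interior T) x * f x)" if "T \<in> \<T>" for T using integrable_simplex[OF f that] by simp
  have i\<Omega>: "integrable lebesgue (\<lambda>x. indicator \<Omega> x * f x)" using f open_domain by (subst (asm) integrable_restrict_space) auto
  have "(LINT x|lebesgue_on \<Omega>. f x) = (LINT x|lebesgue. indicator \<Omega> x * f x)" using open_domain by (subst integral_restrict_space) auto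
  also have "\<dots> = (LINT x|lebesgue. (\<Sum>T\<in>\<T>. indicator (interior T) x * f x))" proof (rule integral_cong_AE)
    show "AE x in lebesgue. indicator \<Omega> x * f x = (\<Sum>T\<in>\<T>. indicator (interior T) x * f x)"
      using indicator_domain_eq_sum[where 'b=real] by eventually_elim (simp add: sum_distrib_right)
    show "(\<lambda>x. \<Sum>T\<in>\<T>. indicator (interior T) x * f x) \<in> borel_measurable lebesgue" using i by (intro borel_measurable_sum borel_measurable_integrable)
  qed (use i\<Omega> in auto)
  also have "\<dots> = (\<Sum>T\<in>\<T>. LINT x|lebesgue. indicator (interior T) x * f x)" using i by (rule Bochner_Integration.integral_sum)
  finally show ?thesis .
qed

text \<open>A sum over the open interiors makes measurability immediate; the value 0 on the null set
  of common faces is harmless.\<close>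

definition piecewise :: "((real^'n) set \<Rightarrow> real^'n \<Rightarrow> 'b::real_vector) \<Rightarrow> real^'n \<Rightarrow> 'b" where
  "piecewise V x = (\<Sum>T\<in>\<T>. indicator (interior T) x *\<^sub>R V T x)"

lemma piecewise_eq:
  assumes T: "T \<in> \<T>" "x \<in> interior T"
  shows "piecewise V x = V T x" proof -
  have "piecewise V x = (\<Sum>S\<in>\<T>. if S = T then V T x else 0)" unfolding piecewise_def proof (intro sum.cong refl)
    fix S assume "S \<in> \<T>"
    then show "indicator (interior S) x *\<^sub>R V S x = (if S = T then V T x else 0)"
      using interior_unique[OF T(1) _ T(2), of S] T(2) by (cases "S = T") (auto simp: indicator_def)
  qed
  then show ?thesis using T finite_mesh by simp
qed

lemma borel_measurable_piecewise:
  fixes V :: "(real^'n) set \<Rightarrow> real^'n \<Rightarrow> 'b::euclidean_space"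
  assumes "\<And>T. T \<in> \<T> \<Longrightarrow> V T \<in> borel_measurable lebesgue"
  shows "piecewise V \<in> borel_measurable lebesgue" unfolding piecewise_def[abs_def] by (intro borel_measurable_sum borel_measurable_scaleR borel_measurable_indicator assms) auto

subsection \<open>The mesh distance\<close>

lemma shared_vertex:
  assumes "T \<in> \<T>" "T' \<in> \<T>" "T \<inter> T' \<noteq> {}"
  shows "\<exists>v. v extreme_point_of T \<and> v extreme_point_of T'" proof -
  interpret full_simplex T by (rule full_simplex[OF assms(1)])
  have f: "(T \<inter> T') face_of T" "(T \<inter> T') face_of T'" using face_Int face_Int' assms by blast+
  have "compact (T \<inter> T')" "convex (T \<inter> T')" using f(1) compact_T face_of_imp_compact face_of_imp_convex convex_T by blast+
  then obtain v where "v extreme_point_of (T \<inter> T')" using extreme_point_exists_convex assms(3) by blast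
  then show ?thesis using extreme_point_of_face[OF f(1)] extreme_point_of_face[OF f(2)] by blast
qed

lemma neighborsI:
  assumes "T \<in> \<T>" "T' \<in> \<T>" "T \<noteq> T'" "x \<in> T" "x \<in> T'"
  shows "(T, T') \<in> neighbors \<T>" using shared_vertex[OF assms(1,2)] assms by (auto simp: neighbors_def)

lemma neighbors_sym: "(T, T') \<in> neighbors \<T> \<Longrightarrow> (T', T) \<in> neighbors \<T>" by (auto simp: neighbors_def)

lemma neighbors_mesh: "(T, T') \<in> neighbors \<T> \<Longrightarrow> T \<in> \<T> \<and> T' \<in> \<T>" by (auto simp: neighbors_def)

lemma neighbors_common_point:
  assumes "(T, T') \<in> neighbors \<T>"
  obtains x where "x \<in> T" "x \<in> T'" using assms unfolding neighbors_def extreme_point_of_def by blast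

text \<open>\<open>\<Union>\<T>\<close> is the closure of a connected set. Otherwise the reachable
  and the unreachable simplices would split it into two nonempty closed sets, disjoint because
  simplices with a common point are equal or neighbors. Hence the \<open>LEAST\<close> in
  \<open>delta\<close> is attained.\<close>

lemma mesh_connected:
  assumes S: "S \<in> \<T>" and T: "T \<in> \<T>"
  shows "(S, T) \<in> (neighbors \<T>)\<^sup>*" proof -
  define A where "A = {T\<in>\<T>. (S, T) \<in> (neighbors \<T>)\<^sup>*}"
  have cl: "closed (\<Union>\<B>)" if "\<B> \<subseteq> \<T>" for \<B> proof (rule closed_Union)
    show "finite \<B>" using finite_mesh that finite_subset by blast
    show "\<forall>T\<in>\<B>. closed T" using full_simplex full_simplex.closed_T that by blast
  qed
  have "connected (\<Union>\<T>)" using connected_imp_connected_closure[OF connected_domain] closure_domain by simp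
  moreover have "closed (\<Union>A)" "closed (\<Union>(\<T> - A))" by (rule cl, auto simp: A_def)+
  moreover have "\<Union>\<T> \<subseteq> \<Union>A \<union> \<Union>(\<T> - A)" by (auto simp: A_def)
  moreover have "\<Union>A \<inter> \<Union>(\<T> - A) \<inter> \<Union>\<T> = {}" proof (rule ccontr)
    assume "\<Union>A \<inter> \<Union>(\<T> - A) \<inter> \<Union>\<T> \<noteq> {}"
    then obtain x P Q where x: "P \<in> A" "Q \<in> \<T> - A" "x \<in> P" "x \<in> Q" by auto
    then have "(P, Q) \<in> neighbors \<T>" by (intro neighborsI) (auto simp: A_def)
    then have "(S, Q) \<in> (neighbors \<T>)\<^sup>*" using x(1) rtrancl_into_rtrancl unfolding A_def by fastforce
    then show False using x(2) by (auto simp: A_def)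
  qed
  ultimately have or: "\<Union>A \<inter> \<Union>\<T> = {} \<or> \<Union>(\<T> - A) \<inter> \<Union>\<T> = {}" using connected_closed[of "\<Union>\<T>"] by blast
  have ne: "P \<noteq> {}" if "P \<in> \<T>" for P using full_simplex.interior_nonempty[OF full_simplex[OF that]] interior_subset by blast
  have "S \<in> A" using S by (simp add: A_def)
  then have "S \<subseteq> \<Union>A \<inter> \<Union>\<T>" using S by auto
  then have "\<Union>(\<T> - A) \<inter> \<Union>\<T> = {}" using or ne[OF S] by auto
  then have "T \<in> A" using ne[OF T] T by auto
  then show ?thesis by (simp add: A_def)
qed

abbreviation "\<delta> \<equiv> delta \<T>"

lemma delta_path:
  assumes "S \<in> \<T>" "T \<in> \<T>"
  shows "(S, T) \<in> neighbors \<T> ^^ \<delta> S T" proof -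
  obtain n where "(S, T) \<in> neighbors \<T> ^^ n" using mesh_connected[OF assms] rtrancl_imp_relpow by blast
  then show ?thesis unfolding delta_def by (rule LeastI)
qed

lemma delta_le: "(S, T) \<in> neighbors \<T> ^^ n \<Longrightarrow> \<delta> S T \<le> n" unfolding delta_def by (rule Least_le)

lemma delta_self: "\<delta> T T = 0" using delta_le[of T T 0] by simp

lemma delta_eq_1_iff:
  assumes "S \<in> \<T>" "T \<in> \<T>"
  shows "\<delta> S T = 1 \<longleftrightarrow> (S, T) \<in> neighbors \<T>" proof
  assume "\<delta> S T = 1"
  then show "(S, T) \<in> neighbors \<T>" using delta_path[OF assms] by simp
next
  assume n: "(S, T) \<in> neighbors \<T>"
  then have "\<delta> S T \<le> 1" using delta_le[of S T 1] by simp
  moreover have "\<delta> S T \<noteq> 0" proof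
    assume "\<delta> S T = 0"
    then have "S = T" using delta_path[OF assms] by simp
    then show False using n by (simp add: neighbors_def)
  qed
  ultimately show "\<delta> S T = 1" by simp
qed

lemma delta_neighbor_le:
  assumes "(S, T) \<in> neighbors \<T>" "R \<in> \<T>"
  shows "\<delta> S R \<le> Suc (\<delta> T R)" proof -
  have "(S, R) \<in> neighbors \<T> ^^ Suc (\<delta> T R)" using delta_path[of T R] neighbors_mesh assms relpow_Suc_I2 by metis
  then show ?thesis by (rule delta_le)
qed

lemma delta_sym:
  assumes "S \<in> \<T>" "T \<in> \<T>"
  shows "\<delta> S T = \<delta> T S" proof -
  have *: "(T, S) \<in> neighbors \<T> ^^ n" if "(S, T) \<in> neighbors \<T> ^^ n" for S T n using that proof (induction n arbitrary: T)
    case (Suc n)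
    then obtain R where R: "(S, R) \<in> neighbors \<T> ^^ n" "(R, T) \<in> neighbors \<T>" by auto
    show ?case by (rule relpow_Suc_I2[OF neighbors_sym[OF R(2)] Suc.IH[OF R(1)]])
  qed simp
  show ?thesis using delta_le[OF *[OF delta_path[OF assms]]] delta_le[OF *[OF delta_path[OF assms(2,1)]]] by simp
qed

lemma graded_path:
  fixes f :: "(real^'n) set \<Rightarrow> real"
  assumes f: "\<And>S T. (S, T) \<in> neighbors \<T> \<Longrightarrow> f T \<le> g * f S" and g: "g \<ge> 0"
    and path: "(S, T) \<in> neighbors \<T> ^^ n"
  shows "f T \<le> g ^ n * f S" using path proof (induction n arbitrary: T)
  case (Suc n)
  then obtain R where R: "(S, R) \<in> neighbors \<T> ^^ n" "(R, T) \<in> neighbors \<T>" by auto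
  have "f T \<le> g * f R" by (rule f[OF R(2)])
  also have "\<dots> \<le> g * (g ^ n * f S)" using Suc.IH[OF R(1)] g by (rule mult_left_mono)
  finally show ?case by (simp add: mult_ac)
qed simp

subsection \<open>Weights\<close>

text \<open>Up to the factor given by the grading, this one number represents the weight on the
  simplex; the discrete estimates see nothing else of it.\<close>

definition low :: "(real^'n \<Rightarrow> real) \<Rightarrow> (real^'n) set \<Rightarrow> real" where
  "low \<rho> T = real_of_ereal (ess_inf T \<rho>)"

text \<open>The essential infimum is an extended real at first. It lies below some value of \<rho>,
  and it cannot be minus infinity because \<gamma> times it bounds the essential supremum, which is
  at least some positive value.\<close>

lemma
  assumes w: "weight \<Omega> \<T> \<gamma> \<rho>" and T: "T \<in> \<T>"
  shows weight_ess_inf: "ess_inf T \<rho> = ereal (low \<rho> T)"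
    and weight_low_pos: "low \<rho> T > 0"
    and weight_bounds: "AE x in lebesgue. x \<in> interior T \<longrightarrow> low \<rho> T \<le> \<rho> x \<and> \<rho> x \<le> \<gamma> * low \<rho> T" proof -
  define i where "i = ess_inf T \<rho>"
  define s where "s = ess_sup T \<rho>"
  have \<gamma>: "\<gamma> \<ge> 1" and si: "s \<le> ereal \<gamma> * i" using w T by (auto simp: weight_def i_def s_def)
  have "AE x in lebesgue_on T. ereal (\<rho> x) \<le> s" unfolding s_def ess_sup_def by (rule esssup_AE)
  then have 1: "AE x in lebesgue. x \<in> interior T \<longrightarrow> ereal (\<rho> x) \<le> s" using AE_simplex_iff[OF T] by simp
  have "AE x in lebesgue_on T. ereal (- \<rho> x) \<le> - i" unfolding i_def ess_inf_def ess_sup_def ereal_uminus_uminus by (rule esssup_AE)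
  then have 2: "AE x in lebesgue. x \<in> interior T \<longrightarrow> ereal (- \<rho> x) \<le> - i" using AE_simplex_iff[OF T] by simp
  have 3: "AE x in lebesgue. x \<in> interior T \<longrightarrow> 0 < \<rho> x" using w T AE_domain_iff[of "\<lambda>x. 0 < \<rho> x"] by (auto simp: weight_def)
  have all: "AE x in lebesgue. x \<in> interior T \<longrightarrow> ereal (\<rho> x) \<le> s \<and> i \<le> ereal (\<rho> x) \<and> 0 < \<rho> x" using 1 2 3 proof eventually_elim
    case (elim x)
    show ?case proof
      assume x: "x \<in> interior T"
      have "i \<le> - ereal (- \<rho> x)" using elim x by (metis ereal_uminus_le_reorder ereal_uminus_uminus)
      then show "ereal (\<rho> x) \<le> s \<and> i \<le> ereal (\<rho> x) \<and> 0 < \<rho> x" using elim x by simp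
    qed
  qed
  obtain x where x: "ereal (\<rho> x) \<le> s" "i \<le> ereal (\<rho> x)" "0 < \<rho> x" using AE_simplex_not_False[OF T all] by blast
  have "i \<noteq> \<infinity>" using x(2) by auto
  moreover have "i \<noteq> -\<infinity>" proof
    assume "i = -\<infinity>"
    then have "s \<le> -\<infinity>" using si \<gamma> by simp
    then show False using x(1) by simp
  qed
  ultimately obtain r where r: "i = ereal r" by (cases i) auto
  have low: "low \<rho> T = r" using r by (simp add: low_def i_def[symmetric])
  then show "ess_inf T \<rho> = ereal (low \<rho> T)" using r i_def by simp
  have sr: "s \<le> ereal (\<gamma> * r)" using si r by simp
  then have "ereal (\<rho> x) \<le> ereal (\<gamma> * r)" using x(1) by (rule order_trans[rotated])
  then have "0 < \<gamma> * r" using x(3) by simp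
  then show "low \<rho> T > 0" using \<gamma> low by (simp add: zero_less_mult_iff)
  show "AE x in lebesgue. x \<in> interior T \<longrightarrow> low \<rho> T \<le> \<rho> x \<and> \<rho> x \<le> \<gamma> * low \<rho> T" using all proof eventually_elim
    case (elim y)
    show ?case proof
      assume y: "y \<in> interior T"
      then have "ereal (\<rho> y) \<le> ereal (\<gamma> * r)" using elim sr order_trans by blast
      then show "low \<rho> T \<le> \<rho> y \<and> \<rho> y \<le> \<gamma> * low \<rho> T" using elim y r low by simp
    qed
  qed
qed

definition graded :: "real \<Rightarrow> ((real^'n) set \<Rightarrow> real) \<Rightarrow> bool" where
  "graded g V \<longleftrightarrow> (\<forall>T\<in>\<T>. V T > 0) \<and> (\<forall>S T. (S, T) \<in> neighbors \<T> \<longrightarrow> V T \<le> g * V S)"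

lemma graded_low:
  assumes w: "weight \<Omega> \<T> \<gamma> \<rho>"
  shows "graded \<gamma> (low \<rho>)" unfolding graded_def proof (intro conjI ballI allI impI)
  fix S T assume n: "(S, T) \<in> neighbors \<T>"
  have ST: "S \<in> \<T>" "T \<in> \<T>" using neighbors_mesh[OF n] by auto
  then have "ess_inf T \<rho> \<le> ereal \<gamma> * ess_inf S \<rho>" using w delta_eq_1_iff[OF ST] n by (auto simp: weight_def)
  then show "low \<rho> T \<le> \<gamma> * low \<rho> S" using weight_ess_inf[OF w] ST by simp
qed (rule weight_low_pos[OF w])

lemma finite_measure_domain: "finite_measure (lebesgue_on \<Omega>)" by (intro finite_measure_lebesgue_on lmeasurable_open bounded_domain open_domain)

text \<open>Turns a graded function of simplices into an admissible weight, so that the hypothesis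
  on the worst grading applies to weights constructed in the proof. On each simplex the essential
  bounds coincide.\<close>

lemma weight_piecewise:
  assumes V: "graded g V" and g: "g \<ge> 1"
  shows "weight \<Omega> \<T> g (piecewise (\<lambda>T _. V T))" proof -
  let ?p = "piecewise (\<lambda>T _. V T) :: real^'n \<Rightarrow> real"
  have V0: "V T > 0" if "T \<in> \<T>" for T using V that by (simp add: graded_def)
  have pm: "?p \<in> borel_measurable (lebesgue_on S)" for S by (intro measurable_restrict_space1 borel_measurable_piecewise) simp
  have "esssup (lebesgue_on T) (\<lambda>x. ereal (c * ?p x)) = ereal (c * V T)" if T: "T \<in> \<T>" for T c proof -
    interpret full_simplex T by (rule full_simplex[OF T])
    have "AE x in lebesgue_on T. ereal (c * ?p x) = ereal (c * V T)" unfolding AE_simplex_iff[OF T] by (rule AE_I2) (simp add: piecewise_eq[OF T])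
    then have "esssup (lebesgue_on T) (\<lambda>x. ereal (c * ?p x)) = esssup (lebesgue_on T) (\<lambda>_. ereal (c * V T))" using pm by (intro esssup_AE_cong) auto
    moreover have "emeasure (lebesgue_on T) (space (lebesgue_on T)) \<noteq> 0"
      using measure_pos measurable_T by (auto simp: emeasure_restrict_space measure_def fmeasurableD simp del: emeasure_completion)
    ultimately show ?thesis by (simp add: esssup_const)
  qed
  from this[of _ 1] this[of _ "-1"]
  have ess: "ess_sup T ?p = ereal (V T)" "ess_inf T ?p = ereal (V T)" if "T \<in> \<T>" for T using that by (simp_all add: ess_sup_def ess_inf_def)
  have "\<bar>?p x\<bar> \<le> (\<Sum>T\<in>\<T>. V T)" for x unfolding piecewise_def using V0
    by (intro order_trans[OF sum_abs] sum_mono) (auto simp: indicator_def intro: less_imp_le)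
  then have "integrable (lebesgue_on \<Omega>) ?p" using pm by (intro finite_measure.integrable_const_bound[OF finite_measure_domain, of _ "\<Sum>T\<in>\<T>. V T"] AE_I2) auto
  then have "?p \<in> Lp 1 \<Omega>" using pm by (auto simp: integrable_iff_bounded Lp_def Lp_norm_def Let_def powr_one')
  moreover have "AE x in lebesgue_on \<Omega>. 0 < ?p x" unfolding AE_domain_iff using V0 by (intro ballI AE_I2) (simp add: piecewise_eq)
  ultimately show ?thesis unfolding weight_def using g V V0 delta_eq_1_iff by (auto simp: ess graded_def)
qed

end

text \<open>The polynomial growth of the layers does not affect the ratio test: the quotients tend
  to \<open>1 / s < 1\<close>.\<close>

lemma summable_layers:
  assumes s: "s > (1::real)"
  shows "summable (\<lambda>n. real (n + 1) ^ d / s ^ n)" proof -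
  have "(\<lambda>n. ((1 + 1 / real (Suc n)) ^ d) / s) \<longlonglongrightarrow> (1 + 0) ^ d / s" using s by (intro tendsto_intros LIMSEQ_Suc[OF lim_1_over_n]) simp
  moreover have "(1 + 0) ^ d / s < (1 + 1 / s) / 2" using s by (simp add: field_simps)
  ultimately have "eventually (\<lambda>n. ((1 + 1 / real (Suc n)) ^ d) / s < (1 + 1 / s) / 2) sequentially" by (rule order_tendstoD(2))
  then obtain N where N: "\<And>n. n \<ge> N \<Longrightarrow> ((1 + 1 / real (Suc n)) ^ d) / s \<le> (1 + 1 / s) / 2" unfolding eventually_sequentially by (meson less_imp_le)
  show ?thesis proof (rule summable_ratio_test)
    show "(1 + 1 / s) / 2 < 1" using s by simp
    fix n assume "n \<ge> N"
    have eq: "real (Suc n + 1) ^ d = (1 + 1 / real (Suc n)) ^ d * real (n + 1) ^ d"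
      by (subst power_mult_distrib[symmetric], rule arg_cong[where f="\<lambda>x. x ^ d"]) (simp add: field_simps)
    have "real (Suc n + 1) ^ d / s ^ Suc n = (1 + 1 / real (Suc n)) ^ d / s * (real (n + 1) ^ d / s ^ n)" unfolding eq by simp
    also have "\<dots> \<le> (1 + 1 / s) / 2 * (real (n + 1) ^ d / s ^ n)" using s by (intro mult_right_mono N \<open>n \<ge> N\<close>) simp
    finally show "norm (real (Suc n + 1) ^ d / s ^ Suc n) \<le> (1 + 1 / s) / 2 * norm (real (n + 1) ^ d / s ^ n)" using s by simp
  qed
qed

definition layer_const :: "nat \<Rightarrow> real \<Rightarrow> real" where
  "layer_const d s = (\<Sum>n. real (n + 1) ^ d / s ^ n)"

lemma layer_sum_le: "s > 1 \<Longrightarrow> (\<Sum>n<N. real (n + 1) ^ d / s ^ n) \<le> layer_const d s" unfolding layer_const_def by (intro sum_le_suminf summable_layers) auto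

text \<open>The inequality of Holder with exponents \<open>1 / a\<close> and
  \<open>1 / (1 - a)\<close>: after both sums are normalized to 1, Young's inequality is applied
  termwise.\<close>

lemma holder_sum:
  fixes m x y :: "'i \<Rightarrow> real"
  assumes nn: "\<And>i. i \<in> I \<Longrightarrow> m i \<ge> 0 \<and> x i \<ge> 0 \<and> y i \<ge> 0" and a: "0 \<le> a" "a < 1"
  shows "(\<Sum>i\<in>I. m i * (x i powr a * y i powr (1 - a))) \<le>
    (\<Sum>i\<in>I. m i * x i) powr a * (\<Sum>i\<in>I. m i * y i) powr (1 - a)" proof (cases "finite I")
  case True
  define X where "X = (\<Sum>i\<in>I. m i * x i)"
  define Y where "Y = (\<Sum>i\<in>I. m i * y i)"
  have X: "X \<ge> 0" and Y: "Y \<ge> 0" unfolding X_def Y_def using nn by (auto intro!: sum_nonneg)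
  consider "X = 0" | "Y = 0" | "X > 0" "Y > 0" using X Y by linarith
  then have "(\<Sum>i\<in>I. m i * (x i powr a * y i powr (1 - a))) \<le> X powr a * Y powr (1 - a)" proof cases
    case 1
    \<comment> \<open>Each term has \<open>m i = 0\<close> or \<open>x i = 0\<close>, and
      \<open>0 powr a = 0\<close> holds also for \<open>a = 0\<close>, so the left side
      vanishes.\<close>
    then have "m i * x i = 0" if "i \<in> I" for i using that nn sum_nonneg_eq_0_iff[OF True, of "\<lambda>i. m i * x i"] by (simp add: X_def)
    then have "(\<Sum>i\<in>I. m i * (x i powr a * y i powr (1 - a))) = 0" by (intro sum.neutral ballI) auto
    then show ?thesis by simp
  next
    case 2
    then have "m i * y i = 0" if "i \<in> I" for i using that nn sum_nonneg_eq_0_iff[OF True, of "\<lambda>i. m i * y i"] by (simp add: Y_def)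
    then have "(\<Sum>i\<in>I. m i * (x i powr a * y i powr (1 - a))) = 0" by (intro sum.neutral ballI) auto
    then show ?thesis by simp
  next
    case 3
    have "(\<Sum>i\<in>I. m i * (x i powr a * y i powr (1 - a))) / (X powr a * Y powr (1 - a)) =
      (\<Sum>i\<in>I. m i * ((x i / X) powr a * (y i / Y) powr (1 - a)))" using 3 nn by (simp add: sum_divide_distrib powr_divide)
    also have "\<dots> \<le> (\<Sum>i\<in>I. m i * (a * (x i / X) + (1 - a) * (y i / Y)))" proof (intro sum_mono mult_left_mono)
      fix i assume i: "i \<in> I"
      show "(x i / X) powr a * (y i / Y) powr (1 - a) \<le> a * (x i / X) + (1 - a) * (y i / Y)" proof (cases "x i = 0 \<or> y i = 0")
        case True
        then show ?thesis using nn[OF i] 3 a by auto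
      next
        case False
        then have "x i / X > 0" "y i / Y > 0" using nn[OF i] 3 by auto
        then show ?thesis using a by (intro Youngs_inequality_0) auto
      qed
    qed (use nn in auto)
    also have "\<dots> = (\<Sum>i\<in>I. a / X * (m i * x i) + (1 - a) / Y * (m i * y i))" by (intro sum.cong refl) (simp add: distrib_left mult_ac)
    also have "\<dots> = a / X * X + (1 - a) / Y * Y" unfolding sum.distrib sum_distrib_left[symmetric] X_def[symmetric] Y_def[symmetric] ..
    also have "\<dots> = 1" using 3 by simp
    finally show ?thesis using 3 by (simp only: divide_le_eq_1_pos mult_pos_pos powr_gt_zero)
  qed
  then show ?thesis by (simp add: X_def Y_def)
qed simp

section \<open>Volume growth of the layers around a simplex\<close>

section \<open>Shape regular graded meshes\<close>

locale graded_mesh = triangulated \<Omega> \<T> \<Gamma> for \<Omega> :: "(real^'n) set" and \<T> \<Gamma> +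
  fixes h :: "real^'n \<Rightarrow> real" and M \<gamma> \<sigma> :: real
  assumes mesh_size: "mesh_size_function M \<Omega> \<T> \<gamma> h"
    and shape: "shape_regularity \<T> = \<sigma>"
begin

abbreviation "hT \<equiv> low h"

lemma weight_h: "weight \<Omega> \<T> \<gamma> h" using mesh_size by (simp add: mesh_size_function_def)

lemma \<gamma>_ge_1: "\<gamma> \<ge> 1" using weight_h by (simp add: weight_def)

lemma hT_pos: "T \<in> \<T> \<Longrightarrow> hT T > 0" by (rule weight_low_pos[OF weight_h])

lemma
  assumes T: "T \<in> \<T>"
  shows hT_le: "hT T \<le> M * diameter T" and diameter_le: "diameter T \<le> M * hT T" using mesh_size T weight_ess_inf[OF weight_h T] by (auto simp: mesh_size_function_def)

lemma diameter_pos: "T \<in> \<T> \<Longrightarrow> diameter T > 0"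
  and inradius_pos: "T \<in> \<T> \<Longrightarrow> inradius T > 0"
  and vol_pos: "T \<in> \<T> \<Longrightarrow> vol T > 0" using full_simplex full_simplex.diameter_pos full_simplex.inradius_pos full_simplex.measure_pos by blast+

lemma M_pos: "M > 0" proof -
  obtain T where T: "T \<in> \<T>" using mesh_nonempty by blast
  have "0 < M * hT T" using diameter_le[OF T] diameter_pos[OF T] by linarith
  then show ?thesis using hT_pos[OF T] by (simp add: zero_less_mult_iff)
qed

lemma diameter_le_inradius:
  assumes T: "T \<in> \<T>"
  shows "diameter T \<le> \<sigma> * inradius T" proof -
  have "diameter T / inradius T \<le> \<sigma>" unfolding shape[symmetric] shape_regularity_def using T finite_mesh by (intro Max_ge) auto
  then show ?thesis using inradius_pos[OF T] by (simp add: field_simps)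
qed

lemma \<sigma>_ge_1: "\<sigma> \<ge> 1" proof -
  obtain T where T: "T \<in> \<T>" using mesh_nonempty by blast
  have "inradius T \<le> \<sigma> * inradius T" using diameter_le_inradius[OF T] full_simplex.inradius_le_diameter[OF full_simplex[OF T]] by linarith
  then show ?thesis using inradius_pos[OF T] by simp
qed

text \<open>Grading controls \<open>hT\<close>, not the diameters; the passage between the two at
  either end of the path costs a factor \<open>M\<close> each.\<close>

lemma diameter_path:
  assumes "S \<in> \<T>" "(S, T) \<in> neighbors \<T> ^^ n"
  shows "diameter T \<le> M\<^sup>2 * \<gamma> ^ n * diameter S" proof -
  have T: "T \<in> \<T>" using assms by (cases n) (auto dest: neighbors_mesh)
  have "hT T \<le> \<gamma> ^ n * hT S" using graded_low[OF weight_h] \<gamma>_ge_1 assms(2) by (intro graded_path) (auto simp: graded_def)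
  also have "\<dots> \<le> \<gamma> ^ n * (M * diameter S)" using hT_le[OF assms(1)] \<gamma>_ge_1 by (intro mult_left_mono) auto
  finally have "M * hT T \<le> M * (\<gamma> ^ n * (M * diameter S))" using M_pos by (intro mult_left_mono) auto
  then show ?thesis using diameter_le[OF T] by (simp add: power2_eq_square mult_ac)
qed

lemma vol_ge_diameter:
  assumes T: "T \<in> \<T>"
  shows "vol (cball (0::real^'n) 1) * (diameter T / (2 * \<sigma>)) ^ CARD('n) \<le> vol T" proof -
  have "diameter T / (2 * \<sigma>) \<le> inradius T / 2" using diameter_le_inradius[OF T] \<sigma>_ge_1 by (simp add: field_simps)
  then have "(diameter T / (2 * \<sigma>)) ^ CARD('n) \<le> (inradius T / 2) ^ CARD('n)" using diameter_pos[OF T] \<sigma>_ge_1 by (intro power_mono) auto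
  then show ?thesis using full_simplex.measure_ge_inradius[OF full_simplex[OF T]] by (meson measure_nonneg mult_left_mono order_trans)
qed

lemma vol_ball_le:
  assumes T: "T \<in> \<T>" and r: "0 \<le> r"
  shows "vol (cball (x::real^'n) (r * diameter T)) \<le> (2 * \<sigma> * r) ^ CARD('n) * vol T" proof -
  have "vol (cball x (r * diameter T)) = vol (cball (0::real^'n) 1) * (r * diameter T) ^ CARD('n)"
    using r diameter_pos[OF T] content_cball[of "r * diameter T" x] content_cball[of 1 "0::real^'n"] by simp
  also have "(r * diameter T) ^ CARD('n) = (2 * \<sigma> * r) ^ CARD('n) * (diameter T / (2 * \<sigma>)) ^ CARD('n)"
    using \<sigma>_ge_1 by (simp add: power_mult_distrib[symmetric])
  also have "vol (cball (0::real^'n) 1) * ((2 * \<sigma> * r) ^ CARD('n) * (diameter T / (2 * \<sigma>)) ^ CARD('n)) \<le> (2 * \<sigma> * r) ^ CARD('n) * vol T"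
    using mult_left_mono[OF vol_ge_diameter[OF T], of "(2 * \<sigma> * r) ^ CARD('n)"] \<sigma>_ge_1 r by (simp add: mult_ac)
  finally show ?thesis .
qed

text \<open>In units of the diameter of the first simplex, the radius of a ball containing
  everything within \<open>n\<close> steps: a path has \<open>n + 1\<close> simplices, each of
  diameter at most \<open>M\<^sup>2 * \<gamma> ^ n\<close> in these units.\<close>

definition reach :: "nat \<Rightarrow> real" where
  "reach n = real (n + 1) * M\<^sup>2 * \<gamma> ^ n"

lemma M2_ge_1: "M\<^sup>2 \<ge> 1" proof -
  obtain T where T: "T \<in> \<T>" using mesh_nonempty by blast
  show ?thesis using diameter_path[OF T, of T 0] diameter_pos[OF T] by simp
qed

lemma reach_ge_1: "reach n \<ge> 1" proof -
  have "1 * 1 * 1 \<le> real (n + 1) * M\<^sup>2 * \<gamma> ^ n" using M2_ge_1 \<gamma>_ge_1 by (intro mult_mono) auto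
  then show ?thesis by (simp add: reach_def)
qed

lemma reach_Suc: "reach n + M\<^sup>2 * \<gamma> ^ Suc n \<le> reach (Suc n)" proof -
  have "real (n + 1) * M\<^sup>2 * \<gamma> ^ n \<le> real (n + 1) * M\<^sup>2 * \<gamma> ^ Suc n" using \<gamma>_ge_1 by (intro mult_left_mono power_increasing) auto
  then show ?thesis by (simp add: reach_def algebra_simps)
qed

lemma path_subset_cball:
  assumes S: "S \<in> \<T>" "x \<in> S" and path: "(S, T) \<in> neighbors \<T> ^^ n"
  shows "T \<subseteq> cball x (reach n * diameter S)" using path proof (induction n arbitrary: T)
  case 0
  then have "T \<subseteq> cball x (1 * diameter S)" using diameter_bounded_bound[OF full_simplex.bounded_T[OF full_simplex[OF S(1)]] S(2)] by auto
  also have "\<dots> \<subseteq> cball x (reach 0 * diameter S)" using mult_right_mono[OF reach_ge_1[of 0], of "diameter S"] diameter_pos[OF S(1)] by (intro subset_cball) auto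
  finally show ?case .
next
  case (Suc n)
  then obtain R where R: "(S, R) \<in> neighbors \<T> ^^ n" "(R, T) \<in> neighbors \<T>" by auto
  obtain z where z: "z \<in> R" "z \<in> T" using neighbors_common_point[OF R(2)] by blast
  have T: "T \<in> \<T>" using neighbors_mesh[OF R(2)] by blast
  show ?case proof
    fix y assume y: "y \<in> T"
    have "dist x y \<le> dist x z + dist z y" by (rule dist_triangle)
    also have "dist x z \<le> reach n * diameter S" using Suc.IH[OF R(1)] z by auto
    also have "dist z y \<le> diameter T" using diameter_bounded_bound[OF full_simplex.bounded_T[OF full_simplex[OF T]] z(2) y] .
    also have "diameter T \<le> M\<^sup>2 * \<gamma> ^ Suc n * diameter S" by (rule diameter_path[OF S(1) Suc.prems])
    also have "reach n * diameter S + M\<^sup>2 * \<gamma> ^ Suc n * diameter S \<le> reach (Suc n) * diameter S"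
      using mult_right_mono[OF reach_Suc[of n], of "diameter S"] diameter_pos[OF S(1)] by (simp add: distrib_right)
    finally show "y \<in> cball x (reach (Suc n) * diameter S)" by simp
  qed
qed

definition patch :: "nat \<Rightarrow> (real^'n) set \<Rightarrow> (real^'n) set set" where
  "patch n S = {T\<in>\<T>. \<delta> S T \<le> n}"

lemma finite_patch: "finite (patch n S)" using finite_mesh by (simp add: patch_def)

lemma reach_mono: "m \<le> n \<Longrightarrow> reach m \<le> reach n" unfolding reach_def using \<gamma>_ge_1
  by (intro mult_mono[of "real (m + 1) * M\<^sup>2"] mult_right_mono power_increasing) auto

lemma patch_subset_cball:
  assumes S: "S \<in> \<T>" "x \<in> S" and T: "T \<in> patch n S"
  shows "T \<subseteq> cball x (reach n * diameter S)" proof -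
  have "T \<subseteq> cball x (reach (\<delta> S T) * diameter S)" using T by (intro path_subset_cball[OF S] delta_path S) (auto simp: patch_def)
  also have "\<dots> \<subseteq> cball x (reach n * diameter S)" using T diameter_pos[OF S(1)] by (intro subset_cball mult_right_mono reach_mono) (auto simp: patch_def)
  finally show ?thesis .
qed

text \<open>The interiors are disjoint and lie in one ball, whose volume is compared with that of
  the central simplex by shape regularity.\<close>

lemma vol_patch:
  assumes S: "S \<in> \<T>"
  shows "(\<Sum>T\<in>patch n S. vol T) \<le> (2 * \<sigma> * reach n) ^ CARD('n) * vol S" proof -
  obtain x where x: "x \<in> S" using full_simplex.interior_nonempty[OF full_simplex[OF S]] interior_subset by blast
  have im: "interior T \<in> lmeasurable" if "T \<in> \<T>" for T
    using full_simplex.bounded_T[OF full_simplex[OF that]] by (intro lmeasurable_open) (auto intro: bounded_subset interior_subset)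
  have "(\<Sum>T\<in>patch n S. vol T) = (\<Sum>T\<in>patch n S. vol (interior T))" using full_simplex.measure_interior[OF full_simplex] by (intro sum.cong) (auto simp: patch_def)
  also have "\<dots> = vol (\<Union>T\<in>patch n S. interior T)" proof (rule measure_finite_Union[symmetric])
    show "disjoint_family_on interior (patch n S)" unfolding disjoint_family_on_def using interior_unique by (fastforce simp: patch_def)
    show "emeasure lebesgue (interior T) \<noteq> \<infinity>" if "T \<in> patch n S" for T
      using im[of T] that by (simp add: patch_def fmeasurable_def less_top del: emeasure_completion)
  qed (use finite_patch in auto)
  also have "\<dots> \<le> vol (cball x (reach n * diameter S))" proof (rule measure_mono_fmeasurable)
    show "(\<Union>T\<in>patch n S. interior T) \<subseteq> cball x (reach n * diameter S)" by (rule UN_least) (rule order_trans[OF interior_subset patch_subset_cball[OF S x]])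
    show "(\<Union>T\<in>patch n S. interior T) \<in> sets lebesgue" using finite_patch by (intro sets.finite_UN) auto
  qed (rule lmeasurable_cball)
  also have "\<dots> \<le> (2 * \<sigma> * reach n) ^ CARD('n) * vol S" using reach_ge_1[of n] by (intro vol_ball_le S) auto
  finally show ?thesis .
qed

lemma vol_patch_elem:
  assumes S: "S \<in> \<T>" and T: "T \<in> patch n S"
  shows "vol T \<le> (2 * \<sigma> * reach n) ^ CARD('n) * vol S" proof -
  have "vol T \<le> (\<Sum>T\<in>patch n S. vol T)" using T finite_patch by (intro member_le_sum) auto
  then show ?thesis using vol_patch[OF S, of n] by linarith
qed

lemma patch_sym: "S \<in> \<T> \<Longrightarrow> T \<in> patch n S \<Longrightarrow> S \<in> patch n T" using delta_sym by (auto simp: patch_def)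

text \<open>By symmetry of the distance \<open>vol S\<close> is also bounded by the volume of each
  member, so the bound on the total volume bounds the number of members. The comparison is used
  twice, which gives the square.\<close>

lemma card_patch:
  assumes S: "S \<in> \<T>"
  shows "real (card (patch n S)) \<le> ((2 * \<sigma> * reach n) ^ CARD('n))\<^sup>2" proof -
  let ?c = "(2 * \<sigma> * reach n) ^ CARD('n)"
  have c: "?c > 0" using \<sigma>_ge_1 reach_ge_1[of n] by simp
  have "real (card (patch n S)) * vol S = (\<Sum>T\<in>patch n S. vol S)" by simp
  also have "\<dots> \<le> (\<Sum>T\<in>patch n S. ?c * vol T)" using patch_sym[OF S] by (intro sum_mono vol_patch_elem) (auto simp: patch_def)
  also have "\<dots> \<le> ?c * (?c * vol S)" using vol_patch[OF S, of n] c by (simp add: sum_distrib_left[symmetric])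
  finally show ?thesis using vol_pos[OF S] by (simp add: power2_eq_square)
qed

definition kernel_const :: "real \<Rightarrow> real" where
  "kernel_const s = (2 * \<sigma> * M\<^sup>2) ^ CARD('n) * layer_const CARD('n) s"

text \<open>The layer at distance \<open>n\<close> has volume at most a constant times
  \<open>(n + 1)^d * \<gamma>^(n * d) * vol S\<close>. The kernel cancels the exponential growth,
  and the extra factor \<open>s\<close> makes the polynomial remainder summable. This is where
  \<open>\<gamma>^d\<close> enters the admissible gradings.\<close>

lemma kernel_sum_le:
  assumes S: "S \<in> \<T>" and s: "s > 1"
  shows "(\<Sum>T\<in>\<T>. vol T / (\<gamma> ^ CARD('n) * s) ^ \<delta> S T) \<le> kernel_const s * vol S" proof -
  define N where "N = Suc (Max (\<delta> S ` \<T>))"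
  have "(\<Sum>T\<in>\<T>. vol T / (\<gamma> ^ CARD('n) * s) ^ \<delta> S T) =
    (\<Sum>n<N. \<Sum>T\<in>{T\<in>\<T>. \<delta> S T = n}. vol T / (\<gamma> ^ CARD('n) * s) ^ \<delta> S T)"
    using finite_mesh unfolding N_def by (intro sum.group[symmetric]) (auto simp: less_Suc_eq_le)
  also have "\<dots> \<le> (\<Sum>n<N. (2 * \<sigma> * M\<^sup>2) ^ CARD('n) * (real (n + 1) ^ CARD('n) / s ^ n) * vol S)" proof (rule sum_mono)
    fix n
    have pos: "(\<gamma> ^ CARD('n) * s) ^ n > 0" using \<gamma>_ge_1 s by simp
    have "(\<Sum>T\<in>{T\<in>\<T>. \<delta> S T = n}. vol T / (\<gamma> ^ CARD('n) * s) ^ \<delta> S T) = (\<Sum>T\<in>{T\<in>\<T>. \<delta> S T = n}. vol T) / (\<gamma> ^ CARD('n) * s) ^ n"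
      by (simp add: sum_divide_distrib)
    also have "\<dots> \<le> (\<Sum>T\<in>patch n S. vol T) / (\<gamma> ^ CARD('n) * s) ^ n" using pos finite_patch by (intro divide_right_mono sum_mono2) (auto simp: patch_def)
    also have "\<dots> \<le> (2 * \<sigma> * reach n) ^ CARD('n) * vol S / (\<gamma> ^ CARD('n) * s) ^ n" using pos by (intro divide_right_mono vol_patch S) auto
    also have "\<dots> = (2 * \<sigma> * M\<^sup>2) ^ CARD('n) * (real (n + 1) ^ CARD('n) / s ^ n) * vol S" proof -
      have g: "(\<gamma> ^ n) ^ CARD('n) = (\<gamma> ^ CARD('n)) ^ n" by (simp add: power_mult[symmetric] mult.commute)
      have r: "(2 * \<sigma> * reach n) ^ CARD('n) = (2 * \<sigma> * M\<^sup>2) ^ CARD('n) * real (n + 1) ^ CARD('n) * (\<gamma> ^ CARD('n)) ^ n"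
        unfolding reach_def power_mult_distrib g by (simp only: mult_ac)
      have "\<gamma> \<noteq> 0" using \<gamma>_ge_1 by simp
      then show ?thesis unfolding r power_mult_distrib[of "\<gamma> ^ CARD('n)"] by simp
    qed
    finally show "(\<Sum>T\<in>{T\<in>\<T>. \<delta> S T = n}. vol T / (\<gamma> ^ CARD('n) * s) ^ \<delta> S T)
      \<le> (2 * \<sigma> * M\<^sup>2) ^ CARD('n) * (real (n + 1) ^ CARD('n) / s ^ n) * vol S" .
  qed
  also have "\<dots> = (2 * \<sigma> * M\<^sup>2) ^ CARD('n) * (\<Sum>n<N. real (n + 1) ^ CARD('n) / s ^ n) * vol S" by (simp only: sum_distrib_left sum_distrib_right)
  also have "\<dots> \<le> kernel_const s * vol S" unfolding kernel_const_def using \<sigma>_ge_1 by (intro mult_right_mono mult_left_mono layer_sum_le s) auto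
  finally show ?thesis .
qed

end

lemma enn2real_exponent:
  fixes p :: ennreal
  assumes "p \<ge> 1" "p \<noteq> \<infinity>"
  shows "enn2real p \<ge> 1" "enn2real (1 / p) = 1 / enn2real p" proof -
  obtain r where r: "r \<ge> 0" "p = ennreal r" using assms(2) by (cases p) auto
  then have r1: "r \<ge> 1" using assms(1) by (simp add: ennreal_1[symmetric] del: ennreal_1)
  then show "enn2real p \<ge> 1" using r by simp
  have "1 / p = ennreal (1 / r)" using r r1 divide_ennreal[of 1 r] by simp
  then show "enn2real (1 / p) = 1 / enn2real p" using r by simp
qed

context graded_mesh
begin

subsection \<open>Discrete norms\<close>

text \<open>For nonnegative \<open>b\<close> this is the \<open>L^p\<close> norm of the function
  with value \<open>b T\<close> in the interior of each \<open>T\<close>.\<close>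

definition mesh_norm :: "ennreal \<Rightarrow> ((real^'n) set \<Rightarrow> real) \<Rightarrow> real" where
  "mesh_norm p b = (if p = \<infinity> then Max (b ` \<T>)
     else (\<Sum>T\<in>\<T>. vol T * b T powr enn2real p) powr (1 / enn2real p))"

lemma mesh_norm_nonneg:
  assumes "\<And>T. T \<in> \<T> \<Longrightarrow> b T \<ge> 0"
  shows "mesh_norm p b \<ge> 0" proof (cases "p = \<infinity>")
  case True
  obtain T where "T \<in> \<T>" using mesh_nonempty by blast
  then have "b T \<le> Max (b ` \<T>)" using finite_mesh by (intro Max_ge) auto
  then show ?thesis using True assms[OF \<open>T \<in> \<T>\<close>] by (simp add: mesh_norm_def)
qed (simp add: mesh_norm_def)

lemma mesh_norm_mono:
  assumes p: "p \<ge> 1" and ab: "\<And>T. T \<in> \<T> \<Longrightarrow> 0 \<le> a T \<and> a T \<le> c * b T" "\<And>T. T \<in> \<T> \<Longrightarrow> 0 \<le> b T"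
    and c: "c \<ge> 0"
  shows "mesh_norm p a \<le> c * mesh_norm p b" proof (cases "p = \<infinity>")
  case True
  have "a T \<le> c * Max (b ` \<T>)" if T: "T \<in> \<T>" for T proof -
    have "b T \<le> Max (b ` \<T>)" using finite_mesh T by (intro Max_ge) auto
    then show ?thesis using ab(1)[OF T] c mult_left_mono order_trans by blast
  qed
  then show ?thesis using True finite_mesh mesh_nonempty by (simp add: mesh_norm_def)
next
  case False
  define r where "r = enn2real p"
  have r: "r \<ge> 1" using enn2real_exponent[OF p False] by (simp add: r_def)
  have "(\<Sum>T\<in>\<T>. vol T * a T powr r) \<le> (\<Sum>T\<in>\<T>. vol T * (c * b T) powr r)" using ab r by (intro sum_mono mult_left_mono powr_mono2) auto
  also have "\<dots> = c powr r * (\<Sum>T\<in>\<T>. vol T * b T powr r)" unfolding sum_distrib_left using c ab(2) by (intro sum.cong refl) (simp add: powr_mult mult_ac)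
  finally have "(\<Sum>T\<in>\<T>. vol T * a T powr r) powr (1 / r) \<le> (c powr r * (\<Sum>T\<in>\<T>. vol T * b T powr r)) powr (1 / r)"
    using r by (intro powr_mono2) (auto intro!: sum_nonneg)
  also have "\<dots> = c * (\<Sum>T\<in>\<T>. vol T * b T powr r) powr (1 / r)" using c r by (subst powr_mult) (auto simp: powr_powr powr_one' intro!: sum_nonneg)
  finally show ?thesis using False by (simp add: mesh_norm_def r_def)
qed

text \<open>A crude triangle inequality suffices: one factor 2 comes from bounding a sum by twice
  the maximum, the other from \<open>2 powr (1 / r) \<le> 2\<close>.\<close>

lemma mesh_norm_add:
  assumes p: "p \<ge> 1" and ab: "\<And>T. T \<in> \<T> \<Longrightarrow> 0 \<le> a T" "\<And>T. T \<in> \<T> \<Longrightarrow> 0 \<le> b T"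
  shows "mesh_norm p (\<lambda>T. a T + b T) \<le> 4 * (mesh_norm p a + mesh_norm p b)" proof (cases "p = \<infinity>")
  case True
  have "a T + b T \<le> Max (a ` \<T>) + Max (b ` \<T>)" if T: "T \<in> \<T>" for T using finite_mesh T by (intro add_mono Max_ge) auto
  moreover have "Max (a ` \<T>) \<ge> 0" "Max (b ` \<T>) \<ge> 0" using mesh_norm_nonneg[of a p] mesh_norm_nonneg[of b p] ab True by (auto simp: mesh_norm_def)
  ultimately have "a T + b T \<le> 4 * (Max (a ` \<T>) + Max (b ` \<T>))" if T: "T \<in> \<T>" for T using that by fastforce
  then show ?thesis using True finite_mesh mesh_nonempty by (simp add: mesh_norm_def)
next
  case False
  define r where "r = enn2real p"
  have r: "r \<ge> 1" using enn2real_exponent[OF p False] by (simp add: r_def)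
  define X where "X = (\<Sum>T\<in>\<T>. vol T * a T powr r)"
  define Y where "Y = (\<Sum>T\<in>\<T>. vol T * b T powr r)"
  define Z where "Z = max X Y"
  have XY: "X \<ge> 0" "Y \<ge> 0" unfolding X_def Y_def by (auto intro!: sum_nonneg)
  have "(\<Sum>T\<in>\<T>. vol T * (a T + b T) powr r) \<le> (\<Sum>T\<in>\<T>. vol T * (2 powr r * (a T powr r + b T powr r)))" proof (intro sum_mono mult_left_mono)
    fix T assume T: "T \<in> \<T>"
    have "(a T + b T) powr r \<le> (2 * max (a T) (b T)) powr r" using ab T r by (intro powr_mono2) auto
    also have "\<dots> = 2 powr r * max (a T) (b T) powr r" using ab T by (simp add: powr_mult max_def)
    also have "max (a T) (b T) powr r \<le> a T powr r + b T powr r" by (simp add: max_def)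
    finally show "(a T + b T) powr r \<le> 2 powr r * (a T powr r + b T powr r)" by simp
  qed simp
  also have "\<dots> = 2 powr r * (X + Y)" unfolding X_def Y_def sum.distrib[symmetric] sum_distrib_left by (intro sum.cong refl) (simp add: algebra_simps)
  also have "\<dots> \<le> 2 powr r * (2 * Z)" by (intro mult_left_mono) (auto simp: Z_def)
  finally have "(\<Sum>T\<in>\<T>. vol T * (a T + b T) powr r) powr (1 / r) \<le> (2 powr r * (2 * Z)) powr (1 / r)" using r by (intro powr_mono2) (auto intro!: sum_nonneg)
  also have "\<dots> = 2 * (2 powr (1 / r) * Z powr (1 / r))" using r XY by (simp add: powr_mult powr_powr Z_def)
  also have "\<dots> \<le> 2 * (2 powr 1 * (X powr (1 / r) + Y powr (1 / r)))" using r by (intro mult_left_mono mult_mono powr_mono) (auto simp: Z_def max_def)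
  finally show ?thesis using False by (simp add: mesh_norm_def r_def[symmetric] X_def[symmetric] Y_def[symmetric])
qed

definition patch_const :: "nat \<Rightarrow> real" where
  "patch_const n = (2 * \<sigma> * reach n) ^ CARD('n)"

lemma patch_const_ge_1: "patch_const n \<ge> 1" proof -
  have "1 * 1 \<le> \<sigma> * reach n" using \<sigma>_ge_1 reach_ge_1[of n] by (intro mult_mono) auto
  then show ?thesis unfolding patch_const_def by (intro one_le_power) auto
qed

text \<open>Finite overlap: a patch has at most \<open>patch_const n ^ 2\<close> members, and after
  exchanging the sums the volumes around each \<open>S\<close> add up to at most
  \<open>patch_const n * vol S\<close>.\<close>

lemma mesh_norm_patch_sum:
  assumes p: "p \<ge> 1" and b: "\<And>T. T \<in> \<T> \<Longrightarrow> 0 \<le> b T"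
  shows "mesh_norm p (\<lambda>T. \<Sum>S\<in>patch n T. b S) \<le> (patch_const n) ^ 3 * mesh_norm p b" proof -
  define L where "L = patch_const n"
  define N where "N = L\<^sup>2"
  have L: "L \<ge> 1" unfolding L_def by (rule patch_const_ge_1)
  have N: "N \<ge> 0" by (simp add: N_def)
  have card: "real (card (patch n T)) \<le> N" if "T \<in> \<T>" for T using card_patch[OF that, of n] by (simp add: N_def L_def patch_const_def)
  have patchb: "S \<in> \<T>" if "S \<in> patch n T" for S T using that by (simp add: patch_def)
  have L3: "(patch_const n) ^ 3 = N * L" by (simp add: N_def L_def power2_eq_square power3_eq_cube)
  show ?thesis proof (cases "p = \<infinity>")
    case True
    have "(\<Sum>S\<in>patch n T. b S) \<le> (N * L) * Max (b ` \<T>)" if T: "T \<in> \<T>" for T proof -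
      have M0: "Max (b ` \<T>) \<ge> 0" using mesh_norm_nonneg[of b p] b True by (simp add: mesh_norm_def)
      have "(\<Sum>S\<in>patch n T. b S) \<le> (\<Sum>S\<in>patch n T. Max (b ` \<T>))" using finite_mesh patchb by (intro sum_mono Max_ge) auto
      also have "\<dots> = real (card (patch n T)) * Max (b ` \<T>)" by simp
      also have "\<dots> \<le> N * Max (b ` \<T>)" using card[OF T] M0 by (rule mult_right_mono)
      also have "\<dots> \<le> (N * L) * Max (b ` \<T>)" using mult_left_mono[OF L N] M0 by (intro mult_right_mono) auto
      finally show ?thesis .
    qed
    then show ?thesis unfolding L3 using True finite_mesh mesh_nonempty by (simp add: mesh_norm_def)
  next
    case False
    define r where "r = enn2real p"
    have r: "r \<ge> 1" using enn2real_exponent[OF p False] by (simp add: r_def)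
    define X where "X = (\<Sum>T\<in>\<T>. vol T * b T powr r)"
    have X: "X \<ge> 0" unfolding X_def by (auto intro!: sum_nonneg)
    \<comment> \<open>A sum of at most \<open>N\<close> terms is at most \<open>N\<close> times the
      largest, and the power of the largest is one of the summands on the right.\<close>
    have local: "(\<Sum>S\<in>patch n T. b S) powr r \<le> N powr r * (\<Sum>S\<in>patch n T. b S powr r)" if T: "T \<in> \<T>" for T proof -
      define m where "m = Max (b ` patch n T)"
      have Tp: "T \<in> patch n T" using T by (simp add: patch_def delta_self)
      obtain S where S: "S \<in> patch n T" "b S = m" proof -
        have "m \<in> b ` patch n T" unfolding m_def using finite_patch Tp by (intro Max_in) auto
        then show ?thesis using that by auto
      qed
      have m0: "m \<ge> 0" using S b patchb by metis
      have "(\<Sum>S\<in>patch n T. b S) \<le> (\<Sum>S\<in>patch n T. m)" unfolding m_def using finite_patch by (intro sum_mono Max_ge) auto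
      also have "\<dots> \<le> N * m" using card[OF T] m0 by (simp add: mult_right_mono)
      finally have "(\<Sum>S\<in>patch n T. b S) powr r \<le> (N * m) powr r" using r b patchb by (intro powr_mono2) (auto intro!: sum_nonneg)
      also have "\<dots> = N powr r * b S powr r" using N m0 S by (simp add: powr_mult)
      also have "b S powr r \<le> (\<Sum>S\<in>patch n T. b S powr r)" using S finite_patch by (intro member_le_sum) auto
      finally show ?thesis by (simp add: mult_left_mono)
    qed
    have "(\<Sum>T\<in>\<T>. vol T * (\<Sum>S\<in>patch n T. b S) powr r) \<le> (\<Sum>T\<in>\<T>. vol T * (N powr r * (\<Sum>S\<in>patch n T. b S powr r)))"
      by (intro sum_mono mult_left_mono local) auto
    also have "\<dots> = N powr r * (\<Sum>T\<in>\<T>. \<Sum>S\<in>patch n T. vol T * b S powr r)" by (simp add: sum_distrib_left mult_ac)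
    also have "(\<Sum>T\<in>\<T>. \<Sum>S\<in>patch n T. vol T * b S powr r) = (\<Sum>S\<in>\<T>. \<Sum>T\<in>patch n S. vol T * b S powr r)" proof -
      have "(\<Sum>T\<in>\<T>. \<Sum>S\<in>patch n T. vol T * b S powr r) = (\<Sum>T\<in>\<T>. \<Sum>S\<in>\<T>. if \<delta> T S \<le> n then vol T * b S powr r else 0)"
        unfolding patch_def using finite_mesh by (intro sum.cong refl sum.inter_filter)
      also have "\<dots> = (\<Sum>S\<in>\<T>. \<Sum>T\<in>\<T>. if \<delta> T S \<le> n then vol T * b S powr r else 0)" by (rule sum.swap)
      also have "\<dots> = (\<Sum>S\<in>\<T>. \<Sum>T\<in>\<T>. if \<delta> S T \<le> n then vol T * b S powr r else 0)" by (intro sum.cong refl) (simp add: delta_sym)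
      also have "\<dots> = (\<Sum>S\<in>\<T>. \<Sum>T\<in>patch n S. vol T * b S powr r)" unfolding patch_def using finite_mesh by (intro sum.cong refl sum.inter_filter[symmetric])
      finally show ?thesis .
    qed
    also have "\<dots> \<le> (\<Sum>S\<in>\<T>. (L * vol S) * b S powr r)" unfolding sum_distrib_right[symmetric] L_def patch_const_def
      by (intro sum_mono mult_right_mono vol_patch) auto
    also have "\<dots> = L * X" by (simp add: X_def sum_distrib_left mult_ac)
    finally have le: "(\<Sum>T\<in>\<T>. vol T * (\<Sum>S\<in>patch n T. b S) powr r) \<le> N powr r * (L * X)" by (simp add: mult_left_mono)
    then have "(\<Sum>T\<in>\<T>. vol T * (\<Sum>S\<in>patch n T. b S) powr r) powr (1 / r) \<le> (N powr r * (L * X)) powr (1 / r)"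
      using r by (intro powr_mono2) (auto intro!: sum_nonneg)
    also have "\<dots> = N * (L powr (1 / r) * X powr (1 / r))" using r X L N by (simp add: powr_mult powr_powr)
    also have "\<dots> \<le> N * (L powr 1 * X powr (1 / r))" using r L N by (intro mult_left_mono mult_right_mono powr_mono) auto
    also have "\<dots> = (patch_const n) ^ 3 * X powr (1 / r)" using L L3 by simp
    finally show ?thesis using False by (simp add: mesh_norm_def r_def[symmetric] X_def)
  qed
qed

subsection \<open>Extrapolation\<close>

text \<open>A discrete convolution. The kernel decays fast enough in \<open>\<delta>\<close> to
  preserve total mass up to a constant, yet slowly enough that neighbors differ at most by the
  factor \<open>\<gamma> ^ CARD('n) * s\<close>.\<close>

definition majorant :: "real \<Rightarrow> ((real^'n) set \<Rightarrow> real) \<Rightarrow> (real^'n) set \<Rightarrow> real" where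
  "majorant s w T = (\<Sum>S\<in>\<T>. w S / (\<gamma> ^ CARD('n) * s) ^ \<delta> T S)"

text \<open>The diagonal term gives the lower bound; \<open>\<delta>\<close> changes by at most 1
  between neighbors, which gives the grading; and for the total mass the sums are exchanged and
  \<open>kernel_sum_le\<close> is applied.\<close>

lemma
  assumes s: "s > 1" and w: "\<And>T. T \<in> \<T> \<Longrightarrow> 0 \<le> w T"
  shows majorant_ge: "T \<in> \<T> \<Longrightarrow> w T \<le> majorant s w T"
    and majorant_nonneg: "majorant s w T \<ge> 0"
    and majorant_pos: "S \<in> \<T> \<Longrightarrow> w S > 0 \<Longrightarrow> majorant s w T > 0"
    and majorant_neighbor: "(S, T) \<in> neighbors \<T> \<Longrightarrow> majorant s w T \<le> (\<gamma> ^ CARD('n) * s) * majorant s w S"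
    and sum_majorant_le: "(\<Sum>T\<in>\<T>. vol T * majorant s w T) \<le> kernel_const s * (\<Sum>T\<in>\<T>. vol T * w T)" proof -
  define \<theta> where "\<theta> = \<gamma> ^ CARD('n) * s"
  have "1 * 1 \<le> \<gamma> ^ CARD('n) * s" using \<gamma>_ge_1 s by (intro mult_mono one_le_power) auto
  then have \<theta>: "\<theta> \<ge> 1" by (simp add: \<theta>_def)
  have maj: "majorant s w T = (\<Sum>S\<in>\<T>. w S / \<theta> ^ \<delta> T S)" for T by (simp add: majorant_def \<theta>_def)
  have terms: "0 \<le> w S / \<theta> ^ \<delta> T S" if "S \<in> \<T>" for S T using w[OF that] \<theta> by simp
  show "w T \<le> majorant s w T" if "T \<in> \<T>" proof -
    have "w T / \<theta> ^ \<delta> T T \<le> (\<Sum>S\<in>\<T>. w S / \<theta> ^ \<delta> T S)"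
      using terms that finite_mesh by (intro member_le_sum[of T \<T> "\<lambda>S. w S / \<theta> ^ \<delta> T S"]) auto
    then show ?thesis by (simp add: maj delta_self)
  qed
  show "majorant s w T \<ge> 0" for T unfolding maj by (intro sum_nonneg terms)
  show "majorant s w T > 0" if "S \<in> \<T>" "w S > 0" for S T unfolding maj using terms that finite_mesh \<theta> by (intro sum_pos2[of \<T> S]) auto
  show "majorant s w T \<le> (\<gamma> ^ CARD('n) * s) * majorant s w S" if n: "(S, T) \<in> neighbors \<T>" for S T unfolding \<theta>_def[symmetric] maj sum_distrib_left
  proof (rule sum_mono)
    fix R assume R: "R \<in> \<T>"
    have "\<theta> ^ \<delta> S R \<le> \<theta> ^ Suc (\<delta> T R)" using \<theta> delta_neighbor_le[OF n R] by (intro power_increasing) auto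
    then have "\<theta> ^ \<delta> S R \<le> \<theta> * \<theta> ^ \<delta> T R" by simp
    then have "w R / (\<theta> * \<theta> ^ \<delta> T R) \<le> w R / \<theta> ^ \<delta> S R" using w[OF R] \<theta> by (intro divide_left_mono) auto
    then have "\<theta> * (w R / (\<theta> * \<theta> ^ \<delta> T R)) \<le> \<theta> * (w R / \<theta> ^ \<delta> S R)" using \<theta> by (intro mult_left_mono) auto
    then show "w R / \<theta> ^ \<delta> T R \<le> \<theta> * (w R / \<theta> ^ \<delta> S R)" using \<theta> by simp
  qed
  have "(\<Sum>T\<in>\<T>. vol T * majorant s w T) = (\<Sum>T\<in>\<T>. \<Sum>S\<in>\<T>. vol T * (w S / \<theta> ^ \<delta> T S))" by (simp add: maj sum_distrib_left)
  also have "\<dots> = (\<Sum>S\<in>\<T>. \<Sum>T\<in>\<T>. vol T * (w S / \<theta> ^ \<delta> T S))" by (rule sum.swap)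
  also have "\<dots> = (\<Sum>S\<in>\<T>. w S * (\<Sum>T\<in>\<T>. vol T / (\<gamma> ^ CARD('n) * s) ^ \<delta> S T))"
    by (intro sum.cong refl) (simp add: sum_distrib_left delta_sym \<theta>_def mult_ac)
  also have "\<dots> \<le> (\<Sum>S\<in>\<T>. w S * (kernel_const s * vol S))" using kernel_sum_le[OF _ s] w by (intro sum_mono mult_left_mono) auto
  also have "\<dots> = kernel_const s * (\<Sum>T\<in>\<T>. vol T * w T)" by (simp add: sum_distrib_left mult_ac)
  finally show "(\<Sum>T\<in>\<T>. vol T * majorant s w T) \<le> kernel_const s * (\<Sum>T\<in>\<T>. vol T * w T)" .
qed

lemma kernel_const_pos: "s > 1 \<Longrightarrow> kernel_const s > 0" using \<sigma>_ge_1 M_pos layer_sum_le[of s "CARD('n)" "Suc 0"] by (simp add: kernel_const_def)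

text \<open>The power \<kappa> turns the grading of the majorant into its power with exponent
  \<open>2 * e\<close>; negative \<kappa> is covered because the neighbor relation is symmetric. The
  result is written as a square since the square root of this function becomes a weight. As
  \<open>e \<le> 1 / 2\<close>, the factor \<open>s\<close> is generously estimated.\<close>

lemma graded_powr_majorant:
  assumes s: "s > 1" and w: "\<And>T. T \<in> \<T> \<Longrightarrow> 0 \<le> w T" and S: "S \<in> \<T>" "w S > 0"
    and \<kappa>: "\<bar>\<kappa>\<bar> = 2 * e" "e \<le> 1 / 2"
  shows "graded ((\<gamma> powr (real CARD('n) * e) * s)\<^sup>2) (\<lambda>T. majorant s w T powr \<kappa>)" proof -
  define \<theta> where "\<theta> = \<gamma> ^ CARD('n) * s"
  have pos: "majorant s w T > 0" for T by (rule majorant_pos[where S=S]) (use s w S in auto)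
  have "1 * 1 \<le> \<gamma> ^ CARD('n) * s" using \<gamma>_ge_1 s by (intro mult_mono one_le_power) auto
  then have \<theta>: "\<theta> \<ge> 1" by (simp add: \<theta>_def)
  have e0: "e \<ge> 0" using \<kappa>(1) by (metis abs_ge_zero zero_le_mult_iff zero_less_numeral not_le order.asym)
  have \<theta>\<kappa>: "\<theta> powr \<bar>\<kappa>\<bar> \<le> (\<gamma> powr (real CARD('n) * e) * s)\<^sup>2" proof -
    have "\<theta> powr (2 * e) = (\<gamma> ^ CARD('n)) powr (2 * e) * s powr (2 * e)" using \<gamma>_ge_1 s by (simp add: \<theta>_def powr_mult)
    also have "(\<gamma> ^ CARD('n)) powr (2 * e) = (\<gamma> powr (real CARD('n) * e))\<^sup>2"
      using \<gamma>_ge_1 by (simp add: powr_realpow[symmetric] powr_powr powr_power mult_ac)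
    also have "s powr (2 * e) \<le> s powr 2" using s \<kappa>(2) by (intro powr_mono) auto
    also have "s powr 2 = s\<^sup>2" using s by (simp add: powr_numeral)
    finally show ?thesis using \<kappa>(1) by (simp add: power_mult_distrib mult_left_mono)
  qed
  show ?thesis unfolding graded_def proof (intro conjI ballI allI impI)
    show "majorant s w T powr \<kappa> > 0" for T using pos[of T] by simp
    fix S T assume n: "(S, T) \<in> neighbors \<T>"
    have "majorant s w T powr \<kappa> \<le> \<theta> powr \<bar>\<kappa>\<bar> * majorant s w S powr \<kappa>" proof (cases "\<kappa> \<ge> 0")
      case True
      have "majorant s w T powr \<kappa> \<le> (\<theta> * majorant s w S) powr \<kappa>"
        using majorant_neighbor[OF s w n] pos[of T] True by (intro powr_mono2) (auto simp: \<theta>_def)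
      then show ?thesis using \<theta> pos[of S] True by (simp add: powr_mult)
    next
      case False
      have "majorant s w S \<le> \<theta> * majorant s w T" using majorant_neighbor[OF s w neighbors_sym[OF n]] by (simp add: \<theta>_def)
      then have "(\<theta> * majorant s w T) powr \<kappa> \<le> majorant s w S powr \<kappa>" using pos[of S] False by (intro powr_mono2') auto
      then have "\<theta> powr \<bar>\<kappa>\<bar> * (\<theta> powr \<kappa> * majorant s w T powr \<kappa>) \<le> \<theta> powr \<bar>\<kappa>\<bar> * majorant s w S powr \<kappa>"
        using \<theta> pos[of T] by (intro mult_left_mono) (auto simp: powr_mult)
      moreover have "\<theta> powr \<bar>\<kappa>\<bar> * (\<theta> powr \<kappa> * majorant s w T powr \<kappa>) = majorant s w T powr \<kappa>"
        using \<theta> False by (simp add: mult.assoc[symmetric] powr_add[symmetric])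
      ultimately show ?thesis by simp
    qed
    also have "\<dots> \<le> (\<gamma> powr (real CARD('n) * e) * s)\<^sup>2 * majorant s w S powr \<kappa>" using \<theta>\<kappa> by (intro mult_right_mono) auto
    finally show "majorant s w T powr \<kappa> \<le> (\<gamma> powr (real CARD('n) * e) * s)\<^sup>2 * majorant s w S powr \<kappa>" .
  qed
qed

text \<open>An \<open>L\<^sup>2\<close> bound for all graded weights yields \<open>L\<^sup>p\<close> bounds: for \<open>p > 2\<close> one inserts a graded
  majorant of \<open>a\<^sup>p\<^sup>-\<^sup>2\<close>, for \<open>p < 2\<close> the reciprocal of one of \<open>b\<^sup>2\<^sup>-\<^sup>p\<close>, and for \<open>p = \<infinity>\<close> one of a unit mass.\<close>
lemma extrapolation:
  assumes p: "p \<ge> 1" and s: "s > 1" and ab: "\<And>T. T \<in> \<T> \<Longrightarrow> 0 \<le> a T" "\<And>T. T \<in> \<T> \<Longrightarrow> 0 \<le> b T"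
    and C: "C \<ge> 0" and e: "e = \<bar>1 / 2 - enn2real (1 / p)\<bar>"
    and H: "\<And>V. graded ((\<gamma> powr (real CARD('n) * e) * s)\<^sup>2) V \<Longrightarrow>
      (\<Sum>T\<in>\<T>. vol T * (V T * (a T)\<^sup>2)) \<le> C * (\<Sum>T\<in>\<T>. vol T * (V T * (b T)\<^sup>2))"
  shows "mesh_norm p a \<le> (sqrt C * kernel_const s powr e) * mesh_norm p b" proof -
  define K where "K = kernel_const s"
  have K: "K > 0" unfolding K_def by (rule kernel_const_pos[OF s])
  define g where "g = (\<gamma> powr (real CARD('n) * e) * s)\<^sup>2"
  have "1 * 1 \<le> \<gamma> powr (real CARD('n) * e) * s" using \<gamma>_ge_1 s by (intro mult_mono ge_one_powr_ge_zero) (auto simp: e)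
  then have g1: "g \<ge> 1" unfolding g_def by (intro one_le_power) simp
  have "graded g (\<lambda>_. 1)" using g1 by (simp add: graded_def)
  from H[OF this[unfolded g_def]]
  have H1: "(\<Sum>T\<in>\<T>. vol T * (a T)\<^sup>2) \<le> C * (\<Sum>T\<in>\<T>. vol T * (b T)\<^sup>2)" by simp
  show ?thesis proof (cases "p = \<infinity>")
    case True
    have e2: "e = 1 / 2" using True by (simp add: e)
    define m where "m = Max (b ` \<T>)"
    have m0: "m \<ge> 0" using mesh_norm_nonneg[of b p] ab(2) True by (simp add: mesh_norm_def m_def)
    have bm: "b T \<le> m" if "T \<in> \<T>" for T unfolding m_def using that finite_mesh by (intro Max_ge) auto
    have "a S \<le> sqrt C * sqrt K * m" if S: "S \<in> \<T>" for S proof -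
      \<comment> \<open>The unit mass at \<open>S\<close> has a majorant of total mass at most
        \<open>K * vol S\<close>; keeping only the term of \<open>S\<close> on the left lets
        \<open>vol S\<close> cancel.\<close>
      define w where "w T = (if T = S then 1 else 0 :: real)" for T
      have w: "0 \<le> w T" for T by (simp add: w_def)
      define V where "V = (\<lambda>T. majorant s w T powr 1)"
      have V: "V T = majorant s w T" for T using majorant_nonneg[OF s w] by (simp add: V_def)
      have "graded g V" unfolding V_def g_def by (rule graded_powr_majorant[OF s w S]) (auto simp: w_def e2)
      note HV = H[OF this[unfolded g_def]]
      have "vol S * (a S)\<^sup>2 \<le> vol S * (V S * (a S)\<^sup>2)" proof (rule mult_left_mono)
        have "w S \<le> V S" unfolding V by (rule majorant_ge[OF s w S])
        then have "1 \<le> V S" by (simp add: w_def)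
        then show "(a S)\<^sup>2 \<le> V S * (a S)\<^sup>2" using mult_right_mono[of 1 "V S" "(a S)\<^sup>2"] by simp
      qed simp
      also have "\<dots> \<le> (\<Sum>T\<in>\<T>. vol T * (V T * (a T)\<^sup>2))" using S finite_mesh majorant_nonneg[OF s w]
        by (intro member_le_sum[of S \<T> "\<lambda>T. vol T * (V T * (a T)\<^sup>2)"]) (auto simp: V)
      also have "\<dots> \<le> C * (\<Sum>T\<in>\<T>. vol T * (V T * (b T)\<^sup>2))" by (rule HV)
      also have "\<dots> \<le> C * (\<Sum>T\<in>\<T>. vol T * (V T * m\<^sup>2))"
        using C bm ab(2) majorant_nonneg[OF s w] by (intro mult_left_mono sum_mono power_mono) (auto simp: V)
      also have "(\<Sum>T\<in>\<T>. vol T * (V T * m\<^sup>2)) = (\<Sum>T\<in>\<T>. vol T * majorant s w T) * m\<^sup>2" unfolding V sum_distrib_right by (simp only: mult.assoc)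
      also have "C * ((\<Sum>T\<in>\<T>. vol T * majorant s w T) * m\<^sup>2) \<le> C * (K * (\<Sum>T\<in>\<T>. vol T * w T) * m\<^sup>2)"
        unfolding K_def using C sum_majorant_le[OF s w] by (intro mult_left_mono mult_right_mono) auto
      also have "(\<Sum>T\<in>\<T>. vol T * w T) = vol S" using S finite_mesh by (simp add: w_def if_distrib cong: if_cong)
      finally have "vol S * (a S)\<^sup>2 \<le> vol S * (C * K * m\<^sup>2)" by (simp add: mult_ac)
      then have "(a S)\<^sup>2 \<le> C * K * m\<^sup>2" using vol_pos[OF S] by simp
      then have "sqrt ((a S)\<^sup>2) \<le> sqrt (C * K * m\<^sup>2)" by (rule real_sqrt_le_mono)
      then show ?thesis using ab(1)[OF S] m0 by (simp add: real_sqrt_mult)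
    qed
    then show ?thesis using True finite_mesh mesh_nonempty K by (simp add: mesh_norm_def e2 K_def[symmetric] m_def powr_half_sqrt)
  next
    case False
    define r where "r = enn2real p"
    have r: "r \<ge> 1" and er: "e = \<bar>1 / 2 - 1 / r\<bar>" using enn2real_exponent[OF p False] by (simp_all add: r_def e)
    define A where "A = (\<Sum>T\<in>\<T>. vol T * a T powr r)"
    define B where "B = (\<Sum>T\<in>\<T>. vol T * b T powr r)"
    have A0: "A \<ge> 0" and B0: "B \<ge> 0" unfolding A_def B_def by (auto intro!: sum_nonneg)
    have "A powr (1 / r) \<le> sqrt C * K powr e * B powr (1 / r)" proof -
      consider "r \<ge> 2" | "r < 2" by linarith
      then show ?thesis proof cases
        case 1
        define \<kappa> where "\<kappa> = 1 - 2 / r"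
        have \<kappa>: "0 \<le> \<kappa>" "\<kappa> < 1" "\<kappa> = 2 * e" "1 - \<kappa> = 2 / r" using 1 by (auto simp: \<kappa>_def er abs_if field_simps)
        show ?thesis proof (cases "\<exists>S\<in>\<T>. a S > 0")
          case False
          then have "a T = 0" if "T \<in> \<T>" for T using ab(1)[OF that] that by force
          then have "A = 0" unfolding A_def by (intro sum.neutral) auto
          then show ?thesis using C K B0 by simp
        next
          case True
          then obtain S where S: "S \<in> \<T>" "a S > 0" by blast
          define w where "w T = a T powr r" for T
          have w: "0 \<le> w T" for T by (simp add: w_def)
          define W where "W = majorant s w"
          have W0: "W T \<ge> 0" for T unfolding W_def by (rule majorant_nonneg[OF s w])
          have Ww: "w T \<le> W T" if "T \<in> \<T>" for T unfolding W_def by (rule majorant_ge[OF s w that])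
          have A: "A > 0" proof -
            have "vol S * a S powr r \<le> A" unfolding A_def using S finite_mesh by (intro member_le_sum[of S \<T> "\<lambda>T. vol T * a T powr r"]) auto
            moreover have "vol S * a S powr r > 0" using S vol_pos by simp
            ultimately show ?thesis by linarith
          qed
          have "graded g (\<lambda>T. W T powr \<kappa>)" unfolding g_def W_def by (rule graded_powr_majorant[OF s w S(1)]) (use S \<kappa> in \<open>auto simp: w_def\<close>)
          note HV = H[OF this[unfolded g_def]]
          \<comment> \<open>As \<open>r * \<kappa> = r - 2\<close>, the power
            \<open>a T powr r\<close> is \<open>w T powr \<kappa>\<close> times the square of
            \<open>a T\<close>, and \<open>w\<close> may be replaced by its majorant.\<close>
          have "A \<le> (\<Sum>T\<in>\<T>. vol T * (W T powr \<kappa> * (a T)\<^sup>2))" unfolding A_def proof (intro sum_mono mult_left_mono)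
            fix T assume T: "T \<in> \<T>"
            show "a T powr r \<le> W T powr \<kappa> * (a T)\<^sup>2" proof (cases "a T = 0")
              case False
              then have aT: "a T > 0" using ab(1)[OF T] by simp
              have "a T powr r = a T powr (r * \<kappa>) * a T powr 2" using 1 by (simp add: powr_add[symmetric] \<kappa>_def right_diff_distrib)
              also have "\<dots> = w T powr \<kappa> * (a T)\<^sup>2" using aT by (simp add: w_def powr_powr powr_numeral)
              also have "\<dots> \<le> W T powr \<kappa> * (a T)\<^sup>2" using Ww[OF T] w \<kappa> by (intro mult_right_mono powr_mono2) auto
              finally show ?thesis .
            qed simp
          qed simp
          also have "\<dots> \<le> C * (\<Sum>T\<in>\<T>. vol T * (W T powr \<kappa> * (b T)\<^sup>2))" by (rule HV)
          \<comment> \<open>Since \<open>1 - \<kappa> = 2 / r\<close>, the square of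
            \<open>b T\<close> is a power of \<open>b T powr r\<close>; this prepares the separation
            of majorant and \<open>b\<close> by \<open>holder_sum\<close>.\<close>
          also have "(\<Sum>T\<in>\<T>. vol T * (W T powr \<kappa> * (b T)\<^sup>2)) = (\<Sum>T\<in>\<T>. vol T * (W T powr \<kappa> * (b T powr r) powr (1 - \<kappa>)))"
          proof (intro sum.cong refl)
            fix T assume T: "T \<in> \<T>"
            have "(b T powr r) powr (1 - \<kappa>) = (b T)\<^sup>2" unfolding \<kappa>(4) using 1 ab(2)[OF T] by (cases "b T = 0") (auto simp: powr_powr powr_numeral)
            then show "vol T * (W T powr \<kappa> * (b T)\<^sup>2) = vol T * (W T powr \<kappa> * (b T powr r) powr (1 - \<kappa>))" by simp
          qed
          also have "C * \<dots> \<le> C * ((\<Sum>T\<in>\<T>. vol T * W T) powr \<kappa> * B powr (1 - \<kappa>))"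
            unfolding B_def using C W0 \<kappa> by (intro mult_left_mono holder_sum) auto
          also have "\<dots> \<le> C * ((K * A) powr \<kappa> * B powr (1 - \<kappa>))" using C W0 \<kappa> sum_majorant_le[OF s w] unfolding W_def K_def A_def w_def
            by (intro mult_left_mono mult_right_mono powr_mono2) (auto intro!: sum_nonneg)
          also have "\<dots> = (C * K powr \<kappa> * B powr (1 - \<kappa>)) * A powr \<kappa>" using K A by (simp add: powr_mult)
          \<comment> \<open>\<open>A\<close> occurs on both sides, through the mass of the majorant
            on the right; as \<open>A > 0\<close>, the factor \<open>A powr \<kappa>\<close> can be
            divided out.\<close>
          finally have "A powr 1 \<le> (C * K powr \<kappa> * B powr (1 - \<kappa>)) * A powr \<kappa>" using A by simp
          then have "A powr (1 - \<kappa>) * A powr \<kappa> \<le> (C * K powr \<kappa> * B powr (1 - \<kappa>)) * A powr \<kappa>" by (simp add: powr_add[symmetric])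
          then have "A powr (1 - \<kappa>) \<le> C * K powr \<kappa> * B powr (1 - \<kappa>)" using A by (simp add: mult_le_cancel_right)
          then have "sqrt (A powr (1 - \<kappa>)) \<le> sqrt (C * K powr \<kappa> * B powr (1 - \<kappa>))" by (rule real_sqrt_le_mono)
          moreover have "sqrt (A powr (1 - \<kappa>)) = A powr (1 / r)" "sqrt (B powr (1 - \<kappa>)) = B powr (1 / r)"
            "sqrt (K powr \<kappa>) = K powr e" using A B0 K \<kappa> by (simp_all add: powr_half_sqrt[symmetric] powr_powr)
          ultimately show ?thesis by (simp add: real_sqrt_mult)
        qed
      next
        case 2
        define \<kappa> where "\<kappa> = 1 - 2 / r"
        have \<kappa>: "\<kappa> < 0" "\<bar>\<kappa>\<bar> = 2 * e" "e \<le> 1 / 2" "e = 1 / r - 1 / 2" "\<kappa> * (r / 2) = - (1 - r / 2)"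
          using 2 r by (auto simp: \<kappa>_def er abs_if field_simps)
        show ?thesis proof (cases "\<exists>S\<in>\<T>. b S > 0")
          case False
          \<comment> \<open>If \<open>b\<close> vanishes, its majorant is 0 and has no negative
            power; the constant weight 1 shows that \<open>a\<close> vanishes too.\<close>
          then have b0: "b T = 0" if "T \<in> \<T>" for T using ab(2)[OF that] that by force
          then have "(\<Sum>T\<in>\<T>. vol T * (b T)\<^sup>2) = 0" by (intro sum.neutral) auto
          then have "(\<Sum>T\<in>\<T>. vol T * (a T)\<^sup>2) \<le> 0" using H1 by simp
          then have "(\<Sum>T\<in>\<T>. vol T * (a T)\<^sup>2) = 0" by (intro antisym sum_nonneg) auto
          then have "vol T * (a T)\<^sup>2 = 0" if "T \<in> \<T>" for T using sum_nonneg_eq_0_iff[OF finite_mesh, of "\<lambda>T. vol T * (a T)\<^sup>2"] that by simp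
          then have "a T = 0" if "T \<in> \<T>" for T using that vol_pos[OF that] by force
          then have "A = 0" unfolding A_def by (intro sum.neutral) auto
          then show ?thesis using C K B0 by simp
        next
          case True
          then obtain S where S: "S \<in> \<T>" "b S > 0" by blast
          define w where "w T = b T powr r" for T
          have w: "0 \<le> w T" for T by (simp add: w_def)
          define W where "W = majorant s w"
          have W0: "W T > 0" for T unfolding W_def by (rule majorant_pos[where S=S]) (use s S in \<open>auto simp: w_def\<close>)
          have Ww: "w T \<le> W T" if "T \<in> \<T>" for T unfolding W_def by (rule majorant_ge[OF s w that])
          have "graded g (\<lambda>T. W T powr \<kappa>)" unfolding g_def W_def by (rule graded_powr_majorant[OF s w S(1)]) (use S \<kappa> in \<open>auto simp: w_def\<close>)
          note HV = H[OF this[unfolded g_def]]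
          \<comment> \<open>The weight is inserted artificially: because
            \<open>\<kappa> * (r / 2) = - (1 - r / 2)\<close>, the powers of \<open>W\<close>
            cancel. Then \<open>holder_sum\<close> with exponent \<open>r / 2\<close> yields a
            weighted \<open>L^2\<close> sum.\<close>
          have "A = (\<Sum>T\<in>\<T>. vol T * ((W T powr \<kappa> * (a T)\<^sup>2) powr (r / 2) * W T powr (1 - r / 2)))" unfolding A_def proof (intro sum.cong refl)
            fix T assume T: "T \<in> \<T>"
            have "(W T powr \<kappa> * (a T)\<^sup>2) powr (r / 2) = W T powr (- (1 - r / 2)) * ((a T)\<^sup>2) powr (r / 2)"
              using W0[of T] by (subst powr_mult) (simp_all only: powr_powr \<kappa>(5) powr_ge_zero zero_le_power2)
            also have "((a T)\<^sup>2) powr (r / 2) = a T powr r" proof (cases "a T = 0")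
              case False
              then have "(a T)\<^sup>2 = a T powr 2" using ab(1)[OF T] by (simp add: powr_numeral)
              then show ?thesis by (simp only: powr_powr) simp
            qed simp
            finally have X: "(W T powr \<kappa> * (a T)\<^sup>2) powr (r / 2) = W T powr (- (1 - r / 2)) * a T powr r" .
            have Y: "W T powr (- (1 - r / 2)) * W T powr (1 - r / 2) = 1" using W0[of T] by (simp only: powr_add[symmetric]) simp
            have "W T powr (- (1 - r / 2)) * a T powr r * W T powr (1 - r / 2) =
              a T powr r * (W T powr (- (1 - r / 2)) * W T powr (1 - r / 2))" by (simp only: mult_ac)
            then show "vol T * a T powr r = vol T * ((W T powr \<kappa> * (a T)\<^sup>2) powr (r / 2) * W T powr (1 - r / 2))" unfolding X Y by simp
          qed
          also have "\<dots> \<le> (\<Sum>T\<in>\<T>. vol T * (W T powr \<kappa> * (a T)\<^sup>2)) powr (r / 2) * (\<Sum>T\<in>\<T>. vol T * W T) powr (1 - r / 2)"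
            using W0 r 2 by (intro holder_sum) (auto intro: less_imp_le)
          also have "\<dots> \<le> (C * B) powr (r / 2) * (K * B) powr (1 - r / 2)" proof (intro mult_mono powr_mono2)
            \<comment> \<open>As \<kappa> is negative, a larger \<open>W\<close> only helps, and
              with \<open>w\<close> in place of \<open>W\<close> the exponents add up to
              \<open>r * \<kappa> + 2 = r\<close>.\<close>
            have "(\<Sum>T\<in>\<T>. vol T * (W T powr \<kappa> * (b T)\<^sup>2)) \<le> B" unfolding B_def proof (intro sum_mono mult_left_mono)
              fix T assume T: "T \<in> \<T>"
              show "W T powr \<kappa> * (b T)\<^sup>2 \<le> b T powr r" proof (cases "b T = 0")
                case False
                then have bT: "b T > 0" using ab(2)[OF T] by simp
                have "W T powr \<kappa> * (b T)\<^sup>2 \<le> w T powr \<kappa> * (b T)\<^sup>2"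
                  using Ww[OF T] bT \<kappa> by (intro mult_right_mono powr_mono2') (auto simp: w_def)
                also have "\<dots> = b T powr (r * \<kappa>) * b T powr 2" using bT by (simp add: w_def powr_powr powr_numeral)
                also have "\<dots> = b T powr r" using r by (simp add: powr_add[symmetric] \<kappa>_def right_diff_distrib)
                finally show ?thesis .
              qed simp
            qed simp
            then have "C * (\<Sum>T\<in>\<T>. vol T * (W T powr \<kappa> * (b T)\<^sup>2)) \<le> C * B" using C by (rule mult_left_mono)
            then show "(\<Sum>T\<in>\<T>. vol T * (W T powr \<kappa> * (a T)\<^sup>2)) \<le> C * B" using HV by linarith
            show "(\<Sum>T\<in>\<T>. vol T * W T) \<le> K * B" using sum_majorant_le[OF s, of w] w by (simp add: W_def K_def B_def w_def)
          qed (use r 2 less_imp_le[OF W0] in \<open>auto intro!: sum_nonneg mult_nonneg_nonneg\<close>)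
          also have "\<dots> = C powr (r / 2) * K powr (1 - r / 2) * (B powr (r / 2) * B powr (1 - r / 2))" using C K B0 by (simp add: powr_mult)
          also have "B powr (r / 2) * B powr (1 - r / 2) = B" using B0 by (simp add: powr_add[symmetric])
          finally have "A powr (1 / r) \<le> (C powr (r / 2) * K powr (1 - r / 2) * B) powr (1 / r)" using A0 r by (intro powr_mono2) auto
          also have "\<dots> = C powr (1 / 2) * K powr e * B powr (1 / r)" proof -
            have "(1 - r / 2) * (1 / r) = e" using r by (simp add: \<kappa>(4) field_simps)
            then show ?thesis using C K B0 r by (simp add: powr_mult powr_powr)
          qed
          finally show ?thesis using C by (simp add: powr_half_sqrt)
        qed
      qed
    qed
    then show ?thesis using False by (simp add: mesh_norm_def r_def[symmetric] A_def B_def K_def)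
  qed
qed

end

section \<open>Inverse estimates and the local projection onto polynomials\<close>

section \<open>Polynomials on simplices\<close>

definition sup_norm :: "(real^'n) set \<Rightarrow> (real^'n \<Rightarrow> real) \<Rightarrow> real" where
  "sup_norm T q = (SUP x\<in>T. \<bar>q x\<bar>)"

context full_simplex
begin

lemma T_nonempty: "T \<noteq> {}" using interior_nonempty interior_subset by blast

lemma
  assumes q: "poly_fun K q"
  shows abs_le_sup_norm: "x \<in> T \<Longrightarrow> \<bar>q x\<bar> \<le> sup_norm T q"
    and sup_norm_attained: "\<exists>x\<in>T. sup_norm T q = \<bar>q x\<bar>" proof -
  have c: "continuous_on T (\<lambda>x. \<bar>q x\<bar>)" by (intro continuous_intros smooth_continuous_on smooth_poly_fun[OF q])
  obtain z where z: "z \<in> T" "\<And>y. y \<in> T \<Longrightarrow> \<bar>q y\<bar> \<le> \<bar>q z\<bar>" using continuous_attains_sup[OF compact_T T_nonempty c] by blast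
  have bdd: "bdd_above ((\<lambda>x. \<bar>q x\<bar>) ` T)" using z by (intro bdd_aboveI[of _ "\<bar>q z\<bar>"]) auto
  show "x \<in> T \<Longrightarrow> \<bar>q x\<bar> \<le> sup_norm T q" for x unfolding sup_norm_def by (rule cSUP_upper[OF _ bdd])
  have "sup_norm T q = \<bar>q z\<bar>" unfolding sup_norm_def using z by (intro antisym cSUP_least cSUP_upper bdd T_nonempty) auto
  then show "\<exists>x\<in>T. sup_norm T q = \<bar>q x\<bar>" using z(1) by blast
qed

lemma sup_norm_nonneg: "poly_fun K q \<Longrightarrow> sup_norm T q \<ge> 0" using sup_norm_attained by fastforce

lemma AE_interior_eq: "AE x in lebesgue. indicator T x = (indicator (interior T) x :: real)" proof -
  have "AE x in lebesgue. x \<notin> frontier T" using negligible_frontier_T unfolding negligible_iff_null_sets by (rule AE_not_in)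
  then show ?thesis by eventually_elim (use closure_subset[of T] interior_subset[of T] in \<open>auto simp: frontier_def indicator_def\<close>)
qed

lemma integrable_indicator_interior: "integrable lebesgue (indicator (interior T) :: _ \<Rightarrow> real)" proof -
  have "interior T \<in> lmeasurable" by (intro lmeasurable_open bounded_subset[OF bounded_T interior_subset]) simp
  then show ?thesis by (simp add: fmeasurable_def integrable_indicator_iff del: emeasure_completion)
qed

lemma poly_fun_measurable: "poly_fun K q \<Longrightarrow> q \<in> borel_measurable lebesgue" by (intro continuous_imp_borel_lebesgue smooth_continuous_on smooth_poly_fun)

lemma integrable_poly_times:
  assumes f: "integrable lebesgue (\<lambda>x. indicator (interior T) x * f x)" and q: "poly_fun K q"
  shows "integrable lebesgue (\<lambda>x. indicator (interior T) x * (f x * q x))" proof -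
  have "integrable lebesgue (\<lambda>x. (indicator (interior T) x * f x) * (indicator (interior T) x * q x))" proof (rule integrable_mult_bounded[OF f])
    show "\<bar>indicator (interior T) x * q x\<bar> \<le> sup_norm T q" for x
      using abs_le_sup_norm[OF q, of x] sup_norm_nonneg[OF q] interior_subset[of T] by (auto simp: indicator_def)
  qed (intro borel_measurable_times borel_measurable_indicator poly_fun_measurable[OF q], simp)
  moreover have "(indicator (interior T) x * f x) * (indicator (interior T) x * q x) = indicator (interior T) x * (f x * q x)" for x by (simp add: indicator_def)
  ultimately show ?thesis by simp
qed

lemma integrable_poly:
  assumes q: "poly_fun K q"
  shows "integrable lebesgue (\<lambda>x. indicator (interior T) x * q x)" using integrable_poly_times[OF _ q, of "\<lambda>_. 1"] integrable_indicator_interior by simp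

lemma integral_interior_eq:
  fixes f :: "real^'n \<Rightarrow> real"
  assumes "f \<in> borel_measurable lebesgue"
  shows "(LINT x|lebesgue. indicator T x * f x) = lint T f" proof (rule integral_cong_AE)
  show "AE x in lebesgue. indicator T x * f x = indicator (interior T) x * f x" using AE_interior_eq by eventually_elim simp
  show "(\<lambda>x. indicator T x * f x) \<in> borel_measurable lebesgue" using measurable_T by (intro borel_measurable_times borel_measurable_indicator assms) auto
  show "(\<lambda>x. indicator (interior T) x * f x) \<in> borel_measurable lebesgue" by (intro borel_measurable_times borel_measurable_indicator assms) auto
qed

lemma sup_norm_le_L1:
  assumes q: "poly_fun K q"
  shows "sup_norm T q * vol T \<le> nikolskii CARD('n) K * lint T (\<lambda>x. \<bar>q x\<bar>)" proof -
  obtain x where x: "x \<in> T" "sup_norm T q = \<bar>q x\<bar>" using sup_norm_attained[OF q] by blast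
  show ?thesis using sup_poly_fun_le_average[OF q convex_T compact_T x(1)] integral_interior_eq[of "\<lambda>x. \<bar>q x\<bar>"]
      poly_fun_measurable[OF q] x(2) by simp
qed

text \<open>With \<open>t\<close> the supremum divided by the constant, \<open>2 \<bar>q\<bar> \<le> t + q\<^sup>2 / t\<close> turns the \<open>L\<^sup>1\<close> into an \<open>L\<^sup>2\<close> bound.\<close>
lemma sup_norm_le_L2:
  assumes q: "poly_fun K q"
  shows "(sup_norm T q)\<^sup>2 * vol T \<le> (nikolskii CARD('n) K)\<^sup>2 * lint T (\<lambda>x. q x * q x)" proof (cases "sup_norm T q = 0")
  case True
  have "0 \<le> lint T (\<lambda>x. q x * q x)" by (intro integral_nonneg_AE AE_I2) (simp add: indicator_def)
  then show ?thesis using True by simp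
next
  case False
  define S where "S = sup_norm T q"
  define N where "N = nikolskii CARD('n) K"
  define m where "m = vol T"
  define J where "J = lint T (\<lambda>x. q x * q x)"
  have S: "S > 0" using False sup_norm_nonneg[OF q] by (simp add: S_def)
  have N: "N \<ge> 1" unfolding N_def by (rule nikolskii_ge_1)
  define t where "t = S / N"
  have t: "t > 0" using S N by (simp add: t_def)
  have iq: "integrable lebesgue (\<lambda>x. indicator (interior T) x * \<bar>q x\<bar>)" using integrable_abs[OF integrable_poly[OF q]] by (simp add: abs_mult)
  have iqq: "integrable lebesgue (\<lambda>x. indicator (interior T) x * (q x * q x))" by (rule integrable_poly_times[OF integrable_poly[OF q] q])
  have "lint T (\<lambda>x. \<bar>q x\<bar>) \<le>
    (LINT x|lebesgue. indicator (interior T) x * (t / 2) + indicator (interior T) x * (q x * q x) * (1 / (2 * t)))" proof (rule integral_mono[OF iq])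
    show "integrable lebesgue (\<lambda>x. indicator (interior T) x * (t / 2) + indicator (interior T) x * (q x * q x) * (1 / (2 * t)))"
      by (intro Bochner_Integration.integrable_add integrable_mult_left integrable_indicator_interior iqq)
    fix x
    have "0 \<le> (t - \<bar>q x\<bar>)\<^sup>2" by simp
    then have "2 * t * \<bar>q x\<bar> \<le> t * t + q x * q x" by (simp add: power2_eq_square algebra_simps)
    then have "\<bar>q x\<bar> \<le> t / 2 + q x * q x * (1 / (2 * t))" using t by (simp add: field_simps)
    then show "indicator (interior T) x * \<bar>q x\<bar> \<le> indicator (interior T) x * (t / 2) + indicator (interior T) x * (q x * q x) * (1 / (2 * t))"
      by (simp add: indicator_def)
  qed
  also have "\<dots> = lint T (\<lambda>x. t / 2) + (LINT x|lebesgue. indicator (interior T) x * (q x * q x) * (1 / (2 * t)))"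
    by (intro Bochner_Integration.integral_add integrable_mult_left integrable_indicator_interior iqq)
  also have "lint T (\<lambda>x. t / 2) = m * (t / 2)" using measure_interior by (simp add: m_def)
  also have "(LINT x|lebesgue. indicator (interior T) x * (q x * q x) * (1 / (2 * t))) = J / (2 * t)" unfolding J_def by (subst integral_mult_left_zero) simp
  finally have "S * m \<le> N * (m * (t / 2) + J / (2 * t))" using sup_norm_le_L1[OF q] N unfolding S_def m_def N_def[symmetric] by (meson mult_left_mono order_trans zero_le_one)
  also have "\<dots> = S * m / 2 + N\<^sup>2 * J / (2 * S)" using S N by (simp add: t_def field_simps power2_eq_square)
  finally have "S * m \<le> N\<^sup>2 * J / S" using S by (simp add: field_simps)
  then have "S\<^sup>2 * m \<le> N\<^sup>2 * J" using S by (simp add: field_simps power2_eq_square)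
  then show ?thesis by (simp add: S_def m_def N_def J_def)
qed

lemma lebesgue_on_interior_LINT:
  fixes f :: "real^'n \<Rightarrow> real"
  shows "(LINT x|lebesgue_on (interior T). f x) = lint T f" by (subst integral_restrict_space) auto

text \<open>For the bound, orthogonality is tested with \<open>q\<close> itself: the integral of
  \<open>q x * q x\<close> equals that of \<open>u x * q x\<close>, at most the supremum of
  \<open>q\<close> times the \<open>L^1\<close> norm of \<open>u\<close>. The \<open>L^2\<close>
  inverse estimate turns the left side into the squared supremum, one power of which
  cancels.\<close>

lemma local_projection:
  assumes u: "integrable lebesgue (\<lambda>x. indicator (interior T) x * u x)"
  shows "\<exists>q. poly_fun K q \<and> (\<forall>v. poly_fun K v \<longrightarrow> lint T (\<lambda>x. q x * v x) = lint T (\<lambda>x. u x * v x)) \<and>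
    sup_norm T q * vol T \<le> (nikolskii CARD('n) K)\<^sup>2 * lint T (\<lambda>x. \<bar>u x\<bar>)" proof -
  define N where "N = nikolskii CARD('n) K"
  define m where "m = vol T"
  have m: "m > 0" unfolding m_def by (rule measure_pos)
  have "\<exists>q\<in>Collect (poly_fun K). \<forall>v\<in>Collect (poly_fun K).
    (LINT x|lebesgue_on (interior T). q x * v x) = (LINT x|lebesgue_on (interior T). u x * v x)" proof (rule ex_orthogonal_projection[where A="N\<^sup>2 / m"])
    have "interior T \<in> lmeasurable" by (intro lmeasurable_open bounded_subset[OF bounded_T interior_subset]) simp
    then show "finite_measure (lebesgue_on (interior T))" by (rule finite_measure_lebesgue_on)
    show "Collect (poly_fun K) \<noteq> {}" using poly_fun_const by blast
    show "\<exists>b. \<forall>x\<in>space (lebesgue_on (interior T)). \<bar>f x\<bar> \<le> b" if "f \<in> Collect (poly_fun K)" for f :: "real^'n \<Rightarrow> real"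
      using abs_le_sup_norm[of K f] that interior_subset by (intro exI[of _ "sup_norm T f"]) auto
    show "(f x)\<^sup>2 \<le> N\<^sup>2 / m * (LINT y|lebesgue_on (interior T). f y * f y)"
      if f: "f \<in> Collect (poly_fun K)" and x: "x \<in> space (lebesgue_on (interior T))" for f x proof -
      have pf: "poly_fun K f" using f by simp
      have "x \<in> T" using x interior_subset by auto
      then have "\<bar>f x\<bar> \<le> sup_norm T f" by (rule abs_le_sup_norm[OF pf])
      then have "\<bar>f x\<bar>\<^sup>2 \<le> (sup_norm T f)\<^sup>2" by (rule power_mono) simp
      then have "(f x)\<^sup>2 * m \<le> (sup_norm T f)\<^sup>2 * m" using m by simp
      also have "\<dots> \<le> N\<^sup>2 * (LINT y|lebesgue_on (interior T). f y * f y)" unfolding lebesgue_on_interior_LINT N_def m_def by (rule sup_norm_le_L2[OF pf])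
      finally show ?thesis using m by (simp add: field_simps)
    qed
    show "integrable (lebesgue_on (interior T)) u" using u by (subst integrable_restrict_space) auto
    show "f \<in> borel_measurable (lebesgue_on (interior T))" if "f \<in> Collect (poly_fun K)" for f :: "real^'n \<Rightarrow> real"
      using poly_fun_measurable that by (intro measurable_restrict_space1) auto
  qed (use m in \<open>auto intro: poly_fun_add poly_fun_cmult\<close>)
  then obtain q where q: "poly_fun K q" "\<And>v. poly_fun K v \<Longrightarrow>
    lint T (\<lambda>x. q x * v x) = lint T (\<lambda>x. u x * v x)" unfolding lebesgue_on_interior_LINT by blast
  define S where "S = sup_norm T q"
  have S0: "S \<ge> 0" unfolding S_def by (rule sup_norm_nonneg[OF q(1)])
  have iu: "integrable lebesgue (\<lambda>x. indicator (interior T) x * \<bar>u x\<bar>)" using integrable_abs[OF u] by (simp add: abs_mult)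
  define I where "I = lint T (\<lambda>x. \<bar>u x\<bar>)"
  have I0: "I \<ge> 0" unfolding I_def by (intro integral_nonneg_AE AE_I2) (simp add: indicator_def)
  have "S\<^sup>2 * m \<le> N\<^sup>2 * lint T (\<lambda>x. q x * q x)" unfolding S_def m_def N_def by (rule sup_norm_le_L2[OF q(1)])
  also have "lint T (\<lambda>x. q x * q x) = lint T (\<lambda>x. u x * q x)" by (rule q(2)[OF q(1)])
  also have "\<dots> \<le> (LINT x|lebesgue. indicator (interior T) x * \<bar>u x\<bar> * S)"
  proof (rule integral_mono[OF integrable_poly_times[OF u q(1)] integrable_mult_left[OF iu]])
    fix x
    show "indicator (interior T) x * (u x * q x) \<le> indicator (interior T) x * \<bar>u x\<bar> * S" proof (cases "x \<in> interior T")
      case True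
      then have "\<bar>q x\<bar> \<le> S" unfolding S_def using abs_le_sup_norm[OF q(1)] interior_subset by blast
      then have "\<bar>u x\<bar> * \<bar>q x\<bar> \<le> \<bar>u x\<bar> * S" by (intro mult_left_mono) auto
      then show ?thesis using True abs_ge_self[of "u x * q x"] by (simp add: abs_mult)
    qed simp
  qed
  also have "\<dots> = I * S" by (simp add: I_def)
  finally have "S\<^sup>2 * m \<le> N\<^sup>2 * (I * S)" by (simp add: mult_left_mono)
  then have "S * (S * m) \<le> S * (N\<^sup>2 * I)" by (simp add: power2_eq_square mult_ac)
  then have "S * m \<le> N\<^sup>2 * I" using S0 I0 by (cases "S = 0") auto
  then show ?thesis using q unfolding S_def m_def N_def I_def by blast
qed

lemma norm_grad_le_sup_norm:
  assumes q: "poly_fun K q" and x: "x \<in> T"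
  shows "norm (grad q x) * inradius T \<le> 2 * coeff_bound K * sup_norm T q" proof -
  obtain c where c: "cball c (inradius T / 2) \<subseteq> T" using incircle by blast
  have "norm (grad q x) * (inradius T / 2) \<le> coeff_bound K * sup_norm T q" using abs_le_sup_norm[OF q] inradius_pos by (intro abs_grad_poly_fun_le[OF q convex_T c x]) auto
  then show ?thesis by simp
qed

end

section \<open>Existence, uniqueness and locality of the global projection\<close>

section \<open>The Lagrange space\<close>

context triangulated
begin

definition piece :: "nat \<Rightarrow> (real^'n \<Rightarrow> real) \<Rightarrow> (real^'n) set \<Rightarrow> real^'n \<Rightarrow> real" where
  "piece K v T = (SOME q. poly_fun K q \<and> (\<forall>x\<in>T \<inter> \<Omega>. v x = q x))"

abbreviation "LK K \<equiv> Lagrange_bc K \<Omega> \<T> \<Gamma>"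

lemma
  assumes v: "v \<in> Lagrange K \<Omega> \<T>" and T: "T \<in> \<T>"
  shows poly_fun_piece: "poly_fun K (piece K v T)"
    and piece_eq: "x \<in> T \<Longrightarrow> x \<in> \<Omega> \<Longrightarrow> piece K v T x = v x" proof -
  have "\<exists>q. poly_fun K q \<and> (\<forall>x\<in>T \<inter> \<Omega>. v x = q x)" using v T by (auto simp: Lagrange_def)
  then have *: "poly_fun K (piece K v T) \<and> (\<forall>x\<in>T \<inter> \<Omega>. v x = piece K v T x)" unfolding piece_def by (rule someI_ex)
  then show "poly_fun K (piece K v T)" "x \<in> T \<Longrightarrow> x \<in> \<Omega> \<Longrightarrow> piece K v T x = v x" by auto
qed

lemma piece_eq_interior: "v \<in> Lagrange K \<Omega> \<T> \<Longrightarrow> T \<in> \<T> \<Longrightarrow> x \<in> interior T \<Longrightarrow> piece K v T x = v x"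
  using piece_eq interior_subset interior_subset_domain by blast

lemma LK_Lagrange: "v \<in> LK K \<Longrightarrow> v \<in> Lagrange K \<Omega> \<T>" by (simp add: Lagrange_bc_def)

lemma LK_lincomb: "f \<in> LK K \<Longrightarrow> g \<in> LK K \<Longrightarrow> (\<lambda>x. a * f x + b * g x) \<in> LK K" unfolding Lagrange_bc_def Lagrange_def
proof (clarsimp, intro conjI ballI allI impI)
  assume fg: "\<forall>T\<in>\<T>. \<exists>q. poly_fun K q \<and> (\<forall>x\<in>T \<inter> \<Omega>. f x = q x)" "\<forall>T\<in>\<T>. \<exists>q. poly_fun K q \<and> (\<forall>x\<in>T \<inter> \<Omega>. g x = q x)"
  fix T assume "T \<in> \<T>"
  then obtain q r where "poly_fun K q" "poly_fun K r" "\<forall>x\<in>T \<inter> \<Omega>. f x = q x" "\<forall>x\<in>T \<inter> \<Omega>. g x = r x" using fg by metis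
  then show "\<exists>q. poly_fun K q \<and> (\<forall>x\<in>T \<inter> \<Omega>. a * f x + b * g x = q x)"
    by (intro exI[of _ "\<lambda>x. a * q x + b * r x"]) (auto intro: poly_fun_add poly_fun_cmult)
next
  fix F x assume "\<forall>F\<in>boundary_faces \<Omega> \<T>. F \<subseteq> \<Gamma> \<longrightarrow> (\<forall>x\<in>rel_interior F. (f \<longlongrightarrow> 0) (at x within \<Omega>))"
    "\<forall>F\<in>boundary_faces \<Omega> \<T>. F \<subseteq> \<Gamma> \<longrightarrow> (\<forall>x\<in>rel_interior F. (g \<longlongrightarrow> 0) (at x within \<Omega>))"
    "F \<in> boundary_faces \<Omega> \<T>" "F \<subseteq> \<Gamma>" "x \<in> rel_interior F"
  then show "((\<lambda>x. a * f x + b * g x) \<longlongrightarrow> 0) (at x within \<Omega>)"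
    using tendsto_add[OF tendsto_mult_right_zero tendsto_mult_right_zero, of f "at x within \<Omega>" g a b] by simp
qed (auto intro: continuous_on_add continuous_on_mult_left)

lemma LK_add: "f \<in> LK K \<Longrightarrow> g \<in> LK K \<Longrightarrow> (\<lambda>x. f x + g x) \<in> LK K" using LK_lincomb[of f K g 1 1] by simp

lemma LK_scale: "f \<in> LK K \<Longrightarrow> (\<lambda>x. a * f x) \<in> LK K" using LK_lincomb[of f K f a 0] by simp

lemma LK_diff: "f \<in> LK K \<Longrightarrow> g \<in> LK K \<Longrightarrow> (\<lambda>x. f x - g x) \<in> LK K" using LK_lincomb[of f K g 1 "-1"] by simp

lemma LK_zero: "(\<lambda>x. 0) \<in> LK K" unfolding Lagrange_bc_def Lagrange_def by (auto intro: poly_fun_const)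

lemma LK_measurable:
  assumes "v \<in> LK K"
  shows "v \<in> borel_measurable (lebesgue_on \<Omega>)" using assms open_domain by (intro continuous_imp_measurable_on_sets_lebesgue) (auto simp: Lagrange_bc_def Lagrange_def)

lemma LK_bounded:
  assumes v: "v \<in> LK K"
  shows "\<exists>b. \<forall>x\<in>\<Omega>. \<bar>v x\<bar> \<le> b" proof (intro exI ballI)
  fix x assume x: "x \<in> \<Omega>"
  then obtain T where T: "T \<in> \<T>" "x \<in> T" using domain_subset by blast
  note L = LK_Lagrange[OF v]
  have "\<bar>v x\<bar> = \<bar>piece K v T x\<bar>" using piece_eq[OF L T x] by simp
  also have "\<dots> \<le> sup_norm T (piece K v T)" by (rule full_simplex.abs_le_sup_norm[OF full_simplex[OF T(1)] poly_fun_piece[OF L T(1)] T(2)])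
  also have "\<dots> \<le> (\<Sum>T\<in>\<T>. sup_norm T (piece K v T))" using finite_mesh T(1) full_simplex.sup_norm_nonneg[OF full_simplex poly_fun_piece[OF L]]
    by (intro member_le_sum) auto
  finally show "\<bar>v x\<bar> \<le> (\<Sum>T\<in>\<T>. sup_norm T (piece K v T))" .
qed

lemma integrable_times_LK:
  assumes u: "integrable (lebesgue_on \<Omega>) u" and v: "v \<in> LK K"
  shows "integrable (lebesgue_on \<Omega>) (\<lambda>x. u x * v x)" proof -
  obtain b where "\<forall>x\<in>\<Omega>. \<bar>v x\<bar> \<le> b" using LK_bounded[OF v] by blast
  then show ?thesis by (intro integrable_mult_bounded[OF u LK_measurable[OF v], of b]) auto
qed

lemma integrable_LK: "v \<in> LK K \<Longrightarrow> integrable (lebesgue_on \<Omega>) v"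
  using integrable_times_LK[OF finite_measure.integrable_const[OF finite_measure_domain, of 1]] by simp

text \<open>The bound serves existence and uniqueness of the projection only, so the dependence of
  its constant on the mesh is harmless. Summing over all simplices makes the constant independent of
  the simplex that contains \<open>x\<close>.\<close>

lemma LK_reproducing:
  assumes v: "v \<in> LK K" and x: "x \<in> \<Omega>"
  shows "(v x)\<^sup>2 \<le> (\<Sum>T\<in>\<T>. (nikolskii CARD('n) K)\<^sup>2 / vol T) * pairing \<Omega> v v" proof -
  note L = LK_Lagrange[OF v]
  define N where "N = nikolskii CARD('n) K"
  obtain T where T: "T \<in> \<T>" "x \<in> T" using domain_subset x by blast
  interpret full_simplex T by (rule full_simplex[OF T(1)])
  let ?q = "piece K v T"
  have q: "poly_fun K ?q" by (rule poly_fun_piece[OF L T(1)])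
  have vv: "integrable (lebesgue_on \<Omega>) (\<lambda>x. v x * v x)" by (rule integrable_times_LK[OF integrable_LK[OF v] v])
  have "\<bar>v x\<bar> \<le> sup_norm T ?q" using abs_le_sup_norm[OF q T(2)] piece_eq[OF L T x] by simp
  then have "\<bar>v x\<bar>\<^sup>2 \<le> (sup_norm T ?q)\<^sup>2" by (rule power_mono) simp
  then have "(v x)\<^sup>2 * vol T \<le> (sup_norm T ?q)\<^sup>2 * vol T" by (simp add: mult_right_mono)
  also have "\<dots> \<le> N\<^sup>2 * lint T (\<lambda>y. ?q y * ?q y)" unfolding N_def by (rule sup_norm_le_L2[OF q])
  also have "lint T (\<lambda>y. ?q y * ?q y) = lint T (\<lambda>y. v y * v y)"
    by (intro Bochner_Integration.integral_cong refl) (simp add: indicator_def piece_eq_interior[OF L T(1)])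
  also have "\<dots> \<le> pairing \<Omega> v v" proof -
    have "0 \<le> lint S (\<lambda>y. v y * v y)" for S by (intro integral_nonneg_AE AE_I2) (simp add: indicator_def)
    then show ?thesis unfolding pairing_def integral_domain[OF vv] using finite_mesh T(1) by (intro member_le_sum) auto
  qed
  finally have "(v x)\<^sup>2 * vol T \<le> N\<^sup>2 * pairing \<Omega> v v" by (simp add: mult_left_mono)
  then have "(v x)\<^sup>2 \<le> N\<^sup>2 / vol T * pairing \<Omega> v v" using measure_pos by (simp add: field_simps)
  also have "\<dots> \<le> (\<Sum>T\<in>\<T>. N\<^sup>2 / vol T) * pairing \<Omega> v v" proof (rule mult_right_mono)
    show "N\<^sup>2 / vol T \<le> (\<Sum>T\<in>\<T>. N\<^sup>2 / vol T)" using finite_mesh T(1) by (intro member_le_sum) auto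
    show "0 \<le> pairing \<Omega> v v" unfolding pairing_def by (intro integral_nonneg_AE AE_I2) simp
  qed
  finally show ?thesis by (simp add: N_def)
qed

abbreviation "Q K \<equiv> L2_projection K \<Omega> \<T> \<Gamma>"

lemma
  assumes u: "integrable (lebesgue_on \<Omega>) u"
  shows L2_projection_in: "Q K u \<in> LK K"
    and L2_projection_pairing: "v \<in> LK K \<Longrightarrow> pairing \<Omega> (Q K u) v = pairing \<Omega> u v" proof -
  have "\<exists>w\<in>LK K. \<forall>v\<in>LK K. (LINT x|lebesgue_on \<Omega>. w x * v x) = (LINT x|lebesgue_on \<Omega>. u x * v x)"
  proof (rule ex_orthogonal_projection[OF finite_measure_domain])
    show "(f x)\<^sup>2 \<le> (\<Sum>T\<in>\<T>. (nikolskii CARD('n) K)\<^sup>2 / vol T) * (LINT y|lebesgue_on \<Omega>. f y * f y)"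
      if "f \<in> LK K" "x \<in> space (lebesgue_on \<Omega>)" for f x using LK_reproducing[of f K x] that by (simp add: pairing_def)
    show "LK K \<noteq> {}" using LK_zero by blast
    show "0 \<le> (\<Sum>T\<in>\<T>. (nikolskii CARD('n) K)\<^sup>2 / vol T)" by (intro sum_nonneg) simp
    show "\<exists>b. \<forall>x\<in>space (lebesgue_on \<Omega>). \<bar>f x\<bar> \<le> b" if "f \<in> LK K" for f using LK_bounded[OF that] by simp
  qed (fact LK_add LK_scale LK_measurable u)+
  then have "\<exists>w. w \<in> LK K \<and> (\<forall>v\<in>LK K. pairing \<Omega> w v = pairing \<Omega> u v)" unfolding pairing_def by blast
  then have "Q K u \<in> LK K \<and> (\<forall>v\<in>LK K. pairing \<Omega> (Q K u) v = pairing \<Omega> u v)" unfolding L2_projection_def by (rule someI_ex)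
  then show "Q K u \<in> LK K" "v \<in> LK K \<Longrightarrow> pairing \<Omega> (Q K u) v = pairing \<Omega> u v" by auto
qed

text \<open>The difference of two candidates is orthogonal to itself, and the pointwise bound then
  gives equality at every point of \<Omega>. Outside \<Omega> the choice operator leaves the values
  open.\<close>

lemma L2_projection_unique:
  assumes u: "integrable (lebesgue_on \<Omega>) u" and w: "w \<in> LK K"
    and eq: "\<And>v. v \<in> LK K \<Longrightarrow> pairing \<Omega> w v = pairing \<Omega> u v" and x: "x \<in> \<Omega>"
  shows "Q K u x = w x" proof -
  define z where "z = (\<lambda>x. Q K u x - w x)"
  note Qu = L2_projection_in[OF u, of K]
  have z: "z \<in> LK K" unfolding z_def by (rule LK_diff[OF Qu w])
  have "pairing \<Omega> z z = pairing \<Omega> (Q K u) z - pairing \<Omega> w z" unfolding pairing_def z_def left_diff_distrib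
    using integrable_times_LK[OF integrable_LK[OF Qu] z] integrable_times_LK[OF integrable_LK[OF w] z] by (intro Bochner_Integration.integral_diff) (auto simp: z_def)
  also have "\<dots> = 0" using eq[OF z] L2_projection_pairing[OF u z] by simp
  finally show ?thesis using LK_reproducing[OF z x] by (simp add: z_def)
qed

text \<open>Linearity combined with reproduction of finite element functions, in the form in which
  \<open>v\<close> will be the quasi-interpolant of \<open>u\<close>.\<close>

lemma L2_projection_diff:
  assumes u: "integrable (lebesgue_on \<Omega>) u" and v: "v \<in> LK K" and x: "x \<in> \<Omega>"
  shows "Q K (\<lambda>x. u x - v x) x = Q K u x - v x" proof (rule L2_projection_unique[OF _ _ _ x])
  show "integrable (lebesgue_on \<Omega>) (\<lambda>x. u x - v x)" by (intro Bochner_Integration.integrable_diff u integrable_LK[OF v])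
  note Qu = L2_projection_in[OF u, of K]
  show "(\<lambda>x. Q K u x - v x) \<in> LK K" by (rule LK_diff[OF Qu v])
  fix w assume w: "w \<in> LK K"
  have "pairing \<Omega> (\<lambda>x. Q K u x - v x) w = pairing \<Omega> (Q K u) w - pairing \<Omega> v w" unfolding pairing_def left_diff_distrib
    by (intro Bochner_Integration.integral_diff integrable_times_LK[OF integrable_LK[OF Qu] w] integrable_times_LK[OF integrable_LK[OF v] w])
  also have "pairing \<Omega> (Q K u) w = pairing \<Omega> u w" by (rule L2_projection_pairing[OF u w])
  also have "pairing \<Omega> u w - pairing \<Omega> v w = pairing \<Omega> (\<lambda>x. u x - v x) w" unfolding pairing_def left_diff_distrib
    by (intro Bochner_Integration.integral_diff[symmetric] integrable_times_LK[OF u w] integrable_times_LK[OF integrable_LK[OF v] w])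
  finally show "pairing \<Omega> (\<lambda>x. Q K u x - v x) w = pairing \<Omega> (\<lambda>x. u x - v x) w" .
qed

text \<open>Only the moments of \<open>u\<close> against polynomials on each simplex enter \<open>Q u\<close>.\<close>
lemma ex_piecewise_polynomial_same_projection:
  assumes u: "integrable (lebesgue_on \<Omega>) u"
  obtains q where "\<And>T. T \<in> \<T> \<Longrightarrow> poly_fun K (q T)"
    "\<And>T. T \<in> \<T> \<Longrightarrow> sup_norm T (q T) * vol T \<le>
      (nikolskii CARD('n) K)\<^sup>2 * lint T (\<lambda>x. \<bar>u x\<bar>)"
    "integrable (lebesgue_on \<Omega>) (piecewise q)" "Q K (piecewise q) = Q K u" proof -
  have uT: "integrable lebesgue (\<lambda>x. indicator (interior T) x * u x)" if "T \<in> \<T>" for T using integrable_simplex[OF u that] by simp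
  obtain q where "\<forall>T\<in>\<T>. poly_fun K (q T) \<and> (\<forall>v. poly_fun K v \<longrightarrow> lint T (\<lambda>x. q T x * v x) = lint T (\<lambda>x. u x * v x)) \<and>
    sup_norm T (q T) * vol T \<le> (nikolskii CARD('n) K)\<^sup>2 * lint T (\<lambda>x. \<bar>u x\<bar>)"
    using bchoice[OF ballI[OF full_simplex.local_projection[OF full_simplex uT, of _ K]]] ..
  then have q: "\<And>T. T \<in> \<T> \<Longrightarrow> poly_fun K (q T)"
    "\<And>T v. T \<in> \<T> \<Longrightarrow> poly_fun K v \<Longrightarrow> lint T (\<lambda>x. q T x * v x) = lint T (\<lambda>x. u x * v x)"
    "\<And>T. T \<in> \<T> \<Longrightarrow> sup_norm T (q T) * vol T \<le> (nikolskii CARD('n) K)\<^sup>2 * lint T (\<lambda>x. \<bar>u x\<bar>)" by blast+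
  have pwi: "integrable (lebesgue_on \<Omega>) (piecewise q)" proof -
    have "integrable lebesgue (piecewise q)" unfolding piecewise_def[abs_def]
      using full_simplex.integrable_poly[OF full_simplex q(1)] by (intro Bochner_Integration.integrable_sum) simp
    then show ?thesis using integrable_mult_indicator[of \<Omega> lebesgue "piecewise q"] open_domain by (subst integrable_restrict_space) auto
  qed
  have "pairing \<Omega> (piecewise q) v = pairing \<Omega> u v" if v: "v \<in> LK K" for v proof -
    note L = LK_Lagrange[OF v]
    have "pairing \<Omega> (piecewise q) v = (\<Sum>T\<in>\<T>. LINT x|lebesgue. indicator (interior T) x * (piecewise q x * v x))"
      unfolding pairing_def by (rule integral_domain[OF integrable_times_LK[OF pwi v]])
    also have "\<dots> = (\<Sum>T\<in>\<T>. LINT x|lebesgue. indicator (interior T) x * (q T x * piece K v T x))" proof (intro sum.cong refl Bochner_Integration.integral_cong)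
      fix T x assume T: "T \<in> \<T>"
      show "indicator (interior T) x * (piecewise q x * v x) = indicator (interior T) x * (q T x * piece K v T x)"
        by (cases "x \<in> interior T") (simp_all add: piecewise_eq[OF T] piece_eq_interior[OF L T])
    qed
    also have "\<dots> = (\<Sum>T\<in>\<T>. LINT x|lebesgue. indicator (interior T) x * (u x * piece K v T x))" using q(2) poly_fun_piece[OF L] by (intro sum.cong refl) auto
    also have "\<dots> = (\<Sum>T\<in>\<T>. LINT x|lebesgue. indicator (interior T) x * (u x * v x))" proof (intro sum.cong refl Bochner_Integration.integral_cong)
      fix T x assume T: "T \<in> \<T>"
      show "indicator (interior T) x * (u x * piece K v T x) = indicator (interior T) x * (u x * v x)" by (cases "x \<in> interior T") (simp_all add: piece_eq_interior[OF L T])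
    qed
    also have "\<dots> = pairing \<Omega> u v" unfolding pairing_def by (rule integral_domain[OF integrable_times_LK[OF u v], symmetric])
    finally show ?thesis .
  qed
  \<comment> \<open>The right hand sides of the defining equations coincide, hence the predicates
    under \<open>SOME\<close> are equal and so are the chosen functions, even outside
    \<Omega>.\<close>
  then have "Q K (piecewise q) = Q K u" unfolding L2_projection_def by (intro arg_cong[of _ _ Eps]) (auto simp: fun_eq_iff)
  from that[OF q(1) q(3) pwi this] show ?thesis .
qed

end

section \<open>Lebesgue norms and discrete norms\<close>

lemma Lp_norm_eq_integral:
  assumes "p \<noteq> \<infinity>" "integrable (lebesgue_on S) (\<lambda>x. norm (f x) powr enn2real p)"
  shows "Lp_norm p S f = ennreal ((LINT x|lebesgue_on S. norm (f x) powr enn2real p) powr (1 / enn2real p))" using assms by (simp add: Lp_norm_def Let_def nn_integral_eq_integral)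

lemma Lp_integrable_powr:
  fixes f :: "real^'n \<Rightarrow> 'b::euclidean_space"
  assumes "p \<noteq> \<infinity>" "f \<in> Lp p S"
  shows "integrable (lebesgue_on S) (\<lambda>x. norm (f x) powr enn2real p)" proof (rule integrableI_nonneg)
  have "f \<in> borel_measurable (lebesgue_on S)" using assms(2) by (simp add: Lp_def)
  then show "(\<lambda>x. norm (f x) powr enn2real p) \<in> borel_measurable (lebesgue_on S)" by measurable
qed (use assms in \<open>auto simp: Lp_def Lp_norm_def Let_def less_top[symmetric] split: if_splits\<close>)

lemma Lp_infinity_AE:
  assumes "f \<in> Lp \<infinity> S"
  shows "AE x in lebesgue_on S. norm (f x) \<le> enn2real (Lp_norm \<infinity> S f)" proof -
  have "AE x in lebesgue_on S. ennreal (norm (f x)) \<le> Lp_norm \<infinity> S f" unfolding Lp_norm_def by (simp add: esssup_AE)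
  then show ?thesis by eventually_elim (use assms in \<open>auto simp: Lp_def dest: enn2real_mono\<close>)
qed

context graded_mesh
begin

lemma Lp_norm_le_mesh_norm:
  fixes f :: "real^'n \<Rightarrow> 'b::euclidean_space"
  assumes p: "p \<ge> 1" and f: "f \<in> borel_measurable (lebesgue_on \<Omega>)"
    and b: "\<And>T. T \<in> \<T> \<Longrightarrow> 0 \<le> b T"
    and fb: "\<And>T. T \<in> \<T> \<Longrightarrow> AE x in lebesgue. x \<in> interior T \<longrightarrow> norm (f x) \<le> b T"
  shows "Lp_norm p \<Omega> f \<le> ennreal (mesh_norm p b)" proof -
  define m where "m = Max (b ` \<T>)"
  have ae: "AE x in lebesgue_on \<Omega>. norm (f x) \<le> m" unfolding AE_domain_iff proof
    fix T assume T: "T \<in> \<T>"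
    have "b T \<le> m" unfolding m_def using finite_mesh T by (intro Max_ge) auto
    then show "AE x in lebesgue. x \<in> interior T \<longrightarrow> norm (f x) \<le> m" using fb[OF T] by (auto elim!: eventually_mono)
  qed
  show ?thesis proof (cases "p = \<infinity>")
    case True
    have "esssup (lebesgue_on \<Omega>) (\<lambda>x. ennreal (norm (f x))) \<le> ennreal m" proof (rule esssup_I)
      show "AE x in lebesgue_on \<Omega>. ennreal (norm (f x)) \<le> ennreal m" using ae by eventually_elim (rule ennreal_leI)
    qed (use f in measurable)
    then show ?thesis using True by (simp add: Lp_norm_def mesh_norm_def m_def)
  next
    case False
    define r where "r = enn2real p"
    have r: "r \<ge> 1" using enn2real_exponent[OF p False] by (simp add: r_def)
    have i: "integrable (lebesgue_on \<Omega>) (\<lambda>x. norm (f x) powr r)" proof (rule finite_measure.integrable_const_bound[OF finite_measure_domain])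
      show "AE x in lebesgue_on \<Omega>. norm (norm (f x) powr r) \<le> m powr r" using ae by eventually_elim (use r in \<open>simp add: powr_mono2\<close>)
    qed (use f in measurable)
    have "(LINT x|lebesgue_on \<Omega>. norm (f x) powr r) = (\<Sum>T\<in>\<T>. LINT x|lebesgue. indicator (interior T) x * norm (f x) powr r)" by (rule integral_domain[OF i])
    also have "\<dots> \<le> (\<Sum>T\<in>\<T>. vol T * b T powr r)" proof (rule sum_mono)
      fix T assume T: "T \<in> \<T>"
      interpret full_simplex T by (rule full_simplex[OF T])
      have "(LINT x|lebesgue. indicator (interior T) x * norm (f x) powr r) \<le> (LINT x|lebesgue. indicator (interior T) x * b T powr r)"
      proof (rule integral_mono_AE[OF _ integrable_mult_left[OF integrable_indicator_interior]])
        show "AE x in lebesgue. indicator (interior T) x * norm (f x) powr r \<le> indicator (interior T) x * b T powr r"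
          using fb[OF T] by eventually_elim (use r in \<open>auto simp: indicator_def intro!: powr_mono2\<close>)
      qed (use integrable_simplex[OF i T] in simp)
      then show "(LINT x|lebesgue. indicator (interior T) x * norm (f x) powr r) \<le> vol T * b T powr r" using measure_interior by simp
    qed
    finally have "(LINT x|lebesgue_on \<Omega>. norm (f x) powr r) powr (1 / r) \<le> (\<Sum>T\<in>\<T>. vol T * b T powr r) powr (1 / r)"
      using r by (intro powr_mono2) (auto intro!: integral_nonneg_AE)
    then show ?thesis using False Lp_norm_eq_integral[OF False i[unfolded r_def]] by (simp add: mesh_norm_def r_def ennreal_leI)
  qed
qed

lemma Lp_integrable:
  fixes f :: "real^'n \<Rightarrow> 'b::euclidean_space"
  assumes p: "p \<ge> 1" and f: "f \<in> Lp p \<Omega>"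
  shows "integrable (lebesgue_on \<Omega>) f" proof -
  have fm: "f \<in> borel_measurable (lebesgue_on \<Omega>)" using f by (simp add: Lp_def)
  interpret finite_measure "lebesgue_on \<Omega>" by (rule finite_measure_domain)
  show ?thesis proof (cases "p = \<infinity>")
    case True
    show ?thesis by (rule integrable_const_bound[OF Lp_infinity_AE[OF f[unfolded True]] fm])
  next
    case False
    define r where "r = enn2real p"
    have r: "r \<ge> 1" using enn2real_exponent[OF p False] by (simp add: r_def)
    have "integrable (lebesgue_on \<Omega>) (\<lambda>x. 1 + norm (f x) powr r)" using Lp_integrable_powr[OF False f] by (simp add: r_def)
    then show ?thesis proof (rule Bochner_Integration.integrable_bound[OF _ fm AE_I2])
      fix x
      have "norm (f x) powr 1 \<le> norm (f x) powr r" if "1 \<le> norm (f x)" using that r by (intro powr_mono) auto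
      then show "norm (f x) \<le> norm (1 + norm (f x) powr r)" by (cases "norm (f x) \<le> 1") (auto simp: add_increasing2)
    qed
  qed
qed

text \<open>Jensen's inequality for a power, obtained from Young's inequality for
  \<open>\<phi> x\<close> and \<open>m powr (r - 1)\<close>, where \<open>m\<close> is the average:
  the conjugate power of the latter is \<open>m powr r\<close>, and integration leaves the
  claim.\<close>

lemma average_powr_le:
  assumes r: "r \<ge> 1" and T: "T \<in> \<T>" and \<phi>: "\<And>x. \<phi> x \<ge> 0"
    and i: "integrable lebesgue (\<lambda>x. indicator (interior T) x * \<phi> x)"
    and ir: "integrable lebesgue (\<lambda>x. indicator (interior T) x * \<phi> x powr r)"
  shows "vol T * (lint T \<phi> / vol T) powr r \<le> (LINT x|lebesgue. indicator (interior T) x * \<phi> x powr r)" proof -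
  interpret full_simplex T by (rule full_simplex[OF T])
  define m where "m = lint T \<phi> / vol T"
  have I: "lint T \<phi> = m * vol T" using measure_pos by (simp add: m_def)
  have I0: "lint T \<phi> \<ge> 0" by (intro integral_nonneg_AE AE_I2) (simp add: \<phi>)
  have m0: "m \<ge> 0" using I0 by (simp add: m_def)
  show ?thesis proof (cases "r = 1")
    case True
    then show ?thesis using I m0 \<phi> by (simp add: m_def[symmetric] mult.commute)
  next
    case False
    then have r1: "r > 1" using r by simp
    define q where "q = r / (r - 1)"
    have q: "q > 1" "1 / r + 1 / q = 1" "(r - 1) * q = r" using r1 by (auto simp: q_def field_simps)
    have pt: "\<phi> x * m powr (r - 1) \<le> \<phi> x powr r * (1 / r) + m powr r * (1 / q)" for x using Youngs_inequality[OF r1 q(1) q(2) \<phi>[of x], of "m powr (r - 1)"]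
      by (simp add: powr_powr q(3))
    have "(LINT x|lebesgue. indicator (interior T) x * \<phi> x * m powr (r - 1)) \<le>
      (LINT x|lebesgue. indicator (interior T) x * \<phi> x powr r * (1 / r) + indicator (interior T) x * (m powr r * (1 / q)))"
      using pt by (intro integral_mono Bochner_Integration.integrable_add integrable_mult_left i ir integrable_indicator_interior)
        (auto simp: indicator_def)
    also have "\<dots> = (LINT x|lebesgue. indicator (interior T) x * \<phi> x powr r * (1 / r)) + lint T (\<lambda>x. m powr r * (1 / q))"
      by (intro Bochner_Integration.integral_add integrable_mult_left ir integrable_indicator_interior)
    also have "lint T (\<lambda>x. m powr r * (1 / q)) = vol T * (m powr r * (1 / q))" using measure_interior by simp
    also have "(LINT x|lebesgue. indicator (interior T) x * \<phi> x powr r * (1 / r)) = (LINT x|lebesgue. indicator (interior T) x * \<phi> x powr r) * (1 / r)"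
      by (rule integral_mult_left_zero)
    also have "(LINT x|lebesgue. indicator (interior T) x * \<phi> x * m powr (r - 1)) = m * vol T * m powr (r - 1)" by (subst integral_mult_left_zero) (simp add: I)
    also have "m * vol T * m powr (r - 1) = vol T * m powr r" using m0 by (cases "m = 0") (auto simp: powr_diff)
    finally have "vol T * m powr r * (1 - 1 / q) \<le> (LINT x|lebesgue. indicator (interior T) x * \<phi> x powr r) * (1 / r)" by (simp add: algebra_simps)
    moreover have "1 - 1 / q = 1 / r" using q(2) by simp
    ultimately show ?thesis using r1 unfolding m_def[symmetric] by (simp add: divide_le_cancel)
  qed
qed

lemma mesh_norm_average_le:
  fixes f :: "real^'n \<Rightarrow> 'b::euclidean_space"
  assumes p: "p \<ge> 1" and f: "f \<in> Lp p \<Omega>"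
  shows "ennreal (mesh_norm p (\<lambda>T. lint T (\<lambda>x. norm (f x)) / vol T)) \<le> Lp_norm p \<Omega> f" proof -
  have fi: "integrable (lebesgue_on \<Omega>) (\<lambda>x. norm (f x))" by (rule integrable_norm[OF Lp_integrable[OF p f]])
  have fT: "integrable lebesgue (\<lambda>x. indicator (interior T) x * norm (f x))" if "T \<in> \<T>" for T using integrable_simplex[OF fi that] by simp
  show ?thesis proof (cases "p = \<infinity>")
    case True
    define B where "B = enn2real (Lp_norm p \<Omega> f)"
    have B: "Lp_norm p \<Omega> f = ennreal B" using f by (simp add: B_def Lp_def)
    have ae: "AE x in lebesgue_on \<Omega>. norm (f x) \<le> B" unfolding B_def True by (rule Lp_infinity_AE[OF f[unfolded True]])
    have "lint T (\<lambda>x. norm (f x)) / vol T \<le> B" if T: "T \<in> \<T>" for T proof -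
      interpret full_simplex T by (rule full_simplex[OF T])
      have "lint T (\<lambda>x. norm (f x)) \<le> (LINT x|lebesgue. indicator (interior T) x * B)"
      proof (rule integral_mono_AE[OF fT[OF T] integrable_mult_left[OF integrable_indicator_interior]])
        have "AE x in lebesgue. x \<in> interior T \<longrightarrow> norm (f x) \<le> B" by (rule bspec[OF ae[unfolded AE_domain_iff] T])
        then show "AE x in lebesgue. indicator (interior T) x * norm (f x) \<le> indicator (interior T) x * B" by eventually_elim (simp add: indicator_def)
      qed
      also have "\<dots> = vol T * B" using measure_interior by simp
      finally show ?thesis using measure_pos by (simp add: field_simps)
    qed
    then have "Max ((\<lambda>T. lint T (\<lambda>x. norm (f x)) / vol T) ` \<T>) \<le> B" using finite_mesh mesh_nonempty by simp
    then show ?thesis unfolding B using True by (simp add: mesh_norm_def ennreal_leI)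
  next
    case False
    define r where "r = enn2real p"
    have r: "r \<ge> 1" using enn2real_exponent[OF p False] by (simp add: r_def)
    have fr: "integrable (lebesgue_on \<Omega>) (\<lambda>x. norm (f x) powr r)" unfolding r_def by (rule Lp_integrable_powr[OF False f])
    have "(\<Sum>T\<in>\<T>. vol T * (lint T (\<lambda>x. norm (f x)) / vol T) powr r) \<le>
      (\<Sum>T\<in>\<T>. LINT x|lebesgue. indicator (interior T) x * norm (f x) powr r)" using integrable_simplex[OF fr] by (intro sum_mono average_powr_le r fT) auto
    also have "\<dots> = (LINT x|lebesgue_on \<Omega>. norm (f x) powr r)" by (rule integral_domain[OF fr, symmetric])
    finally have "(\<Sum>T\<in>\<T>. vol T * (lint T (\<lambda>x. norm (f x)) / vol T) powr r) powr (1 / r) \<le>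
      (LINT x|lebesgue_on \<Omega>. norm (f x) powr r) powr (1 / r)" using r by (intro powr_mono2) (auto intro!: sum_nonneg)
    then show ?thesis using False Lp_norm_eq_integral[OF False fr[unfolded r_def]] by (simp add: mesh_norm_def r_def ennreal_leI)
  qed
qed

lemma mesh_norm_weighted_average_le:
  fixes f :: "real^'n \<Rightarrow> 'b::euclidean_space"
  assumes p: "p \<ge> 1" and \<rho>: "weight \<Omega> \<T> \<gamma>' \<rho>" and f: "integrable (lebesgue_on \<Omega>) f"
    and \<rho>f: "(\<lambda>x. \<rho> x *\<^sub>R f x) \<in> Lp p \<Omega>"
  shows "ennreal (mesh_norm p (\<lambda>T. low \<rho> T * (lint T (\<lambda>x. norm (f x)) / vol T))) \<le>
    Lp_norm p \<Omega> (\<lambda>x. \<rho> x *\<^sub>R f x)" proof -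
  let ?A = "\<lambda>T. low \<rho> T * (lint T (\<lambda>x. norm (f x)) / vol T)"
  let ?B = "\<lambda>T. lint T (\<lambda>x. norm (\<rho> x *\<^sub>R f x)) / vol T"
  have \<rho>fi: "integrable (lebesgue_on \<Omega>) (\<lambda>x. \<rho> x *\<^sub>R f x)" by (rule Lp_integrable[OF p \<rho>f])
  have AB: "0 \<le> ?A T \<and> ?A T \<le> 1 * ?B T" if T: "T \<in> \<T>" for T proof -
    have low: "low \<rho> T > 0" by (rule weight_low_pos[OF \<rho> T])
    have I0: "0 \<le> lint T (\<lambda>x. norm (f x))" by (intro integral_nonneg_AE AE_I2) simp
    have "(LINT x|lebesgue. low \<rho> T * (indicator (interior T) x * norm (f x))) \<le> lint T (\<lambda>x. norm (\<rho> x *\<^sub>R f x))" proof (rule integral_mono_AE)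
      show "integrable lebesgue (\<lambda>x. low \<rho> T * (indicator (interior T) x * norm (f x)))" using integrable_simplex[OF integrable_norm[OF f] T] by simp
      show "integrable lebesgue (\<lambda>x. indicator (interior T) x * norm (\<rho> x *\<^sub>R f x))" using integrable_simplex[OF integrable_norm[OF \<rho>fi] T] by simp
      show "AE x in lebesgue. low \<rho> T * (indicator (interior T) x * norm (f x)) \<le> indicator (interior T) x * norm (\<rho> x *\<^sub>R f x)"
        using weight_bounds[OF \<rho> T] proof eventually_elim
        case (elim x)
        show ?case proof (cases "x \<in> interior T")
          case True
          then have "low \<rho> T * norm (f x) \<le> \<bar>\<rho> x\<bar> * norm (f x)" using elim by (intro mult_right_mono) auto
          then show ?thesis using True by simp
        qed simp
      qed
    qed
    then show ?thesis using I0 low vol_pos[OF T] by (simp add: divide_right_mono)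
  qed
  have "mesh_norm p ?A \<le> 1 * mesh_norm p ?B" by (rule mesh_norm_mono[OF p AB]) (auto intro!: divide_nonneg_nonneg integral_nonneg_AE AE_I2)
  then have "ennreal (mesh_norm p ?A) \<le> ennreal (mesh_norm p ?B)" by (simp add: ennreal_leI)
  also have "\<dots> \<le> Lp_norm p \<Omega> (\<lambda>x. \<rho> x *\<^sub>R f x)" by (rule mesh_norm_average_le[OF p \<rho>f])
  finally show ?thesis .
qed

lemma Lp_norm_weight_le:
  fixes f :: "real^'n \<Rightarrow> 'b::euclidean_space"
  assumes p: "p \<ge> 1" and \<rho>: "weight \<Omega> \<T> \<gamma>' \<rho>" and f: "f \<in> borel_measurable (lebesgue_on \<Omega>)"
    and fB: "\<And>T. T \<in> \<T> \<Longrightarrow> AE x in lebesgue. x \<in> interior T \<longrightarrow> norm (f x) \<le> B T"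
    and B: "\<And>T. T \<in> \<T> \<Longrightarrow> 0 \<le> B T"
  shows "Lp_norm p \<Omega> (\<lambda>x. \<rho> x *\<^sub>R f x) \<le> ennreal (\<gamma>' * mesh_norm p (\<lambda>T. low \<rho> T * B T))" proof -
  have low: "low \<rho> T > 0" if "T \<in> \<T>" for T by (rule weight_low_pos[OF \<rho> that])
  have \<rho>m: "\<rho> \<in> borel_measurable (lebesgue_on \<Omega>)" and \<gamma>': "\<gamma>' \<ge> 1" using \<rho> by (auto simp: weight_def Lp_def)
  have "Lp_norm p \<Omega> (\<lambda>x. \<rho> x *\<^sub>R f x) \<le> ennreal (mesh_norm p (\<lambda>T. \<gamma>' * (low \<rho> T * B T)))" proof (rule Lp_norm_le_mesh_norm[OF p])
    fix T assume T: "T \<in> \<T>"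
    show "AE x in lebesgue. x \<in> interior T \<longrightarrow> norm (\<rho> x *\<^sub>R f x) \<le> \<gamma>' * (low \<rho> T * B T)" using weight_bounds[OF \<rho> T] fB[OF T]
    proof eventually_elim
      case (elim x)
      then show ?case using mult_mono[of "\<bar>\<rho> x\<bar>" "\<gamma>' * low \<rho> T" "norm (f x)" "B T"] low[OF T] B[OF T] by auto
    qed
  qed (use f \<rho>m \<gamma>' less_imp_le[OF low] B in auto)
  also have "\<dots> \<le> ennreal (\<gamma>' * mesh_norm p (\<lambda>T. low \<rho> T * B T))"
    using \<gamma>' less_imp_le[OF low] B by (intro ennreal_leI mesh_norm_mono[OF p]) auto
  finally show ?thesis .
qed

section \<open>Stability of the projection in discrete norms\<close>

lemma mesh_norm_2_sq:
  assumes "\<And>T. T \<in> \<T> \<Longrightarrow> 0 \<le> b T"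
  shows "(mesh_norm 2 b)\<^sup>2 = (\<Sum>T\<in>\<T>. vol T * (b T)\<^sup>2)" proof -
  have "(\<Sum>T\<in>\<T>. vol T * b T powr 2) = (\<Sum>T\<in>\<T>. vol T * (b T)\<^sup>2)" using assms by (intro sum.cong refl) (auto simp: powr_numeral)
  then show ?thesis by (simp add: mesh_norm_def powr_half_sqrt sum_nonneg)
qed

text \<open>One factor \<open>nikolskii\<close> comes from the \<open>L^1\<close> bound for the
  supremum of the projection, two from the local projection; the power of
  \<open>kernel_const\<close> is the loss in the extrapolation. The maximum with 0 is there because
  \<open>C\<close> may take any sign.\<close>

definition projection_const :: "(real \<Rightarrow> real) \<Rightarrow> nat \<Rightarrow> real \<Rightarrow> real \<Rightarrow> real \<Rightarrow> real" where
  "projection_const C K \<gamma>' s e = (let g = \<gamma> powr (real CARD('n) * e) * s in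
     nikolskii CARD('n) K ^ 3 * max 0 (C (\<gamma>' * g)) * kernel_const s powr e)"

text \<open>For every \<open>V\<close> of grading \<open>g\<^sup>2\<close> the function
  \<open>U T * sqrt (V T)\<close> has grading \<open>\<gamma>' * g\<close>, which is below
  \<open>\<gamma>max\<close>, so the \<open>L^2\<close> hypothesis applies to it. Extrapolation over
  all such \<open>V\<close>, with \<open>U\<close> absorbed into the two sequences, gives the bound
  for \<open>p\<close>.\<close>

lemma projection_mesh_norm_le:
  assumes p: "p \<ge> 1" and U: "graded \<gamma>' U" "\<gamma>' \<ge> 1" and wg: "worst_grading C K \<Omega> \<T> \<Gamma> \<gamma>max"
    and s: "s > 1" and e: "e = \<bar>1 / 2 - enn2real (1 / p)\<bar>"
    and less: "\<gamma>' * (\<gamma> powr (real CARD('n) * e) * s) < \<gamma>max"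
    and u: "integrable (lebesgue_on \<Omega>) u"
  shows "mesh_norm p (\<lambda>T. U T * sup_norm T (piece K (Q K u) T)) \<le>
    projection_const C K \<gamma>' s e * mesh_norm p (\<lambda>T. U T * (lint T (\<lambda>x. \<bar>u x\<bar>) / vol T))" proof -
  define g where "g = \<gamma> powr (real CARD('n) * e) * s"
  have "1 * 1 \<le> \<gamma> powr (real CARD('n) * e) * s" using \<gamma>_ge_1 s by (intro mult_mono ge_one_powr_ge_zero) (auto simp: e)
  then have g: "g \<ge> 1" by (simp add: g_def)
  \<comment> \<open>\<open>u\<close> is merely integrable, while the hypothesis concerns square
    integrable functions; the piecewise polynomial with the same projection is bounded.\<close>
  obtain q where q0: "\<And>T. T \<in> \<T> \<Longrightarrow> poly_fun K (q T)"
    "\<And>T. T \<in> \<T> \<Longrightarrow> sup_norm T (q T) * vol T \<le> (nikolskii CARD('n) K)\<^sup>2 * lint T (\<lambda>x. \<bar>u x\<bar>)"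
    "integrable (lebesgue_on \<Omega>) (piecewise q)" "Q K (piecewise q) = Q K u" by (rule ex_piecewise_polynomial_same_projection[OF u, of K]) (rule that)
  define N where "N = nikolskii CARD('n) K"
  note q = q0[folded N_def]
  have N: "N \<ge> 1" unfolding N_def by (rule nikolskii_ge_1)
  define c where "c = max 0 (C (\<gamma>' * g))"
  have c: "c \<ge> 0" by (simp add: c_def)
  define w where "w = piecewise q"
  define z where "z = Q K u"
  have zLK: "z \<in> LK K" unfolding z_def by (rule L2_projection_in[OF u])
  note zL = LK_Lagrange[OF zLK]
  let ?sz = "\<lambda>T. sup_norm T (piece K z T)" and ?sq = "\<lambda>T. sup_norm T (q T)"
  have U0: "U T > 0" if "T \<in> \<T>" for T using U(1) that by (simp add: graded_def)
  have sz: "?sz T \<ge> 0" and sq: "?sq T \<ge> 0" if "T \<in> \<T>" for T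
    using full_simplex.sup_norm_nonneg[OF full_simplex[OF that]] poly_fun_piece[OF zL that] q(1)[OF that] by blast+
  have wm: "w \<in> borel_measurable (lebesgue_on \<Omega>)" using borel_measurable_integrable[OF q(3)] by (simp add: w_def)
  have zm: "z \<in> borel_measurable (lebesgue_on \<Omega>)" by (rule LK_measurable[OF zLK])
  have w_bd: "\<bar>w x\<bar> \<le> ?sq T" if "T \<in> \<T>" "x \<in> interior T" for T x unfolding w_def piecewise_eq[OF that]
    by (rule full_simplex.abs_le_sup_norm[OF full_simplex q(1)]) (use that interior_subset in blast)+
  have z_bd: "\<bar>z x\<bar> \<le> ?sz T" if "T \<in> \<T>" "x \<in> interior T" for T x unfolding piece_eq_interior[OF zL that, symmetric]
    by (rule full_simplex.abs_le_sup_norm[OF full_simplex poly_fun_piece[OF zL]]) (use that interior_subset in blast)+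
  have H: "(\<Sum>T\<in>\<T>. vol T * (V T * (U T * ?sz T)\<^sup>2)) \<le> (N * c)\<^sup>2 * (\<Sum>T\<in>\<T>. vol T * (V T * (U T * ?sq T)\<^sup>2))"
    if V: "graded (g\<^sup>2) V" for V proof -
    have V0: "V T > 0" if "T \<in> \<T>" for T using V that by (simp add: graded_def)
    let ?A = "\<lambda>T. sqrt (V T) * (U T * ?sz T)" and ?B = "\<lambda>T. sqrt (V T) * (U T * ?sq T)"
    define R where "R = (piecewise (\<lambda>T _. U T * sqrt (V T)) :: real^'n \<Rightarrow> real)"
    have "graded (\<gamma>' * g) (\<lambda>T. U T * sqrt (V T))" unfolding graded_def proof (intro conjI ballI allI impI)
      fix S T assume n: "(S, T) \<in> neighbors \<T>"
      then have "sqrt (V T) \<le> sqrt (g\<^sup>2 * V S)" using V by (intro real_sqrt_le_mono) (simp add: graded_def)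
      then have "U T * sqrt (V T) \<le> (\<gamma>' * U S) * (g * sqrt (V S))"
        using g n U U0 V0 neighbors_mesh[OF n] by (intro mult_mono) (auto simp: real_sqrt_mult graded_def less_imp_le)
      then show "U T * sqrt (V T) \<le> \<gamma>' * g * (U S * sqrt (V S))" by (simp add: mult_ac)
    qed (use U0 V0 in simp)
    from weight_piecewise[OF this] have wR: "weight \<Omega> \<T> (\<gamma>' * g) R" using mult_mono[of 1 \<gamma>' 1 g] U(2) g by (simp add: R_def)
    have Rm: "R \<in> borel_measurable (lebesgue_on \<Omega>)" using wR by (simp add: weight_def Lp_def)
    have R: "R x = U T * sqrt (V T)" if "T \<in> \<T>" "x \<in> interior T" for T x unfolding R_def by (rule piecewise_eq[OF that])
    have upper: "Lp_norm 2 \<Omega> (\<lambda>x. R x * f x) \<le> ennreal (mesh_norm 2 (\<lambda>T. sqrt (V T) * (U T * B T)))"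
      if "f \<in> borel_measurable (lebesgue_on \<Omega>)" "\<And>T x. T \<in> \<T> \<Longrightarrow> x \<in> interior T \<Longrightarrow> \<bar>f x\<bar> \<le> B T" "\<And>T. T \<in> \<T> \<Longrightarrow> B T \<ge> 0"
      for f :: "real^'n \<Rightarrow> real" and B proof (rule Lp_norm_le_mesh_norm)
      fix T assume T: "T \<in> \<T>"
      show "0 \<le> sqrt (V T) * (U T * B T)" using U0[OF T] V0[OF T] that(3)[OF T] by simp
      show "AE x in lebesgue. x \<in> interior T \<longrightarrow> norm (R x * f x) \<le> sqrt (V T) * (U T * B T)"
        using U0[OF T] V0[OF T] that(2)[OF T] by (intro AE_I2) (simp add: R[OF T] abs_mult mult.commute mult_left_mono)
    qed (use Rm that(1) in auto)
    have A0: "0 \<le> ?A T" and B0: "0 \<le> ?B T" if "T \<in> \<T>" for T using U0[OF that] sz[OF that] sq[OF that] V0[OF that] by simp_all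
    \<comment> \<open>The weight is constant on each simplex, so the inverse estimate for the
      polynomial pieces carries over to the weighted function.\<close>
    have "mesh_norm 2 ?A \<le> N * mesh_norm 2 (\<lambda>T. lint T (\<lambda>x. norm (R x * z x)) / vol T)" proof (rule mesh_norm_mono)
      fix T assume T: "T \<in> \<T>"
      interpret full_simplex T by (rule full_simplex[OF T])
      have "lint T (\<lambda>x. norm (R x * z x)) =
        (LINT x|lebesgue. (U T * sqrt (V T)) * (indicator (interior T) x * \<bar>piece K z T x\<bar>))" using U0[OF T] V0[OF T] by (intro Bochner_Integration.integral_cong refl)
          (simp add: indicator_def piece_eq_interior[OF zL T] R[OF T] abs_mult)
      also have "\<dots> = (U T * sqrt (V T)) * lint T (\<lambda>x. \<bar>piece K z T x\<bar>)" by simp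
      finally have "N * lint T (\<lambda>x. norm (R x * z x)) =
        (U T * sqrt (V T)) * (N * lint T (\<lambda>x. \<bar>piece K z T x\<bar>))" by simp
      moreover have "(U T * sqrt (V T)) * (?sz T * vol T) \<le> \<dots>"
        using U0[OF T] V0[OF T] by (intro mult_left_mono sup_norm_le_L1[OF poly_fun_piece[OF zL T], folded N_def]) simp
      ultimately have "(U T * sqrt (V T)) * (?sz T * vol T) \<le> N * lint T (\<lambda>x. norm (R x * z x))" by (simp only:)
      then show "0 \<le> ?A T \<and> ?A T \<le> N * (lint T (\<lambda>x. norm (R x * z x)) / vol T)" using A0[OF T] measure_pos by (simp add: le_divide_eq mult_ac)
    qed (use N in \<open>auto intro!: divide_nonneg_nonneg integral_nonneg_AE AE_I2\<close>)
    also have "mesh_norm 2 (\<lambda>T. lint T (\<lambda>x. norm (R x * z x)) / vol T) \<le> c * mesh_norm 2 ?B" proof -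
      have "(\<lambda>x. R x * z x) \<in> Lp 2 \<Omega>" using upper[of z ?sz, OF zm z_bd sz] Rm zm by (auto simp: Lp_def intro: le_less_trans)
      from mesh_norm_average_le[OF _ this]
      have "ennreal (mesh_norm 2 (\<lambda>T. lint T (\<lambda>x. norm (R x * z x)) / vol T)) \<le> Lp_norm 2 \<Omega> (\<lambda>x. R x * Q K w x)"
        using q(4) by (simp add: w_def z_def)
      also have "\<dots> \<le> ennreal (C (\<gamma>' * g)) * Lp_norm 2 \<Omega> (\<lambda>x. R x * w x)" proof -
        have "Lp_norm 2 \<Omega> w \<le> ennreal (mesh_norm 2 ?sq)" using w_bd sq wm by (intro Lp_norm_le_mesh_norm) auto
        then have "w \<in> Lp 2 \<Omega>" using wm by (auto simp: Lp_def intro: le_less_trans)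
        then show ?thesis using wg wR less unfolding worst_grading_def g_def[symmetric] by blast
      qed
      also have "\<dots> \<le> ennreal c * ennreal (mesh_norm 2 ?B)" using upper[of w ?sq, OF wm w_bd sq] by (intro mult_mono) (auto simp: c_def intro: ennreal_leI)
      also have "\<dots> = ennreal (c * mesh_norm 2 ?B)" using c by (simp add: ennreal_mult')
      finally show ?thesis by (rule ennreal_le_iff[THEN iffD1, rotated]) (intro mult_nonneg_nonneg[OF c] mesh_norm_nonneg B0)
    qed
    finally have "(mesh_norm 2 ?A)\<^sup>2 \<le> (N * c * mesh_norm 2 ?B)\<^sup>2" using A0 N by (intro power_mono mesh_norm_nonneg) (simp_all add: mult_left_mono mult.assoc)
    then show ?thesis using mesh_norm_2_sq[of ?A, OF A0] mesh_norm_2_sq[of ?B, OF B0] V0 by (simp add: power_mult_distrib less_imp_le cong: sum.cong)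
  qed
  let ?avg = "\<lambda>T. lint T (\<lambda>x. \<bar>u x\<bar>) / vol T"
  have Nc: "sqrt ((N * c)\<^sup>2) = N * c" using N c by simp
  have "mesh_norm p (\<lambda>T. U T * ?sz T) \<le> (sqrt ((N * c)\<^sup>2) * kernel_const s powr e) * mesh_norm p (\<lambda>T. U T * ?sq T)"
    by (rule extrapolation[OF p s _ _ _ e H[unfolded g_def]]) (use less_imp_le[OF U0] sz sq in auto)
  also have "mesh_norm p (\<lambda>T. U T * ?sq T) \<le> N\<^sup>2 * mesh_norm p (\<lambda>T. U T * ?avg T)" proof (rule mesh_norm_mono[OF p])
    fix T assume T: "T \<in> \<T>"
    show "0 \<le> U T * ?avg T" using U0[OF T] by (intro mult_nonneg_nonneg divide_nonneg_nonneg integral_nonneg_AE AE_I2) auto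
    have "?sq T \<le> N\<^sup>2 * ?avg T" using q(2)[OF T] vol_pos[OF T] by (simp add: field_simps)
    then show "0 \<le> U T * ?sq T \<and> U T * ?sq T \<le> N\<^sup>2 * (U T * ?avg T)"
      using mult_left_mono[OF _ less_imp_le[OF U0[OF T]]] U0[OF T] sq[OF T] by (simp only: mult.left_commute[of "N\<^sup>2"]) simp
  qed simp
  finally have "mesh_norm p (\<lambda>T. U T * ?sz T) \<le> N * c * kernel_const s powr e * (N\<^sup>2 * mesh_norm p (\<lambda>T. U T * ?avg T))"
    unfolding Nc using N c by (simp add: mult_left_mono)
  also have "N * c * kernel_const s powr e * (N\<^sup>2 * mesh_norm p (\<lambda>T. U T * ?avg T)) = projection_const C K \<gamma>' s e * mesh_norm p (\<lambda>T. U T * ?avg T)"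
    by (simp add: projection_const_def Let_def g_def[symmetric] c_def[symmetric] N_def[symmetric] power2_eq_square power3_eq_cube)
  finally show ?thesis by (simp add: z_def)
qed

lemma projection_const_nonneg: "projection_const C K \<gamma>' s e \<ge> 0"
  using nikolskii_ge_1[of "CARD('n)" K] by (auto simp: projection_const_def Let_def intro!: mult_nonneg_nonneg)

text \<open>The added 1 keeps the constant positive, so that the bound holds also when the norm on
  the right is infinite; with the constant 0 the product would be 0 in
  \<open>ennreal\<close>.\<close>

theorem Lp_stability:
  assumes p: "p \<ge> 1" and \<rho>: "weight \<Omega> \<T> \<gamma>' \<rho>" and wg: "worst_grading C K \<Omega> \<T> \<Gamma> \<gamma>max"
    and s: "s > 1" and e: "e = \<bar>1 / 2 - enn2real (1 / p)\<bar>"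
    and less: "\<gamma>' * (\<gamma> powr (real CARD('n) * e) * s) < \<gamma>max"
    and u: "u \<in> Lp p \<Omega>"
  shows "Lp_norm p \<Omega> (\<lambda>x. \<rho> x * Q K u x) \<le> ennreal (\<gamma>' * projection_const C K \<gamma>' s e + 1) * Lp_norm p \<Omega> (\<lambda>x. \<rho> x * u x)"
proof (cases "Lp_norm p \<Omega> (\<lambda>x. \<rho> x * u x) = \<infinity>")
  case True
  have "0 < \<gamma>' * projection_const C K \<gamma>' s e + 1" using \<rho> projection_const_nonneg by (intro add_nonneg_pos mult_nonneg_nonneg) (auto simp: weight_def)
  then show ?thesis using True by (simp add: ennreal_mult_top)
next
  case False
  have ui: "integrable (lebesgue_on \<Omega>) u" by (rule Lp_integrable[OF p u])
  have \<rho>m: "\<rho> \<in> borel_measurable (lebesgue_on \<Omega>)" and \<gamma>': "\<gamma>' \<ge> 1" using \<rho> by (auto simp: weight_def Lp_def)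
  have \<rho>u: "(\<lambda>x. \<rho> x *\<^sub>R u x) \<in> Lp p \<Omega>" using False \<rho>m u by (auto simp: Lp_def less_top[symmetric])
  define z where "z = Q K u"
  have zLK: "z \<in> LK K" unfolding z_def by (rule L2_projection_in[OF ui])
  note zL = LK_Lagrange[OF zLK]
  define P where "P = projection_const C K \<gamma>' s e"
  define m where "m = mesh_norm p (\<lambda>T. low \<rho> T * (lint T (\<lambda>x. norm (u x)) / vol T))"
  have low: "low \<rho> T > 0" if "T \<in> \<T>" for T by (rule weight_low_pos[OF \<rho> that])
  have sz: "sup_norm T (piece K z T) \<ge> 0" if "T \<in> \<T>" for T by (rule full_simplex.sup_norm_nonneg[OF full_simplex[OF that] poly_fun_piece[OF zL that]])
  have z_le: "\<bar>z x\<bar> \<le> sup_norm T (piece K z T)" if "T \<in> \<T>" "x \<in> interior T" for T x unfolding piece_eq_interior[OF zL that, symmetric]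
    by (rule full_simplex.abs_le_sup_norm[OF full_simplex poly_fun_piece[OF zL]]) (use that interior_subset in blast)+
  have "Lp_norm p \<Omega> (\<lambda>x. \<rho> x *\<^sub>R z x) \<le> ennreal (\<gamma>' * mesh_norm p (\<lambda>T. low \<rho> T * sup_norm T (piece K z T)))"
    by (rule Lp_norm_weight_le[OF p \<rho> LK_measurable[OF zLK]]) (use z_le sz in auto)
  also have "\<gamma>' * mesh_norm p (\<lambda>T. low \<rho> T * sup_norm T (piece K z T)) \<le> \<gamma>' * (P * m)"
    unfolding z_def P_def m_def using projection_mesh_norm_le[OF p graded_low[OF \<rho>] \<gamma>' wg s e less ui] \<gamma>' by (intro mult_left_mono) auto
  also have "\<dots> \<le> (\<gamma>' * P + 1) * m" unfolding m_def using less_imp_le[OF low]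
    by (simp add: distrib_right mesh_norm_nonneg mult_nonneg_nonneg divide_nonneg_nonneg integral_nonneg_AE)
  finally have "Lp_norm p \<Omega> (\<lambda>x. \<rho> x * z x) \<le> ennreal ((\<gamma>' * P + 1) * m)" by (auto simp: ennreal_leI)
  also have "\<dots> = ennreal (\<gamma>' * P + 1) * ennreal m" using \<gamma>' projection_const_nonneg by (intro ennreal_mult') (simp add: P_def)
  also have "\<dots> \<le> ennreal (\<gamma>' * P + 1) * Lp_norm p \<Omega> (\<lambda>x. \<rho> x * u x)"
    using mesh_norm_weighted_average_le[OF p \<rho> ui \<rho>u] by (intro mult_left_mono) (auto simp: m_def)
  finally show ?thesis by (simp add: P_def z_def)
qed

end

section \<open>Comparison of averages over simplices that meet inside the domain\<close>

section \<open>Averages of weakly differentiable functions\<close>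

text \<open>Both functions are integrable over the whole space, in the applications after extension
  by 0, while the derivative is tested inside \<open>U\<close> only. Arbitrary directions
  \<open>w\<close> in place of coordinates suit increments.\<close>

definition weakly_diff :: "(real^'n) set \<Rightarrow> (real^'n \<Rightarrow> real) \<Rightarrow> (real^'n \<Rightarrow> real^'n) \<Rightarrow> bool" where
  "weakly_diff U u G \<longleftrightarrow> integrable lebesgue u \<and> integrable lebesgue G \<and>
     (\<forall>\<psi> w. test_function U \<psi> \<longrightarrow>
       (LINT x|lebesgue. u x * (grad \<psi> x \<bullet> w)) = - (LINT x|lebesgue. (G x \<bullet> w) * \<psi> x))"

definition mass :: "(real^'n \<Rightarrow> real^'n) \<Rightarrow> (real^'n) set \<Rightarrow> real" where
  "mass G S = (LINT x|lebesgue. indicator S x * norm (G x))"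

lemma measure_ball_scale:
  "0 \<le> r \<Longrightarrow> vol (ball (x::real^'n) r) = vol (cball (0::real^'n) 1) * r ^ CARD('n)"
  "0 \<le> r \<Longrightarrow> vol (cball (x::real^'n) r) = vol (cball (0::real^'n) 1) * r ^ CARD('n)"
  using content_ball[of r x] content_cball[of r x] content_cball[of 1 "0::real^'n"] by simp_all

lemma mass_nonneg: "mass G S \<ge> 0" unfolding mass_def by (intro integral_nonneg_AE AE_I2) simp

lemma average_diff_le:
  fixes u :: "real^'n \<Rightarrow> real"
  assumes u: "integrable lebesgue u" and V: "V \<in> lmeasurable" "vol V > 0"
    and VU: "V \<subseteq> U" "U \<in> lmeasurable"
  shows "\<bar>average V u - c\<bar> * vol V \<le> (LINT x|lebesgue. indicator U x * \<bar>u x - c\<bar>)" proof -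
  have iV: "integrable lebesgue (indicator V :: _ \<Rightarrow> real)" and iU: "integrable lebesgue (indicator U :: _ \<Rightarrow> real)"
    using V(1) VU(2) by (simp_all add: lmeasurable_iff_integrable)
  have i: "integrable lebesgue (\<lambda>x. indicator V x * (u x - c))" using integrable_indicator_times[OF u, of V] V(1) iV by (simp add: right_diff_distrib fmeasurableD)
  have iu: "integrable lebesgue (\<lambda>x. indicator U x * \<bar>u x - c\<bar>)" by (rule integrable_indicator_abs_diff[OF u VU(2)])
  have "(average V u - c) * vol V = (LINT x|lebesgue. indicator V x * u x) - c * vol V" using V(2) by (simp add: average_def left_diff_distrib)
  also have "\<dots> = (LINT x|lebesgue. indicator V x * (u x - c))" using integrable_indicator_times[OF u, of V] V(1) iV by (simp add: right_diff_distrib fmeasurableD)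
  finally have "\<bar>average V u - c\<bar> * vol V = \<bar>LINT x|lebesgue. indicator V x * (u x - c)\<bar>" using V(2) by (metis abs_mult abs_of_pos)
  also have "\<dots> \<le> (LINT x|lebesgue. \<bar>indicator V x * (u x - c)\<bar>)" by (rule integral_abs_bound)
  also have "\<dots> \<le> (LINT x|lebesgue. indicator U x * \<bar>u x - c\<bar>)" using VU(1) by (intro integral_mono integrable_abs i iu) (auto simp: indicator_def)
  finally show ?thesis .
qed

text \<open>Test functions of \<open>U\<close> do not see \<open>G\<close> outside \<open>U\<close>,
  so \<open>G\<close> can be cut off there and only its mass on \<open>U\<close> remains.\<close>

lemma poincare_subset:
  fixes u :: "real^'n \<Rightarrow> real"
  assumes wd: "weakly_diff \<Omega> u G" and U: "open U" "convex U" "U \<subseteq> \<Omega>"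
    and \<delta>: "\<And>x y. x \<in> U \<Longrightarrow> y \<in> U \<Longrightarrow> dist x y \<le> \<delta>" "0 \<le> \<delta>" and pos: "vol U > 0"
  shows "(LINT x|lebesgue. indicator U x * \<bar>u x - average U u\<bar>) * vol U
    \<le> \<delta> * (vol (cball (0::real^'n) 1) * \<delta> ^ CARD('n)) * mass G U" proof -
  have u: "integrable lebesgue u" and G: "integrable lebesgue G" using wd by (auto simp: weakly_diff_def)
  have Um: "U \<in> sets lebesgue" using U(1) by (simp add: borel_open sets_completionI_sets)
  have "(LINT x|lebesgue. indicator U x * \<bar>u x - average U u\<bar>) * vol U
    \<le> \<delta> * vol (cball (0::real^'n) \<delta>) * (LINT x|lebesgue. norm (indicator U x *\<^sub>R G x))" proof (rule poincare[OF u _ _ U(1,2) \<delta> pos])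
    show "integrable lebesgue (\<lambda>x. indicator U x *\<^sub>R G x)" by (rule integrable_mult_indicator[OF Um G])
    fix \<psi> w assume \<psi>: "test_function U \<psi>"
    have eq: "(indicator U x *\<^sub>R G x \<bullet> w) * \<psi> x = (G x \<bullet> w) * \<psi> x" for x using test_functionD(2)[OF \<psi>, of x] by (cases "x \<in> U") auto
    then show "(LINT x|lebesgue. u x * (grad \<psi> x \<bullet> w)) = - (LINT x|lebesgue. (indicator U x *\<^sub>R G x \<bullet> w) * \<psi> x)"
      unfolding eq using wd test_function_mono[OF \<psi> U(3)] unfolding weakly_diff_def by blast
  qed
  then show ?thesis unfolding mass_def measure_ball_scale(2)[OF \<delta>(2)] by simp
qed

lemma average_subset_diff_le:
  fixes u :: "real^'n \<Rightarrow> real"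
  assumes wd: "weakly_diff \<Omega> u G" and U: "open U" "convex U" "U \<subseteq> \<Omega>"
    and \<delta>: "\<And>x y. x \<in> U \<Longrightarrow> y \<in> U \<Longrightarrow> dist x y \<le> \<delta>" "0 \<le> \<delta>" and pos: "vol U > 0"
    and V: "V \<in> lmeasurable" "vol V > 0" "V \<subseteq> U" "U \<in> lmeasurable"
  shows "\<bar>average V u - average U u\<bar> * (vol V * vol U)
    \<le> \<delta> * (vol (cball (0::real^'n) 1) * \<delta> ^ CARD('n)) * mass G U" proof -
  have u: "integrable lebesgue u" using wd by (auto simp: weakly_diff_def)
  have "\<bar>average V u - average U u\<bar> * vol V * vol U \<le>
      (LINT x|lebesgue. indicator U x * \<bar>u x - average U u\<bar>) * vol U"
    using average_diff_le[OF u V(1,2,3,4), of "average U u"] V(4) pos by (intro mult_right_mono) (auto simp: fmeasurableD)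
  also note poincare_subset[OF wd U \<delta> pos]
  finally show ?thesis by (simp add: mult.assoc)
qed

lemma (in full_simplex) barycenter:
  assumes E: "E \<subseteq> vertices T" "E \<noteq> {}"
  defines "x \<equiv> (\<Sum>v\<in>E. (1 / real (card E)) *\<^sub>R v)"
  shows "x \<in> convex hull E" "\<And>v. v \<in> vertices T \<Longrightarrow> bary T v x = (if v \<in> E then 1 / real (card E) else 0)" proof -
  have fin: "finite E" using E(1) vertices_simplex(1) by (rule finite_subset)
  then have c: "card E > 0" using E(2) by (simp add: card_gt_0_iff)
  show "x \<in> convex hull E" unfolding x_def using c fin hull_inc[of _ E] by (intro convex_sum) auto
  show "bary T v x = (if v \<in> E then 1 / real (card E) else 0)" if v: "v \<in> vertices T" for v proof -
    have "bary T v x = (\<Sum>w\<in>E. (1 / real (card E)) * bary T v w)" unfolding x_def using c by (intro bary_affine_combination) simp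
    also have "\<dots> = (\<Sum>w\<in>E. if w = v then 1 / real (card E) else 0)" using E(1) v by (intro sum.cong refl) (auto simp: bary_vertex subset_iff)
    finally show ?thesis using fin by simp
  qed
qed

context triangulated
begin

text \<open>A vertex with a positive coordinate at a common point lies in the common face, and
  extreme points of a face are extreme points of each simplex.\<close>

lemma vertex_of_both:
  assumes S: "S \<in> \<T>" and T: "T \<in> \<T>" and x: "x \<in> S" "x \<in> T" and z: "z \<in> vertices T" "bary T z x > 0"
  shows "z \<in> vertices S" "z \<in> S" proof -
  have zST: "z \<in> S \<inter> T" using full_simplex.vertex_in_face[OF full_simplex[OF T] face_Int'[OF S T] _ z] x by blast
  then show "z \<in> S" by simp
  have "z extreme_point_of (S \<inter> T)" using zST z(1) extreme_point_of_face[OF face_Int'[OF S T]] by (simp add: vertices_def)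
  then show "z \<in> vertices S" using extreme_point_of_face[OF face_Int[OF S T]] by (simp add: vertices_def)
qed

text \<open>All points of \<open>E\<close> have positive coordinates at \<open>y\<close>, so a
  boundary face through \<open>y\<close> would contain \<open>convex hull E\<close>, including the
  point \<open>x\<close> of the open domain.\<close>

lemma mem_domain_of_hull:
  assumes S: "S \<in> \<T>" and y: "y \<in> S" "\<And>v. v \<in> E \<Longrightarrow> v \<in> vertices S \<and> bary S v y > 0"
    and x: "x \<in> convex hull E" "x \<in> \<Omega>"
  shows "y \<in> \<Omega>" proof (rule ccontr)
  assume "y \<notin> \<Omega>"
  then obtain F where F: "F \<in> boundary_faces \<Omega> \<T>" "y \<in> F" by (rule boundary_faceE[OF y(1) S])
  have "convex hull E \<subseteq> F \<inter> S" by (rule full_simplex.face_eq_or_subset_vertices[OF full_simplex[OF S] boundary_face_Int_face[OF F(1) S]]) (use F y in auto)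
  then show False using x not_in_frontier[OF x(2) F(1)] by blast
qed

text \<open>In the ball the coordinates belonging to \<open>E\<close> stay positive on every simplex
  at \<open>x\<close>. Hence the part \<open>A\<close> of the ball that is covered by these
  simplices lies in \<Omega> and is both closed and open in the ball; as the ball is connected,
  \<open>A\<close> is all of it.\<close>

lemma star_ball:
  assumes T: "T \<in> \<T>" and E: "E \<subseteq> vertices T" "E \<noteq> {}" and x: "x = (\<Sum>v\<in>E. (1 / real (card E)) *\<^sub>R v)" "x \<in> \<Omega>"
    and r: "r > 0" "\<And>S. S \<in> \<T> \<Longrightarrow> x \<in> S \<Longrightarrow> r * (2 * (real CARD('n) + 1)) \<le> inradius S"
  shows "ball x r \<subseteq> \<Omega>" "ball x r \<subseteq> \<Union>{S\<in>\<T>. x \<in> S}" proof -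
  interpret full_simplex T by (rule full_simplex[OF T])
  have finE: "finite E" using E(1) vertices_simplex(1) by (rule finite_subset)
  have cE: "card E > 0" using finE E(2) by (simp add: card_gt_0_iff)
  have cE': "card E \<le> CARD('n) + 1" using card_mono[OF vertices_simplex(1) E(1)] vertices_simplex(3) by simp
  have x_hull: "x \<in> convex hull E" unfolding x(1) by (rule barycenter[OF E])
  have xT: "x \<in> T" using x_hull hull_mono[OF E(1), of convex] vertices_simplex(4) by blast
  have E_vertices: "v \<in> vertices S" if "S \<in> \<T>" "x \<in> S" "v \<in> E" for S v
    using vertex_of_both(1)[OF that(1) T that(2) xT, of v] barycenter(2)[OF E, of v] E(1) that(3) cE unfolding x(1) by auto
  \<comment> \<open>In the ball a coordinate changes by less than
    \<open>(2 / inradius S) * r\<close>, at most \<open>1 / (CARD('n) + 1)\<close>; at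
    \<open>x\<close> it is \<open>1 / card E\<close>, and \<open>E\<close> has at most
    \<open>CARD('n) + 1\<close> points.\<close>
  have pos: "bary S v y > 0" if S: "S \<in> \<T>" "x \<in> S" and v: "v \<in> E" and y: "y \<in> ball x r" for S v y proof -
    interpret S: full_simplex S by (rule full_simplex[OF S(1)])
    have vS: "v \<in> vertices S" by (rule E_vertices[OF S v])
    have "E \<subseteq> vertices S" using E_vertices[OF S] by blast
    from S.barycenter(2)[OF this E(2) vS] have bx: "bary S v x = 1 / real (card E)" using v unfolding x(1) by simp
    have "\<bar>bary_grad S v \<bullet> (y - x)\<bar> \<le> norm (bary_grad S v) * norm (y - x)" by (rule Cauchy_Schwarz_ineq2)
    also have "\<dots> \<le> (2 / inradius S) * norm (y - x)" by (intro mult_right_mono S.norm_bary_grad_le_inradius[OF vS]) simp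
    also have "\<dots> < (2 / inradius S) * r" using y S.inradius_pos by (intro mult_strict_left_mono) (auto simp: dist_norm norm_minus_commute)
    also have "\<dots> \<le> 1 / (real CARD('n) + 1)" using r(2)[OF S] S.inradius_pos by (simp add: field_simps)
    also have "\<dots> \<le> 1 / real (card E)" using cE cE' by (intro divide_left_mono) auto
    finally show ?thesis using S.bary_diff[of v y x] bx by linarith
  qed
  define A where "A = ball x r \<inter> \<Union>{S\<in>\<T>. x \<in> S}"
  have inA: "y \<in> \<Omega>" if y: "y \<in> A" for y proof -
    obtain S where S: "S \<in> \<T>" "x \<in> S" "y \<in> S" "y \<in> ball x r" using y by (auto simp: A_def)
    show ?thesis by (rule mem_domain_of_hull[OF S(1,3) _ x_hull x(2)]) (use S E_vertices pos in auto)
  qed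
  have closed_Union: "closed (\<Union>{S\<in>\<T>. P S})" for P using finite_mesh by (intro closed_Union) (auto intro: full_simplex.closed_T[OF full_simplex])
  have "closedin (top_of_set (ball x r)) A" unfolding A_def by (intro closedin_closed_Int closed_Union)
  moreover have "openin (top_of_set (ball x r)) A" proof -
    define W where "W = ball x r \<inter> (\<Omega> - \<Union>{S\<in>\<T>. x \<notin> S})"
    have "open W" unfolding W_def by (intro open_Int open_ball open_Diff open_domain closed_Union)
    moreover have "A = W" proof (rule subset_antisym)
      show "W \<subseteq> A" unfolding W_def A_def using domain_subset by blast
      show "A \<subseteq> W" proof
        fix y assume y: "y \<in> A"
        then obtain S where S: "S \<in> \<T>" "x \<in> S" "y \<in> S" and yb: "y \<in> ball x r" by (auto simp: A_def)
        \<comment> \<open>A simplex through \<open>y\<close> contains all of \<open>E\<close> and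
          therefore \<open>x\<close>. So \<open>A\<close> avoids the finite, hence closed, union of
          the simplices that miss \<open>x\<close>, which makes it open in the ball.\<close>
        have "x \<in> S'" if S': "S' \<in> \<T>" "y \<in> S'" for S' proof -
          have "convex hull E \<subseteq> S \<inter> S'" by (rule full_simplex.face_eq_or_subset_vertices[OF full_simplex[OF S(1)] face_Int[OF S(1) S'(1)]])
              (use S S' pos[OF S(1,2) _ yb] E_vertices[OF S(1,2)] in auto)
          then show ?thesis using x_hull by blast
        qed
        then show "y \<in> W" using yb inA[OF y] by (auto simp: W_def)
      qed
    qed
    ultimately show ?thesis by (simp add: openin_open_eq W_def)
  qed
  moreover have "x \<in> A" using xT T r(1) by (auto simp: A_def)
  moreover have "connected (ball x r)" by simp
  ultimately have "A = ball x r" unfolding connected_clopen by blast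
  then show "ball x r \<subseteq> \<Omega>" "ball x r \<subseteq> \<Union>{S\<in>\<T>. x \<in> S}" using inA by (auto simp: A_def)
qed

lemma bary_common_vertices:
  assumes S: "S \<in> \<T>" and T: "T \<in> \<T>" and x: "x \<in> S" "x \<in> T"
  defines "E \<equiv> vertices S \<inter> vertices T"
  shows "\<And>z. z \<in> vertices T - E \<Longrightarrow> bary T z x = 0" "(\<Sum>z\<in>E. bary T z x) = 1" "(\<Sum>z\<in>E. bary T z x *\<^sub>R z) = x" proof -
  interpret full_simplex T by (rule full_simplex[OF T])
  show b0: "bary T z x = 0" if "z \<in> vertices T - E" for z using that vertex_of_both(1)[OF S T x, of z] x(2) mem_simplex_iff[of x] by (fastforce simp: E_def)
  have ET: "E \<subseteq> vertices T" by (simp add: E_def)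
  show "(\<Sum>z\<in>E. bary T z x) = 1" using sum.mono_neutral_right[OF vertices_simplex(1) ET, of "\<lambda>z. bary T z x"] b0 sum_bary[of x] by simp
  show "(\<Sum>z\<in>E. bary T z x *\<^sub>R z) = x"
    using sum.mono_neutral_right[OF vertices_simplex(1) ET, of "\<lambda>z. bary T z x *\<^sub>R z"] b0 sum_bary_vertex[of x] by simp
qed

text \<open>The common face may touch the frontier, but once some point of it lies in \<Omega>, its
  barycenter does too, since there all coordinates of common vertices are positive. This point is
  the centre of the comparison ball.\<close>

lemma Int_simplices_vertices:
  assumes S: "S \<in> \<T>" and T: "T \<in> \<T>" and x0: "x0 \<in> S" "x0 \<in> T" "x0 \<in> \<Omega>"
  defines "E \<equiv> vertices S \<inter> vertices T"
  shows "E \<noteq> {}" "(\<Sum>v\<in>E. (1 / real (card E)) *\<^sub>R v) \<in> S \<inter> T \<inter> \<Omega>" proof -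
  interpret full_simplex T by (rule full_simplex[OF T])
  interpret S: full_simplex S by (rule full_simplex[OF S])
  let ?x = "\<Sum>v\<in>E. (1 / real (card E)) *\<^sub>R v"
  note b = bary_common_vertices[OF S T x0(1,2), folded E_def]
  have E: "finite E" "E \<subseteq> vertices S" "E \<subseteq> vertices T" using vertices_simplex(1) by (auto simp: E_def)
  have x0_hull: "x0 \<in> convex hull E" using E mem_simplex_iff[of x0] x0(2) hull_inc[of _ E convex] b(2) by (subst b(3)[symmetric]) (intro convex_sum, auto)
  then show ne: "E \<noteq> {}" by auto
  have x_hull: "?x \<in> convex hull E" by (rule barycenter[OF E(3) ne])
  then have xST: "?x \<in> S" "?x \<in> T" using hull_mono[OF E(2), of convex] hull_mono[OF E(3), of convex] vertices_simplex(4) S.vertices_simplex(4) by auto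
  have cE: "card E > 0" using E(1) ne by (simp add: card_gt_0_iff)
  have "?x \<in> \<Omega>" by (rule mem_domain_of_hull[OF T xST(2) _ x0_hull x0(3)]) (use barycenter(2)[OF E(3) ne] E(3) cE in auto)
  then show "?x \<in> S \<inter> T \<inter> \<Omega>" using xST by blast
qed

end

context graded_mesh
begin

text \<open>Trades the volume of a set at least as large as a ball of radius
  \<open>q * diameter S\<close> for that of \<open>S\<close>, which is at most the volume of a ball
  of radius \<open>diameter S\<close>.\<close>

lemma scale_measure_le:
  assumes S: "S \<in> \<T>" and q: "q > 0"
    and V: "vol (cball (0::real^'n) 1) * (q * diameter S) ^ CARD('n) \<le> vol V"
    and XY: "X * vol V \<le> Y" "0 \<le> X"
  shows "X * vol S \<le> (1 / q) ^ CARD('n) * Y" proof -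
  interpret full_simplex S by (rule full_simplex[OF S])
  define b where "b = vol (cball (0::real^'n) 1)"
  have "X * vol S \<le> X * (b * diameter S ^ CARD('n))" unfolding b_def using measure_le_diameter XY(2) by (intro mult_left_mono) auto
  also have "\<dots> = (1 / q) ^ CARD('n) * (X * (b * (q * diameter S) ^ CARD('n)))" using q by (simp add: power_mult_distrib power_divide)
  also have "\<dots> \<le> (1 / q) ^ CARD('n) * (X * vol V)" using V XY(2) q by (intro mult_left_mono) (auto simp: b_def)
  also have "\<dots> \<le> (1 / q) ^ CARD('n) * Y" using XY(1) q by (intro mult_left_mono) auto
  finally show ?thesis .
qed

lemma average_subset_simplex_diff_le:
  assumes wd: "weakly_diff \<Omega> u G" and S: "S \<in> \<T>" and q: "q > 0"
    and V: "V \<in> lmeasurable" "V \<subseteq> interior S" "vol (cball (0::real^'n) 1) * (q * diameter S) ^ CARD('n) \<le> vol V"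
  shows "\<bar>average V u - average (interior S) u\<bar> * vol S \<le> (1 / q) ^ CARD('n) * (diameter S * mass G (interior S))" proof -
  interpret full_simplex S by (rule full_simplex[OF S])
  define b where "b = vol (cball (0::real^'n) 1)"
  define D where "D = diameter S"
  have b: "b > 0" by (simp add: b_def)
  have D: "D > 0" unfolding D_def by (rule diameter_pos)
  have "b * (q * D) ^ CARD('n) > 0" using b q D by simp
  then have volV0: "vol V > 0" using V(3) by (simp add: b_def D_def)
  have Im: "interior S \<in> lmeasurable" by (intro lmeasurable_open bounded_subset[OF bounded_T interior_subset]) simp
  let ?X = "\<bar>average V u - average (interior S) u\<bar> * vol S"
  have "\<bar>average V u - average (interior S) u\<bar> * (vol V * vol (interior S)) \<le> D * (b * D ^ CARD('n)) * mass G (interior S)" unfolding b_def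
  proof (rule average_subset_diff_le[OF wd _ _ interior_subset_domain[OF S]])
    show "convex (interior S)" by (rule convex_interior[OF convex_T])
    show "dist x y \<le> D" if "x \<in> interior S" "y \<in> interior S" for x y unfolding D_def by (rule diameter_bounded_bound[OF bounded_T]) (use that interior_subset in auto)
  qed (use D measure_pos V volV0 Im in \<open>auto simp: measure_interior\<close>)
  moreover have "?X * (b * (q * D) ^ CARD('n)) \<le> ?X * vol V" using V(3) measure_pos by (intro mult_left_mono) (auto simp: b_def D_def)
  ultimately have "(b * D ^ CARD('n)) * (?X * q ^ CARD('n)) \<le> (b * D ^ CARD('n)) * (D * mass G (interior S))"
    unfolding measure_interior by (simp add: power_mult_distrib mult_ac)
  then have "?X * q ^ CARD('n) \<le> D * mass G (interior S)" using b D by (subst (asm) mult_le_cancel_left_pos) auto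
  then show ?thesis using q by (simp add: D_def power_divide field_simps)
qed

text \<open>Both averages are compared with the average over a small ball \<open>V\<close> in the
  intersection: an inscribed ball of \<open>S\<close> is contracted towards \<open>x\<close>, which
  keeps it in the convex set \<open>S\<close>, until it also fits into
  \<open>ball x r\<close>.\<close>

lemma average_ball_diff_le:
  assumes wd: "weakly_diff \<Omega> u G" and S: "S \<in> \<T>" "x \<in> S" and B: "ball x r \<subseteq> \<Omega>"
    and \<kappa>: "0 < \<kappa>" "\<kappa> \<le> 1" and r: "\<kappa> * diameter S \<le> r" "r \<le> diameter S"
  shows "\<bar>average (interior S) u - average (ball x r) u\<bar> * vol S \<le>
    2 * (2 * (4 * \<sigma> / \<kappa>)) ^ CARD('n) * diameter S * (mass G (interior S) + mass G (ball x r))" proof -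
  interpret full_simplex S by (rule full_simplex[OF S(1)])
  define D where "D = diameter S"
  define b where "b = vol (cball (0::real^'n) 1)"
  have b: "b > 0" by (simp add: b_def)
  have D: "D > 0" unfolding D_def by (rule diameter_pos)
  have r0: "r > 0" using r(1) \<kappa>(1) D by (auto simp: D_def intro: less_le_trans[OF mult_pos_pos])
  obtain c where c: "cball c (inradius S / 2) \<subseteq> S" using incircle by blast
  \<comment> \<open>Points of \<open>V\<close> are at distance less than
    \<open>t * D + t * D = \<kappa> * D\<close> from \<open>x\<close>, hence less than
    \<open>r\<close>.\<close>
  define t where "t = \<kappa> / 2"
  have t: "0 < t" "t \<le> 1" using \<kappa> by (auto simp: t_def)
  define V where "V = ball (x + t *\<^sub>R (c - x)) (t * (inradius S / 2))"
  have cS: "c \<in> S" using c inradius_pos by auto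
  have VS: "V \<subseteq> S" proof
    fix y assume y: "y \<in> V"
    define z where "z = x + (1 / t) *\<^sub>R (y - x)"
    have "t *\<^sub>R (z - c) = y - (x + t *\<^sub>R (c - x))" using t by (simp add: z_def algebra_simps)
    then have "t * norm (z - c) = norm (y - (x + t *\<^sub>R (c - x)))" using t by (metis abs_of_pos norm_scaleR)
    also have "\<dots> < t * (inradius S / 2)" using y by (simp add: V_def dist_norm norm_minus_commute)
    finally have "z \<in> S" using c t by (auto simp: dist_norm norm_minus_commute)
    then have "(1 - t) *\<^sub>R x + t *\<^sub>R z \<in> S" using convexD_alt[OF convex_T S(2)] t by auto
    moreover have "(1 - t) *\<^sub>R x + t *\<^sub>R z = y" using t by (simp add: z_def algebra_simps)
    ultimately show "y \<in> S" by simp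
  qed
  have VI: "V \<subseteq> interior S" using VS by (rule interior_maximal) (simp add: V_def)
  have VB: "V \<subseteq> ball x r" proof
    fix y assume y: "y \<in> V"
    have "dist x y \<le> norm (t *\<^sub>R (c - x)) + norm (y - (x + t *\<^sub>R (c - x)))"
      using norm_triangle_ineq[of "t *\<^sub>R (c - x)" "y - (x + t *\<^sub>R (c - x))"] by (simp add: dist_norm norm_minus_commute)
    also have "\<dots> < t * D + t * (inradius S / 2)" proof (rule add_le_less_mono)
      have "norm (c - x) \<le> D" unfolding D_def using diameter_bounded_bound[OF bounded_T cS S(2)] by (simp add: dist_norm)
      then show "norm (t *\<^sub>R (c - x)) \<le> t * D" using t by simp
      show "norm (y - (x + t *\<^sub>R (c - x))) < t * (inradius S / 2)" using y by (simp add: V_def dist_norm norm_minus_commute)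
    qed
    also have "\<dots> \<le> t * D + t * D" using inradius_le_diameter inradius_pos t D by (auto simp: D_def)
    also have "\<dots> \<le> r" using r(1) by (simp add: t_def D_def)
    finally show "y \<in> ball x r" by simp
  qed
  \<comment> \<open>The radius of \<open>V\<close> is \<open>\<kappa> * inradius S / 4\<close>,
    which shape regularity bounds below by \<open>q * D\<close>.\<close>
  define q where "q = \<kappa> / (4 * \<sigma>)"
  have q: "q > 0" using \<kappa> \<sigma>_ge_1 by (simp add: q_def)
  have volV: "vol V = b * (t * (inradius S / 2)) ^ CARD('n)" unfolding V_def b_def using t inradius_pos by (intro measure_ball_scale) simp
  have "q * D \<le> t * (inradius S / 2)" using diameter_le_inradius[OF S(1)] \<kappa>(1) \<sigma>_ge_1 by (simp add: q_def t_def D_def field_simps)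
  then have volV_ge: "b * (q * D) ^ CARD('n) \<le> vol V" unfolding volV using b q D by (intro mult_left_mono power_mono) auto
  moreover have "b * (q * D) ^ CARD('n) > 0" using b q D by simp
  ultimately have volV0: "vol V > 0" by linarith
  have m: "vol S > 0" by (rule measure_pos)
  have Vm: "V \<in> lmeasurable" by (simp add: V_def)
  have 1: "\<bar>average V u - average (interior S) u\<bar> * vol S \<le> (1 / q) ^ CARD('n) * (D * mass G (interior S))"
    unfolding D_def using volV_ge by (intro average_subset_simplex_diff_le[OF wd S(1) q Vm VI]) (simp add: b_def D_def)
  have volB: "vol (ball x r) = b * r ^ CARD('n)" unfolding b_def using r0 by (intro measure_ball_scale) simp
  have "\<bar>average V u - average (ball x r) u\<bar> * (vol V * vol (ball x r)) \<le> (2 * r) * (b * (2 * r) ^ CARD('n)) * mass G (ball x r)" unfolding b_def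
  proof (rule average_subset_diff_le[OF wd _ _ B])
    show "dist y z \<le> 2 * r" if "y \<in> ball x r" "z \<in> ball x r" for y z using that dist_triangle3[of y z x] by simp
  qed (use r0 Vm volV0 VB volB b in \<open>auto simp: b_def\<close>)
  then have "(b * r ^ CARD('n)) * (\<bar>average V u - average (ball x r) u\<bar> * vol V) \<le> (b * r ^ CARD('n)) * (2 * r * 2 ^ CARD('n) * mass G (ball x r))"
    unfolding volB by (simp add: power_mult_distrib mult_ac)
  then have "\<bar>average V u - average (ball x r) u\<bar> * vol V \<le> 2 * r * 2 ^ CARD('n) * mass G (ball x r)" using b r0 by (subst (asm) mult_le_cancel_left_pos) auto
  also have "\<dots> \<le> 2 * D * 2 ^ CARD('n) * mass G (ball x r)" using r(2) mass_nonneg by (intro mult_right_mono) (auto simp: D_def)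
  finally have 2: "\<bar>average V u - average (ball x r) u\<bar> * vol S \<le> (1 / q) ^ CARD('n) * (2 * D * 2 ^ CARD('n) * mass G (ball x r))"
    by (rule scale_measure_le[OF S(1) q volV_ge[unfolded b_def D_def]]) simp
  have "\<bar>average (interior S) u - average (ball x r) u\<bar> * vol S \<le>
    \<bar>average V u - average (interior S) u\<bar> * vol S + \<bar>average V u - average (ball x r) u\<bar> * vol S"
    unfolding distrib_right[symmetric] using m by (intro mult_right_mono) auto
  also have "\<dots> \<le> (1 / q) ^ CARD('n) * (D * mass G (interior S)) + (1 / q) ^ CARD('n) * (2 * D * 2 ^ CARD('n) * mass G (ball x r))" using 1 2 by (rule add_mono)
  also have "\<dots> = (1 / q) ^ CARD('n) * D * (1 * mass G (interior S) + (2 * 2 ^ CARD('n)) * mass G (ball x r))" by (simp add: algebra_simps)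
  also have "\<dots> \<le> (1 / q) ^ CARD('n) * D * ((2 * 2 ^ CARD('n)) * mass G (interior S) + (2 * 2 ^ CARD('n)) * mass G (ball x r))"
  proof (intro mult_left_mono add_right_mono mult_right_mono mass_nonneg)
    show "1 \<le> 2 * (2::real) ^ CARD('n)" using one_le_power[of "2::real" "CARD('n)"] by linarith
  qed (use q D in auto)
  also have "\<dots> = 2 * (2 * (4 * \<sigma> / \<kappa>)) ^ CARD('n) * D * (mass G (interior S) + mass G (ball x r))" proof -
    have "1 / q = 4 * \<sigma> / \<kappa>" by (simp add: q_def)
    then show ?thesis unfolding power_mult_distrib[of 2] by (simp add: algebra_simps)
  qed
  finally show ?thesis by (simp add: D_def)
qed

text \<open>The inner bracket is \<open>4 * \<sigma> / \<kappa>\<close> for the ratio \<kappa> of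
  the comparison ball to the simplices. The leading 4 counts two averages with two masses each,
  \<open>M\<^sup>2 * \<gamma>\<close> compares diameters, and \<open>patch_const 1\<close> compares
  volumes.\<close>

definition neighbor_const :: real where
  "neighbor_const = 4 * (2 * (2 * (4 * \<sigma> * (2 * (real CARD('n) + 1) * \<sigma> * (M\<^sup>2 * \<gamma>)\<^sup>2))) ^ CARD('n)) * (M\<^sup>2 * \<gamma>) * patch_const 1"

lemma patch_self: "T \<in> \<T> \<Longrightarrow> T \<in> patch n T" by (simp add: patch_def delta_self)

lemma patch_1I:
  assumes "S \<in> \<T>" "T \<in> \<T>" "x \<in> S" "x \<in> T"
  shows "S \<in> patch 1 T" proof (cases "S = T")
  case False
  then have "(T, S) \<in> neighbors \<T> ^^ 1" using neighborsI[of T S x] assms by auto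
  then have "\<delta> T S \<le> 1" by (rule delta_le)
  then show ?thesis using assms by (simp add: patch_def)
qed (simp add: patch_self assms)

lemma diameter_patch_1:
  assumes "T \<in> \<T>" "S \<in> patch 1 T"
  shows "diameter S \<le> M\<^sup>2 * \<gamma> * diameter T" proof -
  have S: "S \<in> \<T>" "\<delta> T S \<le> 1" using assms(2) by (auto simp: patch_def)
  have "diameter S \<le> M\<^sup>2 * \<gamma> ^ \<delta> T S * diameter T" by (rule diameter_path[OF assms(1) delta_path[OF assms(1) S(1)]])
  also have "\<dots> \<le> M\<^sup>2 * \<gamma> * diameter T" using power_increasing[OF S(2) \<gamma>_ge_1] diameter_pos[OF assms(1)] by (intro mult_right_mono mult_left_mono) auto
  finally show ?thesis .
qed

lemma mass_le_sum:
  assumes G: "integrable lebesgue G" and U: "U \<subseteq> \<Omega>" "open U" and P: "\<P> \<subseteq> \<T>" "U \<subseteq> \<Union>\<P>"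
  shows "mass G U \<le> (\<Sum>S\<in>\<P>. mass G (interior S))" proof -
  have fin: "finite \<P>" using P(1) finite_mesh by (rule finite_subset)
  have N: "integrable lebesgue (\<lambda>x. norm (G x))" by (rule integrable_norm[OF G])
  have i: "integrable lebesgue (\<lambda>x. indicator A x * norm (G x))" if "open A" for A
    using that by (intro integrable_indicator_times N) (simp add: borel_open sets_completionI_sets)
  have "mass G U \<le> (LINT x|lebesgue. (\<Sum>S\<in>\<P>. indicator (interior S) x * norm (G x)))" unfolding mass_def proof (rule integral_mono_AE)
    show "AE x in lebesgue. indicator U x * norm (G x) \<le> (\<Sum>S\<in>\<P>. indicator (interior S) x * norm (G x))" proof (rule AE_I')
      show "\<Omega> - (\<Union>T\<in>\<T>. interior T) \<in> null_sets lebesgue" using negligible_skeleton by (simp add: negligible_iff_null_sets)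
      show "{x \<in> space lebesgue. \<not> (indicator U x * norm (G x) \<le> (\<Sum>S\<in>\<P>. indicator (interior S) x * norm (G x)))} \<subseteq> \<Omega> - (\<Union>T\<in>\<T>. interior T)"
      proof safe
        fix x assume n: "\<not> (indicator U x * norm (G x) \<le> (\<Sum>S\<in>\<P>. indicator (interior S) x * norm (G x)))"
        have nn: "0 \<le> (\<Sum>S\<in>\<P>. indicator (interior S) x * norm (G x))" by (intro sum_nonneg) simp
        then have xU: "x \<in> U" using n by (cases "x \<in> U") auto
        then show "x \<in> \<Omega>" using U(1) by blast
        fix T assume T: "T \<in> \<T>" "x \<in> interior T"
        obtain S where S: "S \<in> \<P>" "x \<in> S" using xU P(2) by blast
        have "T = S" using interior_disjoint[OF T(1) _ T(2) S(2)] S(1) P(1) by blast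
        then have "norm (G x) = indicator (interior S) x * norm (G x)" using T(2) by simp
        also have "\<dots> \<le> (\<Sum>S\<in>\<P>. indicator (interior S) x * norm (G x))" using fin S(1) by (intro member_le_sum) auto
        finally show False using n xU by simp
      qed
    qed
  qed (auto intro!: i U Bochner_Integration.integrable_sum)
  also have "\<dots> = (\<Sum>S\<in>\<P>. mass G (interior S))" unfolding mass_def by (intro Bochner_Integration.integral_sum i) simp
  finally show ?thesis .
qed

text \<open>The two simplices may share as little as a vertex, and their union is not convex in
  general. Both are compared with one ball in \<Omega> around the barycenter of the common face,
  which the simplices of the patch cover.\<close>

lemma average_neighbor_diff_le:
  assumes wd: "weakly_diff \<Omega> u G" and S: "S \<in> \<T>" and T: "T \<in> \<T>" and x0: "x0 \<in> S" "x0 \<in> T" "x0 \<in> \<Omega>"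
  shows "\<bar>average (interior S) u - average (interior T) u\<bar> * vol T \<le>
    neighbor_const * diameter T * (\<Sum>R\<in>patch 1 T. mass G (interior R))" proof -
  define E where "E = vertices S \<inter> vertices T"
  define x where "x = (\<Sum>v\<in>E. (1 / real (card E)) *\<^sub>R v)"
  have E: "E \<noteq> {}" "x \<in> S \<inter> T \<inter> \<Omega>" using Int_simplices_vertices[OF S T x0] by (simp_all add: E_def x_def)
  define L where "L = M\<^sup>2 * \<gamma>"
  have L: "L \<ge> 1" unfolding L_def using M2_ge_1 \<gamma>_ge_1 by (metis mult_mono mult_1 zero_le_one order_trans)
  \<comment> \<open>Every simplex \<open>R\<close> at \<open>x\<close> has \<open>T\<close> in its
    patch, so \<open>diameter T \<le> L * \<sigma> * inradius R\<close>; with this ratio the radius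
    meets the requirement of \<open>star_ball\<close> for all of them.\<close>
  define \<kappa>1 where "\<kappa>1 = 1 / (2 * (real CARD('n) + 1) * \<sigma> * L)"
  have den: "2 * (real CARD('n) + 1) * \<sigma> * L \<ge> 1" proof -
    have "1 * 1 * 1 \<le> 2 * (real CARD('n) + 1) * \<sigma> * L" using \<sigma>_ge_1 L by (intro mult_mono) auto
    then show ?thesis by simp
  qed
  have \<kappa>1: "0 < \<kappa>1" "\<kappa>1 \<le> 1" using den by (auto simp: \<kappa>1_def)
  define r where "r = \<kappa>1 * diameter T"
  have r0: "r > 0" using \<kappa>1 diameter_pos[OF T] by (simp add: r_def)
  have r: "r * (2 * (real CARD('n) + 1)) \<le> inradius R" if R: "R \<in> \<T>" "x \<in> R" for R proof -
    have "T \<in> patch 1 R" using patch_1I[OF T R(1), of x] E R by blast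
    then have "diameter T \<le> L * diameter R" unfolding L_def using R by (intro diameter_patch_1)
    also have "\<dots> \<le> L * (\<sigma> * inradius R)" using diameter_le_inradius[OF R(1)] L by (intro mult_left_mono) auto
    finally have d: "diameter T \<le> L * \<sigma> * inradius R" by simp
    have "r * (2 * (real CARD('n) + 1)) = diameter T / (L * \<sigma>)" proof -
      define k where "k = 2 * (real CARD('n) + 1)"
      have "k > 0" by (simp add: k_def)
      then show ?thesis unfolding r_def \<kappa>1_def k_def[symmetric] by (simp add: mult_ac)
    qed
    also have "\<dots> \<le> inradius R" using d L \<sigma>_ge_1 by (simp add: divide_le_eq mult_ac)
    finally show ?thesis .
  qed
  have B: "ball x r \<subseteq> \<Omega>" "ball x r \<subseteq> \<Union>{S\<in>\<T>. x \<in> S}" using star_ball[OF T _ E(1) x_def _ r0 r] E by (auto simp: E_def)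
  have rD: "r \<le> diameter R" if R: "R \<in> \<T>" "x \<in> R" for R proof -
    have "r * 1 \<le> r * (2 * (real CARD('n) + 1))" using r0 by (intro mult_left_mono) auto
    also have "\<dots> \<le> diameter R" using r[OF R] full_simplex.inradius_le_diameter[OF full_simplex[OF R(1)]] by linarith
    finally show ?thesis by simp
  qed
  \<comment> \<open>The radius is measured in \<open>diameter T\<close>; the further division by
    \<open>L\<close> makes one ratio valid for both \<open>S\<close> and \<open>T\<close>.\<close>
  define \<kappa> where "\<kappa> = \<kappa>1 / L"
  have \<kappa>: "0 < \<kappa>" "\<kappa> \<le> 1" "\<kappa> \<le> \<kappa>1" using \<kappa>1 L by (auto simp: \<kappa>_def field_simps intro: order_trans[OF \<kappa>1(2)])
  have ST: "S \<in> patch 1 T" using patch_1I[OF S T] x0 by blast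
  have DS: "diameter S \<le> L * diameter T" unfolding L_def by (rule diameter_patch_1[OF T ST])
  have \<kappa>S: "\<kappa> * diameter S \<le> r" proof -
    have "\<kappa> * diameter S \<le> \<kappa> * (L * diameter T)" using DS \<kappa> by (intro mult_left_mono) auto
    also have "\<dots> = r" using L by (simp add: \<kappa>_def r_def)
    finally show ?thesis .
  qed
  have \<kappa>T: "\<kappa> * diameter T \<le> r" unfolding r_def using \<kappa>(3) diameter_pos[OF T] by (intro mult_right_mono) auto
  define \<Sigma> where "\<Sigma> = (\<Sum>R\<in>patch 1 T. mass G (interior R))"
  have \<Sigma>0: "\<Sigma> \<ge> 0" unfolding \<Sigma>_def by (intro sum_nonneg mass_nonneg)
  have mB: "mass G (ball x r) \<le> \<Sigma>" unfolding \<Sigma>_def proof (rule mass_le_sum[OF _ B(1) open_ball])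
    show "integrable lebesgue G" using wd by (simp add: weakly_diff_def)
    show "patch 1 T \<subseteq> \<T>" by (auto simp: patch_def)
    show "ball x r \<subseteq> \<Union>(patch 1 T)" proof
      fix y assume "y \<in> ball x r"
      then obtain R where R: "R \<in> \<T>" "x \<in> R" "y \<in> R" using B(2) by blast
      have "R \<in> patch 1 T" using patch_1I[OF R(1) T R(2)] E by blast
      then show "y \<in> \<Union>(patch 1 T)" using R(3) by blast
    qed
  qed
  have mem: "mass G (interior R) \<le> \<Sigma>" if "R \<in> patch 1 T" for R unfolding \<Sigma>_def using that by (intro member_le_sum finite_patch mass_nonneg)
  define c where "c = 2 * (2 * (4 * \<sigma> / \<kappa>)) ^ CARD('n)"
  have c: "c \<ge> 0" using \<sigma>_ge_1 \<kappa> by (auto simp: c_def)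
  let ?a = "\<lambda>R. average (interior R) u" and ?b = "average (ball x r) u"
  have 1: "\<bar>?a T - ?b\<bar> * vol T \<le> c * diameter T * (\<Sigma> + \<Sigma>)" proof -
    have "\<bar>?a T - ?b\<bar> * vol T \<le> c * diameter T * (mass G (interior T) + mass G (ball x r))"
      unfolding c_def using E by (intro average_ball_diff_le[OF wd T _ B(1) \<kappa>(1,2) \<kappa>T] rD[OF T]) auto
    also have "\<dots> \<le> c * diameter T * (\<Sigma> + \<Sigma>)" using c diameter_pos[OF T] by (intro mult_left_mono add_mono mB mem patch_self T) auto
    finally show ?thesis .
  qed
  have "\<bar>?a S - ?b\<bar> * vol S \<le> c * (L * diameter T) * (\<Sigma> + \<Sigma>)" proof -
    have "\<bar>?a S - ?b\<bar> * vol S \<le> c * diameter S * (mass G (interior S) + mass G (ball x r))"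
      unfolding c_def using E by (intro average_ball_diff_le[OF wd S _ B(1) \<kappa>(1,2) \<kappa>S] rD[OF S]) auto
    also have "\<dots> \<le> c * (L * diameter T) * (\<Sigma> + \<Sigma>)" using c DS \<Sigma>0 diameter_pos[OF S] diameter_pos[OF T] L
      by (intro mult_mono add_mono mB mem ST order_refl add_nonneg_nonneg mass_nonneg) auto
    finally show ?thesis .
  qed
  moreover have volTS: "vol T \<le> patch_const 1 * vol S" unfolding patch_const_def by (rule vol_patch_elem[OF S patch_sym[OF T ST]])
  ultimately have 2: "\<bar>?a S - ?b\<bar> * vol T \<le> patch_const 1 * (c * (L * diameter T) * (\<Sigma> + \<Sigma>))" proof -
    assume *: "\<bar>?a S - ?b\<bar> * vol S \<le> c * (L * diameter T) * (\<Sigma> + \<Sigma>)"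
    have "\<bar>?a S - ?b\<bar> * vol T \<le> \<bar>?a S - ?b\<bar> * (patch_const 1 * vol S)" using volTS by (intro mult_left_mono) auto
    also have "\<dots> = patch_const 1 * (\<bar>?a S - ?b\<bar> * vol S)" by simp
    also have "\<dots> \<le> patch_const 1 * (c * (L * diameter T) * (\<Sigma> + \<Sigma>))" using * patch_const_ge_1[of 1] by (intro mult_left_mono) auto
    finally show ?thesis .
  qed
  have pL: "1 \<le> patch_const 1 * L" using patch_const_ge_1[of 1] L by (metis mult_mono mult_1 zero_le_one order_trans)
  have "\<bar>?a S - ?a T\<bar> * vol T \<le> \<bar>?a S - ?b\<bar> * vol T + \<bar>?a T - ?b\<bar> * vol T" unfolding distrib_right[symmetric] by (intro mult_right_mono) auto
  also have "\<dots> \<le> patch_const 1 * (c * (L * diameter T) * (\<Sigma> + \<Sigma>)) + 1 * (c * diameter T * (\<Sigma> + \<Sigma>))" using 1 2 by simp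
  also have "\<dots> \<le> patch_const 1 * (c * (L * diameter T) * (\<Sigma> + \<Sigma>)) + (patch_const 1 * L) * (c * diameter T * (\<Sigma> + \<Sigma>))"
    using pL c diameter_pos[OF T] \<Sigma>0 by (intro add_left_mono mult_right_mono) auto
  also have "\<dots> = 4 * c * L * patch_const 1 * diameter T * \<Sigma>" by (simp add: algebra_simps)
  also have "4 * c * L * patch_const 1 = neighbor_const" proof -
    have "4 * \<sigma> / \<kappa> = 4 * \<sigma> * (2 * (real CARD('n) + 1) * \<sigma> * L\<^sup>2)" by (simp add: \<kappa>_def \<kappa>1_def power2_eq_square)
    then show ?thesis by (simp add: neighbor_const_def c_def L_def)
  qed
  finally show ?thesis by (simp add: \<Sigma>_def)
qed

end

section \<open>A zero trace on a facet bounds the average over the simplex\<close>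

section \<open>Functions with zero trace\<close>

lemma has_real_derivative_line:
  fixes f :: "real^'n \<Rightarrow> real"
  assumes "f differentiable (at x)"
  shows "((\<lambda>t. f (x + t *\<^sub>R w)) has_real_derivative (grad f x \<bullet> w)) (at 0)" proof (rule has_derivative_imp_has_field_derivative)
  have "((\<lambda>t. x + t *\<^sub>R w) has_derivative (\<lambda>t. t *\<^sub>R w)) (at (0::real))" by (auto intro!: derivative_eq_intros)
  moreover have "(f has_derivative (\<lambda>v. grad f x \<bullet> v)) (at (x + 0 *\<^sub>R w))" using has_derivative_grad[OF assms] by simp
  ultimately show "((\<lambda>t. f (x + t *\<^sub>R w)) has_derivative (\<lambda>t. grad f x \<bullet> (t *\<^sub>R w))) (at 0)" by (rule has_derivative_compose)
qed simp

lemma closest_point_hyperplane: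
  fixes \<nu> :: "real^'n"
  assumes "\<nu> \<noteq> 0"
  shows "closest_point {y. \<nu> \<bullet> y = \<beta>} x = x - ((\<nu> \<bullet> x - \<beta>) / (norm \<nu>)\<^sup>2) *\<^sub>R \<nu>" proof -
  let ?p = "x - ((\<nu> \<bullet> x - \<beta>) / (norm \<nu>)\<^sup>2) *\<^sub>R \<nu>"
  have N: "norm \<nu> > 0" using assms by simp
  have p: "\<nu> \<bullet> ?p = \<beta>" using N by (simp add: inner_diff_right power2_norm_eq_inner)
  have d: "dist x ?p * norm \<nu> = \<bar>\<nu> \<bullet> x - \<beta>\<bar>" using N by (simp add: dist_norm power2_eq_square)
  show ?thesis proof (rule closest_point_unique[symmetric])
    show "convex {y. \<nu> \<bullet> y = \<beta>}" by (rule convex_hyperplane)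
    show "closed {y. \<nu> \<bullet> y = \<beta>}" by (rule closed_hyperplane)
    show "?p \<in> {y. \<nu> \<bullet> y = \<beta>}" using p by simp
    show "\<forall>z\<in>{y. \<nu> \<bullet> y = \<beta>}. dist x ?p \<le> dist x z" proof
      fix z assume "z \<in> {y. \<nu> \<bullet> y = \<beta>}"
      then have "\<bar>\<nu> \<bullet> x - \<beta>\<bar> = \<bar>\<nu> \<bullet> (x - z)\<bar>" by (simp add: inner_diff_right)
      also have "\<dots> \<le> norm \<nu> * dist x z" unfolding dist_norm by (rule Cauchy_Schwarz_ineq2)
      finally have "dist x ?p * norm \<nu> \<le> dist x z * norm \<nu>" unfolding d by (simp add: mult.commute)
      then show "dist x ?p \<le> dist x z" using N by (rule mult_right_le_imp_le)
    qed
  qed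
qed

text \<open>Reflecting \<open>f\<close> constantly along the normal into the strip of width \<open>1 / 2\<close> below the hyperplane,
  with a cutoff, replaces the fundamental theorem of calculus along the normal and Fubini's theorem.\<close>
lemma halfspace_directional_derivative_le:
  fixes f :: "real^'n \<Rightarrow> real" and n :: "real^'n" and \<beta> :: real
  assumes n: "norm n = 1" and f: "test_function UNIV f"
  defines "P \<equiv> closest_point {y. n \<bullet> y = \<beta>}"
  shows "ennreal \<bar>LINT x|lebesgue. indicator {x. \<beta> < n \<bullet> x} x * (grad f x \<bullet> n)\<bar> \<le>
      2 * (\<integral>\<^sup>+x. ennreal \<bar>f (P x)\<bar> * indicator {x. dist x (P x) \<le> 1 / 2} x \<partial>lebesgue)" proof -
  define D where "D x = grad f x \<bullet> n" for x
  have fs: "smooth f" by (rule test_functionD(1)[OF f])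
  have f_cont: "continuous_on UNIV f" by (rule smooth_continuous_on[OF fs])
  have Di: "integrable lebesgue D"
    using integrable_continuous_times_test_function[OF open_UNIV continuous_on_const test_function_pderiv[OF f], of 1 n] by (simp add: D_def[abs_def])
  have Dm: "D \<in> borel_measurable lebesgue" by (rule borel_measurable_integrable[OF Di])
  have deriv: "((\<lambda>t. f (x + t *\<^sub>R n)) has_real_derivative D x) (at 0)" for x unfolding D_def by (rule has_real_derivative_line[OF smooth_differentiable[OF fs]])
  obtain L where L: "\<And>x y. \<bar>f x - f y\<bar> \<le> L * dist x y" and L0: "L \<ge> 0" by (rule test_function_lipschitz[OF f]) (rule that)
  obtain B where B: "\<And>x. \<bar>f x\<bar> \<le> B" and "B > 0" by (rule test_function_bounded[OF f]) (rule that)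
  then have B0: "B \<ge> 0" by simp
  have "bounded {x. f x \<noteq> 0}" using f by (intro bounded_subset[OF compact_imp_bounded closure_subset]) (simp add: test_function_def)
  then obtain R where R: "\<And>x. f x \<noteq> 0 \<Longrightarrow> norm x \<le> R" unfolding bounded_iff by blast
  have nn: "n \<bullet> n = 1" "n \<noteq> 0" using n by (auto simp: norm_eq_1)
  define s where "s x = n \<bullet> x - \<beta>" for x
  have P: "P x = x - s x *\<^sub>R n" for x unfolding P_def s_def closest_point_hyperplane[OF nn(2)] using n by simp
  have s_line: "s (x + t *\<^sub>R n) = s x + t" for x t by (simp add: s_def inner_add_right nn)
  have P_line: "P (x + t *\<^sub>R n) = P x" for x t by (simp add: P s_line scaleR_add_left)
  have s_lip: "\<bar>s x - s y\<bar> \<le> dist x y" for x y using Cauchy_Schwarz_ineq2[of n "x - y"] n by (simp add: s_def inner_diff_right dist_norm)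
  have s_cont: "continuous_on UNIV s" unfolding s_def by (intro continuous_intros)
  \<comment> \<open>\<open>proj\<close> pushes points below the hyperplane onto it, and
    \<open>cut\<close> falls linearly from 1 to 0 across the strip. So \<open>E\<close> is
    \<open>f\<close> above, \<open>f (P x) * (1 + 2 * s x)\<close> in the strip, and 0 below; the
    slope 2 is the factor in the claim.\<close>
  define proj where "proj x = x + max 0 (- s x) *\<^sub>R n" for x
  define cut where "cut x = max 0 (min 1 (1 + 2 * s x))" for x
  define E where "E x = f (proj x) * cut x" for x
  have proj_lip: "dist (proj x) (proj y) \<le> 2 * dist x y" for x y proof -
    have "proj x - proj y = (x - y) + (max 0 (- s x) - max 0 (- s y)) *\<^sub>R n" by (simp add: proj_def algebra_simps)
    then have "dist (proj x) (proj y) \<le> norm (x - y) + \<bar>max 0 (- s x) - max 0 (- s y)\<bar>"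
      using norm_triangle_ineq[of "x - y" "(max 0 (- s x) - max 0 (- s y)) *\<^sub>R n"] n by (simp add: dist_norm)
    also have "\<bar>max 0 (- s x) - max 0 (- s y)\<bar> \<le> dist x y" using s_lip[of x y] by linarith
    finally show ?thesis by (simp add: dist_norm)
  qed
  have E_lip: "\<bar>E x - E y\<bar> \<le> (2 * L + 2 * B) * dist x y" for x y proof -
    have "E x - E y = (f (proj x) - f (proj y)) * cut x + f (proj y) * (cut x - cut y)" by (simp add: E_def algebra_simps)
    also have "\<bar>\<dots>\<bar> \<le> \<bar>f (proj x) - f (proj y)\<bar> * \<bar>cut x\<bar> + \<bar>f (proj y)\<bar> * \<bar>cut x - cut y\<bar>"
      unfolding abs_mult[symmetric] by (rule abs_triangle_ineq)
    also have "\<dots> \<le> (L * (2 * dist x y)) * 1 + B * (2 * dist x y)" proof (intro add_mono mult_mono B)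
      show "\<bar>f (proj x) - f (proj y)\<bar> \<le> L * (2 * dist x y)" using L[of "proj x" "proj y"] mult_left_mono[OF proj_lip[of x y] L0] by linarith
      show "\<bar>cut x - cut y\<bar> \<le> 2 * dist x y" using s_lip[of x y] unfolding cut_def by linarith
    qed (use L0 B0 in \<open>auto simp: cut_def\<close>)
    finally show ?thesis by (simp add: algebra_simps)
  qed
  have E_supp: "E x = 0" if "x \<notin> cball 0 (R + 1)" for x proof (rule ccontr)
    assume "E x \<noteq> 0"
    then have "norm (proj x) \<le> R" "max 0 (- s x) \<le> 1" using R by (auto simp: E_def cut_def)
    moreover have "norm x \<le> norm (proj x) + max 0 (- s x)" using norm_triangle_ineq4[of "proj x" "max 0 (- s x) *\<^sub>R n"] n by (simp add: proj_def)
    ultimately show False using that by simp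
  qed
  define D1 where "D1 x = indicator {x. 0 < s x} x * D x" for x
  define D2 where "D2 x = indicator {x. - 1 / 2 < s x \<and> s x < 0} x * (2 * f (P x))" for x
  have s_open: "open {x. c < s x}" "open {x. s x < c}" for c by (intro open_Collect_less s_cont continuous_on_const)+
  have sets: "{x. 0 < s x} \<in> sets lebesgue" "{x. - 1 / 2 < s x \<and> s x < 0} \<in> sets lebesgue" using s_open(1)[of 0] open_Int[OF s_open(1)[of "- 1 / 2"] s_open(2)[of 0]]
    by (simp_all add: Collect_conj_eq borel_open sets_completionI_sets)
  have P_cont: "continuous_on UNIV P" unfolding P by (intro continuous_intros s_cont)
  have fP_cont: "continuous_on UNIV (\<lambda>x. f (P x))" by (rule continuous_on_compose2[OF f_cont P_cont]) simp
  have D1m: "D1 \<in> borel_measurable lebesgue" and D2m: "D2 \<in> borel_measurable lebesgue" unfolding D1_def D2_def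
    by (intro borel_measurable_times borel_measurable_indicator sets Dm continuous_imp_borel_lebesgue continuous_intros fP_cont)+
  have neg: "negligible ({x. n \<bullet> x = \<beta>} \<union> {x. n \<bullet> x = \<beta> - 1 / 2})" using nn by (intro negligible_Un negligible_hyperplane) auto
  have dE: "AE x in lebesgue. ((\<lambda>t. E (x + t *\<^sub>R n)) has_real_derivative D1 x + D2 x) (at 0)" using AE_not_in[OF neg[unfolded negligible_iff_null_sets]]
  proof eventually_elim
    case (elim x)
    then have "s x \<noteq> 0" "s x \<noteq> - 1 / 2" by (auto simp: s_def)
    have line_open: "open {t. c < s x + t}" "open {t. s x + t < c}" for c by (intro open_Collect_less continuous_intros)+
    consider "0 < s x" | "- 1 / 2 < s x" "s x < 0" | "s x < - 1 / 2" using \<open>s x \<noteq> 0\<close> \<open>s x \<noteq> - 1 / 2\<close> by linarith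
    then show ?case proof cases
      case 1
      have D: "D1 x + D2 x = D x" using 1 by (simp add: D1_def D2_def)
      show ?thesis unfolding D by (rule has_field_derivative_transform_within_open[OF deriv line_open(1)[of 0]]) (use 1 in \<open>auto simp: E_def proj_def cut_def s_line\<close>)
    next
      case 2
      have D: "D1 x + D2 x = f (P x) * 2" using 2 by (simp add: D1_def D2_def)
      have d: "((\<lambda>t. f (P x) * (1 + 2 * (s x + t))) has_real_derivative f (P x) * 2) (at 0)" by (auto intro!: derivative_eq_intros)
      show ?thesis unfolding D proof (rule has_field_derivative_transform_within_open[OF d open_Int[OF line_open(1)[of "- 1 / 2"] line_open(2)[of 0]]])
        fix t assume t: "t \<in> {t. - 1 / 2 < s x + t} \<inter> {t. s x + t < 0}"
        have "proj (x + t *\<^sub>R n) = P (x + t *\<^sub>R n)" using t by (simp add: proj_def P s_line scaleR_diff_left scaleR_add_left)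
        then show "f (P x) * (1 + 2 * (s x + t)) = E (x + t *\<^sub>R n)" using t by (simp add: E_def cut_def s_line P_line)
      qed (use 2 in auto)
    next
      case 3
      then have D: "D1 x + D2 x = 0" by (simp add: D1_def D2_def)
      show ?thesis unfolding D by (rule has_field_derivative_transform_within_open[OF DERIV_const line_open(2)[of "- 1 / 2"]])
          (use 3 in \<open>auto simp: E_def cut_def s_line\<close>)
    qed
  qed
  have I: "integrable lebesgue (\<lambda>x. D1 x + D2 x)" "(LINT x|lebesgue. D1 x + D2 x) = 0"
    by (rule lipschitz_integral_directional_derivative[OF E_lip bounded_cball E_supp borel_measurable_add[OF D1m D2m] dE], assumption)+
  have I1: "integrable lebesgue D1" unfolding D1_def by (rule integrable_indicator_times[OF Di sets(1)])
  have I2: "integrable lebesgue D2" using Bochner_Integration.integrable_diff[OF I(1) I1] by simp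
  have "(LINT x|lebesgue. D1 x) = - (LINT x|lebesgue. D2 x)" using I(2) Bochner_Integration.integral_add[OF I1 I2] by simp
  then have "ennreal \<bar>LINT x|lebesgue. D1 x\<bar> = ennreal (norm (LINT x|lebesgue. D2 x))" by simp
  also have "\<dots> \<le> (\<integral>\<^sup>+x. ennreal (norm (D2 x)) \<partial>lebesgue)" by (rule integral_norm_bound_ennreal[OF I2])
  also have "\<dots> \<le> (\<integral>\<^sup>+x. 2 * (ennreal \<bar>f (P x)\<bar> * indicator {x. dist x (P x) \<le> 1 / 2} x) \<partial>lebesgue)" proof (rule nn_integral_mono)
    fix x
    have "dist x (P x) = \<bar>s x\<bar>" using n by (simp add: P dist_norm)
    then show "ennreal (norm (D2 x)) \<le> 2 * (ennreal \<bar>f (P x)\<bar> * indicator {x. dist x (P x) \<le> 1 / 2} x)"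
      by (auto simp: D2_def indicator_def abs_mult ennreal_mult')
  qed
  also have "\<dots> = 2 * (\<integral>\<^sup>+x. ennreal \<bar>f (P x)\<bar> * indicator {x. dist x (P x) \<le> 1 / 2} x \<partial>lebesgue)" proof (rule nn_integral_cmult)
    have "closed {x. dist x (P x) \<le> 1 / 2}" by (intro closed_Collect_le continuous_intros P_cont)
    then have "{x. dist x (P x) \<le> 1 / 2} \<in> sets lebesgue" by (simp add: borel_closed sets_completionI_sets)
    then show "(\<lambda>x. ennreal \<bar>f (P x)\<bar> * indicator {x. dist x (P x) \<le> 1 / 2} x) \<in> borel_measurable lebesgue"
      using continuous_imp_borel_lebesgue[OF fP_cont] by measurable
  qed
  finally show ?thesis by (simp add: D1_def D_def s_def)
qed

lemma Lp_norm_1: "Lp_norm 1 S f = (\<integral>\<^sup>+x. ennreal (norm (f x)) \<partial>lebesgue_on S)" by (auto simp: Lp_norm_def Let_def less_top)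

lemma facet_integral_eq:
  assumes F: "closed F" and P: "continuous_on UNIV (closest_point (affine hull F))"
  shows "facet_integral F f = (\<integral>\<^sup>+x. f (closest_point (affine hull F) x) *
    indicator {x. closest_point (affine hull F) x \<in> F \<and> dist x (closest_point (affine hull F) x) \<le> 1 / 2} x \<partial>lebesgue)" proof -
  let ?P = "closest_point (affine hull F)"
  have "closed {x. dist x (?P x) \<le> 1 / 2}" by (intro closed_Collect_le continuous_intros P)
  moreover have "closed (?P -` F)" by (rule closed_vimage[OF F P])
  ultimately have "closed (?P -` F \<inter> {x. dist x (?P x) \<le> 1 / 2})" by (rule closed_Int[rotated])
  also have "?P -` F \<inter> {x. dist x (?P x) \<le> 1 / 2} = {x. ?P x \<in> F \<and> dist x (?P x) \<le> 1 / 2}" by auto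
  finally have "{x. ?P x \<in> F \<and> dist x (?P x) \<le> 1 / 2} \<in> sets lebesgue" by (simp add: borel_closed sets_completionI_sets)
  then show ?thesis unfolding facet_integral_def Let_def by (subst nn_integral_restrict_space) auto
qed

context graded_mesh
begin

text \<open>The volume of the ball left over by the Poincare inequality is absorbed into
  \<open>vol T\<close> by shape regularity.\<close>

lemma simplex_poincare:
  assumes wd: "weakly_diff \<Omega> u G" and T: "T \<in> \<T>"
  shows "lint T (\<lambda>x. \<bar>u x - average (interior T) u\<bar>) \<le>
    (2 * \<sigma>) ^ CARD('n) * diameter T * mass G (interior T)" proof -
  interpret full_simplex T by (rule full_simplex[OF T])
  define b where "b = vol (cball (0::real^'n) 1)"
  define D where "D = diameter T"
  let ?I = "LINT x|lebesgue. indicator (interior T) x * \<bar>u x - average (interior T) u\<bar>"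
  have D: "D > 0" unfolding D_def by (rule diameter_pos)
  have "?I * vol (interior T) \<le> D * (b * D ^ CARD('n)) * mass G (interior T)" unfolding b_def proof (rule poincare_subset[OF wd _ _ interior_subset_domain[OF T]])
    show "convex (interior T)" by (rule convex_interior[OF convex_T])
    show "dist x y \<le> D" if "x \<in> interior T" "y \<in> interior T" for x y unfolding D_def by (rule diameter_bounded_bound[OF bounded_T]) (use that interior_subset in auto)
  qed (use D measure_pos in \<open>auto simp: measure_interior\<close>)
  also have "b * D ^ CARD('n) \<le> (2 * \<sigma>) ^ CARD('n) * vol T" proof -
    have "b * D ^ CARD('n) = (2 * \<sigma>) ^ CARD('n) * (b * (D / (2 * \<sigma>)) ^ CARD('n))" using \<sigma>_ge_1 by (simp add: power_divide)
    also have "\<dots> \<le> (2 * \<sigma>) ^ CARD('n) * vol T" using vol_ge_diameter[OF T] \<sigma>_ge_1 by (intro mult_left_mono) (auto simp: b_def D_def)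
    finally show ?thesis .
  qed
  finally have "?I * vol T \<le> ((2 * \<sigma>) ^ CARD('n) * D * mass G (interior T)) * vol T"
    using D mass_nonneg[of G "interior T"] by (simp add: measure_interior mult_left_mono mult_right_mono mult_ac)
  then show ?thesis using measure_pos by (simp add: D_def)
qed

text \<open>The power passes from a ball of radius at least
  \<open>diameter T / (8 * d * \<sigma>)\<close> to the volume of \<open>T\<close>;
  \<open>2 * exp (16 / 7)\<close> inverts the lower bound for \<open>r * w x\<close> on that ball.
  In the last bracket the first term is the Poincare term with the supremum of \<open>w\<close>, the
  1 is the gradient term.\<close>

definition zero_trace_const :: real where
  "zero_trace_const = (8 * real CARD('n) * \<sigma>) ^ CARD('n) * (2 * exp (16 / 7) * (48 * (2 * \<sigma>) ^ CARD('n) + 1))"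

text \<open>Let \<open>\<psi>\<close> be a radially decreasing bump at the centre \<open>c\<close> of \<open>F\<close>. Integrating the normal derivative of
  \<open>u \<psi>\<close> over a half ball \<open>H\<close> bounds the mean of \<open>u\<close> with the weight \<open>w = - \<partial>\<psi>/\<partial>n \<ge> 0\<close>, which differs from the
  mean over \<open>T\<close> by a Poincare term.\<close>
lemma average_zero_trace_le:
  fixes u :: "real^'n \<Rightarrow> real"
  defines "W \<equiv> wgrad \<Omega> u"
  assumes u: "integrable (lebesgue_on \<Omega>) u" and W: "integrable (lebesgue_on \<Omega>) W"
    and wd: "weakly_diff \<Omega> (\<lambda>x. indicator \<Omega> x * u x) (\<lambda>x. indicator \<Omega> x *\<^sub>R W x)"
    and T: "T \<in> \<T>" and F: "F facet_of T" and zt: "zero_trace \<Omega> T F u"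
  shows "\<bar>average (interior T) (\<lambda>x. indicator \<Omega> x * u x)\<bar> * vol T \<le> zero_trace_const * diameter T * mass (\<lambda>x. indicator \<Omega> x *\<^sub>R W x) (interior T)"
proof -
  interpret full_simplex T by (rule full_simplex[OF T])
  define ut where "ut x = indicator \<Omega> x * u x" for x
  define Wt where "Wt x = indicator \<Omega> x *\<^sub>R W x" for x
  obtain v where v: "v \<in> vertices T" "vertices T - {v} \<noteq> {}" "F = convex hull (vertices T - {v})"
    "F = {x\<in>T. bary T v x = 0}" "affine hull F = {x. bary T v x = 0}" by (rule facet_vertex[OF F]) (rule that)
  define \<nu> where "\<nu> = bary_grad T v"
  define \<beta> where "\<beta> = \<nu> \<bullet> v - 1"
  have bary: "bary T v x = \<nu> \<bullet> x - \<beta>" for x by (simp add: bary_def \<nu>_def \<beta>_def inner_diff_right)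
  have \<nu>: "\<nu> \<noteq> 0" unfolding \<nu>_def by (rule bary_grad_nonzero[OF v(1,2)])
  define n where "n = (1 / norm \<nu>) *\<^sub>R \<nu>"
  have n1: "norm n = 1" using \<nu> by (simp add: n_def)
  have \<nu>n: "\<nu> = norm \<nu> *\<^sub>R n" using \<nu> by (simp add: n_def)
  define d where "d = real CARD('n)"
  have d: "d \<ge> 1" by (simp add: d_def)
  have cE: "card (vertices T - {v}) = CARD('n)" using vertices_simplex(1,3) v(1) by simp
  define c where "c = (\<Sum>w\<in>vertices T - {v}. (1 / d) *\<^sub>R w)"
  have bary_c: "bary T w c = (if w = v then 0 else 1 / d)" if "w \<in> vertices T" for w
    using barycenter(2)[OF Diff_subset v(2) that] that unfolding cE d_def[symmetric] c_def by simp
  \<comment> \<open>In the ball a coordinate varies by at most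
    \<open>(2 / inradius T) * r = 1 / d\<close>, and at \<open>c\<close> all coordinates but that of
    \<open>v\<close> equal \<open>1 / d\<close>; so the half of the ball above the facet lies in
    \<open>T\<close>.\<close>
  define r where "r = inradius T / (2 * d)"
  have r: "r > 0" using inradius_pos d by (simp add: r_def)
  have rD: "r \<le> diameter T" proof -
    have "r \<le> inradius T" using inradius_pos d by (simp add: r_def divide_le_eq)
    then show ?thesis using inradius_le_diameter by linarith
  qed
  have half: "y \<in> T" if y: "y \<in> ball c r" "\<beta> \<le> \<nu> \<bullet> y" for y unfolding mem_simplex_iff proof
    fix w assume w: "w \<in> vertices T"
    show "0 \<le> bary T w y" proof (cases "w = v")
      case True
      then show ?thesis using y(2) bary[of y] by simp
    next
      case False
      have "\<bar>bary_grad T w \<bullet> (y - c)\<bar> \<le> norm (bary_grad T w) * norm (y - c)" by (rule Cauchy_Schwarz_ineq2)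
      also have "\<dots> \<le> (2 / inradius T) * r" using y(1) inradius_pos norm_bary_grad_le_inradius[OF w] by (intro mult_mono) (auto simp: dist_norm norm_minus_commute)
      also have "\<dots> = 1 / d" using inradius_pos by (simp add: r_def)
      finally show ?thesis using bary_diff[of w y c] bary_c[OF w] False by simp
    qed
  qed
  have \<nu>c: "\<nu> \<bullet> c = \<beta>" using bary_c[OF v(1)] bary[of c] by simp
  have above: "n \<bullet> c < n \<bullet> y \<longleftrightarrow> \<beta> < \<nu> \<bullet> y" for y
    unfolding \<nu>c[symmetric] using \<nu> by (simp add: n_def divide_less_cancel)
  define H where "H = ball c r \<inter> {x. n \<bullet> c < n \<bullet> x}"
  have H_open: "open H" unfolding H_def by (intro open_Int open_ball open_halfspace_gt)
  have HT: "H \<subseteq> interior T" using half above by (intro interior_maximal H_open) (auto simp: H_def less_imp_le)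
  \<comment> \<open>\<open>q\<close> is positive exactly in \<open>ball c r\<close>, so
    \<open>flat 0\<close> of it is a bump with support in the closed ball; its derivative carries
    \<open>flat 2\<close>, the derivative of \<open>flat 0\<close>.\<close>
  define q where "q x = 1 - (1 / r\<^sup>2) * (norm (x - c))\<^sup>2" for x
  have q_smooth: "smooth q" unfolding q_def by (intro smooth_diff smooth_const smooth_mult smooth_dist_square)
  have q_le: "q x \<le> 1" for x by (simp add: q_def)
  have q_ball: "q x > 0 \<longleftrightarrow> x \<in> ball c r" for x proof -
    have "q x > 0 \<longleftrightarrow> (norm (x - c))\<^sup>2 < r\<^sup>2" using r by (simp add: q_def)
    also have "\<dots> \<longleftrightarrow> norm (x - c) < r" using r by (auto intro: power_strict_mono power2_less_imp_less)
    finally show ?thesis by (simp add: dist_norm norm_minus_commute)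
  qed
  define \<psi> where "\<psi> x = flat 0 (q x)" for x
  have \<psi>_out: "flat k (q x) = 0" if "x \<notin> ball c r" for x k using that q_ball[of x] by (simp add: flat_def)
  have \<psi>: "test_function UNIV \<psi>" proof -
    have "{x. \<psi> x \<noteq> 0} \<subseteq> ball c r" using \<psi>_out unfolding \<psi>_def by blast
    then have "bounded {x. \<psi> x \<noteq> 0}" using bounded_ball bounded_subset by blast
    then show ?thesis unfolding test_function_def \<psi>_def[abs_def] by (simp add: compact_closure smooth_flat q_smooth)
  qed
  have \<psi>01: "0 \<le> \<psi> x \<and> \<psi> x \<le> 1" for x by (simp add: \<psi>_def flat_def)
  have \<psi>_grad: "grad \<psi> x \<bullet> n = - (flat 2 (q x) * (2 * ((x - c) \<bullet> n) / r\<^sup>2))" for x proof -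
    have "grad q x = (- 2 / r\<^sup>2) *\<^sub>R (x - c)" proof (rule grad_unique)
      have "((\<lambda>x. 1 - k * ((x - c) \<bullet> (x - c))) has_derivative (\<lambda>v. ((- 2 * k) *\<^sub>R (x - c)) \<bullet> v)) (at x)" for k
        by (auto intro!: derivative_eq_intros simp: inner_commute)
      from this[of "1 / r\<^sup>2"] show "(q has_derivative (\<lambda>v. ((- 2 / r\<^sup>2) *\<^sub>R (x - c)) \<bullet> v)) (at x)"
        by (simp add: q_def[abs_def] power2_norm_eq_inner)
    qed
    then have "grad \<psi> x = flat 2 (q x) *\<^sub>R ((- 2 / r\<^sup>2) *\<^sub>R (x - c))"
      using grad_compose_real[OF smooth_differentiable[OF q_smooth] flat_deriv[of 0]] by (simp add: \<psi>_def[abs_def] numeral_2_eq_2)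
    then show ?thesis by simp
  qed
  define w where "w x = indicator H x * (flat 2 (q x) * (2 * ((x - c) \<bullet> n) / r\<^sup>2))" for x
  have n_diff: "(x - c) \<bullet> n = n \<bullet> x - n \<bullet> c" for x by (subst inner_commute) (rule inner_diff_right)
  \<comment> \<open>\<open>flat_bound\<close> with \<open>fact 4 = 24\<close> bounds
    \<open>flat 2\<close> on the unit interval, and the remaining factor is at most
    \<open>2 * r / r\<^sup>2\<close>.\<close>
  have w: "0 \<le> w x \<and> w x \<le> 48 / r" for x proof (cases "x \<in> H")
    case True
    have "\<bar>(x - c) \<bullet> n\<bar> \<le> norm (x - c)" using Cauchy_Schwarz_ineq2[of "x - c" n] n1 by simp
    moreover have xH: "n \<bullet> c < n \<bullet> x" "norm (x - c) < r" "q x > 0" using True q_ball[of x] by (auto simp: H_def dist_norm norm_minus_commute)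
    moreover have "flat 2 (q x) \<le> 24" using flat_bound[of "q x" 2] power_le_one[of "q x" 2] xH(3) q_le[of x] by (simp add: fact_numeral)
    moreover have "0 \<le> flat 2 (q x)" by (simp add: flat_def)
    ultimately have "0 \<le> flat 2 (q x) * (2 * ((x - c) \<bullet> n)) \<and> flat 2 (q x) * (2 * ((x - c) \<bullet> n)) \<le> 24 * (2 * r)"
      unfolding n_diff by (intro conjI mult_mono mult_nonneg_nonneg) auto
    then show ?thesis using True r by (simp add: w_def field_simps power2_eq_square)
  qed (use r in \<open>simp add: w_def\<close>)
  define I where "I = lebesgue_on (interior T)"
  have Is: "interior T \<in> sets lebesgue" by (simp add: borel_open sets_completionI_sets)
  have cont_I: "f \<in> borel_measurable I" if "continuous_on UNIV f" for f :: "real^'n \<Rightarrow> 'c::euclidean_space"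
    unfolding I_def using that by (intro measurable_restrict_space1 continuous_imp_borel_lebesgue)
  have ind_I: "indicator A \<in> borel_measurable I" if "open A" for A :: "(real^'n) set"
    unfolding I_def using that by (intro measurable_restrict_space1 borel_measurable_indicator) (simp add: borel_open sets_completionI_sets)
  have int_I: "integrable I f" if "integrable (lebesgue_on \<Omega>) f" for f :: "real^'n \<Rightarrow> 'c::euclidean_space"
    unfolding I_def using integrable_simplex[OF that T] Is by (subst integrable_restrict_space) auto
  have LINT_I: "(LINT x|I. f x) = lint T f" for f :: "real^'n \<Rightarrow> real" unfolding I_def using Is by (subst integral_restrict_space) auto
  define p where "p x = indicator H x * \<psi> x" for x
  have p: "\<bar>p x\<bar> \<le> 1" for x using \<psi>01[of x] by (simp add: p_def indicator_def)
  have pm: "p \<in> borel_measurable I" unfolding p_def by (intro borel_measurable_times ind_I H_open cont_I smooth_continuous_on test_functionD(1)[OF \<psi>])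
  have wm: "w \<in> borel_measurable I" unfolding w_def using r
    by (intro borel_measurable_times ind_I H_open cont_I continuous_intros smooth_continuous_on smooth_flat q_smooth) auto
  have uI: "integrable I u" and WI: "integrable I W" by (rule int_I[OF u], rule int_I[OF W])
  have Wp: "integrable I (\<lambda>x. (W x \<bullet> n) * p x)" by (rule integrable_mult_bounded[OF integrable_inner_left[OF WI] pm p])
  have uw: "integrable I (\<lambda>x. u x * w x)" by (rule integrable_mult_bounded[OF uI wm, of "48 / r"]) (use w in auto)
  \<comment> \<open>For smooth \<open>u\<close> this is the normal derivative of
    \<open>u x * \<psi> x\<close> on the half ball; the zero trace will force its integral to
    vanish.\<close>
  define X where "X = (\<lambda>x. (W x \<bullet> n) * p x - u x * w x)"
  have Xi: "integrable I X" unfolding X_def by (intro Bochner_Integration.integrable_diff Wp uw)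
  have F_closed: "closed F" unfolding v(3) by (intro compact_imp_closed finite_imp_compact_convex_hull finite_Diff vertices_simplex(1))
  have F_hyp: "affine hull F = {y. n \<bullet> y = n \<bullet> c}" unfolding v(5) bary \<nu>c[symmetric] using \<nu> by (simp add: n_def)
  define P where "P = closest_point {y. n \<bullet> y = n \<bullet> c}"
  have n0: "n \<noteq> 0" using n1 by auto
  have P_eq: "P x = x - (n \<bullet> x - n \<bullet> c) *\<^sub>R n" for x unfolding P_def closest_point_hyperplane[OF n0] n1 by simp
  have P_cont: "continuous_on UNIV P" unfolding P_eq by (intro continuous_intros)
  have P_in: "n \<bullet> P x = n \<bullet> c" for x unfolding P_eq using n1 by (simp add: inner_diff_right norm_eq_1)
  have P_F: "P x \<in> F" if "P x \<in> ball c r" for x proof -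
    have "P x \<in> affine hull F" unfolding F_hyp using P_in by simp
    then have "\<nu> \<bullet> P x = \<beta>" unfolding v(5) bary by simp
    then show ?thesis using half[OF that] unfolding v(4) bary by simp
  qed
  obtain \<phi> :: "nat \<Rightarrow> real^'n \<Rightarrow> real" where \<phi>: "\<And>k. smooth (\<phi> k)"
    "(\<lambda>k. Lp_norm 1 T (\<lambda>x. \<phi> k x - u x)) \<longlonglongrightarrow> 0"
    "(\<lambda>k. Lp_norm 1 T (\<lambda>x. grad (\<phi> k) x - W x)) \<longlonglongrightarrow> 0"
    "(\<lambda>k. facet_integral F (\<lambda>x. ennreal \<bar>\<phi> k x\<bar>)) \<longlonglongrightarrow> 0" using zt unfolding zero_trace_def W_def by blast
  let ?a = "\<lambda>k. Lp_norm 1 T (\<lambda>x. \<phi> k x - u x)" and ?b = "\<lambda>k. Lp_norm 1 T (\<lambda>x. grad (\<phi> k) x - W x)"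
    and ?f = "\<lambda>k. facet_integral F (\<lambda>x. ennreal \<bar>\<phi> k x\<bar>)"
  \<comment> \<open>\<open>X\<close> is compared with its analogue \<open>Y\<close> for the smooth
    approximant: their difference is bounded by the two \<open>L^1\<close> errors, and the integral
    of \<open>Y\<close> by the facet integral.\<close>
  have main: "ennreal \<bar>LINT x|I. X x\<bar> \<le> (?b k + ennreal (48 / r) * ?a k) + 2 * ?f k" for k proof -
    note \<phi>s = \<phi>(1)[of k]
    define f where "f x = \<phi> k x * \<psi> x" for x
    have f: "test_function UNIV f" unfolding f_def by (rule test_function_mult[OF \<psi> \<phi>s])
    note halfspace_directional_derivative_le[OF n1 f, of "n \<bullet> c", folded P_def]
    also have "2 * (\<integral>\<^sup>+x. ennreal \<bar>f (P x)\<bar> * indicator {x. dist x (P x) \<le> 1 / 2} x \<partial>lebesgue) \<le> 2 * ?f k" proof (rule mult_left_mono)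
      have "(\<integral>\<^sup>+x. ennreal \<bar>f (P x)\<bar> * indicator {x. dist x (P x) \<le> 1 / 2} x \<partial>lebesgue) \<le>
        (\<integral>\<^sup>+x. ennreal \<bar>\<phi> k (P x)\<bar> * indicator {x. P x \<in> F \<and> dist x (P x) \<le> 1 / 2} x \<partial>lebesgue)" proof (rule nn_integral_mono)
        fix x
        show "ennreal \<bar>f (P x)\<bar> * indicator {x. dist x (P x) \<le> 1 / 2} x \<le> ennreal \<bar>\<phi> k (P x)\<bar> * indicator {x. P x \<in> F \<and> dist x (P x) \<le> 1 / 2} x"
        proof (cases "P x \<in> ball c r")
          case True
          have "\<bar>f (P x)\<bar> \<le> \<bar>\<phi> k (P x)\<bar>"
            using mult_left_mono[of "\<psi> (P x)" 1 "\<bar>\<phi> k (P x)\<bar>"] \<psi>01[of "P x"] by (simp add: f_def abs_mult)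
          then show ?thesis using P_F[OF True] by (auto simp: indicator_def intro: ennreal_leI)
        qed (simp add: f_def \<psi>_def \<psi>_out)
      qed
      also have "\<dots> = ?f k" using P_cont by (subst facet_integral_eq[OF F_closed]) (simp_all add: P_def F_hyp)
      finally show "(\<integral>\<^sup>+x. ennreal \<bar>f (P x)\<bar> * indicator {x. dist x (P x) \<le> 1 / 2} x \<partial>lebesgue) \<le> ?f k" .
    qed simp
    finally have D_le: "ennreal \<bar>LINT x|lebesgue. indicator {x. n \<bullet> c < n \<bullet> x} x * (grad f x \<bullet> n)\<bar> \<le> 2 * ?f k" .
    define Y where "Y = (\<lambda>x. (grad (\<phi> k) x \<bullet> n) * p x - \<phi> k x * w x)"
    have YD: "indicator (interior T) x * Y x = indicator {x. n \<bullet> c < n \<bullet> x} x * (grad f x \<bullet> n)" for x proof -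
      have "grad f x \<bullet> n = \<psi> x * (grad (\<phi> k) x \<bullet> n) + \<phi> k x * (grad \<psi> x \<bullet> n)"
        using grad_mult[OF smooth_differentiable[OF \<phi>s] smooth_differentiable[OF test_functionD(1)[OF \<psi>]]] by (simp add: f_def[abs_def] inner_add_left)
      then show ?thesis using HT \<psi>_out[of x] unfolding \<psi>_grad by (auto simp: Y_def p_def w_def H_def \<psi>_def indicator_def)
    qed
    have Yi: "integrable I Y" proof -
      have "integrable lebesgue (\<lambda>x. indicator {x. n \<bullet> c < n \<bullet> x} x * (grad f x \<bullet> n))"
        using integrable_continuous_times_test_function[OF open_UNIV continuous_on_const test_function_pderiv[OF f], of 1 n]
        by (intro integrable_indicator_times) (simp_all add: borel_open open_halfspace_gt sets_completionI_sets)
      then show ?thesis unfolding I_def using Is by (subst integrable_restrict_space) (simp_all add: YD)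
    qed
    have Y: "(LINT x|I. Y x) = (LINT x|lebesgue. indicator {x. n \<bullet> c < n \<bullet> x} x * (grad f x \<bullet> n))" unfolding LINT_I YD ..
    have int_T: "(\<integral>\<^sup>+x. ennreal (norm (g x)) \<partial>I) \<le> Lp_norm 1 T g" for g :: "real^'n \<Rightarrow> 'c::euclidean_space"
      unfolding Lp_norm_1 I_def using measurable_T Is interior_subset[of T]
      by (subst (1 2) nn_integral_restrict_space) (auto simp: fmeasurableD indicator_def intro!: nn_integral_mono)
    have m: "(\<lambda>x. norm (grad (\<phi> k) x - W x)) \<in> borel_measurable I" "(\<lambda>x. norm (\<phi> k x - u x)) \<in> borel_measurable I"
      by (intro measurable_compose[OF _ borel_measurable_norm] borel_measurable_diff cont_I continuous_on_grad smooth_continuous_on \<phi>s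
          borel_measurable_integrable[OF WI] borel_measurable_integrable[OF uI])+
    have "ennreal \<bar>LINT x|I. X x - Y x\<bar> \<le> (\<integral>\<^sup>+x. ennreal (norm (X x - Y x)) \<partial>I)"
      using integral_norm_bound_ennreal[OF Bochner_Integration.integrable_diff[OF Xi Yi]] by simp
    also have "\<dots> \<le> (\<integral>\<^sup>+x. ennreal (norm (grad (\<phi> k) x - W x)) + ennreal (48 / r) * ennreal (norm (\<phi> k x - u x)) \<partial>I)"
    proof (rule nn_integral_mono)
      fix x
      have "X x - Y x = - ((grad (\<phi> k) x - W x) \<bullet> n) * p x + (\<phi> k x - u x) * w x" by (simp add: X_def Y_def inner_diff_left algebra_simps)
      also have "\<bar>\<dots>\<bar> \<le> \<bar>(grad (\<phi> k) x - W x) \<bullet> n\<bar> * \<bar>p x\<bar> + \<bar>\<phi> k x - u x\<bar> * \<bar>w x\<bar>"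
        unfolding abs_mult[symmetric] by (rule order_trans[OF abs_triangle_ineq]) simp
      also have "\<dots> \<le> norm (grad (\<phi> k) x - W x) * 1 + \<bar>\<phi> k x - u x\<bar> * (48 / r)"
        using Cauchy_Schwarz_ineq2[of "grad (\<phi> k) x - W x" n] n1 w[of x] p[of x] by (intro add_mono mult_mono) auto
      finally have "ennreal (norm (X x - Y x)) \<le> ennreal (norm (grad (\<phi> k) x - W x) + (48 / r) * norm (\<phi> k x - u x))" by (intro ennreal_leI) (simp add: mult.commute)
      then show "ennreal (norm (X x - Y x)) \<le> ennreal (norm (grad (\<phi> k) x - W x)) + ennreal (48 / r) * ennreal (norm (\<phi> k x - u x))"
        using r by (simp add: ennreal_plus ennreal_mult'[symmetric])
    qed
    also have "\<dots> = (\<integral>\<^sup>+x. ennreal (norm (grad (\<phi> k) x - W x)) \<partial>I) + ennreal (48 / r) * (\<integral>\<^sup>+x. ennreal (norm (\<phi> k x - u x)) \<partial>I)"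
      using m by (simp add: nn_integral_add nn_integral_cmult)
    also have "\<dots> \<le> ?b k + ennreal (48 / r) * ?a k" by (intro add_mono mult_left_mono int_T) auto
    finally have XY: "ennreal \<bar>LINT x|I. X x - Y x\<bar> \<le> ?b k + ennreal (48 / r) * ?a k" .
    have "(LINT x|I. X x) = (LINT x|I. X x - Y x) + (LINT x|I. Y x)" using Bochner_Integration.integral_diff[OF Xi Yi] by simp
    then have "ennreal \<bar>LINT x|I. X x\<bar> \<le> ennreal (\<bar>LINT x|I. X x - Y x\<bar> + \<bar>LINT x|I. Y x\<bar>)" by (intro ennreal_leI) (simp add: abs_triangle_ineq)
    also have "\<dots> \<le> (?b k + ennreal (48 / r) * ?a k) + 2 * ?f k" using add_mono[OF XY D_le] by (simp add: ennreal_plus Y)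
    finally show ?thesis .
  qed
  have "(\<lambda>k. (?b k + ennreal (48 / r) * ?a k) + 2 * ?f k) \<longlonglongrightarrow>
    (0 + ennreal (48 / r) * 0) + 2 * 0" by (intro tendsto_add ennreal_tendsto_cmult \<phi>) auto
  then have "ennreal \<bar>LINT x|I. X x\<bar> \<le> 0" using main by (intro LIMSEQ_le_const) auto
  then have uw_eq: "(LINT x|I. u x * w x) = (LINT x|I. (W x \<bullet> n) * p x)" using Bochner_Integration.integral_diff[OF Wp uw] by (simp add: X_def)
  define a where "a = average (interior T) ut"
  define m where "m = mass Wt (interior T)"
  define \<omega> where "\<omega> = (LINT x|I. w x)"
  have wi: "integrable I w" using integrable_mult_bounded[OF int_I[OF finite_measure.integrable_const[OF finite_measure_domain, of 1]] wm, of "48 / r"] w by simp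
  have ut: "ut x = u x" and Wt: "Wt x = W x" if "x \<in> interior T" for x using that interior_subset_domain[OF T] by (auto simp: ut_def Wt_def)
  \<comment> \<open>The integral of \<open>u x * w x\<close> is now bounded by the gradient, and
    replacing \<open>u\<close> by its average \<open>a\<close> costs a Poincare term. A lower bound
    for \<open>\<omega>\<close> then bounds \<open>a\<close>.\<close>
  have "a * \<omega> = (LINT x|I. (a - u x) * w x) + (LINT x|I. u x * w x)" proof -
    have "(LINT x|I. (a - u x) * w x) = (LINT x|I. a * w x - u x * w x)" by (simp add: left_diff_distrib)
    also have "\<dots> = (LINT x|I. a * w x) - (LINT x|I. u x * w x)" by (intro Bochner_Integration.integral_diff integrable_mult_right wi uw)
    finally show ?thesis by (simp add: \<omega>_def)
  qed
  moreover have "\<bar>LINT x|I. (a - u x) * w x\<bar> \<le> (48 / r) * ((2 * \<sigma>) ^ CARD('n) * diameter T * m)" proof -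
    have i1: "integrable I (\<lambda>x. \<bar>u x - a\<bar>)"
      by (intro integrable_abs Bochner_Integration.integrable_diff uI int_I finite_measure.integrable_const[OF finite_measure_domain])
    have "\<bar>LINT x|I. (a - u x) * w x\<bar> \<le> (LINT x|I. (48 / r) * \<bar>u x - a\<bar>)" proof (rule order_trans[OF integral_abs_bound integral_mono])
      show "integrable I (\<lambda>x. \<bar>(a - u x) * w x\<bar>)"
        unfolding left_diff_distrib by (intro integrable_abs Bochner_Integration.integrable_diff integrable_mult_right wi uw)
      show "\<bar>(a - u x) * w x\<bar> \<le> (48 / r) * \<bar>u x - a\<bar>" for x
        unfolding abs_mult using w[of x] mult_right_mono[of "w x" "48 / r" "\<bar>u x - a\<bar>"] by (simp add: abs_minus_commute mult.commute)
    qed (use i1 in simp)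
    also have "\<dots> = (48 / r) * lint T (\<lambda>x. \<bar>ut x - a\<bar>)" proof -
      have "(LINT x|I. \<bar>u x - a\<bar>) = lint T (\<lambda>x. \<bar>ut x - a\<bar>)"
        unfolding LINT_I by (intro Bochner_Integration.integral_cong refl) (auto simp: ut indicator_def)
      then show ?thesis by simp
    qed
    also have "\<dots> \<le> (48 / r) * ((2 * \<sigma>) ^ CARD('n) * diameter T * m)"
      unfolding a_def m_def using r wd by (intro mult_left_mono simplex_poincare T) (simp_all add: ut_def[abs_def] Wt_def[abs_def])
    finally show ?thesis .
  qed
  moreover have "\<bar>LINT x|I. u x * w x\<bar> \<le> m" proof -
    have "\<bar>LINT x|I. (W x \<bullet> n) * p x\<bar> \<le> (LINT x|I. norm (W x))" proof (rule order_trans[OF integral_abs_bound integral_mono])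
      show "\<bar>(W x \<bullet> n) * p x\<bar> \<le> norm (W x)" for x using mult_mono[OF Cauchy_Schwarz_ineq2[of "W x" n] p[of x]] n1 by (simp add: abs_mult)
    qed (use Wp WI in auto)
    also have "\<dots> = m" proof -
      have "(LINT x|I. norm (W x)) = m" unfolding LINT_I m_def mass_def by (intro Bochner_Integration.integral_cong refl) (auto simp: Wt indicator_def)
      then show ?thesis by simp
    qed
    finally show ?thesis by (simp add: uw_eq)
  qed
  ultimately have "\<bar>a\<bar> * \<bar>\<omega>\<bar> \<le> (48 / r) * ((2 * \<sigma>) ^ CARD('n) * diameter T * m) + m" unfolding abs_mult[symmetric] by linarith
  then have "r * (\<bar>a\<bar> * \<bar>\<omega>\<bar>) \<le> r * ((48 / r) * ((2 * \<sigma>) ^ CARD('n) * diameter T * m) + m)" using r by (intro mult_left_mono) auto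
  also have "\<dots> \<le> (48 * (2 * \<sigma>) ^ CARD('n) + 1) * (diameter T * m)" using rD r mult_right_mono[OF rD, of m] mass_nonneg[of Wt] by (simp add: m_def algebra_simps)
  finally have a\<omega>: "r * (\<bar>a\<bar> * \<bar>\<omega>\<bar>) \<le> (48 * (2 * \<sigma>) ^ CARD('n) + 1) * (diameter T * m)" .
  \<comment> \<open>A ball away from both the hyperplane and the sphere: there
    \<open>norm (x - c) \<le> 3 / 4 * r\<close>, hence \<open>q x \<ge> 7 / 16\<close>, and the
    normal component of \<open>x - c\<close> is at least \<open>r / 4\<close>.\<close>
  define V where "V = ball (c + (r / 2) *\<^sub>R n) (r / 4)"
  define l where "l = exp (- 16 / 7) / (2 * r)"
  have V: "x \<in> H \<and> l \<le> w x" if x: "x \<in> V" for x proof -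
    define y where "y = x - (c + (r / 2) *\<^sub>R n)"
    have y: "norm y < r / 4" using x by (simp add: V_def y_def dist_norm norm_minus_commute)
    have xc: "x - c = (r / 2) *\<^sub>R n + y" by (simp add: y_def)
    have "norm (x - c) \<le> norm ((r / 2) *\<^sub>R n) + norm y" unfolding xc by (rule norm_triangle_ineq)
    then have 1: "norm (x - c) \<le> 3 / 4 * r" using y r n1 by simp
    have "(x - c) \<bullet> n = r / 2 + y \<bullet> n" unfolding xc inner_add_left using n1 by (simp add: norm_eq_1)
    moreover have "\<bar>y \<bullet> n\<bar> \<le> norm y" using Cauchy_Schwarz_ineq2[of y n] n1 by simp
    ultimately have 2: "r / 4 \<le> (x - c) \<bullet> n" using y by linarith
    have xH: "x \<in> H" using 1 2 r unfolding H_def n_diff by (simp add: dist_norm norm_minus_commute)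
    have "(norm (x - c))\<^sup>2 \<le> (3 / 4 * r)\<^sup>2" using 1 by (intro power_mono) auto
    then have q7: "7 / 16 \<le> q x" using r by (simp add: q_def power2_eq_square field_simps)
    have "exp (- 16 / 7) \<le> exp (- 1 / q x)" using q7 by (simp add: field_simps)
    also have "\<dots> \<le> flat 2 (q x)" using q7 q_le[of x] power_le_one[of "q x" 2] by (simp add: flat_def le_divide_eq mult_left_le)
    finally have "exp (- 16 / 7) * (2 * (r / 4) / r\<^sup>2) \<le> flat 2 (q x) * (2 * ((x - c) \<bullet> n) / r\<^sup>2)"
      using 2 r by (intro mult_mono divide_right_mono) (auto simp: flat_def)
    then show ?thesis using xH r by (simp add: w_def l_def power2_eq_square)
  qed
  have Vm: "V \<in> lmeasurable" by (simp add: V_def)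
  have "l * vol V = (LINT x|lebesgue. indicator V x * l)" by simp
  also have "\<dots> \<le> lint T w" proof (rule integral_mono)
    show "integrable lebesgue (\<lambda>x. indicator (interior T) x * w x)" using wi Is unfolding I_def by (subst (asm) integrable_restrict_space) auto
    show "integrable lebesgue (\<lambda>x. indicator V x * l)" using Vm by (intro integrable_mult_left) (simp add: lmeasurable_iff_integrable)
    show "indicator V x * l \<le> indicator (interior T) x * w x" for x using V[of x] w[of x] HT by (auto simp: indicator_def)
  qed
  also have "\<dots> = \<omega>" unfolding \<omega>_def LINT_I ..
  finally have "r * (\<bar>a\<bar> * (l * vol V)) \<le> r * (\<bar>a\<bar> * \<bar>\<omega>\<bar>)" using r by (intro mult_left_mono) auto
  also note a\<omega>
  also have "r * (\<bar>a\<bar> * (l * vol V)) = exp (- 16 / 7) / 2 * (\<bar>a\<bar> * vol V)" using r by (simp add: l_def)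
  finally have "2 * exp (16 / 7) * (exp (- 16 / 7) / 2 * (\<bar>a\<bar> * vol V)) \<le> 2 * exp (16 / 7) * ((48 * (2 * \<sigma>) ^ CARD('n) + 1) * (diameter T * m))"
    by (rule mult_left_mono) simp
  then have aV: "\<bar>a\<bar> * vol V \<le> (2 * exp (16 / 7) * (48 * (2 * \<sigma>) ^ CARD('n) + 1)) * (diameter T * m)" by (simp add: mult.assoc exp_minus field_simps)
  define \<kappa> where "\<kappa> = 1 / (8 * d * \<sigma>)"
  have \<kappa>: "\<kappa> > 0" using d \<sigma>_ge_1 by (simp add: \<kappa>_def)
  have "\<kappa> * diameter T \<le> r / 4" using diameter_le_inradius[OF T] d \<sigma>_ge_1 by (simp add: \<kappa>_def r_def field_simps)
  then have "vol (cball (0::real^'n) 1) * (\<kappa> * diameter T) ^ CARD('n) \<le> vol V"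
    unfolding V_def using r \<kappa> diameter_pos by (subst measure_ball_scale) (auto intro!: mult_left_mono power_mono)
  from scale_measure_le[OF T \<kappa> this aV] have "\<bar>a\<bar> * vol T \<le> (1 / \<kappa>) ^ CARD('n) * ((2 * exp (16 / 7) * (48 * (2 * \<sigma>) ^ CARD('n) + 1)) * (diameter T * m))" by simp
  then show ?thesis by (simp add: a_def m_def ut_def[abs_def] Wt_def[abs_def] \<kappa>_def d_def zero_trace_const_def mult_ac)
qed

end

section \<open>A continuous piecewise affine function with the boundary condition, built from
  averages\<close>

section \<open>Quasi-interpolation\<close>

context triangulated
begin

lemma bary_eq:
  assumes S: "S \<in> \<T>" and T: "T \<in> \<T>" and x: "x \<in> S" "x \<in> T" and z: "z \<in> vertices T" "z \<in> vertices S"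
  shows "bary T z x = bary S z x" proof -
  interpret S: full_simplex S by (rule full_simplex[OF S])
  note b = bary_common_vertices[OF S T x]
  let ?E = "vertices S \<inter> vertices T"
  have "bary S z x = (\<Sum>w\<in>?E. bary T w x * bary S z w)" using S.bary_affine_combination[OF b(2), of z "\<lambda>w. w"] b(3) by simp
  also have "\<dots> = (\<Sum>w\<in>?E. if w = z then bary T z x else 0)" using z(2) by (intro sum.cong refl) (auto simp: S.bary_vertex)
  also have "\<dots> = bary T z x" using z S.vertices_simplex(1) by simp
  finally show ?thesis by simp
qed

text \<open>Simplices at \<open>z\<close> that share a point of \<Omega>. Continuity couples their
  nodal values there, so these must be constant along the relation but may differ between its
  classes.\<close>

definition node_rel :: "real^'n \<Rightarrow> ((real^'n) set \<times> (real^'n) set) set" where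
  "node_rel z = {(S, S'). S \<in> \<T> \<and> S' \<in> \<T> \<and> z \<in> S \<and> z \<in> S' \<and> S \<inter> S' \<inter> \<Omega> \<noteq> {}}"

definition node_star :: "real^'n \<Rightarrow> (real^'n) set \<Rightarrow> (real^'n) set set" where
  "node_star z T = {S. (T, S) \<in> (node_rel z)\<^sup>*}"

text \<open>The simplices at a node \<open>z\<close> of the boundary need not be connected through \<open>\<Omega>\<close> (slits), so
  nodal values are attached to the components of the star of \<open>z\<close>.\<close>
definition node_val :: "((real^'n) set \<Rightarrow> real) \<Rightarrow> real^'n \<Rightarrow> (real^'n) set \<Rightarrow> real" where
  "node_val a z T = (if \<exists>S\<in>node_star z T. \<exists>F. F facet_of S \<and> z \<in> F \<and> F \<subseteq> \<Gamma> then 0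
     else a (SOME S. S \<in> node_star z T))"

definition nodal :: "((real^'n) set \<Rightarrow> real) \<Rightarrow> (real^'n) set \<Rightarrow> real^'n \<Rightarrow> real" where
  "nodal a T x = (\<Sum>z\<in>vertices T. bary T z x * node_val a z T)"

text \<open>Inside \<Omega> the choice of the simplex is immaterial by \<open>nodal_eq\<close>;
  outside, the value is arbitrary.\<close>

definition interpolant :: "((real^'n) set \<Rightarrow> real) \<Rightarrow> real^'n \<Rightarrow> real" where
  "interpolant a x = nodal a (SOME T. T \<in> \<T> \<and> x \<in> T) x"

lemma node_rel_sym: "sym (node_rel z)" unfolding sym_def node_rel_def by (auto simp: Int_commute)

lemma node_star_eq:
  assumes "(S, T) \<in> node_rel z"
  shows "node_star z S = node_star z T" proof -
  have "(T, S) \<in> node_rel z" using assms node_rel_sym by (rule symD[rotated])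
  then show ?thesis using assms unfolding node_star_def by (auto intro: converse_rtrancl_into_rtrancl)
qed

lemma node_star_mesh: "T \<in> \<T> \<Longrightarrow> z \<in> T \<Longrightarrow> S \<in> node_star z T \<Longrightarrow> S \<in> \<T> \<and> z \<in> S"
  by (drule node_star_def[THEN equalityD1, THEN subsetD], drule CollectD, erule rtranclE)
    (simp_all add: node_rel_def)

text \<open>Only common vertices have a nonzero coordinate at \<open>x\<close>, their coordinates
  agree in both simplices, and \<open>x\<close> itself relates \<open>S\<close> and \<open>T\<close>
  at each of these vertices, so the nodal values agree as well.\<close>

lemma nodal_eq:
  assumes S: "S \<in> \<T>" and T: "T \<in> \<T>" and x: "x \<in> S" "x \<in> T" "x \<in> \<Omega>"
  shows "nodal a T x = nodal a S x" proof -
  interpret full_simplex T by (rule full_simplex[OF T])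
  interpret S: full_simplex S by (rule full_simplex[OF S])
  let ?E = "vertices S \<inter> vertices T"
  have "nodal a T x = (\<Sum>z\<in>?E. bary T z x * node_val a z T)" unfolding nodal_def using bary_common_vertices(1)[OF S T x(1,2)]
    by (intro sum.mono_neutral_right vertices_simplex(1)) auto
  also have "\<dots> = (\<Sum>z\<in>?E. bary S z x * node_val a z S)" proof (rule sum.cong[OF refl])
    fix z assume z: "z \<in> ?E"
    then have "z \<in> T" "z \<in> S" using vertices_subset S.vertices_subset by auto
    then have r: "(T, S) \<in> node_rel z" using S T x by (auto simp: node_rel_def)
    have "node_val a z T = node_val a z S" by (simp only: node_val_def node_star_eq[OF r])
    then show "bary T z x * node_val a z T = bary S z x * node_val a z S" using bary_eq[OF S T x(1,2)] z by simp
  qed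
  also have "\<dots> = nodal a S x" unfolding nodal_def using bary_common_vertices(1)[OF T S x(2,1)] by (intro sum.mono_neutral_left S.vertices_simplex(1)) auto
  finally show ?thesis .
qed

lemma interpolant_eq:
  assumes T: "T \<in> \<T>" and x: "x \<in> T" "x \<in> \<Omega>"
  shows "interpolant a x = nodal a T x" proof -
  have "(SOME T. T \<in> \<T> \<and> x \<in> T) \<in> \<T> \<and> x \<in> (SOME T. T \<in> \<T> \<and> x \<in> T)" by (rule someI[of _ T]) (use T x in blast)
  then show ?thesis unfolding interpolant_def using nodal_eq[OF T _ x(1) _ x(2)] by blast
qed

lemma poly_fun_nodal:
  assumes T: "T \<in> \<T>" and K: "K \<ge> 1"
  shows "poly_fun K (nodal a T)" proof -
  have "poly_fun K (\<lambda>x. \<Sum>z\<in>vertices T. node_val a z T * bary T z x)" by (intro poly_fun_sum poly_fun_cmult full_simplex.poly_fun_bary[OF full_simplex[OF T]] K)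
  then show ?thesis by (simp add: nodal_def[abs_def] mult.commute)
qed

lemma eventually_mem_simplex:
  "\<forall>\<^sub>F y in nhds x. \<forall>T\<in>\<T>. y \<in> T \<longrightarrow> x \<in> T" proof -
  have "\<forall>\<^sub>F y in nhds x. y \<in> T \<longrightarrow> x \<in> T" if T: "T \<in> \<T>" for T proof (cases "x \<in> T")
    case False
    have "open (- T)" using full_simplex.closed_T[OF full_simplex[OF T]] by (simp add: open_Compl)
    then have "\<forall>\<^sub>F y in nhds x. y \<in> - T" using False by (intro eventually_nhds_in_open) auto
    then show ?thesis by eventually_elim simp
  qed simp
  then show ?thesis using finite_mesh by (simp add: eventually_ball_finite)
qed

text \<open>Near \<open>x\<close> only the finitely many polynomials of the simplices at \<open>x\<close> occur.\<close>
lemma tendsto_interpolant: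
  assumes l: "\<And>T. T \<in> \<T> \<Longrightarrow> x \<in> T \<Longrightarrow> nodal a T x = l"
  shows "(interpolant a \<longlongrightarrow> l) (at x within \<Omega>)" proof (rule tendstoI)
  fix e :: real assume e: "e > 0"
  have "\<forall>\<^sub>F y in nhds x. dist (nodal a T y) l < e" if T: "T \<in> \<T>" "x \<in> T" for T proof -
    have "continuous_on UNIV (nodal a T)" by (rule smooth_continuous_on[OF smooth_poly_fun[OF poly_fun_nodal[OF T(1), of 1]]]) simp
    then have "(nodal a T \<longlongrightarrow> nodal a T x) (nhds x)" by (simp add: continuous_on_eq_continuous_at isCont_def tendsto_nhds_iff)
    then show ?thesis using e tendstoD unfolding l[OF T] by blast
  qed
  then have "\<forall>\<^sub>F y in nhds x. \<forall>T\<in>{T\<in>\<T>. x \<in> T}. dist (nodal a T y) l < e" using finite_mesh by (intro eventually_ball_finite) auto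
  then have "\<forall>\<^sub>F y in nhds x. y \<in> \<Omega> \<longrightarrow> dist (interpolant a y) l < e" using eventually_mem_simplex[of x] proof eventually_elim
    case (elim y)
    show ?case proof
      assume y: "y \<in> \<Omega>"
      then obtain T where T: "T \<in> \<T>" "y \<in> T" using domain_subset by blast
      then show "dist (interpolant a y) l < e" using elim interpolant_eq[OF T y] by auto
    qed
  qed
  then show "\<forall>\<^sub>F y in at x within \<Omega>. dist (interpolant a y) l < e" by (auto simp: eventually_at_filter elim: eventually_mono)
qed

text \<open>A face of \<open>F\<close> that contains a relative interior point of \<open>F\<close>
  is all of \<open>F\<close>. So every simplex that reaches such a point has \<open>F\<close> as a
  facet, and vanishing at the vertices of \<open>F\<close> suffices for the boundary
  condition.\<close>

lemma boundary_face_subset: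
  assumes F: "F \<in> boundary_faces \<Omega> \<T>" and x: "x \<in> rel_interior F" and T: "T \<in> \<T>" "x \<in> T"
  shows "F facet_of T" proof -
  obtain S where S: "S \<in> \<T>" "F facet_of S" using F by (auto simp: boundary_faces_def)
  have xF: "x \<in> F" using x rel_interior_subset by blast
  have FS: "F face_of S" "F \<subseteq> S" using S(2) facet_of_imp_face_of face_of_imp_subset by blast+
  have "(F \<inter> (S \<inter> T)) face_of S" by (rule face_of_Int[OF FS(1) face_Int[OF S(1) T(1)]])
  then have "(F \<inter> T) face_of F" using FS(2) face_of_subset[of "F \<inter> T" S F] by (simp add: Int_absorb1 Int_assoc[symmetric] inf.absorb1)
  moreover have "(F \<inter> T) \<inter> rel_interior F \<noteq> {}" using x xF T(2) by blast
  ultimately have "F \<subseteq> F \<inter> T" using subset_of_face_of[of "F \<inter> T" F F] by auto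
  then have "F \<inter> T = F" by blast
  then have "F face_of T" using boundary_face_Int_face[OF F T(1)] by simp
  moreover have "aff_dim S = aff_dim T" using full_simplex.aff_dim_T[OF full_simplex] S(1) T(1) by simp
  ultimately show ?thesis using S(2) by (simp add: facet_of_def)
qed

lemma interpolant_in:
  assumes K: "K \<ge> 1"
  shows "interpolant a \<in> LK K" proof -
  have "continuous_on \<Omega> (interpolant a)" unfolding continuous_on_def proof
    fix x assume x: "x \<in> \<Omega>"
    show "(interpolant a \<longlongrightarrow> interpolant a x) (at x within \<Omega>)" using interpolant_eq x by (intro tendsto_interpolant) simp
  qed
  moreover have "(interpolant a \<longlongrightarrow> 0) (at x within \<Omega>)"
    if F: "F \<in> boundary_faces \<Omega> \<T>" "F \<subseteq> \<Gamma>" and x: "x \<in> rel_interior F" for F x proof (rule tendsto_interpolant)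
    fix T assume T: "T \<in> \<T>" "x \<in> T"
    interpret full_simplex T by (rule full_simplex[OF T(1)])
    have FT: "F facet_of T" by (rule boundary_face_subset[OF F(1) x T])
    have xF: "x \<in> F" using x rel_interior_subset by blast
    show "nodal a T x = 0" unfolding nodal_def proof (rule sum.neutral, rule ballI)
      fix z assume z: "z \<in> vertices T"
      show "bary T z x * node_val a z T = 0" proof (cases "bary T z x > 0")
        case True
        \<comment> \<open>A vertex with a positive coordinate at \<open>x\<close> lies on
          \<open>F\<close>, and \<open>T\<close> itself is the member of the star that sets the
          nodal value to 0.\<close>
        have "z \<in> F" by (rule vertex_in_face[OF facet_of_imp_face_of[OF FT] xF z True])
        moreover have "T \<in> node_star z T" by (simp add: node_star_def)
        ultimately have "node_val a z T = 0" unfolding node_val_def using FT F(2) by auto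
        then show ?thesis by simp
      next
        case False
        then have "bary T z x = 0" using z T(2) mem_simplex_iff[of x] by force
        then show ?thesis by simp
      qed
    qed
  qed
  moreover have "\<exists>q. poly_fun K q \<and> (\<forall>x\<in>T \<inter> \<Omega>. interpolant a x = q x)" if "T \<in> \<T>" for T
    using poly_fun_nodal[OF that K] interpolant_eq[OF that] by blast
  ultimately show ?thesis by (simp add: Lagrange_bc_def Lagrange_def)
qed

end

context graded_mesh
begin

text \<open>A chain in \<open>node_rel\<close> can be shortened to at most as many steps as the
  relation has pairs. They lie in the square of \<open>patch 1 T\<close>, a set of at most
  \<open>patch_const 1 ^ 2\<close> simplices. The added 1 pays for the value 0 at boundary
  nodes.\<close>

definition chain_const :: real where
  "chain_const = (patch_const 1) ^ 4 + 1"

lemma abs_node_val_diff_le: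
  assumes T: "T \<in> \<T>" and z: "z \<in> T" and B: "B \<ge> 0"
    and jump: "\<And>S S' x. S \<in> patch 1 T \<Longrightarrow> S' \<in> patch 1 T \<Longrightarrow> x \<in> S \<Longrightarrow> x \<in> S' \<Longrightarrow> x \<in> \<Omega> \<Longrightarrow> \<bar>a S - a S'\<bar> \<le> B"
    and bd: "\<And>S F. S \<in> patch 1 T \<Longrightarrow> F facet_of S \<Longrightarrow> F \<subseteq> \<Gamma> \<Longrightarrow> \<bar>a S\<bar> \<le> B"
  shows "\<bar>node_val a z T - a T\<bar> \<le> chain_const * B" proof -
  let ?R = "node_rel z"
  have Rsub: "?R \<subseteq> patch 1 T \<times> patch 1 T" using patch_1I[OF _ T _ z] by (auto simp: node_rel_def)
  have finR: "finite ?R" by (rule finite_subset[OF Rsub]) (intro finite_cartesian_product finite_patch)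
  have "card ?R \<le> card (patch 1 T) * card (patch 1 T)" using card_mono[OF _ Rsub] finite_patch by (simp add: card_cartesian_product)
  then have "real (card ?R) \<le> real (card (patch 1 T) * card (patch 1 T))" by (rule of_nat_mono)
  also have "\<dots> \<le> (patch_const 1)\<^sup>2 * (patch_const 1)\<^sup>2" unfolding of_nat_mult patch_const_def by (intro mult_mono card_patch[OF T]) auto
  finally have card: "real (card ?R) \<le> (patch_const 1) ^ 4" by simp
  have step: "\<bar>a T - a S\<bar> \<le> real k * B" if "(T, S) \<in> ?R ^^ k" for k S using that proof (induction k arbitrary: S)
    case (Suc k)
    then obtain S' where S': "(T, S') \<in> ?R ^^ k" "(S', S) \<in> ?R" by auto
    have "\<bar>a S' - a S\<bar> \<le> B" using S'(2) Rsub jump[of S' S] by (auto simp: node_rel_def)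
    then show ?case using Suc.IH[OF S'(1)] by (simp add: algebra_simps)
  qed simp
  have chain: "\<bar>a T - a S\<bar> \<le> (patch_const 1) ^ 4 * B" if S: "S \<in> node_star z T" for S proof -
    obtain k where k: "k \<le> card ?R" "(T, S) \<in> ?R ^^ k" using S rtrancl_finite_eq_relpow[OF finR] by (auto simp: node_star_def)
    have "\<bar>a T - a S\<bar> \<le> real k * B" by (rule step[OF k(2)])
    also have "\<dots> \<le> (patch_const 1) ^ 4 * B" using k(1) card B by (intro mult_right_mono) auto
    finally show ?thesis .
  qed
  show ?thesis proof (cases "\<exists>S\<in>node_star z T. \<exists>F. F facet_of S \<and> z \<in> F \<and> F \<subseteq> \<Gamma>")
    case True
    then obtain S F where S: "S \<in> node_star z T" "F facet_of S" "F \<subseteq> \<Gamma>" by blast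
    have "S \<in> \<T>" "z \<in> S" using node_star_mesh[OF T z S(1)] by auto
    then have "S \<in> patch 1 T" using patch_1I[OF _ T _ z] by blast
    then have "\<bar>a S\<bar> \<le> B" using bd S by blast
    then show ?thesis using chain[OF S(1)] True by (simp add: node_val_def chain_const_def algebra_simps)
  next
    case False
    have "T \<in> node_star z T" by (simp add: node_star_def)
    then have "(SOME S. S \<in> node_star z T) \<in> node_star z T" by (rule someI)
    from chain[OF this] have "\<bar>a (SOME S. S \<in> node_star z T) - a T\<bar> \<le> chain_const * B" using B by (simp add: abs_minus_commute chain_const_def algebra_simps)
    then show ?thesis unfolding node_val_def if_not_P[OF False] .
  qed
qed

lemma abs_nodal_diff_le:
  assumes T: "T \<in> \<T>" and x: "x \<in> T" and B: "\<And>z. z \<in> vertices T \<Longrightarrow> \<bar>node_val a z T - c\<bar> \<le> B"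
  shows "\<bar>nodal a T x - c\<bar> \<le> B" proof -
  interpret full_simplex T by (rule full_simplex[OF T])
  have "nodal a T x - c = (\<Sum>z\<in>vertices T. bary T z x * (node_val a z T - c))"
    using sum_bary[of x] by (simp add: nodal_def right_diff_distrib sum_subtractf sum_distrib_right[symmetric])
  also have "\<bar>\<dots>\<bar> \<le> (\<Sum>z\<in>vertices T. bary T z x * B)" proof (rule order_trans[OF sum_abs sum_mono])
    fix z assume z: "z \<in> vertices T"
    then have "0 \<le> bary T z x" using x mem_simplex_iff by blast
    then show "\<bar>bary T z x * (node_val a z T - c)\<bar> \<le> bary T z x * B" using B[OF z] by (simp add: abs_mult mult_left_mono)
  qed
  also have "\<dots> = B" using sum_bary[of x] by (simp add: sum_distrib_right[symmetric])
  finally show ?thesis .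
qed

lemma patch_trans:
  assumes "T \<in> \<T>" "S \<in> patch m T" "R \<in> patch n S"
  shows "R \<in> patch (m + n) T" proof -
  have S: "S \<in> \<T>" "\<delta> T S \<le> m" and R: "R \<in> \<T>" "\<delta> S R \<le> n" using assms by (auto simp: patch_def)
  have "(T, R) \<in> neighbors \<T> ^^ (\<delta> T S + \<delta> S R)" unfolding relpow_add using delta_path[OF assms(1) S(1)] delta_path[OF S(1) R(1)] by auto
  then have "\<delta> T R \<le> \<delta> T S + \<delta> S R" by (rule delta_le)
  then show ?thesis using S R by (simp add: patch_def)
qed

definition interpolation_const :: real where
  "interpolation_const = chain_const * (patch_const 1 * (M\<^sup>2 * \<gamma>) * (neighbor_const + zero_trace_const))"

lemma neighbor_const_nonneg: "neighbor_const \<ge> 0" unfolding neighbor_const_def using patch_const_ge_1[of 1] \<gamma>_ge_1 \<sigma>_ge_1 M_pos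
  by (intro mult_nonneg_nonneg zero_le_power) auto

lemma zero_trace_const_nonneg: "zero_trace_const \<ge> 0" using \<sigma>_ge_1 by (simp add: zero_trace_const_def)

lemma interpolation_const_nonneg: "interpolation_const \<ge> 0" unfolding interpolation_const_def chain_const_def
  using patch_const_ge_1[of 1] \<gamma>_ge_1 \<sigma>_ge_1 M_pos neighbor_const_nonneg zero_trace_const_nonneg by (intro mult_nonneg_nonneg add_nonneg_nonneg zero_le_power) auto

text \<open>A nodal value is joined to the average on \<open>T\<close> by a chain of jumps in
  \<open>patch 1 T\<close>. Each jump is controlled by masses in the patch of one of its simplices,
  hence in \<open>patch 2 T\<close>.\<close>

lemma abs_interpolant_diff_le:
  fixes u :: "real^'n \<Rightarrow> real"
  defines "W \<equiv> wgrad \<Omega> u"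
  defines "ut \<equiv> \<lambda>x. indicator \<Omega> x * u x" and "Wt \<equiv> \<lambda>x. indicator \<Omega> x *\<^sub>R W x"
  defines "a \<equiv> \<lambda>S. average (interior S) ut"
  assumes u: "integrable (lebesgue_on \<Omega>) u" and W: "integrable (lebesgue_on \<Omega>) W"
    and wd: "weakly_diff \<Omega> ut Wt"
    and zt: "\<And>S F. S \<in> \<T> \<Longrightarrow> F facet_of S \<Longrightarrow> F \<subseteq> \<Gamma> \<Longrightarrow> zero_trace \<Omega> S F u"
    and T: "T \<in> \<T>" and x: "x \<in> T"
  shows "\<bar>nodal a T x - a T\<bar> * vol T \<le> interpolation_const * diameter T * (\<Sum>R\<in>patch 2 T. mass Wt (interior R))" proof -
  define \<Sigma> where "\<Sigma> = (\<Sum>R\<in>patch 2 T. mass Wt (interior R))"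
  define L where "L = M\<^sup>2 * \<gamma>"
  define zc where "zc = zero_trace_const"
  define p where "p = patch_const 1"
  have \<Sigma>0: "\<Sigma> \<ge> 0" unfolding \<Sigma>_def by (intro sum_nonneg mass_nonneg)
  have L: "L \<ge> 0" unfolding L_def using \<gamma>_ge_1 by simp
  have zc: "zc \<ge> 0" unfolding zc_def by (rule zero_trace_const_nonneg)
  have p: "p \<ge> 1" unfolding p_def by (rule patch_const_ge_1)
  have volT: "vol T > 0" by (rule vol_pos[OF T])
  have D: "diameter T > 0" by (rule diameter_pos[OF T])
  define B where "B = p * (L * (neighbor_const + zc) * diameter T * \<Sigma>) / vol T"
  have B0: "B \<ge> 0" unfolding B_def using p L zc neighbor_const_nonneg D \<Sigma>0 volT by simp
  \<comment> \<open>Rescales bounds from a simplex \<open>S\<close> of the patch to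
    \<open>T\<close>: the factor \<open>p\<close> changes the volume, \<open>L\<close> the
    diameter.\<close>
  have transfer: "y \<le> B" if S: "S \<in> patch 1 T" and y: "0 \<le> y" "y * vol S \<le> c * diameter S * m" and c: "0 \<le> c" "c \<le> neighbor_const + zc"
      and m: "0 \<le> m" "m \<le> \<Sigma>" for S y c m proof -
    have ST: "S \<in> \<T>" using S by (simp add: patch_def)
    have "y * vol T \<le> y * (p * vol S)" using vol_patch_elem[OF ST patch_sym[OF T S]] y(1) unfolding p_def patch_const_def by (rule mult_left_mono)
    also have "\<dots> = p * (y * vol S)" by simp
    also have "\<dots> \<le> p * ((neighbor_const + zc) * (L * diameter T) * \<Sigma>)" proof (rule mult_left_mono)
      have "c * diameter S * m \<le> (neighbor_const + zc) * (L * diameter T) * \<Sigma>"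
        using diameter_patch_1[OF T S] c m L D diameter_pos[OF ST] by (intro mult_mono) (auto simp: L_def)
      then show "y * vol S \<le> (neighbor_const + zc) * (L * diameter T) * \<Sigma>" using y(2) by linarith
    qed (use p in simp)
    finally show ?thesis unfolding B_def using volT by (simp add: le_divide_eq mult_ac)
  qed
  have nv: "\<bar>node_val a z T - a T\<bar> \<le> chain_const * B" if z: "z \<in> vertices T" for z proof (rule abs_node_val_diff_le[OF T _ B0])
    show "z \<in> T" using full_simplex.vertices_subset[OF full_simplex[OF T]] z by blast
    fix S assume S: "S \<in> patch 1 T"
    then have ST: "S \<in> \<T>" by (simp add: patch_def)
    {
      fix S' y assume S': "S' \<in> patch 1 T" and y: "y \<in> S" "y \<in> S'" "y \<in> \<Omega>"
      have S'T: "S' \<in> \<T>" using S' by (simp add: patch_def)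
      show "\<bar>a S - a S'\<bar> \<le> B" proof (rule transfer[OF S'])
        show "\<bar>a S - a S'\<bar> * vol S' \<le> neighbor_const * diameter S' * (\<Sum>R\<in>patch 1 S'. mass Wt (interior R))"
          unfolding a_def by (rule average_neighbor_diff_le[OF wd ST S'T y])
        have "patch 1 S' \<subseteq> patch 2 T" using patch_trans[OF T S', of _ 1] by (auto simp: numeral_2_eq_2)
        then show "(\<Sum>R\<in>patch 1 S'. mass Wt (interior R)) \<le> \<Sigma>" unfolding \<Sigma>_def by (intro sum_mono2 finite_patch mass_nonneg)
      qed (use neighbor_const_nonneg zc in \<open>auto intro!: sum_nonneg mass_nonneg\<close>)
    }
    fix F assume F: "F facet_of S" "F \<subseteq> \<Gamma>"
    show "\<bar>a S\<bar> \<le> B" proof (rule transfer[OF S])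
      show "\<bar>a S\<bar> * vol S \<le> zc * diameter S * mass Wt (interior S)"
        using average_zero_trace_le[OF u W[unfolded W_def] wd[unfolded ut_def Wt_def W_def] ST F(1) zt[OF ST F]] by (simp add: zc_def a_def ut_def Wt_def W_def)
      have "S \<in> patch 2 T" using S by (auto simp: patch_def)
      then show "mass Wt (interior S) \<le> \<Sigma>" unfolding \<Sigma>_def by (intro member_le_sum finite_patch mass_nonneg)
    qed (use neighbor_const_nonneg zc in \<open>auto intro!: mass_nonneg\<close>)
  qed
  have "\<bar>nodal a T x - a T\<bar> * vol T \<le> (chain_const * B) * vol T" using abs_nodal_diff_le[OF T x nv] volT by (intro mult_right_mono) auto
  also have "\<dots> = interpolation_const * diameter T * \<Sigma>" using volT by (simp add: B_def interpolation_const_def p_def L_def zc_def)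
  finally show ?thesis by (simp add: \<Sigma>_def)
qed

end

section \<open>Uniqueness of weak gradients and the gradient of finite element functions\<close>

section \<open>Weak gradients\<close>

lemma open_sets_lebesgue: "open U \<Longrightarrow> U \<in> sets lebesgue" by (simp add: borel_open sets_completionI_sets)

lemma pairing_eq_LINT:
  assumes "open \<Omega>"
  shows "pairing \<Omega> u v = (LINT x|lebesgue. indicator \<Omega> x * (u x * v x))"
  unfolding pairing_def using open_sets_lebesgue[OF assms] by (subst integral_restrict_space) auto

text \<open>\<open>wgrad\<close> is a choice, so uniqueness is the only access to its values. On a
  closed ball in \<Omega> both gradients are integrable, and duality with test functions makes each
  component of the difference vanish almost everywhere in the open ball; negligibility is
  local.\<close>

lemma weak_gradient_unique:
  fixes u :: "real^'n \<Rightarrow> real"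
  assumes \<Omega>: "open \<Omega>" and G: "weak_gradient \<Omega> u G" and H: "weak_gradient \<Omega> u H"
  shows "negligible {x\<in>\<Omega>. G x \<noteq> H x}" unfolding locally_negligible_alt[of "{x\<in>\<Omega>. G x \<noteq> H x}"] proof
  fix x assume "x \<in> {x\<in>\<Omega>. G x \<noteq> H x}"
  then have x: "x \<in> \<Omega>" "G x \<noteq> H x" by auto
  obtain r where r: "r > 0" "cball x r \<subseteq> \<Omega>" using \<Omega> x(1) open_contains_cball by blast
  have ball\<Omega>: "ball x r \<subseteq> \<Omega>" using r(2) ball_subset_cball by blast
  have int: "integrable lebesgue (\<lambda>y. indicator (cball x r) y *\<^sub>R G y)" "integrable lebesgue (\<lambda>y. indicator (cball x r) y *\<^sub>R H y)"
    using G H r(2) compact_cball[of x r] unfolding weak_gradient_def set_integrable_def[symmetric] by blast+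
  have "AE y in lebesgue. y \<in> ball x r \<longrightarrow> G y $ i = H y $ i" for i proof -
    define f where "f y = indicator (cball x r) y * (G y $ i - H y $ i)" for y
    have nth: "integrable lebesgue (\<lambda>y. indicator (cball x r) y * (K y $ i))"
      if "integrable lebesgue (\<lambda>y. indicator (cball x r) y *\<^sub>R K y)" for K :: "real^'n \<Rightarrow> real^'n" proof -
      have "integrable lebesgue (\<lambda>y. (indicator (cball x r) y *\<^sub>R K y) \<bullet> axis i 1)" by (rule integrable_inner_left) (rule that)
      then show ?thesis by (simp add: inner_axis)
    qed
    have fi: "integrable lebesgue f" unfolding f_def right_diff_distrib by (intro Bochner_Integration.integrable_diff nth int)
    have "(LINT y|lebesgue. indicator (ball x r) y * \<bar>f y\<bar>) \<le> 0" proof (rule L1_norm_le_test_functions[OF fi open_ball])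
      fix \<psi> :: "real^'n \<Rightarrow> real" assume \<psi>: "test_function (ball x r) \<psi>" "\<And>y. \<bar>\<psi> y\<bar> \<le> 1"
      have \<psi>\<Omega>: "test_function \<Omega> \<psi>" by (rule test_function_mono[OF \<psi>(1) ball\<Omega>])
      have \<psi>m: "\<psi> \<in> borel_measurable lebesgue" by (intro continuous_imp_borel_lebesgue smooth_continuous_on test_functionD(1)[OF \<psi>(1)])
      have pr: "pairing \<Omega> (\<lambda>x. K x $ i) \<psi> = (LINT y|lebesgue. (indicator (cball x r) y * (K y $ i)) * \<psi> y)" for K :: "real^'n \<Rightarrow> real^'n"
        unfolding pairing_eq_LINT[OF \<Omega>] proof (intro Bochner_Integration.integral_cong refl)
        fix y show "indicator \<Omega> y * (K y $ i * \<psi> y) = indicator (cball x r) y * (K y $ i) * \<psi> y"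
          using test_functionD(2)[OF \<psi>(1), of y] ball\<Omega> ball_subset_cball[of x r] by (cases "y \<in> ball x r") (auto simp: indicator_def)
      qed
      have "(LINT y|lebesgue. f y * \<psi> y) = (LINT y|lebesgue. (indicator (cball x r) y * (G y $ i)) * \<psi> y - (indicator (cball x r) y * (H y $ i)) * \<psi> y)"
        by (simp add: f_def algebra_simps)
      also have "\<dots> = pairing \<Omega> (\<lambda>x. G x $ i) \<psi> - pairing \<Omega> (\<lambda>x. H x $ i) \<psi>"
        unfolding pr by (intro Bochner_Integration.integral_diff integrable_mult_bounded[OF nth[OF int(1)] \<psi>m \<psi>(2)]
            integrable_mult_bounded[OF nth[OF int(2)] \<psi>m \<psi>(2)])
      also have "\<dots> = 0" using G H \<psi>\<Omega> unfolding weak_gradient_def by (metis (no_types, lifting) diff_self minus_equation_iff)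
      finally show "(LINT y|lebesgue. f y * \<psi> y) \<le> 0" by simp
    qed
    moreover have "(LINT y|lebesgue. indicator (ball x r) y * \<bar>f y\<bar>) \<ge> 0" by (intro integral_nonneg_AE AE_I2) simp
    ultimately have "(LINT y|lebesgue. indicator (ball x r) y * \<bar>f y\<bar>) = 0" by simp
    then have "AE y in lebesgue. indicator (ball x r) y * \<bar>f y\<bar> = 0" by (subst (asm) integral_nonneg_eq_0_iff_AE)
        (auto intro!: integrable_indicator_times integrable_abs fi open_sets_lebesgue)
    then show ?thesis proof eventually_elim
      case (elim y)
      then show ?case using ball_subset_cball[of x r] by (auto simp: f_def indicator_def split: if_splits)
    qed
  qed
  then have "AE y in lebesgue. \<forall>i. y \<in> ball x r \<longrightarrow> G y $ i = H y $ i" by (subst AE_all_countable) simp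
  then have "AE y in lebesgue. \<not> (y \<in> {x\<in>\<Omega>. G x \<noteq> H x} \<inter> ball x r)" by eventually_elim (auto simp: vec_eq_iff)
  then obtain N where "N \<in> null_sets lebesgue" "{x\<in>\<Omega>. G x \<noteq> H x} \<inter> ball x r \<subseteq> N" unfolding eventually_ae_filter by (auto simp: subset_iff)
  then have "negligible ({x\<in>\<Omega>. G x \<noteq> H x} \<inter> ball x r)" unfolding negligible_iff_null_sets[symmetric] by (rule negligible_subset)
  then show "\<exists>U. openin (top_of_set {x\<in>\<Omega>. G x \<noteq> H x}) U \<and> x \<in> U \<and> negligible U"
    using x r(1) by (intro exI[of _ "{x\<in>\<Omega>. G x \<noteq> H x} \<inter> ball x r"]) auto
qed

context triangulated
begin

lemma weak_gradient_wgrad: "u \<in> W1p p \<Omega> \<Longrightarrow> weak_gradient \<Omega> u (wgrad \<Omega> u)"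
  unfolding W1p_def wgrad_def by (auto intro: someI_ex[of "weak_gradient \<Omega> u"])

lemma weakly_diff_of_weak_gradient:
  assumes u: "integrable (lebesgue_on \<Omega>) u" and G: "integrable (lebesgue_on \<Omega>) G" and w: "weak_gradient \<Omega> u G"
  shows "weakly_diff \<Omega> (\<lambda>x. indicator \<Omega> x * u x) (\<lambda>x. indicator \<Omega> x *\<^sub>R G x)" unfolding weakly_diff_def proof (intro conjI allI impI)
  have Os: "\<Omega> \<in> sets lebesgue" by (rule open_sets_lebesgue[OF open_domain])
  show ui: "integrable lebesgue (\<lambda>x. indicator \<Omega> x * u x)" using u Os by (subst (asm) integrable_restrict_space) auto
  show Gi: "integrable lebesgue (\<lambda>x. indicator \<Omega> x *\<^sub>R G x)" using G Os by (subst (asm) integrable_restrict_space) auto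
  fix \<psi> w assume \<psi>: "test_function \<Omega> \<psi>"
  have \<psi>s: "smooth \<psi>" by (rule test_functionD(1)[OF \<psi>])
  obtain B where B: "\<And>x. \<bar>\<psi> x\<bar> \<le> B" by (rule test_function_bounded[OF \<psi>]) (rule that)
  have Gn: "integrable lebesgue (\<lambda>x. (indicator \<Omega> x * (G x $ i)) * \<psi> x)" for i proof (rule integrable_mult_bounded[OF _ _ B])
    have "integrable lebesgue (\<lambda>x. (indicator \<Omega> x *\<^sub>R G x) \<bullet> axis i 1)" by (rule integrable_inner_left) (rule Gi)
    then show "integrable lebesgue (\<lambda>x. indicator \<Omega> x * (G x $ i))" by (simp add: inner_axis)
  qed (intro continuous_imp_borel_lebesgue smooth_continuous_on \<psi>s)
  have un: "integrable lebesgue (\<lambda>x. (indicator \<Omega> x * u x) * (grad \<psi> x $ i))" for i proof -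
    obtain B' where "\<And>x. \<bar>grad \<psi> x $ i\<bar> \<le> B'" by (rule test_function_bounded[OF test_function_grad_nth[OF \<psi>]]) (rule that)
    then show ?thesis by (rule integrable_mult_bounded[OF ui continuous_imp_borel_lebesgue[OF smooth_continuous_on[OF smooth_grad_nth[OF \<psi>s]]]])
  qed
  have eq: "(LINT x|lebesgue. (indicator \<Omega> x * u x) * (grad \<psi> x $ i)) = - (LINT x|lebesgue. (indicator \<Omega> x * (G x $ i)) * \<psi> x)" for i
    using w \<psi> unfolding weak_gradient_def pairing_eq_LINT[OF open_domain] by (simp add: mult.assoc)
  have "(LINT x|lebesgue. indicator \<Omega> x * u x * (grad \<psi> x \<bullet> w)) = (LINT x|lebesgue. (\<Sum>i\<in>UNIV. w $ i * ((indicator \<Omega> x * u x) * (grad \<psi> x $ i))))"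
    by (simp add: inner_vec_def sum_distrib_left mult_ac)
  also have "\<dots> = (\<Sum>i\<in>UNIV. w $ i * (LINT x|lebesgue. (indicator \<Omega> x * u x) * (grad \<psi> x $ i)))" using un by (subst Bochner_Integration.integral_sum) auto
  also have "\<dots> = - (\<Sum>i\<in>UNIV. w $ i * (LINT x|lebesgue. (indicator \<Omega> x * (G x $ i)) * \<psi> x))" by (simp add: eq sum_negf)
  also have "(\<Sum>i\<in>UNIV. w $ i * (LINT x|lebesgue. (indicator \<Omega> x * (G x $ i)) * \<psi> x)) = (LINT x|lebesgue. (\<Sum>i\<in>UNIV. w $ i * ((indicator \<Omega> x * (G x $ i)) * \<psi> x)))"
    using Gn by (subst Bochner_Integration.integral_sum) auto
  also have "\<dots> = (LINT x|lebesgue. (indicator \<Omega> x *\<^sub>R G x \<bullet> w) * \<psi> x)" by (simp add: inner_vec_def sum_distrib_left sum_distrib_right mult_ac)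
  finally show "(LINT x|lebesgue. indicator \<Omega> x * u x * (grad \<psi> x \<bullet> w)) = - (LINT x|lebesgue. (indicator \<Omega> x *\<^sub>R G x \<bullet> w) * \<psi> x)" .
qed

text \<open>The piecewise gradient \<open>H\<close> is a weak gradient by
  \<open>piecewise_smooth_weak_derivative\<close>, and uniqueness carries its values and its
  measurability over to the chosen \<open>wgrad\<close>.\<close>

lemma
  assumes v: "v \<in> LK K"
  shows wgrad_LK: "T \<in> \<T> \<Longrightarrow> AE x in lebesgue. x \<in> interior T \<longrightarrow> wgrad \<Omega> v x = grad (piece K v T) x"
    and wgrad_LK_measurable: "wgrad \<Omega> v \<in> borel_measurable (lebesgue_on \<Omega>)" proof -
  note vL = LK_Lagrange[OF v]
  define H where "H = piecewise (\<lambda>T. grad (piece K v T))"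
  have sm: "smooth (piece K v T)" if "T \<in> \<T>" for T by (rule smooth_poly_fun[OF poly_fun_piece[OF vL that]])
  have vc: "continuous_on \<Omega> v" using vL by (simp add: Lagrange_def)
  have Hm: "H \<in> borel_measurable lebesgue" unfolding H_def proof (rule borel_measurable_piecewise)
    fix T assume "T \<in> \<T>"
    then show "grad (piece K v T) \<in> borel_measurable lebesgue" by (intro continuous_imp_borel_lebesgue continuous_on_grad sm)
  qed
  have Hi: "integrable lebesgue H" unfolding H_def piecewise_def proof (rule Bochner_Integration.integrable_sum)
    fix T assume T: "T \<in> \<T>"
    interpret full_simplex T by (rule full_simplex[OF T])
    have 1: "integrable lborel (\<lambda>x. indicator T x *\<^sub>R grad (piece K v T) x)" by (rule borel_integrable_compact[OF compact_T continuous_on_grad[OF sm[OF T]]])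
    then have "integrable lebesgue (\<lambda>x. indicator T x *\<^sub>R grad (piece K v T) x)" by (subst integrable_completion) (auto intro: borel_measurable_integrable)
    then have "grad (piece K v T) absolutely_integrable_on T" by (simp add: set_integrable_def)
    then show "integrable lebesgue (\<lambda>x. indicat_real (interior T) x *\<^sub>R grad (piece K v T) x)"
      using set_integrable_subset[of lebesgue T _ "interior T"] interior_subset[of T] open_sets_lebesgue[of "interior T"] by (simp add: set_integrable_def)
  qed
  have wH: "weak_gradient \<Omega> v H" unfolding weak_gradient_def proof (intro conjI allI impI)
    fix S assume S: "compact S \<and> S \<subseteq> \<Omega>"
    then have Sm: "S \<in> sets lebesgue" by (simp add: compact_imp_closed borel_closed sets_completionI_sets)
    have "integrable lebesgue (\<lambda>x. indicator \<Omega> x *\<^sub>R v x)"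
      using integrable_LK[OF v] open_sets_lebesgue[OF open_domain] by (subst (asm) integrable_restrict_space) auto
    then have "v absolutely_integrable_on \<Omega>" by (simp add: set_integrable_def)
    then show "v absolutely_integrable_on S" by (rule set_integrable_subset) (use S Sm in auto)
    show "H absolutely_integrable_on S" unfolding set_integrable_def by (rule integrable_mult_indicator[OF Sm Hi])
  next
    fix \<phi> i assume \<phi>: "test_function \<Omega> \<phi>"
    have z: "indicator \<Omega> x * (c * \<phi> x) = c * \<phi> x" "indicator \<Omega> x * (c * (grad \<phi> x $ i)) = c * (grad \<phi> x $ i)" for c x
      using test_functionD(2)[OF \<phi>, of x] test_functionD(2)[OF test_function_grad_nth[OF \<phi>], of x i] by (cases "x \<in> \<Omega>"; simp)+
    have "(LINT x|lebesgue. v x * (grad \<phi> x \<bullet> axis i 1)) = - (LINT x|lebesgue. (H x \<bullet> axis i 1) * \<phi> x)"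
    proof (rule piecewise_smooth_weak_derivative[OF open_domain vc finite_mesh _ _ domain_subset sm _ Hm _ \<phi>])
      show "closed T" "negligible (frontier T)" if "T \<in> \<T>" for T
        by (rule full_simplex.closed_T[OF full_simplex[OF that]], rule full_simplex.negligible_frontier_T[OF full_simplex[OF that]])
      show "v x = piece K v T x" if "T \<in> \<T>" "x \<in> T \<inter> \<Omega>" for T x using piece_eq[OF vL that(1)] that(2) by simp
      show "H x = grad (piece K v T) x" if "T \<in> \<T>" "x \<in> interior T \<inter> \<Omega>" for T x unfolding H_def using that by (intro piecewise_eq) auto
    qed
    then show "pairing \<Omega> v (\<lambda>x. grad \<phi> x $ i) = - pairing \<Omega> (\<lambda>x. H x $ i) \<phi>"
      unfolding pairing_eq_LINT[OF open_domain] by (simp add: inner_axis z)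
  qed
  then have "weak_gradient \<Omega> v (wgrad \<Omega> v)" unfolding wgrad_def by (rule someI[of "weak_gradient \<Omega> v"])
  from weak_gradient_unique[OF open_domain wH this]
  have ae: "AE x in lebesgue. x \<notin> {x\<in>\<Omega>. H x \<noteq> wgrad \<Omega> v x}" unfolding negligible_iff_null_sets by (rule AE_not_in)
  show "AE x in lebesgue. x \<in> interior T \<longrightarrow> wgrad \<Omega> v x = grad (piece K v T) x" if T: "T \<in> \<T>" using ae proof eventually_elim
    case (elim x)
    then show ?case using interior_subset_domain[OF T] piecewise_eq[OF T, of x "\<lambda>T. grad (piece K v T)"] by (auto simp: H_def)
  qed
  have Os: "\<Omega> \<in> sets lebesgue" by (rule open_sets_lebesgue[OF open_domain])
  have "(\<lambda>x. indicator \<Omega> x *\<^sub>R wgrad \<Omega> v x) \<in> borel_measurable lebesgue" proof (rule borel_measurable_AE)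
    show "(\<lambda>x. indicator \<Omega> x *\<^sub>R H x) \<in> borel_measurable lebesgue" using Hm Os by (intro borel_measurable_scaleR borel_measurable_indicator)
    show "AE x in lebesgue. indicator \<Omega> x *\<^sub>R H x = indicator \<Omega> x *\<^sub>R wgrad \<Omega> v x" using ae by eventually_elim (auto simp: indicator_def)
  qed
  then show "wgrad \<Omega> v \<in> borel_measurable (lebesgue_on \<Omega>)" using Os by (subst borel_measurable_restrict_space_iff) auto
qed

end

section \<open>The weighted gradient bound, and the margin in the condition on the gradings\<close>

section \<open>Stability of the gradient\<close>

context graded_mesh
begin

text \<open>\<open>A\<close> belongs to the inverse estimate, \<open>L\<close> to the comparison of
  weights and volumes within two steps, the cubes to finite overlap, and 4 to the triangle
  inequality. The projection enters with the grading \<open>\<gamma>' * \<gamma>\<close> of the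
  weight divided by the mesh size.\<close>

definition W1p_const :: "(real \<Rightarrow> real) \<Rightarrow> nat \<Rightarrow> real \<Rightarrow> real \<Rightarrow> real \<Rightarrow> real" where
  "W1p_const C K \<gamma>' s e = (let A = 2 * coeff_bound K * \<sigma>; L = \<gamma>'\<^sup>2 * patch_const 2; I = interpolation_const in
     \<gamma>' * (4 * (A * M * (projection_const C K (\<gamma>' * \<gamma>) s e * (M * ((2 * \<sigma>) ^ CARD('n) + I) * L * patch_const 2 ^ 3)) +
       A * I * L * patch_const 2 ^ 3)) + 1)"

lemma W1p_stability:
  assumes K: "K \<ge> 1" and p: "p \<ge> 1" and \<rho>: "weight \<Omega> \<T> \<gamma>' \<rho>" and wg: "worst_grading C K \<Omega> \<T> \<Gamma> \<gamma>max"
    and s: "s > 1" and e: "e = \<bar>1 / 2 - enn2real (1 / p)\<bar>"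
    and less: "(\<gamma>' * \<gamma>) * (\<gamma> powr (real CARD('n) * e) * s) < \<gamma>max"
    and u: "u \<in> W1p_bc p \<Omega> \<T> \<Gamma>"
  shows "Lp_norm p \<Omega> (\<lambda>x. \<rho> x *\<^sub>R wgrad \<Omega> (Q K u) x) \<le> ennreal (W1p_const C K \<gamma>' s e) * Lp_norm p \<Omega> (\<lambda>x. \<rho> x *\<^sub>R wgrad \<Omega> u x)"
proof -
  define W where "W = wgrad \<Omega> u"
  define A where "A = 2 * coeff_bound K * \<sigma>"
  define P where "P = patch_const 2"
  define L where "L = \<gamma>'\<^sup>2 * P"
  define I where "I = interpolation_const"
  define E where "E = M * ((2 * \<sigma>) ^ CARD('n) + I) * L"
  define J where "J = projection_const C K (\<gamma>' * \<gamma>) s e"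
  define N where "N = A * M * (J * (E * P ^ 3)) + A * I * L * P ^ 3"
  have c: "W1p_const C K \<gamma>' s e = \<gamma>' * (4 * N) + 1" unfolding W1p_const_def Let_def N_def J_def E_def A_def L_def P_def I_def by simp
  have \<gamma>': "\<gamma>' \<ge> 1" and \<rho>m: "\<rho> \<in> borel_measurable (lebesgue_on \<Omega>)" using \<rho> by (auto simp: weight_def Lp_def)
  have \<gamma>\<gamma>: "\<gamma>' * \<gamma> \<ge> 1" using mult_mono[of 1 \<gamma>' 1 \<gamma>] \<gamma>' \<gamma>_ge_1 by simp
  have P: "P \<ge> 1" unfolding P_def by (rule patch_const_ge_1)
  have I: "I \<ge> 0" unfolding I_def by (rule interpolation_const_nonneg)
  have A: "A \<ge> 0" using coeff_bound_ge_1[of K] \<sigma>_ge_1 by (simp add: A_def)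
  have L: "L \<ge> 0" using P by (simp add: L_def)
  have E: "E \<ge> 0" using M_pos \<sigma>_ge_1 I L by (simp add: E_def)
  have J: "J \<ge> 0" unfolding J_def by (rule projection_const_nonneg)
  have N: "N \<ge> 0" unfolding N_def using A M_pos J E P I L by (intro add_nonneg_nonneg mult_nonneg_nonneg) auto
  show ?thesis proof (cases "Lp_norm p \<Omega> (\<lambda>x. \<rho> x *\<^sub>R W x) = \<infinity>")
    case True
    have "W1p_const C K \<gamma>' s e > 0" unfolding c using \<gamma>' N by (simp add: add_nonneg_pos)
    then show ?thesis using True by (simp add: W_def ennreal_mult_top)
  next
    case False
    have uW: "u \<in> W1p p \<Omega>" using u by (simp add: W1p_bc_def)
    then have "u \<in> Lp p \<Omega>" and WLp: "W \<in> Lp p \<Omega>" by (auto simp: W1p_def W_def)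
    then have ui: "integrable (lebesgue_on \<Omega>) u" and Wi: "integrable (lebesgue_on \<Omega>) W" using Lp_integrable[OF p] by blast+
    have \<rho>W: "(\<lambda>x. \<rho> x *\<^sub>R W x) \<in> Lp p \<Omega>" using False \<rho>m WLp by (auto simp: Lp_def less_top[symmetric])
    define ut where "ut x = indicator \<Omega> x * u x" for x
    define Wt where "Wt x = indicator \<Omega> x *\<^sub>R W x" for x
    have wd: "weakly_diff \<Omega> ut Wt"
      using weakly_diff_of_weak_gradient[OF ui Wi[unfolded W_def] weak_gradient_wgrad[OF uW]] by (simp add: ut_def[abs_def] Wt_def[abs_def] W_def)
    define a where "a S = average (interior S) ut" for S
    define v where "v = interpolant a"
    have v: "v \<in> LK K" unfolding v_def by (rule interpolant_in[OF K])
    define f where "f x = u x - v x" for x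
    have fi: "integrable (lebesgue_on \<Omega>) f" unfolding f_def[abs_def] by (intro Bochner_Integration.integrable_diff ui integrable_LK[OF v])
    have Qu: "Q K u \<in> LK K" and Qf: "Q K f \<in> LK K" using L2_projection_in ui fi by blast+
    note QuL = LK_Lagrange[OF Qu] and QfL = LK_Lagrange[OF Qf]
    have Qf_eq: "Q K f x = Q K u x - v x" if "x \<in> \<Omega>" for x using L2_projection_diff[OF ui v that] by (simp add: f_def[abs_def])
    have low: "low \<rho> T > 0" if "T \<in> \<T>" for T by (rule weight_low_pos[OF \<rho> that])
    \<comment> \<open>Dividing by the mesh size compensates the diameter in the interpolation
      estimate and costs one factor \<gamma> in the grading; this is the additional 1 in the
      exponent.\<close>
    define U where "U T = low \<rho> T / hT T" for T
    have U0: "U T > 0" if "T \<in> \<T>" for T using low[OF that] hT_pos[OF that] by (simp add: U_def)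
    have gU: "graded (\<gamma>' * \<gamma>) U" unfolding graded_def proof (intro conjI ballI allI impI U0)
      fix S T assume n: "(S, T) \<in> neighbors \<T>"
      have ST: "S \<in> \<T>" "T \<in> \<T>" using neighbors_mesh[OF n] by auto
      have "low \<rho> T \<le> \<gamma>' * low \<rho> S" "hT S \<le> \<gamma> * hT T"
        using graded_low[OF \<rho>] graded_low[OF weight_h] n neighbors_sym[OF n] by (auto simp: graded_def)
      then have "low \<rho> T * hT S \<le> (\<gamma>' * low \<rho> S) * (\<gamma> * hT T)" using low ST hT_pos \<gamma>' by (intro mult_mono) (auto intro: less_imp_le)
      then show "U T \<le> \<gamma>' * \<gamma> * U S" using hT_pos ST by (simp add: U_def field_simps)
    qed
    define m where "m T = mass Wt (interior T)" for T
    define b where "b T = low \<rho> T * (m T / vol T)" for T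
    define X where "X T = (\<Sum>S\<in>patch 2 T. b S)" for T
    define S2 where "S2 T = (\<Sum>S\<in>patch 2 T. m S)" for T
    define z where "z T = sup_norm T (piece K (Q K f) T)" for T
    define \<eta> where "\<eta> T = I * diameter T * S2 T / vol T" for T
    have m0: "m T \<ge> 0" for T unfolding m_def by (rule mass_nonneg)
    have b0: "b T \<ge> 0" if "T \<in> \<T>" for T using low[OF that] m0 by (simp add: b_def)
    have X0: "X T \<ge> 0" for T unfolding X_def by (intro sum_nonneg b0) (simp add: patch_def)
    have S0: "S2 T \<ge> 0" for T unfolding S2_def by (intro sum_nonneg m0)
    have z0: "z T \<ge> 0" if "T \<in> \<T>" for T unfolding z_def by (rule full_simplex.sup_norm_nonneg[OF full_simplex[OF that] poly_fun_piece[OF QfL that]])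
    \<comment> \<open>Within two steps weights change by at most \<open>\<gamma>'\<^sup>2\<close>
      and volumes by at most \<open>P\<close>, so the weight on \<open>T\<close> can be moved to
      each simplex of the patch.\<close>
    have LX: "low \<rho> T * (S2 T / vol T) \<le> L * X T" if T: "T \<in> \<T>" for T unfolding S2_def X_def sum_divide_distrib sum_distrib_left proof (rule sum_mono)
      fix S assume S: "S \<in> patch 2 T"
      then have ST: "S \<in> \<T>" "\<delta> T S \<le> 2" by (auto simp: patch_def)
      have "low \<rho> T \<le> \<gamma>' ^ \<delta> S T * low \<rho> S" using graded_low[OF \<rho>] \<gamma>' delta_path[OF ST(1) T] by (intro graded_path) (auto simp: graded_def)
      also have "\<dots> \<le> \<gamma>'\<^sup>2 * low \<rho> S" using ST(2) \<gamma>' low[OF ST(1)] delta_sym[OF T ST(1)] by (intro mult_right_mono power_increasing) auto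
      finally have 1: "low \<rho> T \<le> \<gamma>'\<^sup>2 * low \<rho> S" .
      have "vol S \<le> P * vol T" using vol_patch_elem[OF T S] by (simp add: P_def patch_const_def)
      then have "1 / vol T \<le> P / vol S" using vol_pos[OF T] vol_pos[OF ST(1)] by (simp add: field_simps)
      then have "m S * (1 / vol T) \<le> m S * (P / vol S)" using m0 by (rule mult_left_mono)
      then have "low \<rho> T * (m S / vol T) \<le> (\<gamma>'\<^sup>2 * low \<rho> S) * (m S * (P / vol S))"
        using 1 m0[of S] low[OF T] low[OF ST(1)] vol_pos[OF T] by (intro mult_mono) auto
      then show "low \<rho> T * (m S / vol T) \<le> L * b S" by (simp add: L_def b_def mult_ac)
    qed
    have nod: "\<bar>nodal a T x - a T\<bar> \<le> \<eta> T" if T: "T \<in> \<T>" and x: "x \<in> T" for T x proof -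
      have "\<bar>nodal a T x - a T\<bar> * vol T \<le> I * diameter T * S2 T" unfolding I_def S2_def m_def a_def Wt_def[abs_def] W_def ut_def[abs_def]
        by (rule abs_interpolant_diff_le[OF ui Wi[unfolded W_def] wd[unfolded ut_def[abs_def] Wt_def[abs_def] W_def] _ T x]) (use u in \<open>auto simp: W1p_bc_def\<close>)
      then show ?thesis using vol_pos[OF T] by (simp add: \<eta>_def le_divide_eq)
    qed
    \<comment> \<open>On \<open>T\<close> the error \<open>f\<close> is \<open>u\<close> minus its
      average, less the interpolant minus that average: Poincare bounds the first,
      \<open>\<eta> T\<close> the second. The diameter in both cancels against \<open>hT\<close> in
      \<open>U\<close>.\<close>
    have avg: "U T * (lint T (\<lambda>x. \<bar>f x\<bar>) / vol T) \<le> E * X T" if T: "T \<in> \<T>" for T proof -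
      interpret full_simplex T by (rule full_simplex[OF T])
      have ut_int: "integrable lebesgue (\<lambda>x. indicator (interior T) x * \<bar>ut x - a T\<bar>)"
        using wd lmeasurable_open[OF bounded_subset[OF bounded_T interior_subset] open_interior] by (intro integrable_indicator_abs_diff) (auto simp: weakly_diff_def)
      have "lint T (\<lambda>x. \<bar>f x\<bar>) \<le>
        (LINT x|lebesgue. indicator (interior T) x * \<bar>ut x - a T\<bar> + indicator (interior T) x * \<eta> T)" proof (rule integral_mono)
        show "integrable lebesgue (\<lambda>x. indicator (interior T) x * \<bar>f x\<bar>)" using integrable_simplex[OF integrable_abs[OF fi] T] by simp
        fix x
        have "\<bar>f x\<bar> \<le> \<bar>ut x - a T\<bar> + \<eta> T" if x: "x \<in> interior T" proof -
          have xT: "x \<in> T" "x \<in> \<Omega>" using x interior_subset interior_subset_domain[OF T] by auto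
          then have "f x = (ut x - a T) - (nodal a T x - a T)" using interpolant_eq[OF T xT] by (simp add: f_def v_def ut_def)
          then show ?thesis using nod[OF T xT(1)] by linarith
        qed
        then show "indicator (interior T) x * \<bar>f x\<bar> \<le> indicator (interior T) x * \<bar>ut x - a T\<bar> + indicator (interior T) x * \<eta> T"
          by (simp add: indicator_def)
      qed (intro Bochner_Integration.integrable_add ut_int integrable_mult_left integrable_indicator_interior)
      also have "\<dots> = lint T (\<lambda>x. \<bar>ut x - a T\<bar>) + (LINT x|lebesgue. indicator (interior T) x * \<eta> T)"
        by (intro Bochner_Integration.integral_add ut_int integrable_mult_left integrable_indicator_interior)
      also have "(LINT x|lebesgue. indicator (interior T) x * \<eta> T) = I * diameter T * S2 T" using measure_interior measure_pos by (simp add: \<eta>_def)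
      also have "lint T (\<lambda>x. \<bar>ut x - a T\<bar>) \<le> (2 * \<sigma>) ^ CARD('n) * diameter T * m T" unfolding a_def m_def by (rule simplex_poincare[OF wd T])
      also have "\<dots> \<le> (2 * \<sigma>) ^ CARD('n) * diameter T * S2 T" unfolding S2_def using \<sigma>_ge_1 diameter_pos
        by (intro mult_left_mono member_le_sum[of T] finite_patch patch_self T m0) auto
      finally have "lint T (\<lambda>x. \<bar>f x\<bar>) \<le> ((2 * \<sigma>) ^ CARD('n) + I) * diameter T * S2 T" by (simp add: algebra_simps)
      then have "lint T (\<lambda>x. \<bar>f x\<bar>) / vol T \<le> ((2 * \<sigma>) ^ CARD('n) + I) * diameter T * S2 T / vol T" using measure_pos by (simp add: divide_right_mono)
      also have "\<dots> \<le> ((2 * \<sigma>) ^ CARD('n) + I) * (M * hT T) * S2 T / vol T"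
        using diameter_le[OF T] \<sigma>_ge_1 I S0 measure_pos by (intro divide_right_mono mult_right_mono mult_left_mono) auto
      finally have "U T * (lint T (\<lambda>x. \<bar>f x\<bar>) / vol T) \<le>
        U T * (((2 * \<sigma>) ^ CARD('n) + I) * (M * hT T) * S2 T / vol T)" using U0[OF T] by (intro mult_left_mono) auto
      also have "\<dots> = M * ((2 * \<sigma>) ^ CARD('n) + I) * (low \<rho> T * (S2 T / vol T))" using hT_pos[OF T] by (simp add: U_def)
      also have "\<dots> \<le> M * ((2 * \<sigma>) ^ CARD('n) + I) * (L * X T)" using M_pos \<sigma>_ge_1 I by (intro mult_left_mono LX[OF T]) auto
      finally show ?thesis by (simp add: E_def mult_ac)
    qed
    \<comment> \<open>The inverse estimate bounds the gradient of the projection by its deviation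
      from the constant \<open>a T\<close>; that deviation consists of \<open>Q K f\<close>, bounded
      by \<open>z T\<close>, and the deviation of the interpolant, bounded by
      \<open>\<eta> T\<close>.\<close>
    define B where "B T = A / diameter T * (z T + \<eta> T)" for T
    have \<eta>0: "\<eta> T \<ge> 0" if "T \<in> \<T>" for T using I S0 diameter_pos[OF that] by (simp add: \<eta>_def)
    have B0: "B T \<ge> 0" if "T \<in> \<T>" for T using A z0[OF that] \<eta>0[OF that] diameter_pos[OF that] by (simp add: B_def)
    have gB: "norm (grad (piece K (Q K u) T) x) \<le> B T" if T: "T \<in> \<T>" and x: "x \<in> T" for T x proof -
      interpret full_simplex T by (rule full_simplex[OF T])
      let ?q = "piece K (Q K u) T"
      \<comment> \<open>Subtracting \<open>a T\<close> leaves the gradient unchanged but reduces the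
        supremum to the oscillation, which is what the estimates control.\<close>
      define g where "g y = ?q y - a T" for y
      have q: "poly_fun K ?q" by (rule poly_fun_piece[OF QuL T])
      have g: "poly_fun K g" unfolding g_def[abs_def] by (intro poly_fun_diff q poly_fun_const)
      have "?q = (\<lambda>y. g y + a T)" by (simp add: g_def fun_eq_iff)
      then have grad_eq: "grad ?q x = grad g x" using grad_add[OF smooth_differentiable[OF smooth_poly_fun[OF g]], of "\<lambda>_. a T" x] by simp
      have int: "\<bar>g y\<bar> \<le> z T + \<eta> T" if y: "y \<in> interior T" for y proof -
        have yT: "y \<in> T" "y \<in> \<Omega>" using y interior_subset interior_subset_domain[OF T] by auto
        have "g y = piece K (Q K f) T y + (nodal a T y - a T)" using piece_eq_interior[OF QuL T y] piece_eq_interior[OF QfL T y] Qf_eq[OF yT(2)] interpolant_eq[OF T yT, of a]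
          by (simp add: g_def v_def)
        moreover have "\<bar>piece K (Q K f) T y\<bar> \<le> z T" unfolding z_def by (rule abs_le_sup_norm[OF poly_fun_piece[OF QfL T] yT(1)])
        ultimately show ?thesis using nod[OF T yT(1)] by linarith
      qed
      \<comment> \<open>The decomposition of \<open>g\<close> is known in the interior of
        \<open>T\<close>; continuity extends the bound to the point where the supremum is
        attained.\<close>
      have cl: "closure (interior T) = T" using convex_closure_interior[OF convex_T interior_nonempty] closed_T by simp
      obtain y where y: "y \<in> T" "sup_norm T g = \<bar>g y\<bar>" using sup_norm_attained[OF g] by blast
      have "\<bar>g y\<bar> \<le> z T + \<eta> T" by (rule continuous_le_on_closure[of "interior T" "\<lambda>y. \<bar>g y\<bar>"])
          (use y(1) int in \<open>auto simp: cl intro!: continuous_on_rabs smooth_continuous_on[OF smooth_poly_fun[OF g]]\<close>)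
      then have sg: "sup_norm T g \<le> z T + \<eta> T" using y by simp
      have "norm (grad ?q x) * diameter T \<le> norm (grad ?q x) * (\<sigma> * inradius T)" using diameter_le_inradius[OF T] by (intro mult_left_mono) auto
      also have "\<dots> = \<sigma> * (norm (grad g x) * inradius T)" by (simp add: grad_eq)
      also have "\<dots> \<le> \<sigma> * (2 * coeff_bound K * (z T + \<eta> T))" using coeff_bound_ge_1[of K] \<sigma>_ge_1
        by (intro mult_left_mono order_trans[OF norm_grad_le_sup_norm[OF g x] mult_left_mono[OF sg]]) auto
      finally show ?thesis using diameter_pos by (simp add: B_def A_def field_simps)
    qed
    have "Lp_norm p \<Omega> (\<lambda>x. \<rho> x *\<^sub>R wgrad \<Omega> (Q K u) x) \<le> ennreal (\<gamma>' * mesh_norm p (\<lambda>T. low \<rho> T * B T))"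
    proof (rule Lp_norm_weight_le[OF p \<rho> wgrad_LK_measurable[OF Qu]])
      fix T assume T: "T \<in> \<T>"
      show "AE x in lebesgue. x \<in> interior T \<longrightarrow> norm (wgrad \<Omega> (Q K u) x) \<le> B T" using wgrad_LK[OF Qu T] proof eventually_elim
        case (elim x)
        then show ?case using gB[OF T, of x] interior_subset[of T] by auto
      qed
    qed (rule B0)
    also have "\<gamma>' * mesh_norm p (\<lambda>T. low \<rho> T * B T) \<le> \<gamma>' * (4 * (N * mesh_norm p b))" proof (rule mult_left_mono)
      let ?\<alpha> = "\<lambda>T. A * M * (U T * z T)" and ?\<beta> = "\<lambda>T. A * I * L * X T"
      have \<alpha>0: "?\<alpha> T \<ge> 0" if "T \<in> \<T>" for T using A M_pos U0[OF that] z0[OF that] by simp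
      have \<beta>0: "?\<beta> T \<ge> 0" for T using A I L X0 by simp
      have "mesh_norm p (\<lambda>T. low \<rho> T * B T) \<le> 1 * mesh_norm p (\<lambda>T. ?\<alpha> T + ?\<beta> T)" proof (rule mesh_norm_mono[OF p])
        fix T assume T: "T \<in> \<T>"
        have D: "diameter T > 0" by (rule diameter_pos[OF T])
        have "low \<rho> T / diameter T \<le> M * U T" using hT_le[OF T] D hT_pos[OF T] low[OF T] by (simp add: U_def field_simps)
        then have "A * (low \<rho> T / diameter T) * z T \<le> A * (M * U T) * z T" using A z0[OF T] by (intro mult_right_mono mult_left_mono)
        moreover have "A * I * (low \<rho> T * (S2 T / vol T)) \<le> A * I * (L * X T)" using A I by (intro mult_left_mono LX[OF T]) auto
        moreover have "low \<rho> T * B T = A * (low \<rho> T / diameter T) * z T + A * I * (low \<rho> T * (S2 T / vol T))" using D by (simp add: B_def \<eta>_def field_simps)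
        ultimately have "low \<rho> T * B T \<le> ?\<alpha> T + ?\<beta> T" by (simp add: mult_ac)
        then show "0 \<le> low \<rho> T * B T \<and> low \<rho> T * B T \<le> 1 * (?\<alpha> T + ?\<beta> T)" using low[OF T] B0[OF T] by simp
      qed (use \<alpha>0 \<beta>0 in auto)
      also have "\<dots> \<le> 4 * (mesh_norm p ?\<alpha> + mesh_norm p ?\<beta>)" using mesh_norm_add[OF p \<alpha>0 \<beta>0] by simp
      also have "mesh_norm p ?\<alpha> \<le> A * M * (J * (E * (P ^ 3 * mesh_norm p b)))" proof -
        have AM: "0 \<le> A * M" using A M_pos by simp
        have XP: "mesh_norm p X \<le> P ^ 3 * mesh_norm p b" unfolding X_def[abs_def] P_def by (rule mesh_norm_patch_sum[OF p b0])
        have "mesh_norm p ?\<alpha> \<le> A * M * mesh_norm p (\<lambda>T. U T * z T)" using A M_pos less_imp_le[OF U0] z0 \<alpha>0 by (intro mesh_norm_mono[OF p]) auto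
        also have "mesh_norm p (\<lambda>T. U T * z T) \<le> J * mesh_norm p (\<lambda>T. U T * (lint T (\<lambda>x. \<bar>f x\<bar>) / vol T))"
          unfolding z_def J_def by (rule projection_mesh_norm_le[OF p gU \<gamma>\<gamma> wg s e less fi])
        also have "mesh_norm p (\<lambda>T. U T * (lint T (\<lambda>x. \<bar>f x\<bar>) / vol T)) \<le> E * mesh_norm p X" using avg X0 E less_imp_le[OF U0]
          by (intro mesh_norm_mono[OF p]) (auto intro!: mult_nonneg_nonneg divide_nonneg_nonneg integral_nonneg_AE AE_I2)
        also have "E * mesh_norm p X \<le> E * (P ^ 3 * mesh_norm p b)" using XP E by (rule mult_left_mono)
        finally show ?thesis using mult_left_mono[OF _ AM] mult_left_mono[OF _ J] by blast
      qed
      also have "mesh_norm p ?\<beta> \<le> A * I * L * (P ^ 3 * mesh_norm p b)" proof -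
        have "mesh_norm p ?\<beta> \<le> (A * I * L) * mesh_norm p X" using \<beta>0 X0 A I L by (intro mesh_norm_mono[OF p]) auto
        also have "mesh_norm p X \<le> P ^ 3 * mesh_norm p b" unfolding X_def[abs_def] P_def by (rule mesh_norm_patch_sum[OF p b0])
        finally show ?thesis using A I L by (simp add: mult_left_mono)
      qed
      finally show "mesh_norm p (\<lambda>T. low \<rho> T * B T) \<le> 4 * (N * mesh_norm p b)" by (simp add: N_def algebra_simps)
    qed (use \<gamma>' in simp)
    finally have "Lp_norm p \<Omega> (\<lambda>x. \<rho> x *\<^sub>R wgrad \<Omega> (Q K u) x) \<le> ennreal (\<gamma>' * (4 * N) * mesh_norm p b)"
      by (simp add: ennreal_leI mult.assoc)
    also have "\<dots> \<le> ennreal ((\<gamma>' * (4 * N) + 1) * mesh_norm p b)" using mesh_norm_nonneg[of b p] b0 by (intro ennreal_leI mult_right_mono) auto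
    also have "\<dots> = ennreal (W1p_const C K \<gamma>' s e) * ennreal (mesh_norm p b)" unfolding c using \<gamma>' N by (intro ennreal_mult') simp
    also have "ennreal (mesh_norm p b) \<le> Lp_norm p \<Omega> (\<lambda>x. \<rho> x *\<^sub>R W x)" proof -
      have "b T = low \<rho> T * (lint T (\<lambda>x. norm (W x)) / vol T)" if T: "T \<in> \<T>" for T unfolding b_def m_def mass_def using interior_subset_domain[OF T]
        by (intro arg_cong[of _ _ "\<lambda>y. low \<rho> T * (y / vol T)"] Bochner_Integration.integral_cong refl) (auto simp: Wt_def indicator_def)
      then have "mesh_norm p b = mesh_norm p (\<lambda>T. low \<rho> T * (lint T (\<lambda>x. norm (W x)) / vol T))" by (simp add: mesh_norm_def cong: sum.cong image_cong)
      then show ?thesis using mesh_norm_weighted_average_le[OF p \<rho> Wi \<rho>W] by simp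
    qed
    finally show ?thesis unfolding W_def by (simp add: mult_left_mono)
  qed
qed

end

text \<open>Extracts from the strict inequality on the gradings the factor \<open>s\<close> that
  makes the sums over layers converge.\<close>

lemma ex_factor_gt_1:
  fixes a b :: real
  assumes "a < b"
  shows "\<exists>s>1. a * s < b" proof (cases "a > 0")
  case True
  then show ?thesis using assms by (intro exI[of _ "(1 + b / a) / 2"]) (simp add: field_simps)
next
  case False
  then show ?thesis using assms by (intro exI[of _ 2]) simp
qed

lemma graded_meshI:
  "triangulated_domain \<Omega> \<T> \<Gamma> \<Longrightarrow> mesh_size_function M \<Omega> \<T> \<gamma> h \<Longrightarrow> shape_regularity \<T> = \<sigma> \<Longrightarrow> graded_mesh \<Omega> \<T> \<Gamma> h M \<gamma> \<sigma>"
  by (simp add: graded_mesh_def triangulated_def graded_mesh_axioms_def)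

theorem theorem4p14:
  fixes K :: nat and p :: ennreal and \<gamma>\<^sub>\<rho> \<gamma>\<^sub>h \<gamma>max \<chi>\<^sub>0 M :: real and C :: "real \<Rightarrow> real"
  assumes "K \<ge> 1" and "p \<ge> 1"
  shows
    "(\<gamma>\<^sub>\<rho> * \<gamma>\<^sub>h powr (real CARD('n::finite) * \<bar>1 / 2 - enn2real (1 / p)\<bar>) < \<gamma>max \<longrightarrow>
      (\<exists>c::real. \<forall>(\<Omega> :: (real ^ 'n) set) \<T> \<Gamma> \<rho> h.
        triangulated_domain \<Omega> \<T> \<Gamma> \<and> shape_regularity \<T> = \<chi>\<^sub>0 \<and>
        weight \<Omega> \<T> \<gamma>\<^sub>\<rho> \<rho> \<and> mesh_size_function M \<Omega> \<T> \<gamma>\<^sub>h h \<and> worst_grading C K \<Omega> \<T> \<Gamma> \<gamma>max \<longrightarrow>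
        (\<forall>u \<in> Lp p \<Omega>.
           Lp_norm p \<Omega> (\<lambda>x. \<rho> x * L2_projection K \<Omega> \<T> \<Gamma> u x)
             \<le> ennreal c * Lp_norm p \<Omega> (\<lambda>x. \<rho> x * u x)))) \<and>
     (\<gamma>\<^sub>\<rho> * \<gamma>\<^sub>h powr (1 + real CARD('n) * \<bar>1 / 2 - enn2real (1 / p)\<bar>) < \<gamma>max \<longrightarrow>
      (\<exists>c::real. \<forall>(\<Omega> :: (real ^ 'n) set) \<T> \<Gamma> \<rho> h.
        triangulated_domain \<Omega> \<T> \<Gamma> \<and> shape_regularity \<T> = \<chi>\<^sub>0 \<and>
        weight \<Omega> \<T> \<gamma>\<^sub>\<rho> \<rho> \<and> mesh_size_function M \<Omega> \<T> \<gamma>\<^sub>h h \<and> worst_grading C K \<Omega> \<T> \<Gamma> \<gamma>max \<longrightarrow>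
        (\<forall>u \<in> W1p_bc p \<Omega> \<T> \<Gamma>.
           Lp_norm p \<Omega> (\<lambda>x. \<rho> x *\<^sub>R wgrad \<Omega> (L2_projection K \<Omega> \<T> \<Gamma> u) x)
             \<le> ennreal c * Lp_norm p \<Omega> (\<lambda>x. \<rho> x *\<^sub>R wgrad \<Omega> u x))))"
proof (intro conjI impI, goal_cases)
  define e where "e = \<bar>1 / 2 - enn2real (1 / p)\<bar>"
  {
    case 1
    \<comment> \<open>\<open>s\<close> depends only on the numbers in the hypothesis, and the
      constants defined for graded meshes involve only \<open>M\<close>, the grading of the mesh
      size and the shape parameter. So one value of \<open>c\<close> serves all meshes.\<close>
    then obtain s where s: "s > 1" "\<gamma>\<^sub>\<rho> * \<gamma>\<^sub>h powr (real CARD('n) * e) * s < \<gamma>max"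
      using ex_factor_gt_1 unfolding e_def by blast
    show ?case
      by (intro exI allI impI ballI, elim conjE)
        (rule graded_mesh.Lp_stability[OF graded_meshI \<open>p \<ge> 1\<close> _ _ s(1) e_def], use s(2) in \<open>simp_all add: mult.assoc\<close>)
  next
    case 2
    then obtain s where s: "s > 1" "\<gamma>\<^sub>\<rho> * \<gamma>\<^sub>h powr (1 + real CARD('n) * e) * s < \<gamma>max"
      using ex_factor_gt_1 unfolding e_def by blast
    \<comment> \<open>Splitting off one factor uses
      \<open>\<gamma>\<^sub>h powr 1 = \<gamma>\<^sub>h\<close>, for which
      \<open>\<gamma>\<^sub>h \<ge> 1\<close> is taken from the mesh size function.\<close>
    have "\<gamma>\<^sub>\<rho> * \<gamma>\<^sub>h * (\<gamma>\<^sub>h powr (real CARD('n) * e) * s) < \<gamma>max"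
      if "mesh_size_function M \<Omega> \<T> \<gamma>\<^sub>h h" for \<Omega> \<T> and h :: "real^'n \<Rightarrow> real"
      using s(2) that by (simp add: mesh_size_function_def weight_def powr_add mult.assoc)
    then show ?case
      by (intro exI allI impI ballI, elim conjE)
        (rule graded_mesh.W1p_stability[OF graded_meshI assms _ _ s(1) e_def])
  }
qed

end
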